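(* Let $\alpha_0\in\{-l_0,l_0+1\}$ and set $$\eta=\tfrac{-\alpha_0-l_1-l_2-l_3+1}{2},\quad l_0'=\tfrac{-\alpha_0+l_1+l_2+l_3+1}{2},$$ $$l_1'=\tfrac{-\alpha_0+l_1-l_2-l_3-1}{2},\quad l_2'=\tfrac{-\alpha_0-l_1+l_2-l_3-1}{2},\quad l_3'=\tfrac{-\alpha_0-l_1-l_2+l_3-1}{2}.$$ If $l_0,l_1,l_2,l_3\in\mathbb{Z}+\frac12$ and $l_0+l_1+l_2+l_3\in2\mathbb{Z}+1$, then $\eta\in\mathbb{Z}+\frac12$ and $l_0',l_1',l_2',l_3'\in\mathbb{Z}$. In this case, for $k\in\{1,3\}$ let $M_{2\omega_k}$ be the monodromy matrix of solutions of $$\Big(-\frac{d^2}{dx^2}+\sum_{i=0}^3l_i(l_i+1)\wp(x+\omega_i)-E\Big)f(x)=0$$ with respect to the shift $x\to x+2\omega_k$. Then $$\mathrm{tr}\,M_{2\omega_k}=2(-1)^{q_k}\cos\left(\int_{E_0}^{E}\frac{\omega_kc(\tilde E)-\eta_ka(\tilde E)}{\sqrt{Q(\tilde E)}}\,d\tilde E\right),$$ where $c(E)$, $a(E)$, $Q(E)$ are the polynomials described in the context for the parameters $l_0',l_1',l_2',l_3'$, $E_0$ is a zero of $Q(E)$, and $q_k\in\{0,1\}$ is such that $\Lambda(x+2\omega_k,E_0)=(-1)^{q_k}\Lambda(x,E_0)$. Also $$\mathrm{tr}\,M_{2\omega_k}=2\cos\Big(\sqrt{-1}\,\big(2\omega_k(\zeta(\alpha)+\kappa)-2\eta_k\alpha\big)\Big),$$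 where $\alpha$ and $\kappa$ are the values attached in the context to the parameters $l_0',l_1',l_2',l_3',E$ (for $E$ at which they are defined, $P_2(E)\neq0$).
   Context: $\wp$, $\zeta$, $\sigma$ are the Weierstrass functions with periods $(2\omega_1,2\omega_3)$ of $\wp$; $\omega_0=0$, $\omega_2=-\omega_1-\omega_3$; $\eta_k=\zeta(\omega_k)$ (not to be confused with $\eta$). The monodromy matrix $M_{2\omega_k}$ is defined by $(f_1(x+2\omega_k),f_2(x+2\omega_k))=(f_1(x),f_2(x))M_{2\omega_k}$ for a basis $(f_1,f_2)$ of solutions, with analytic continuation along the straight segment from $x$ to $x+2\omega_k$ ($x$ generic, so that the segment avoids $\mathbb{Z}\omega_1+\mathbb{Z}\omega_3$). Let $l_0',\dots,l_3'\in\mathbb{Z}$ and $u(x)=\sum_{i=0}^3l_i'(l_i'+1)\wp(x+\omega_i)$. It is known that the equation $h'''-4(u-E)h'-2u'h=0$ (satisfied by products of two solutions of $-f''+uf=Ef$) has a non-zero doubly periodic solution $$\Xi(x,E)=c_0(E)+\sum_{i=0}^3\sum_{j=0}^{\max(l_i',-l_i'-1)-1}b^{(i)}_j(E)\wp(x+\omega_i)^{\max(l_i',-l_i'-1)-j},$$ where $c_0(E)$, $b_j^{(i)}(E)$ are polynomials in $E$ without common divisor and $c_0(E)$ is monic. Set $$Q(E)=\Xi(x,E)^2(E-u(x))+\tfrac12\Xi(x,E)\Xi''(x,E)-\tfrac14\Xi'(x,E)^2,$$ which is independent of $x$ and a monic polynomial in $E$ of odd degree, and $$\Lambda(x,E)=\sqrt{\Xi(x,E)}\,\exp\int\frac{\sqrt{-Q(E)}\,dx}{\Xi(x,E)};$$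 $\Lambda(\pm x,E)$ are solutions of $-f''+uf=Ef$. Write $$\Xi(x,E)=c(E)+\sum_{i=0}^3\sum_{j=0}^{\max(l_i',-l_i'-1)-1}a_j^{(i)}(E)\Big(\frac{d}{dx}\Big)^{2j}\wp(x+\omega_i),\qquad a(E)=\sum_{i=0}^3a_0^{(i)}(E).$$ It is known that if $Q(E_0)=0$ then for each $k\in\{1,3\}$ there is $q_k\in\{0,1\}$ with $\Lambda(x+2\omega_k,E_0)=(-1)^{q_k}\Lambda(x,E_0)$. It is also known (Hermite–Krichever Ansatz) that there exist polynomials $P_1(E),\dots,P_6(E)$ such that, if $P_2(E)\ne0$, then $$\Lambda(x,E)=\exp(\kappa x)\sum_{i=0}^3\sum_{j=0}^{|l_i'+1/2|-3/2}\tilde b_j^{(i)}\Big(\frac{d}{dx}\Big)^j\Phi_i(x,\alpha),\qquad \Phi_i(x,\alpha)=\frac{\sigma(x+\omega_i-\alpha)}{\sigma(x+\omega_i)}\exp(\zeta(\alpha)x),$$ for some constants $\tilde b_j^{(i)}$, where $\alpha,\kappa$ are given by $\wp(\alpha)=\frac{P_1(E)}{P_2(E)}$, $\wp'(\alpha)=\frac{P_3(E)}{P_4(E)}\sqrt{-Q(E)}$, $\kappa=\frac{P_5(E)}{P_6(E)}\sqrt{-Q(E)}$. These are the $\alpha$ and $\kappa$ in the claim. *)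

theory Defs
  imports
    "HOL-Complex_Analysis.Complex_Analysis"
    "HOL-Computational_Algebra.Polynomial"
begin

section \<open>Weierstrass functions with periods \<open>(2\<omega>\<^sub>1, 2\<omega>\<^sub>3)\<close>\<close>

definition period_lattice :: "complex \<Rightarrow> complex \<Rightarrow> complex set" where
  "period_lattice \<omega>\<^sub>1 \<omega>\<^sub>3 = {of_int m * (2 * \<omega>\<^sub>1) + of_int n * (2 * \<omega>\<^sub>3) | m n. True}"

definition half_lattice :: "complex \<Rightarrow> complex \<Rightarrow> complex set" where
  "half_lattice \<omega>\<^sub>1 \<omega>\<^sub>3 = {of_int m * \<omega>\<^sub>1 + of_int n * \<omega>\<^sub>3 | m n. True}"

text \<open>The values of the following functions at lattice points, which are poles of \<open>\<wp>\<close> and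
  \<open>\<zeta>\<close>, are meaningless (division by zero); every use below stays away from the poles.\<close>

definition weierstrass_p :: "complex \<Rightarrow> complex \<Rightarrow> complex \<Rightarrow> complex" where
  "weierstrass_p \<omega>\<^sub>1 \<omega>\<^sub>3 z =
     1 / z ^ 2 + (\<Sum>\<^sub>\<infinity>w\<in>period_lattice \<omega>\<^sub>1 \<omega>\<^sub>3 - {0}. 1 / (z - w) ^ 2 - 1 / w ^ 2)"

definition weierstrass_zeta :: "complex \<Rightarrow> complex \<Rightarrow> complex \<Rightarrow> complex" where
  "weierstrass_zeta \<omega>\<^sub>1 \<omega>\<^sub>3 z =
     1 / z + (\<Sum>\<^sub>\<infinity>w\<in>period_lattice \<omega>\<^sub>1 \<omega>\<^sub>3 - {0}. 1 / (z - w) + 1 / w + z / w ^ 2)"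

text \<open>The unordered infinite product is the limit over the finite subsets of the index set, just
  as \<^const>\<open>infsum\<close> is for sums.\<close>

definition weierstrass_sigma :: "complex \<Rightarrow> complex \<Rightarrow> complex \<Rightarrow> complex" where
  "weierstrass_sigma \<omega>\<^sub>1 \<omega>\<^sub>3 z =
     z * Lim (finite_subsets_at_top (period_lattice \<omega>\<^sub>1 \<omega>\<^sub>3 - {0}))
           (\<lambda>F. \<Prod>w\<in>F. (1 - z / w) * exp (z / w + z ^ 2 / (2 * w ^ 2)))"

definition half_period :: "complex \<Rightarrow> complex \<Rightarrow> nat \<Rightarrow> complex" where
  "half_period \<omega>\<^sub>1 \<omega>\<^sub>3 i =
     (if i = 1 then \<omega>\<^sub>1 else if i = 2 then - \<omega>\<^sub>1 - \<omega>\<^sub>3 else if i = 3 then \<omega>\<^sub>3 else 0)"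

definition quasi_period :: "complex \<Rightarrow> complex \<Rightarrow> nat \<Rightarrow> complex" where
  "quasi_period \<omega>\<^sub>1 \<omega>\<^sub>3 k = weierstrass_zeta \<omega>\<^sub>1 \<omega>\<^sub>3 (half_period \<omega>\<^sub>1 \<omega>\<^sub>3 k)"

section \<open>The parameters\<close>

definition half_odd :: "complex \<Rightarrow> bool" where
  "half_odd z \<longleftrightarrow> (\<exists>m::int. z = of_int m + 1 / 2)"

definition eta_param :: "complex \<Rightarrow> (nat \<Rightarrow> complex) \<Rightarrow> complex" where
  "eta_param \<alpha>\<^sub>0 l = (- \<alpha>\<^sub>0 - l 1 - l 2 - l 3 + 1) / 2"

definition l_prime :: "complex \<Rightarrow> (nat \<Rightarrow> complex) \<Rightarrow> nat \<Rightarrow> complex" where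
  "l_prime \<alpha>\<^sub>0 l i =
     (if i = 0 then (- \<alpha>\<^sub>0 + l 1 + l 2 + l 3 + 1) / 2
      else if i = 1 then (- \<alpha>\<^sub>0 + l 1 - l 2 - l 3 - 1) / 2
      else if i = 2 then (- \<alpha>\<^sub>0 - l 1 + l 2 - l 3 - 1) / 2
      else (- \<alpha>\<^sub>0 - l 1 - l 2 + l 3 - 1) / 2)"

section \<open>The differential equation and its monodromy\<close>

definition potential :: "complex \<Rightarrow> complex \<Rightarrow> (nat \<Rightarrow> complex) \<Rightarrow> complex \<Rightarrow> complex" where
  "potential \<omega>\<^sub>1 \<omega>\<^sub>3 l x =
     (\<Sum>i\<le>3. l i * (l i + 1) * weierstrass_p \<omega>\<^sub>1 \<omega>\<^sub>3 (x + half_period \<omega>\<^sub>1 \<omega>\<^sub>3 i))"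

definition solution_on ::
  "(complex \<Rightarrow> complex) \<Rightarrow> complex \<Rightarrow> complex set \<Rightarrow> (complex \<Rightarrow> complex) \<Rightarrow> bool" where
  "solution_on u E S f \<longleftrightarrow>
     f holomorphic_on S \<and> (\<forall>y\<in>S. - (deriv ^^ 2) f y + (u y - E) * f y = 0)"

text \<open>A solution on an open neighbourhood \<open>S\<close> of the segment from \<open>x\<close> to \<open>x + p\<close> is a germ of
  solution at \<open>x\<close> together with its analytic continuation along that segment. The solution space
  near a regular point is two-dimensional, so two linearly independent germs form a basis.\<close>

definition monodromy_matrix ::
  "(complex \<Rightarrow> complex) \<Rightarrow> complex \<Rightarrow> complex \<Rightarrow> complex \<Rightarrow>
   (complex \<Rightarrow> complex) \<Rightarrow> (complex \<Rightarrow> complex) \<Rightarrow> complex^2^2 \<Rightarrow> bool" where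
  "monodromy_matrix u E p x f\<^sub>1 f\<^sub>2 M \<longleftrightarrow>
     (\<exists>S. open S \<and> closed_segment x (x + p) \<subseteq> S \<and>
          solution_on u E S f\<^sub>1 \<and> solution_on u E S f\<^sub>2) \<and>
     (\<forall>r s. (\<forall>\<^sub>F y in nhds x. r * f\<^sub>1 y + s * f\<^sub>2 y = 0) \<longrightarrow> r = 0 \<and> s = 0) \<and>
     (\<forall>\<^sub>F y in nhds x.
        (vector [f\<^sub>1 (y + p), f\<^sub>2 (y + p)] :: complex^2) = vector [f\<^sub>1 y, f\<^sub>2 y] v* M)"

section \<open>The doubly periodic solution and the spectral polynomial (integer parameters)\<close>

definition pole_count :: "(nat \<Rightarrow> int) \<Rightarrow> nat \<Rightarrow> nat" where
  "pole_count l i = nat (max (l i) (- l i - 1))"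

definition Xi_fun ::
  "complex \<Rightarrow> complex \<Rightarrow> (nat \<Rightarrow> int) \<Rightarrow> complex poly \<Rightarrow> (nat \<Rightarrow> nat \<Rightarrow> complex poly) \<Rightarrow>
   complex \<Rightarrow> complex \<Rightarrow> complex" where
  "Xi_fun \<omega>\<^sub>1 \<omega>\<^sub>3 l c\<^sub>0 b E x =
     poly c\<^sub>0 E + (\<Sum>i\<le>3. \<Sum>j<pole_count l i.
        poly (b i j) E * weierstrass_p \<omega>\<^sub>1 \<omega>\<^sub>3 (x + half_period \<omega>\<^sub>1 \<omega>\<^sub>3 i) ^ (pole_count l i - j))"

text \<open>\<open>c\<^sub>0\<close>, \<open>b\<close> are the coefficients of \<open>\<Xi>\<close>; \<open>c\<^sub>0\<close> being monic makes \<open>\<Xi>\<close> non-zero.\<close>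

definition is_Xi ::
  "complex \<Rightarrow> complex \<Rightarrow> (nat \<Rightarrow> int) \<Rightarrow> complex poly \<Rightarrow> (nat \<Rightarrow> nat \<Rightarrow> complex poly) \<Rightarrow> bool" where
  "is_Xi \<omega>\<^sub>1 \<omega>\<^sub>3 l c\<^sub>0 b \<longleftrightarrow>
     lead_coeff c\<^sub>0 = 1 \<and>
     (\<forall>d. d dvd c\<^sub>0 \<and> (\<forall>i\<le>3. \<forall>j<pole_count l i. d dvd b i j) \<longrightarrow> is_unit d) \<and>
     (let u = potential \<omega>\<^sub>1 \<omega>\<^sub>3 (\<lambda>i. of_int (l i)) in
      \<forall>E. \<forall>x\<in>- half_lattice \<omega>\<^sub>1 \<omega>\<^sub>3. let h = Xi_fun \<omega>\<^sub>1 \<omega>\<^sub>3 l c\<^sub>0 b E in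
        (deriv ^^ 3) h x - 4 * (u x - E) * deriv h x - 2 * deriv u x * h x = 0)"

definition is_Q ::
  "complex \<Rightarrow> complex \<Rightarrow> (nat \<Rightarrow> int) \<Rightarrow> complex poly \<Rightarrow> (nat \<Rightarrow> nat \<Rightarrow> complex poly) \<Rightarrow>
   complex poly \<Rightarrow> bool" where
  "is_Q \<omega>\<^sub>1 \<omega>\<^sub>3 l c\<^sub>0 b Q \<longleftrightarrow>
     (let u = potential \<omega>\<^sub>1 \<omega>\<^sub>3 (\<lambda>i. of_int (l i)) in
      \<forall>E. \<forall>x\<in>- half_lattice \<omega>\<^sub>1 \<omega>\<^sub>3. let h = Xi_fun \<omega>\<^sub>1 \<omega>\<^sub>3 l c\<^sub>0 b E in
        poly Q E = (h x) ^ 2 * (E - u x) + 1 / 2 * h x * (deriv ^^ 2) h x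
                   - 1 / 4 * (deriv h x) ^ 2)"

definition derivative_expansion ::
  "complex \<Rightarrow> complex \<Rightarrow> (nat \<Rightarrow> int) \<Rightarrow> complex poly \<Rightarrow> (nat \<Rightarrow> nat \<Rightarrow> complex poly) \<Rightarrow>
   complex poly \<Rightarrow> (nat \<Rightarrow> nat \<Rightarrow> complex poly) \<Rightarrow> bool" where
  "derivative_expansion \<omega>\<^sub>1 \<omega>\<^sub>3 l c\<^sub>0 b c a \<longleftrightarrow>
     (\<forall>E. \<forall>x\<in>- half_lattice \<omega>\<^sub>1 \<omega>\<^sub>3.
        Xi_fun \<omega>\<^sub>1 \<omega>\<^sub>3 l c\<^sub>0 b E x =
          poly c E + (\<Sum>i\<le>3. \<Sum>j<pole_count l i.
            poly (a i j) E *
            (deriv ^^ (2 * j)) (weierstrass_p \<omega>\<^sub>1 \<omega>\<^sub>3) (x + half_period \<omega>\<^sub>1 \<omega>\<^sub>3 i)))"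

text \<open>Coefficients \<open>a i 0\<close> with \<open>pole_count l i = 0\<close> do not occur in the expansion and count as
  zero.\<close>

definition a_total :: "(nat \<Rightarrow> int) \<Rightarrow> (nat \<Rightarrow> nat \<Rightarrow> complex poly) \<Rightarrow> complex poly" where
  "a_total l a = (\<Sum>i | i \<le> 3 \<and> 0 < pole_count l i. a i 0)"

text \<open>\<open>L\<close> is (a branch of) \<open>\<Lambda> = \<surd>\<Xi> exp (\<integral> s dx / \<Xi>)\<close>, where \<open>h = \<Xi>(\<cdot>, E)\<close> and \<open>s\<close> is the
  chosen value of \<open>\<surd>(- Q(E))\<close>. Locally, away from the zeros of \<open>\<Xi>\<close>, \<open>r\<close> is a branch of
  \<open>\<surd>\<Xi>\<close> and \<open>P\<close> an antiderivative of \<open>s / \<Xi>\<close>. Since \<open>L\<close> is holomorphic on the connected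
  complement of \<open>H\<close>, these choices are coherent, so \<open>L\<close> is determined by \<open>h\<close> and \<open>s\<close> up to a
  non-zero constant factor.\<close>

definition is_Lambda ::
  "complex set \<Rightarrow> (complex \<Rightarrow> complex) \<Rightarrow> complex \<Rightarrow> (complex \<Rightarrow> complex) \<Rightarrow> bool" where
  "is_Lambda H h s L \<longleftrightarrow>
     L holomorphic_on - H \<and>
     (\<forall>z\<in>- H. h z \<noteq> 0 \<longrightarrow>
        (\<exists>e>0. \<exists>r P. r holomorphic_on ball z e \<and>
           (\<forall>y\<in>ball z e. r y ^ 2 = h y \<and> (P has_field_derivative s / h y) (at y) \<and>
                          L y = r y * exp (P y))))"

section \<open>The integral along a path in the \<open>E\<close>-plane\<close>

text \<open>\<open>g\<close> is a path from \<open>E\<^sub>0\<close> to \<open>E\<close> meeting the zeros of \<open>Q\<close> at most at its end points, and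
  \<open>r\<close> is a continuous branch of \<open>\<surd>Q\<close> along it.\<close>

definition spectral_path ::
  "complex poly \<Rightarrow> complex \<Rightarrow> complex \<Rightarrow> (real \<Rightarrow> complex) \<Rightarrow> (real \<Rightarrow> complex) \<Rightarrow> bool" where
  "spectral_path Q E\<^sub>0 E g r \<longleftrightarrow>
     valid_path g \<and> pathstart g = E\<^sub>0 \<and> pathfinish g = E \<and>
     (\<forall>t\<in>{0<..<1}. poly Q (g t) \<noteq> 0) \<and>
     continuous_on {0..1} r \<and> (\<forall>t\<in>{0..1}. r t ^ 2 = poly Q (g t))"

text \<open>The integral is improper at zeros of \<open>Q\<close>; the Henstock-Kurzweil integral
  \<^const>\<open>has_integral\<close> covers this.\<close>

definition has_spectral_integral ::
  "complex \<Rightarrow> complex \<Rightarrow> nat \<Rightarrow> complex poly \<Rightarrow> complex poly \<Rightarrow>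
   (real \<Rightarrow> complex) \<Rightarrow> (real \<Rightarrow> complex) \<Rightarrow> complex \<Rightarrow> bool" where
  "has_spectral_integral \<omega>\<^sub>1 \<omega>\<^sub>3 k c a g r I \<longleftrightarrow>
     ((\<lambda>t. (half_period \<omega>\<^sub>1 \<omega>\<^sub>3 k * poly c (g t) - quasi_period \<omega>\<^sub>1 \<omega>\<^sub>3 k * poly a (g t)) / r t
           * vector_derivative g (at t within {0..1})) has_integral I) {0..1}"

section \<open>The Hermite-Krichever Ansatz\<close>

definition Phi_fun ::
  "complex \<Rightarrow> complex \<Rightarrow> nat \<Rightarrow> complex \<Rightarrow> complex \<Rightarrow> complex" where
  "Phi_fun \<omega>\<^sub>1 \<omega>\<^sub>3 i \<alpha> x =
     weierstrass_sigma \<omega>\<^sub>1 \<omega>\<^sub>3 (x + half_period \<omega>\<^sub>1 \<omega>\<^sub>3 i - \<alpha>) /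
     weierstrass_sigma \<omega>\<^sub>1 \<omega>\<^sub>3 (x + half_period \<omega>\<^sub>1 \<omega>\<^sub>3 i) *
     exp (weierstrass_zeta \<omega>\<^sub>1 \<omega>\<^sub>3 \<alpha> * x)"

definition HK_defined :: "(nat \<Rightarrow> complex poly) \<Rightarrow> complex \<Rightarrow> bool" where
  "HK_defined P E \<longleftrightarrow> poly (P 2) E \<noteq> 0 \<and> poly (P 4) E \<noteq> 0 \<and> poly (P 6) E \<noteq> 0"

text \<open>As in \<^const>\<open>is_Lambda\<close>, \<open>s\<close> is the chosen value of \<open>\<surd>(- Q(E))\<close>.\<close>

definition HK_values ::
  "complex \<Rightarrow> complex \<Rightarrow> (nat \<Rightarrow> complex poly) \<Rightarrow> complex \<Rightarrow> complex \<Rightarrow>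
   complex \<Rightarrow> complex \<Rightarrow> bool" where
  "HK_values \<omega>\<^sub>1 \<omega>\<^sub>3 P E s \<alpha> \<kappa> \<longleftrightarrow>
     \<alpha> \<notin> period_lattice \<omega>\<^sub>1 \<omega>\<^sub>3 \<and>
     weierstrass_p \<omega>\<^sub>1 \<omega>\<^sub>3 \<alpha> = poly (P 1) E / poly (P 2) E \<and>
     deriv (weierstrass_p \<omega>\<^sub>1 \<omega>\<^sub>3) \<alpha> = poly (P 3) E / poly (P 4) E * s \<and>
     \<kappa> = poly (P 5) E / poly (P 6) E * s"

text \<open>The upper summation bound \<open>\<bar>l i + 1/2\<bar> - 3/2\<close> equals \<open>pole_count l i - 1\<close>.\<close>

definition hermite_krichever ::
  "complex \<Rightarrow> complex \<Rightarrow> (nat \<Rightarrow> int) \<Rightarrow> complex poly \<Rightarrow> (nat \<Rightarrow> nat \<Rightarrow> complex poly) \<Rightarrow>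
   complex poly \<Rightarrow> (nat \<Rightarrow> complex poly) \<Rightarrow> bool" where
  "hermite_krichever \<omega>\<^sub>1 \<omega>\<^sub>3 l c\<^sub>0 b Q P \<longleftrightarrow>
     P 2 \<noteq> 0 \<and> P 4 \<noteq> 0 \<and> P 6 \<noteq> 0 \<and>
     (\<forall>E s L. HK_defined P E \<and> s ^ 2 = - poly Q E \<and>
        is_Lambda (half_lattice \<omega>\<^sub>1 \<omega>\<^sub>3) (Xi_fun \<omega>\<^sub>1 \<omega>\<^sub>3 l c\<^sub>0 b E) s L \<longrightarrow>
        (\<exists>\<alpha> \<kappa> bt. HK_values \<omega>\<^sub>1 \<omega>\<^sub>3 P E s \<alpha> \<kappa> \<and>
           (\<forall>x\<in>- half_lattice \<omega>\<^sub>1 \<omega>\<^sub>3.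
              L x = exp (\<kappa> * x) *
                (\<Sum>i\<le>3. \<Sum>j<pole_count l i.
                   bt i j * (deriv ^^ j) (Phi_fun \<omega>\<^sub>1 \<omega>\<^sub>3 i \<alpha>) x))))"

end

theory Submission
  imports Defs
begin

text \<open>Put \<open>p = 2\<omega>\<^sub>k\<close>, let \<open>a\<^sub>0 = \<alpha>\<^sub>0\<close>, \<open>a\<^sub>i = l\<^sub>i + 1\<close> for \<open>i = 1, 2, 3\<close>, \<open>2\<tau> = \<Sum> a\<^sub>i\<close> and \<open>b\<^sub>i = \<tau> - a\<^sub>i\<close>. The kernel
  \<open>K(x, y) = \<Prod> \<sigma>(x + \<omega>\<^sub>i)\<^bsup>a\<^sub>i\<^esup> \<Prod> \<sigma>(y + \<omega>\<^sub>i)\<^bsup>b\<^sub>i\<^esup> (\<sigma>(x + y) \<sigma>(y - x))\<^bsup>-\<tau>\<^esup>\<close>, corrected by an exponential factor,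
  intertwines the equations with parameters \<open>l\<close> and \<open>l'\<close>, so \<open>f \<mapsto> \<integral> K(x, y) f(y) dy\<close> over \<open>[x, x + p]\<close>
  maps Bloch solutions to Bloch solutions with the same multiplier. At large negative energies the
  Bloch solution built from \<open>\<Xi>\<close> decays exponentially and its image does not vanish, so the
  two traces agree there; both are entire in \<open>E\<close>, hence they agree for all \<open>E\<close>.

  For integer parameters \<open>\<Xi>\<close> defines a quadratic form on the solutions that is invariant under
  the monodromy \<open>T\<close>. With \<open>tr T = 2\<alpha>\<close> this gives \<open>T - \<alpha> = \<rho> N / (p\<^sup>2 Q)\<close> for an explicit traceless matrix \<open>N\<close>,
  and \<open>z = \<alpha> + \<i> \<beta>\<close> with \<open>\<beta> = \<rho> / (p \<surd>Q)\<close> satisfies \<open>\<alpha>\<^sup>2 + \<beta>\<^sup>2 = 1\<close> and \<open>dz = \<i> z (\<omega>\<^sub>k c - \<eta>\<^sub>k a) / \<surd>Q dE\<close>,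
  because \<open>\<integral> \<Xi> dx = 2 (\<omega>\<^sub>k c - \<eta>\<^sub>k a)\<close> over a period. For the second formula, the logarithmic derivative
  of \<open>\<Lambda>\<close> has integer residues by the Riccati equation, so \<open>\<Lambda>\<close> exists as a single-valued function, and its
  multiplier can be read off from the functions \<open>\<Phi>\<^sub>i\<close>.\<close>

subsection \<open>Hill's equation on the unit interval\<close>

text \<open>At a single energy the transform may annihilate a Bloch solution, and then it says
  nothing about the trace; this is why the traces are compared only where a Laplace argument shows
  the image to be non-zero, and are continued from there. The kernel is a product of complex powers
  of \<sigma>, hence multivalued, and singular at y = x and y = x + p. With x = X s and y = X (s +
  t), where X s = \<open>x\<^sub>0\<close> + s p, all becomes a matter of two real variables: the
  powers are exponentials of primitives along a line that avoids the half-lattice, y - x = t p is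
  independent of s, and a shift by a period is s -> s + 1. The exponent - \<tau> = j - 1/2 makes the
  singularities at t = 0 and t = 1 integrable, and t = sin^2 \<theta> removes them. The boundary
  terms of the integration by parts vanish because the s-derivative of the logarithm of the kernel
  is 0 at both ends, a consequence of the duplication formula of \<zeta>. In the variable s both
  equations are Hill equations y'' = w y on [0, 1] with w = \<open>p ^ 2\<close> (u - E); their
  solutions, with bounds locally uniform in E, come from a Volterra series.\<close>

definition hill_sol :: "(real \<Rightarrow> complex) \<Rightarrow> (real \<Rightarrow> complex) \<Rightarrow> (real \<Rightarrow> complex) \<Rightarrow> bool" where
  "hill_sol w y y' \<longleftrightarrow> (\<forall>s\<in>{0..1}.
     (y has_vector_derivative y' s) (at s within {0..1}) \<and>
     (y' has_vector_derivative w s * y s) (at s within {0..1}))"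

lemma hill_solD:
  assumes "hill_sol w y y'" "0 \<le> s" "s \<le> 1"
  shows "(y has_vector_derivative y' s) (at s within {0..1})"
    and "(y' has_vector_derivative w s * y s) (at s within {0..1})"
  using assms by (auto simp: hill_sol_def)

lemma hill_sol_continuous:
  assumes "hill_sol w y y'"
  shows "continuous_on {0..1} y" "continuous_on {0..1} y'"
proof -
  show "continuous_on {0..1} y"
    by (rule continuous_on_vector_derivative[of _ _ y']) (use hill_solD[OF assms] in auto)
  show "continuous_on {0..1} y'"
    by (rule continuous_on_vector_derivative[of _ _ "\<lambda>s. w s * y s"]) (use hill_solD[OF assms] in auto)
qed

section \<open>Picard iteration for Hill's equation\<close>

lemma has_vector_derivative_suminf_integral:
  fixes f :: "nat \<Rightarrow> real \<Rightarrow> complex"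
  assumes cont: "\<And>n. continuous_on {0..1} (f n)"
    and bound: "\<And>n s. 0 \<le> s \<Longrightarrow> s \<le> 1 \<Longrightarrow> norm (f n s) \<le> c n"
    and c: "summable c" and s: "0 \<le> s" "s \<le> 1"
  shows "((\<lambda>s. \<Sum>n. integral {0..s} (f n)) has_vector_derivative (\<Sum>n. f n s)) (at s within {0..1})"
proof -
  have ul: "uniform_limit {0..1} (\<lambda>N s. \<Sum>n<N. f n s) (\<lambda>s. \<Sum>n. f n s) sequentially"
    by (rule Weierstrass_m_test[where M = c]) (use bound c in auto)
  have cF: "continuous_on {0..1} (\<lambda>s. \<Sum>n. f n s)"
    by (rule uniform_limit_theorem[OF _ ul]) (auto intro!: always_eventually continuous_on_sum cont)
  have eq: "integral {0..r} (\<lambda>s. \<Sum>n. f n s) = (\<Sum>n. integral {0..r} (f n))" if r: "r \<in> {0..1}" for r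
  proof -
    have sub: "{0..r} \<subseteq> {0..1}" using r by auto
    obtain I J where I: "\<And>N. ((\<lambda>s. \<Sum>n<N. f n s) has_integral I N) {0..r}"
      and J: "((\<lambda>s. \<Sum>n. f n s) has_integral J) {0..r}" and lim: "I \<longlonglongrightarrow> J"
    proof (rule uniform_limit_integral[OF uniform_limit_on_subset[OF ul sub]])
      show "continuous_on {0..r} (\<lambda>s. \<Sum>n<N. f n s)" for N
        by (intro continuous_on_sum continuous_on_subset[OF cont sub])
    qed auto
    have "I N = (\<Sum>n<N. integral {0..r} (f n))" for N
    proof -
      have "((\<lambda>s. \<Sum>n<N. f n s) has_integral (\<Sum>n<N. integral {0..r} (f n))) {0..r}"
        by (intro has_integral_sum integrable_integral integrable_continuous_real
            continuous_on_subset[OF cont sub]) auto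
      with I show ?thesis by (rule has_integral_unique)
    qed
    hence "I = (\<lambda>N. \<Sum>n<N. integral {0..r} (f n))" by auto
    with lim have "(\<lambda>n. integral {0..r} (f n)) sums J" by (simp add: sums_def)
    thus ?thesis using J by (simp add: integral_unique sums_unique)
  qed
  have "((\<lambda>s. integral {0..s} (\<lambda>s. \<Sum>n. f n s)) has_vector_derivative (\<Sum>n. f n s)) (at s within {0..1})"
    by (rule integral_has_vector_derivative[OF cF]) (use s in auto)
  thus ?thesis
    by (rule has_vector_derivative_transform[rotated 2]) (use s eq in auto)
qed

text \<open>Terms of the Picard series of y'' = w y: the double integral inverts the second
  derivative with zero initial values, so the sum solves the equation with the initial data a, b of
  the term n = 0.\<close>

primrec volterra :: "(real \<Rightarrow> complex) \<Rightarrow> complex \<Rightarrow> complex \<Rightarrow> nat \<Rightarrow> real \<Rightarrow> complex" where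
  "volterra w a b 0 = (\<lambda>s. a + of_real s * b)"
| "volterra w a b (Suc n) = (\<lambda>s. integral {0..s} (\<lambda>r. integral {0..r} (\<lambda>q. w q * volterra w a b n q)))"

lemma integral_power_0:
  fixes s :: real assumes "0 \<le> s"
  shows "((\<lambda>r. r ^ n) has_integral s ^ Suc n / Suc n) {0..s}"
proof -
  have "((\<lambda>r. r ^ n) has_integral (s ^ Suc n / Suc n - 0 ^ Suc n / Suc n)) {0..s}"
  proof (rule fundamental_theorem_of_calculus[OF assms])
    fix r :: real
    show "((\<lambda>r. r ^ Suc n / Suc n) has_vector_derivative r ^ n) (at r within {0..s})"
      using DERIV_cdivide[OF DERIV_pow[of "Suc n" r "{0..s}"], of "real (Suc n)"]
      by (simp flip: has_real_derivative_iff_has_vector_derivative del: power_Suc of_nat_Suc)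
  qed
  thus ?thesis by simp
qed

lemma volterra_continuous:
  assumes w: "continuous_on {0..1} w"
  shows "continuous_on {0..1} (volterra w a b n)"
    and "continuous_on {0..1} (\<lambda>s. integral {0..s} (\<lambda>q. w q * volterra w a b n q))"
proof (induction n)
  case 0
  { case 1 show ?case by (auto intro!: continuous_intros) }
  { case 2 show ?case
      by (intro indefinite_integral_continuous_1 integrable_continuous_real)
         (auto intro!: continuous_intros w) }
next
  case (Suc n)
  { case 1 show ?case
      unfolding volterra.simps
      by (intro indefinite_integral_continuous_1 integrable_continuous_real Suc) }
  note c = this
  { case 2 show ?case
      by (intro indefinite_integral_continuous_1 integrable_continuous_real continuous_on_mult w c) }
qed

text \<open>The claims, one for a term and one for the derivative of the next term, feed each other
  in one induction. Only every second integration is exploited: the gain s / (n + 2) of the outer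
  one is estimated by 1, which still leaves an exponential majorant.\<close>

lemma volterra_bound:
  assumes w: "continuous_on {0..1} w" and M: "\<And>s. 0 \<le> s \<Longrightarrow> s \<le> 1 \<Longrightarrow> norm (w s) \<le> M"
    and s: "0 \<le> s" "s \<le> 1"
  shows "norm (volterra w a b n s) \<le> (norm a + norm b) * M ^ n * s ^ n / fact n"
    and "norm (integral {0..s} (\<lambda>q. w q * volterra w a b n q)) \<le>
          (norm a + norm b) * M ^ Suc n * s ^ Suc n / fact (Suc n)"
  using s
proof (induction n arbitrary: s)
  have M0: "0 \<le> M" using M[of 0] norm_ge_zero[of "w 0"] by linarith
  have step2: "norm (integral {0..s} (\<lambda>q. w q * volterra w a b n q)) \<le>
          (norm a + norm b) * M ^ Suc n * s ^ Suc n / fact (Suc n)"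
    if IH: "\<And>s. 0 \<le> s \<Longrightarrow> s \<le> 1 \<Longrightarrow> norm (volterra w a b n s) \<le> (norm a + norm b) * M ^ n * s ^ n / fact n"
      and s: "0 \<le> s" "s \<le> 1" for n s
  proof -
    have sub: "{0..s} \<subseteq> {0..1}" using s by auto
    have hi: "((\<lambda>r. (norm a + norm b) * M ^ Suc n / fact n * r ^ n) has_integral
        (norm a + norm b) * M ^ Suc n / fact n * (s ^ Suc n / Suc n)) {0..s}"
      by (intro has_integral_mult_right integral_power_0 s)
    have "norm (integral {0..s} (\<lambda>q. w q * volterra w a b n q))
        \<le> integral {0..s} (\<lambda>r. (norm a + norm b) * M ^ Suc n / fact n * r ^ n)"
    proof (rule integral_norm_bound_integral)
      show "(\<lambda>q. w q * volterra w a b n q) integrable_on {0..s}"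
        by (intro integrable_continuous_real continuous_on_mult continuous_on_subset[OF w sub]
            continuous_on_subset[OF volterra_continuous(1)[OF w] sub])
      show "(\<lambda>r. (norm a + norm b) * M ^ Suc n / fact n * r ^ n) integrable_on {0..s}"
        using hi by blast
      fix q assume q: "q \<in> {0..s}"
      have "norm (w q) * norm (volterra w a b n q) \<le> M * ((norm a + norm b) * M ^ n * q ^ n / fact n)"
        by (intro mult_mono M IH) (use q s M0 in auto)
      thus "norm (w q * volterra w a b n q) \<le> (norm a + norm b) * M ^ Suc n / fact n * q ^ n"
        by (simp add: norm_mult mult_ac)
    qed
    also have "\<dots> = (norm a + norm b) * M ^ Suc n / fact n * (s ^ Suc n / Suc n)"
      using hi by (rule integral_unique)
    also have "\<dots> = (norm a + norm b) * M ^ Suc n * s ^ Suc n / fact (Suc n)"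
      by (simp add: field_simps)
    finally show ?thesis .
  qed
  case 0
  { case 1
    have "norm (a + of_real s * b) \<le> norm a + s * norm b"
      using 1 norm_triangle_ineq[of a "of_real s * b"] by (simp add: norm_mult)
    also have "\<dots> \<le> norm a + norm b" using 1 by (simp add: mult_left_le_one_le)
    finally show ?case by simp }
  note base = this
  { case 2 show ?case using step2[of 0 s] base 2 by blast }
next
  case (Suc n)
  have M0: "0 \<le> M" using M[of 0] norm_ge_zero[of "w 0"] by linarith
  have IH2: "norm (integral {0..s} (\<lambda>q. w q * volterra w a b n q)) \<le>
          (norm a + norm b) * M ^ Suc n * s ^ Suc n / fact (Suc n)" if "0 \<le> s" "s \<le> 1" for s
    using Suc that by blast
  have b1: "norm (volterra w a b (Suc n) s) \<le> (norm a + norm b) * M ^ Suc n * s ^ Suc n / fact (Suc n)"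
    if s: "0 \<le> s" "s \<le> 1" for s
  proof -
    have sub: "{0..s} \<subseteq> {0..1}" using s by auto
    have hi: "((\<lambda>r. (norm a + norm b) * M ^ Suc n / fact (Suc n) * r ^ Suc n) has_integral
        (norm a + norm b) * M ^ Suc n / fact (Suc n) * (s ^ Suc (Suc n) / Suc (Suc n))) {0..s}"
      by (intro has_integral_mult_right integral_power_0 s)
    have "norm (volterra w a b (Suc n) s)
        \<le> integral {0..s} (\<lambda>r. (norm a + norm b) * M ^ Suc n / fact (Suc n) * r ^ Suc n)"
      unfolding volterra.simps
    proof (rule integral_norm_bound_integral)
      show "(\<lambda>r. integral {0..r} (\<lambda>q. w q * volterra w a b n q)) integrable_on {0..s}"
        by (intro integrable_continuous_real continuous_on_subset[OF volterra_continuous(2)[OF w] sub])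
      show "(\<lambda>r. (norm a + norm b) * M ^ Suc n / fact (Suc n) * r ^ Suc n) integrable_on {0..s}"
        using hi by blast
      fix q assume q: "q \<in> {0..s}"
      show "norm (integral {0..q} (\<lambda>q. w q * volterra w a b n q)) \<le> (norm a + norm b) * M ^ Suc n / fact (Suc n) * q ^ Suc n"
        using IH2[of q] q s by (simp add: field_simps)
    qed
    also have "\<dots> = (norm a + norm b) * M ^ Suc n / fact (Suc n) * s ^ Suc n * (s / Suc (Suc n))"
      using integral_unique[OF hi] by (simp add: field_simps)
    also have "\<dots> \<le> (norm a + norm b) * M ^ Suc n / fact (Suc n) * s ^ Suc n * 1"
      using s M0 by (intro mult_left_mono) (auto intro!: divide_nonneg_nonneg)
    finally show ?thesis by simp
  qed
  { case 1 thus ?case using b1 by blast }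
  { case 2
    have M0: "0 \<le> M" using M[of 0] norm_ge_zero[of "w 0"] by linarith
    have sub: "{0..s} \<subseteq> {0..1}" using 2 by auto
    have hi: "((\<lambda>r. (norm a + norm b) * M ^ Suc (Suc n) / fact (Suc n) * r ^ Suc n) has_integral
        (norm a + norm b) * M ^ Suc (Suc n) / fact (Suc n) * (s ^ Suc (Suc n) / Suc (Suc n))) {0..s}"
      by (intro has_integral_mult_right integral_power_0 2)
    have "norm (integral {0..s} (\<lambda>q. w q * volterra w a b (Suc n) q))
        \<le> integral {0..s} (\<lambda>r. (norm a + norm b) * M ^ Suc (Suc n) / fact (Suc n) * r ^ Suc n)"
    proof (rule integral_norm_bound_integral)
      show "(\<lambda>q. w q * volterra w a b (Suc n) q) integrable_on {0..s}"
        by (intro integrable_continuous_real continuous_on_mult continuous_on_subset[OF w sub]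
            continuous_on_subset[OF volterra_continuous(1)[OF w] sub])
      show "(\<lambda>r. (norm a + norm b) * M ^ Suc (Suc n) / fact (Suc n) * r ^ Suc n) integrable_on {0..s}"
        using hi by blast
      fix q assume q: "q \<in> {0..s}"
      have "norm (w q) * norm (volterra w a b (Suc n) q) \<le> M * ((norm a + norm b) * M ^ Suc n * q ^ Suc n / fact (Suc n))"
        by (intro mult_mono M b1) (use q 2 M0 in \<open>auto simp del: volterra.simps\<close>)
      thus "norm (w q * volterra w a b (Suc n) q) \<le> (norm a + norm b) * M ^ Suc (Suc n) / fact (Suc n) * q ^ Suc n"
        by (simp add: norm_mult mult_ac del: volterra.simps)
    qed
    also have "\<dots> = (norm a + norm b) * M ^ Suc (Suc n) / fact (Suc n) * (s ^ Suc (Suc n) / Suc (Suc n))"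
      using hi by (rule integral_unique)
    also have "\<dots> = (norm a + norm b) * M ^ Suc (Suc n) * s ^ Suc (Suc n) / fact (Suc (Suc n))"
      by (simp add: field_simps)
    finally show ?case . }
qed


text \<open>Summing the bounds of the terms gives \<open>exp M\<close>. The estimate belongs to the
  conclusion because it is uniform in all w bounded by M, and continuity in the spectral parameter
  rests on it.\<close>

lemma hill_sol_exists:
  assumes w: "continuous_on {0..1} w" and M: "\<And>s. 0 \<le> s \<Longrightarrow> s \<le> 1 \<Longrightarrow> norm (w s) \<le> M"
  obtains y y' where "hill_sol w y y'" "y 0 = a" "y' 0 = b"
    "\<And>s. 0 \<le> s \<Longrightarrow> s \<le> 1 \<Longrightarrow> norm (y s) \<le> (norm a + norm b) * exp M"
proof -
  have M0: "0 \<le> M" using M[of 0] norm_ge_zero[of "w 0"] by linarith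
  define c where "c n = (norm a + norm b) * (M ^ n / fact n)" for n
  have c_sums: "c sums ((norm a + norm b) * exp M)"
    unfolding c_def using exp_converges[of M] by (intro sums_mult) (simp add: divide_inverse mult_ac)
  hence c: "summable c" by (rule sums_summable)
  let ?u = "volterra w a b" and ?v = "\<lambda>n s. integral {0..s} (\<lambda>q. w q * volterra w a b n q)"
  have pw: "(norm a + norm b) * M ^ n * s ^ n / fact n \<le> c n" if "0 \<le> s" "s \<le> 1" for n and s :: real
  proof -
    have "c n * s ^ n \<le> c n * 1"
      by (intro mult_left_mono power_le_one that) (auto simp: c_def M0)
    thus ?thesis by (simp add: c_def field_simps)
  qed
  have ub: "norm (?u n s) \<le> c n" if "0 \<le> s" "s \<le> 1" for n s
    using volterra_bound(1)[OF w M that] pw[OF that] by (rule order_trans)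
  have vb: "norm (?v n s) \<le> c (Suc n)" if "0 \<le> s" "s \<le> 1" for n s
    using volterra_bound(2)[OF w M that] pw[OF that] by (rule order_trans)
  have wub: "norm (w s * ?u n s) \<le> M * c n" if "0 \<le> s" "s \<le> 1" for n s
    unfolding norm_mult by (intro mult_mono M ub that M0 norm_ge_zero)
  have uc: "continuous_on {0..1} (?u n)" for n by (rule volterra_continuous[OF w])
  have vc: "continuous_on {0..1} (?v n)" for n by (rule volterra_continuous[OF w])
  define z where "z s = b + (\<Sum>n. ?v n s)" for s
  define y where "y s = (\<Sum>n. ?u n s)" for s
  have summ_u: "summable (\<lambda>n. ?u n s)" if "0 \<le> s" "s \<le> 1" for s
    by (rule summable_comparison_test'[OF c]) (use ub that in auto)
  have y_eq: "y s = a + of_real s * b + (\<Sum>n. integral {0..s} (?v n))" if "0 \<le> s" "s \<le> 1" for s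
    using suminf_split_head[OF summ_u[OF that]] by (simp add: y_def algebra_simps)
  have dy: "(y has_vector_derivative z s) (at s within {0..1})" if s: "0 \<le> s" "s \<le> 1" for s
  proof -
    have "((\<lambda>s. \<Sum>n. integral {0..s} (?v n)) has_vector_derivative (\<Sum>n. ?v n s)) (at s within {0..1})"
      by (rule has_vector_derivative_suminf_integral[where c = "\<lambda>n. c (Suc n)"])
         (use vb vc s c summable_Suc_iff[of c] in auto)
    moreover have "((\<lambda>s. a + of_real s * b) has_vector_derivative b) (at s within {0..1})"
      by (auto intro!: derivative_eq_intros)
    ultimately have "((\<lambda>s. (a + of_real s * b) + (\<Sum>n. integral {0..s} (?v n))) has_vector_derivative z s)
        (at s within {0..1})"
      unfolding z_def by (rule has_vector_derivative_add[rotated])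
    thus ?thesis
      by (rule has_vector_derivative_transform[rotated 2]) (use s y_eq in auto)
  qed
  have dz: "(z has_vector_derivative w s * y s) (at s within {0..1})" if s: "0 \<le> s" "s \<le> 1" for s
  proof -
    have "((\<lambda>s. \<Sum>n. integral {0..s} (\<lambda>q. w q * ?u n q)) has_vector_derivative (\<Sum>n. w s * ?u n s)) (at s within {0..1})"
      by (rule has_vector_derivative_suminf_integral[where c = "\<lambda>n. M * c n"])
         (use wub s c in \<open>auto intro!: continuous_intros uc w summable_mult\<close>)
    hence "((\<lambda>s. b + (\<Sum>n. ?v n s)) has_vector_derivative 0 + (\<Sum>n. w s * ?u n s)) (at s within {0..1})"
      by (intro has_vector_derivative_add has_vector_derivative_const)
    thus ?thesis
      unfolding z_def[abs_def] y_def using suminf_mult[OF summ_u[OF s], of "w s"] by simp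
  qed
  show ?thesis
  proof (rule that[of y z])
    show "hill_sol w y z" using dy dz by (auto simp: hill_sol_def)
    show "y 0 = a" by (simp add: y_eq)
    show "z 0 = b" by (simp add: z_def)
    show "norm (y s) \<le> (norm a + norm b) * exp M" if "0 \<le> s" "s \<le> 1" for s
    proof -
      have "norm (y s) \<le> (\<Sum>n. c n)"
        unfolding y_def by (rule norm_suminf_le[OF _ c]) (use ub that in auto)
      thus ?thesis using c_sums by (simp add: sums_iff)
    qed
  qed
qed

section \<open>Wronskians and analytic dependence on the spectral parameter\<close>

lemma hill_lagrange:
  assumes y: "hill_sol (\<lambda>s. V s + \<kappa>) y y'" and z: "hill_sol (\<lambda>s. V s + \<mu>) z z'"
    and s: "0 \<le> s" "s \<le> 1"
  shows "((\<lambda>r. y r * z r) integrable_on {0..s})"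
    and "y s * z' s - y' s * z s = y 0 * z' 0 - y' 0 * z 0 + (\<mu> - \<kappa>) * integral {0..s} (\<lambda>r. y r * z r)"
proof -
  have sub: "{0..s} \<subseteq> {0..1}" using s by auto
  show int: "(\<lambda>r. y r * z r) integrable_on {0..s}"
    by (intro integrable_continuous_real continuous_on_mult
        continuous_on_subset[OF hill_sol_continuous(1)[OF y] sub]
        continuous_on_subset[OF hill_sol_continuous(1)[OF z] sub])
  \<comment> \<open>Lagrange's identity: in the derivative of y z' - y' z the products y' z' and the
    terms with V cancel.\<close>
  have "((\<lambda>r. (\<mu> - \<kappa>) * (y r * z r)) has_integral
      (y s * z' s - y' s * z s) - (y 0 * z' 0 - y' 0 * z 0)) {0..s}"
  proof (rule fundamental_theorem_of_calculus[OF s(1)])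
    fix r assume r: "r \<in> {0..s}"
    have r1: "0 \<le> r" "r \<le> 1" using r s by auto
    note d = has_vector_derivative_within_subset[OF hill_solD(1)[OF y r1] sub]
      has_vector_derivative_within_subset[OF hill_solD(2)[OF y r1] sub]
      has_vector_derivative_within_subset[OF hill_solD(1)[OF z r1] sub]
      has_vector_derivative_within_subset[OF hill_solD(2)[OF z r1] sub]
    show "((\<lambda>r. y r * z' r - y' r * z r) has_vector_derivative (\<mu> - \<kappa>) * (y r * z r)) (at r within {0..s})"
      by (rule has_vector_derivative_eq_rhs,
          rule has_vector_derivative_diff[OF has_vector_derivative_mult[OF d(1) d(4)]
            has_vector_derivative_mult[OF d(2) d(3)]])
         (simp add: algebra_simps)
  qed
  thus "y s * z' s - y' s * z s = y 0 * z' 0 - y' 0 * z 0 + (\<mu> - \<kappa>) * integral {0..s} (\<lambda>r. y r * z r)"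
    using has_integral_unique[OF _ has_integral_mult_right[OF integrable_integral[OF int], of "\<mu> - \<kappa>"]]
    by (fastforce simp: algebra_simps)
qed

lemma hill_wronskian:
  assumes "hill_sol w y y'" "hill_sol w z z'" "0 \<le> s" "s \<le> 1"
  shows "y s * z' s - y' s * z s = y 0 * z' 0 - y' 0 * z 0"
  using hill_lagrange(2)[of w 0 y y' 0 z z' s] assms by simp

text \<open>One choice for y and y' together, so that both belong to the same solution. The estimate
  is demanded for every bound M at once, so that later no supremum of w has to be mentioned.\<close>

definition hill_pair :: "(real \<Rightarrow> complex) \<Rightarrow> complex \<Rightarrow> complex \<Rightarrow> (real \<Rightarrow> complex) \<times> (real \<Rightarrow> complex)" where
  "hill_pair w a b = (SOME (y, y'). hill_sol w y y' \<and> y 0 = a \<and> y' 0 = b \<and>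
     (\<forall>M. (\<forall>s\<in>{0..1}. norm (w s) \<le> M) \<longrightarrow> (\<forall>s\<in>{0..1}. norm (y s) \<le> (norm a + norm b) * exp M)))"

definition hill_y where "hill_y w a b = fst (hill_pair w a b)"
definition hill_dy where "hill_dy w a b = snd (hill_pair w a b)"

lemma hill_y_aux:
  assumes w: "continuous_on {0..1} w"
  shows "hill_sol w (hill_y w a b) (hill_dy w a b) \<and> hill_y w a b 0 = a \<and> hill_dy w a b 0 = b \<and>
     (\<forall>M. (\<forall>s\<in>{0..1}. norm (w s) \<le> M) \<longrightarrow> (\<forall>s\<in>{0..1}. norm (hill_y w a b s) \<le> (norm a + norm b) * exp M))"
proof -
  let ?P = "\<lambda>(y, y'). hill_sol w y y' \<and> y 0 = a \<and> y' 0 = b \<and>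
     (\<forall>M. (\<forall>s\<in>{0..1}. norm (w s) \<le> M) \<longrightarrow> (\<forall>s\<in>{0..1}. norm (y s) \<le> (norm a + norm b) * exp M))"
  have bdd: "bounded (w ` {0..1})" using compact_continuous_image[OF w] compact_imp_bounded by blast
  define M where "M = (SUP s\<in>{0..1}. norm (w s))"
  have bdd': "bdd_above ((\<lambda>s. norm (w s)) ` {0..1})"
    using bdd by (auto simp: bounded_iff bdd_above_def)
  have M: "norm (w s) \<le> M" if "0 \<le> s" "s \<le> 1" for s
    unfolding M_def by (rule cSUP_upper[OF _ bdd']) (use that in auto)
  have Mle: "M \<le> M'" if "\<forall>s\<in>{0..1}. norm (w s) \<le> M'" for M'
    unfolding M_def by (rule cSUP_least) (use that in auto)
  obtain y y' where "hill_sol w y y'" "y 0 = a" "y' 0 = b"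
    and bd: "\<And>s. 0 \<le> s \<Longrightarrow> s \<le> 1 \<Longrightarrow> norm (y s) \<le> (norm a + norm b) * exp M"
    using hill_sol_exists[OF w M] by blast
  moreover have "norm (y s) \<le> (norm a + norm b) * exp M'"
    if "\<forall>s\<in>{0..1}. norm (w s) \<le> M'" "s \<in> {0..1}" for M' s
  proof -
    have "norm (y s) \<le> (norm a + norm b) * exp M" using bd that by auto
    also have "\<dots> \<le> (norm a + norm b) * exp M'" using Mle[OF that(1)] by (intro mult_left_mono) auto
    finally show ?thesis .
  qed
  ultimately have "?P (y, y')" by auto
  hence "?P (hill_pair w a b)" unfolding hill_pair_def by (rule someI)
  thus ?thesis by (simp add: hill_y_def hill_dy_def case_prod_unfold)
qed

lemma hill_y:
  assumes "continuous_on {0..1} w"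
  shows "hill_sol w (hill_y w a b) (hill_dy w a b)" "hill_y w a b 0 = a" "hill_dy w a b 0 = b"
    and "(\<And>s. s \<in> {0..1} \<Longrightarrow> norm (w s) \<le> M) \<Longrightarrow> s \<in> {0..1} \<Longrightarrow> norm (hill_y w a b s) \<le> (norm a + norm b) * exp M"
  using hill_y_aux[OF assms, of a b] by auto

text \<open>Cramer's rule: the Wronskians of y with the two fundamental solutions are the constants
  y 0 and - y' 0, and the determinant of the resulting linear system is the Wronskian 1.\<close>

lemma hill_sol_representation:
  assumes w: "continuous_on {0..1} w" and y: "hill_sol w y y'" and s: "0 \<le> s" "s \<le> 1"
  shows "y s = y 0 * hill_y w 1 0 s + y' 0 * hill_y w 0 1 s"
    and "y' s = y 0 * hill_dy w 1 0 s + y' 0 * hill_dy w 0 1 s"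
proof -
  note h = hill_y[OF w]
  have W: "hill_y w 1 0 s * hill_dy w 0 1 s - hill_dy w 1 0 s * hill_y w 0 1 s = 1"
    using hill_wronskian[OF h(1) h(1) s, of 1 0 0 1] by (simp add: h)
  have 1: "y s * hill_dy w 0 1 s - y' s * hill_y w 0 1 s = y 0"
    using hill_wronskian[OF y h(1) s, of 0 1] by (simp add: h)
  have 2: "y s * hill_dy w 1 0 s - y' s * hill_y w 1 0 s = - y' 0"
    using hill_wronskian[OF y h(1) s, of 1 0] by (simp add: h)
  show "y s = y 0 * hill_y w 1 0 s + y' 0 * hill_y w 0 1 s"
    "y' s = y 0 * hill_dy w 1 0 s + y' 0 * hill_dy w 0 1 s"
    using W 1 2 by algebra+
qed

lemma hill_sol_unique:
  assumes w: "continuous_on {0..1} w" and y: "hill_sol w y y'" "y 0 = 0" "y' 0 = 0"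
    and s: "0 \<le> s" "s \<le> 1"
  shows "y s = 0" "y' s = 0"
  using hill_sol_representation[OF w y(1) s] y by auto

text \<open>Lagrange's identity between a solution at \<mu> and the fundamental solutions at
  \<kappa>, solved by Cramer's rule. The formula is exact, and apart from the factor \<mu> -
  \<kappa> only the integrals on the right involve \<mu>; so continuity in \<mu> already yields the
  derivative.\<close>

lemma hill_variation:
  fixes a b \<kappa> \<mu> :: complex
  assumes V: "continuous_on {0..1} V" and s: "0 \<le> s" "s \<le> 1"
  defines "u \<equiv> \<lambda>\<nu>. hill_y (\<lambda>s. V s + \<nu>)" and "du \<equiv> \<lambda>\<nu>. hill_dy (\<lambda>s. V s + \<nu>)"
  defines "I1 \<equiv> \<lambda>\<mu>. integral {0..s} (\<lambda>r. u \<mu> a b r * u \<kappa> 1 0 r)"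
    and "I2 \<equiv> \<lambda>\<mu>. integral {0..s} (\<lambda>r. u \<mu> a b r * u \<kappa> 0 1 r)"
  shows "u \<mu> a b s = u \<kappa> a b s + (\<mu> - \<kappa>) * (u \<kappa> 0 1 s * I1 \<mu> - u \<kappa> 1 0 s * I2 \<mu>)"
    and "du \<mu> a b s = du \<kappa> a b s + (\<mu> - \<kappa>) * (du \<kappa> 0 1 s * I1 \<mu> - du \<kappa> 1 0 s * I2 \<mu>)"
proof -
  have c: "continuous_on {0..1} (\<lambda>s. V s + \<nu>)" for \<nu> by (intro continuous_intros V)
  have h: "hill_sol (\<lambda>s. V s + \<nu>) (u \<nu> a' b') (du \<nu> a' b')" "u \<nu> a' b' 0 = a'" "du \<nu> a' b' 0 = b'" for \<nu> a' b'
    unfolding u_def du_def by (rule hill_y[OF c])+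
  have W: "u \<kappa> 1 0 s * du \<kappa> 0 1 s - du \<kappa> 1 0 s * u \<kappa> 0 1 s = 1"
    using hill_wronskian[OF h(1)[of \<kappa> 1 0] h(1)[of \<kappa> 0 1] s] by (simp add: h)
  have 1: "u \<mu> a b s * du \<kappa> 1 0 s - du \<mu> a b s * u \<kappa> 1 0 s = - b + (\<kappa> - \<mu>) * I1 \<mu>"
    using hill_lagrange(2)[OF h(1) h(1) s, of \<mu> a b \<kappa> 1 0] by (simp add: h I1_def)
  have 2: "u \<mu> a b s * du \<kappa> 0 1 s - du \<mu> a b s * u \<kappa> 0 1 s = a + (\<kappa> - \<mu>) * I2 \<mu>"
    using hill_lagrange(2)[OF h(1) h(1) s, of \<mu> a b \<kappa> 0 1] by (simp add: h I2_def)
  have 3: "u \<kappa> a b s = a * u \<kappa> 1 0 s + b * u \<kappa> 0 1 s" "du \<kappa> a b s = a * du \<kappa> 1 0 s + b * du \<kappa> 0 1 s"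
    using hill_sol_representation[OF c h(1) s, of \<kappa> a b] by (simp_all add: h u_def du_def hill_y[OF c])
  show "u \<mu> a b s = u \<kappa> a b s + (\<mu> - \<kappa>) * (u \<kappa> 0 1 s * I1 \<mu> - u \<kappa> 1 0 s * I2 \<mu>)"
    using W 1 2 3(1) by algebra
  show "du \<mu> a b s = du \<kappa> a b s + (\<mu> - \<kappa>) * (du \<kappa> 0 1 s * I1 \<mu> - du \<kappa> 1 0 s * I2 \<mu>)"
    using W 1 2 3(2) by algebra
qed

lemma hill_y_uniform_limit:
  assumes V: "continuous_on {0..1} V"
  shows "uniform_limit {0..1} (\<lambda>\<mu>. hill_y (\<lambda>s. V s + \<mu>) a b) (hill_y (\<lambda>s. V s + \<kappa>) a b) (at \<kappa>)"
proof -
  define u where "u = (\<lambda>\<nu>. hill_y (\<lambda>s. V s + \<nu>))"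
  have c: "continuous_on {0..1} (\<lambda>s. V s + \<nu>)" for \<nu> by (intro continuous_intros V)
  have h: "hill_sol (\<lambda>s. V s + \<nu>) (u \<nu> a' b') (hill_dy (\<lambda>s. V s + \<nu>) a' b')" for \<nu> a' b'
    unfolding u_def by (rule hill_y[OF c])
  obtain B where B: "\<And>s. s \<in> {0..1} \<Longrightarrow> norm (V s) \<le> B"
    using compact_imp_bounded[OF compact_continuous_image[OF V compact_Icc]]
    unfolding bounded_iff by blast
  \<comment> \<open>A common bound of all solutions involved for |\<nu> - \<kappa>| <= 1; the extra
    1 covers the initial data (1, 0) and (0, 1).\<close>
  define K where "K = (norm a + norm b + 1) * exp (B + norm \<kappa> + 1)"
  have K0: "0 \<le> K" by (simp add: K_def)
  have bd: "norm (u \<nu> a' b' s) \<le> K" if "norm (\<nu> - \<kappa>) \<le> 1" "s \<in> {0..1}" "norm a' + norm b' \<le> norm a + norm b + 1"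
    for \<nu> a' b' s
  proof -
    have "norm (V s + \<nu>) \<le> B + norm \<kappa> + 1" if "s \<in> {0..1}" for s
      using B[OF that] \<open>norm (\<nu> - \<kappa>) \<le> 1\<close> norm_triangle_ineq[of "V s" \<nu>] norm_triangle_ineq2[of \<nu> \<kappa>] by linarith
    from hill_y(4)[OF c this that(2)] have "norm (u \<nu> a' b' s) \<le> (norm a' + norm b') * exp (B + norm \<kappa> + 1)"
      by (simp add: u_def)
    also have "\<dots> \<le> K" unfolding K_def by (intro mult_right_mono that) auto
    finally show ?thesis .
  qed
  have diff: "norm (u \<mu> a b s - u \<kappa> a b s) \<le> norm (\<mu> - \<kappa>) * (2 * K ^ 3)"
    if mu: "norm (\<mu> - \<kappa>) \<le> 1" and s: "s \<in> {0..1}" for \<mu> s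
  proof -
    have s': "0 \<le> s" "s \<le> 1" using s by auto
    have int: "norm (integral {0..s} (\<lambda>r. u \<mu> a b r * u \<kappa> a' b' r)) \<le> K * K"
      if ab: "norm a' + norm b' \<le> norm a + norm b + 1" for a' b'
    proof -
      have "norm (integral {0..s} (\<lambda>r. u \<mu> a b r * u \<kappa> a' b' r)) \<le> integral {0..s} (\<lambda>r. K * K)"
      proof (rule integral_norm_bound_integral)
        show "(\<lambda>r. u \<mu> a b r * u \<kappa> a' b' r) integrable_on {0..s}"
          by (rule hill_lagrange(1)[OF h h s'])
        fix r assume r: "r \<in> {0..s}"
        show "norm (u \<mu> a b r * u \<kappa> a' b' r) \<le> K * K"
          unfolding norm_mult by (intro mult_mono bd) (use r s mu ab K0 in auto)
      qed auto
      also have "\<dots> = s * (K * K)" using s' by simp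
      also have "\<dots> \<le> 1 * (K * K)" by (rule mult_right_mono) (use s' K0 in auto)
      finally show ?thesis by simp
    qed
    have "norm (u \<mu> a b s - u \<kappa> a b s) = norm (\<mu> - \<kappa>) *
        norm (u \<kappa> 0 1 s * integral {0..s} (\<lambda>r. u \<mu> a b r * u \<kappa> 1 0 r) - u \<kappa> 1 0 s * integral {0..s} (\<lambda>r. u \<mu> a b r * u \<kappa> 0 1 r))"
      using hill_variation(1)[OF V s', of \<mu> a b \<kappa>] by (simp add: u_def norm_mult)
    also have "\<dots> \<le> norm (\<mu> - \<kappa>) * (K * (K * K) + K * (K * K))"
    proof (rule mult_left_mono)
      show "norm (u \<kappa> 0 1 s * integral {0..s} (\<lambda>r. u \<mu> a b r * u \<kappa> 1 0 r) - u \<kappa> 1 0 s * integral {0..s} (\<lambda>r. u \<mu> a b r * u \<kappa> 0 1 r))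
        \<le> K * (K * K) + K * (K * K)"
        using bd[of \<kappa> s 1 0] bd[of \<kappa> s 0 1] int[of 1 0] int[of 0 1] s K0
        by (intro order_trans[OF norm_triangle_ineq4] add_mono) (auto simp: norm_mult intro!: mult_mono)
    qed auto
    finally show ?thesis by (simp add: power3_eq_cube algebra_simps)
  qed
  have "uniform_limit {0..1} (\<lambda>\<mu>. u \<mu> a b) (u \<kappa> a b) (at \<kappa>)"
  proof (rule uniform_limitI)
    fix e :: real assume e: "0 < e"
    define d where "d = min 1 (e / (2 * K ^ 3 + 1))"
    have d: "0 < d" using e K0 by (auto simp: d_def intro!: divide_pos_pos add_nonneg_pos)
    have "\<forall>\<^sub>F \<mu> in at \<kappa>. dist \<mu> \<kappa> < d" using d by (auto simp: eventually_at)
    thus "\<forall>\<^sub>F \<mu> in at \<kappa>. \<forall>s\<in>{0..1}. dist (u \<mu> a b s) (u \<kappa> a b s) < e"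
    proof eventually_elim
      case (elim \<mu>)
      have mu: "norm (\<mu> - \<kappa>) \<le> 1" "norm (\<mu> - \<kappa>) < e / (2 * K ^ 3 + 1)"
        using elim by (auto simp: d_def dist_norm)
      show ?case
      proof
        fix s :: real assume s: "s \<in> {0..1}"
        have "norm (u \<mu> a b s - u \<kappa> a b s) \<le> norm (\<mu> - \<kappa>) * (2 * K ^ 3)" by (rule diff[OF mu(1) s])
        also have "\<dots> \<le> norm (\<mu> - \<kappa>) * (2 * K ^ 3 + 1)" by (intro mult_left_mono) auto
        also have "\<dots> < e"
        proof -
          have "0 < 2 * K ^ 3 + 1" using K0 by (simp add: add_nonneg_pos)
          thus ?thesis using mu(2) by (simp only: pos_less_divide_eq)
        qed
        finally show "dist (u \<mu> a b s) (u \<kappa> a b s) < e" by (simp add: dist_norm)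
      qed
    qed
  qed
  thus ?thesis by (simp add: u_def)
qed

text \<open>The difference quotients of \<open>hill_variation\<close>, with the limit taken under
  the integrals by uniform convergence. The explicit form is what later identifies the derivative of
  the trace.\<close>

lemma hill_y_has_field_derivative:
  fixes a b \<kappa> :: complex
  assumes V: "continuous_on {0..1} V"
  defines "u \<equiv> \<lambda>\<nu>. hill_y (\<lambda>s. V s + \<nu>)" and "du \<equiv> \<lambda>\<nu>. hill_dy (\<lambda>s. V s + \<nu>)"
  defines "I1 \<equiv> integral {0..1} (\<lambda>r. u \<kappa> a b r * u \<kappa> 1 0 r)"
    and "I2 \<equiv> integral {0..1} (\<lambda>r. u \<kappa> a b r * u \<kappa> 0 1 r)"
  shows "((\<lambda>\<mu>. u \<mu> a b 1) has_field_derivative u \<kappa> 0 1 1 * I1 - u \<kappa> 1 0 1 * I2) (at \<kappa>)"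
    and "((\<lambda>\<mu>. du \<mu> a b 1) has_field_derivative du \<kappa> 0 1 1 * I1 - du \<kappa> 1 0 1 * I2) (at \<kappa>)"
proof -
  have c: "continuous_on {0..1} (\<lambda>s. V s + \<nu>)" for \<nu> by (intro continuous_intros V)
  have h: "hill_sol (\<lambda>s. V s + \<nu>) (u \<nu> a' b') (du \<nu> a' b')" "u \<nu> a' b' 0 = a'" "du \<nu> a' b' 0 = b'" for \<nu> a' b'
    unfolding u_def du_def by (rule hill_y[OF c])+
  have uc: "continuous_on {0..1} (u \<nu> a' b')" for \<nu> a' b' by (rule hill_sol_continuous(1)[OF h(1)])
  have lim: "((\<lambda>\<mu>. integral {0..1} (\<lambda>r. u \<mu> a b r * u \<kappa> a' b' r)) \<longlongrightarrow>
      integral {0..1} (\<lambda>r. u \<kappa> a b r * u \<kappa> a' b' r)) (at \<kappa>)" for a' b'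
  proof -
    have bd: "bounded (u \<kappa> a b ` {0..1})" "bounded (u \<kappa> a' b' ` {0..1})"
      by (intro compact_imp_bounded compact_continuous_image uc compact_Icc)+
    have "uniform_limit {0..1} (\<lambda>\<mu> r. u \<mu> a b r * u \<kappa> a' b' r) (\<lambda>r. u \<kappa> a b r * u \<kappa> a' b' r) (at \<kappa>)"
      by (rule uniform_lim_mult[OF _ uniform_limit_const bd])
         (use hill_y_uniform_limit[OF V, of a b \<kappa>] in \<open>simp add: u_def\<close>)
    then obtain I J where I: "\<And>\<mu>. ((\<lambda>r. u \<mu> a b r * u \<kappa> a' b' r) has_integral I \<mu>) {0..1}"
      and J: "((\<lambda>r. u \<kappa> a b r * u \<kappa> a' b' r) has_integral J) {0..1}" and l: "(I \<longlongrightarrow> J) (at \<kappa>)"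
      by (rule uniform_limit_integral) (auto intro!: continuous_intros uc)
    have "I = (\<lambda>\<mu>. integral {0..1} (\<lambda>r. u \<mu> a b r * u \<kappa> a' b' r))"
      using integral_unique[OF I] by simp
    thus ?thesis using l integral_unique[OF J] by simp
  qed
  have 1: "(u \<mu> a b 1 - u \<kappa> a b 1) / (\<mu> - \<kappa>) = u \<kappa> 0 1 1 * integral {0..1} (\<lambda>r. u \<mu> a b r * u \<kappa> 1 0 r)
      - u \<kappa> 1 0 1 * integral {0..1} (\<lambda>r. u \<mu> a b r * u \<kappa> 0 1 r)" if "\<mu> \<noteq> \<kappa>" for \<mu>
    using hill_variation(1)[OF V, of 1 \<mu> a b \<kappa>] that by (simp add: u_def)
  have 2: "(du \<mu> a b 1 - du \<kappa> a b 1) / (\<mu> - \<kappa>) = du \<kappa> 0 1 1 * integral {0..1} (\<lambda>r. u \<mu> a b r * u \<kappa> 1 0 r)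
      - du \<kappa> 1 0 1 * integral {0..1} (\<lambda>r. u \<mu> a b r * u \<kappa> 0 1 r)" if "\<mu> \<noteq> \<kappa>" for \<mu>
    using hill_variation(2)[OF V, of 1 \<mu> a b \<kappa>] that by (simp add: u_def du_def)
  have "((\<lambda>\<mu>. u \<kappa> 0 1 1 * integral {0..1} (\<lambda>r. u \<mu> a b r * u \<kappa> 1 0 r)
      - u \<kappa> 1 0 1 * integral {0..1} (\<lambda>r. u \<mu> a b r * u \<kappa> 0 1 r)) \<longlongrightarrow> u \<kappa> 0 1 1 * I1 - u \<kappa> 1 0 1 * I2) (at \<kappa>)"
    unfolding I1_def I2_def by (intro tendsto_intros lim)
  thus "((\<lambda>\<mu>. u \<mu> a b 1) has_field_derivative u \<kappa> 0 1 1 * I1 - u \<kappa> 1 0 1 * I2) (at \<kappa>)"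
    unfolding has_field_derivative_iff by (rule Lim_transform_eventually) (auto simp: eventually_at_filter 1)
  have "((\<lambda>\<mu>. du \<kappa> 0 1 1 * integral {0..1} (\<lambda>r. u \<mu> a b r * u \<kappa> 1 0 r)
      - du \<kappa> 1 0 1 * integral {0..1} (\<lambda>r. u \<mu> a b r * u \<kappa> 0 1 r)) \<longlongrightarrow> du \<kappa> 0 1 1 * I1 - du \<kappa> 1 0 1 * I2) (at \<kappa>)"
    unfolding I1_def I2_def by (intro tendsto_intros lim)
  thus "((\<lambda>\<mu>. du \<mu> a b 1) has_field_derivative du \<kappa> 0 1 1 * I1 - du \<kappa> 1 0 1 * I2) (at \<kappa>)"
    unfolding has_field_derivative_iff by (rule Lim_transform_eventually) (auto simp: eventually_at_filter 2)
qed

subsection \<open>The functions \<open>\<zeta>\<close> and \<open>\<wp>\<close>\<close>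

text \<open>The M-test makes the finite partial sums converge uniformly on a closed disc, and
  uniform limits of holomorphic functions may be differentiated termwise; so the majorant concerns f
  alone.\<close>

lemma has_field_derivative_infsum:
  fixes f :: "'a \<Rightarrow> complex \<Rightarrow> complex"
  assumes r: "0 < r" and bound: "\<And>w y. w \<in> X \<Longrightarrow> y \<in> cball z r \<Longrightarrow> norm (f w y) \<le> M w"
    and M: "M summable_on X"
    and deriv: "\<And>w y. w \<in> X \<Longrightarrow> y \<in> cball z r \<Longrightarrow> (f w has_field_derivative f' w y) (at y)"
  shows "((\<lambda>y. \<Sum>\<^sub>\<infinity>w\<in>X. f w y) has_field_derivative (\<Sum>\<^sub>\<infinity>w\<in>X. f' w z)) (at z)"
    and "(\<lambda>w. f' w z) summable_on X"
proof -
  let ?F = "finite_subsets_at_top X"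
  have ul: "uniform_limit (cball z r) (\<lambda>X y. \<Sum>x\<in>X. f x y) (\<lambda>y. \<Sum>\<^sub>\<infinity>x\<in>X. f x y) ?F"
    by (rule Weierstrass_m_test_general[OF bound M])
  have d: "((\<lambda>y. \<Sum>x\<in>Y. f x y) has_field_derivative (\<Sum>x\<in>Y. f' x y)) (at y)"
    if "Y \<subseteq> X" "y \<in> cball z r" for Y y
    by (rule DERIV_sum) (use that deriv in auto)
  have ev: "\<forall>\<^sub>F Y in ?F. continuous_on (cball z r) (\<lambda>y. \<Sum>x\<in>Y. f x y) \<and>
      (\<forall>w \<in> ball z r. ((\<lambda>y. \<Sum>x\<in>Y. f x y) has_field_derivative (\<Sum>x\<in>Y. f' x w)) (at w))"
  proof (rule eventually_finite_subsets_at_top_weakI)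
    fix Y assume Y: "finite Y" "Y \<subseteq> X"
    show "continuous_on (cball z r) (\<lambda>y. \<Sum>x\<in>Y. f x y) \<and>
      (\<forall>w \<in> ball z r. ((\<lambda>y. \<Sum>x\<in>Y. f x y) has_field_derivative (\<Sum>x\<in>Y. f' x w)) (at w))"
      using d[OF Y(2)] by (auto intro!: continuous_at_imp_continuous_on DERIV_isCont[OF d[OF Y(2)]])
  qed
  obtain g' where g': "\<And>w. w \<in> ball z r \<Longrightarrow>
      ((\<lambda>y. \<Sum>\<^sub>\<infinity>x\<in>X. f x y) has_field_derivative (g' w)) (at w) \<and> ((\<lambda>Y. \<Sum>x\<in>Y. f' x w) \<longlongrightarrow> g' w) ?F"
    by (rule has_complex_derivative_uniform_limit[OF ev ul _ r]) auto
  have hs: "((\<lambda>w. f' w z) has_sum g' z) X" using g'[of z] r by (simp add: has_sum_def)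
  thus "(\<lambda>w. f' w z) summable_on X" by (rule has_sum_imp_summable)
  show "((\<lambda>y. \<Sum>\<^sub>\<infinity>w\<in>X. f w y) has_field_derivative (\<Sum>\<^sub>\<infinity>w\<in>X. f' w z)) (at z)"
    using g'[of z] r infsumI[OF hs] by simp
qed

lemma has_field_derivative_inverse_square:
  fixes y w :: complex
  assumes "y \<noteq> w" shows "((\<lambda>y. 1 / (y - w) ^ 2) has_field_derivative - 2 / (y - w) ^ 3) (at y)"
proof -
  have nz: "y - w \<noteq> 0" using assms by simp
  have "((\<lambda>y. inverse (y - w)) has_field_derivative - (inverse (y - w) * 1 * inverse (y - w))) (at y)"
    by (rule DERIV_inverse') (use nz in \<open>auto intro!: derivative_eq_intros\<close>)
  from DERIV_power[OF this, of 2] show ?thesis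
    using nz by (simp add: power_inverse divide_inverse power2_eq_square power3_eq_cube mult_ac)
qed

section \<open>Convergence of the lattice sums\<close>

lemma summable_on_int_powr: "(\<lambda>n::int. (1 + \<bar>real_of_int n\<bar>) powr (-3/2)) summable_on UNIV"
proof -
  have "summable (\<lambda>n::nat. real (Suc n) powr (-3/2))"
    using summable_real_powr_iff[of "-3/2"] by (subst summable_Suc_iff) simp
  hence s: "(\<lambda>n::nat. real (Suc n) powr (-3/2)) summable_on UNIV"
    by (subst summable_on_UNIV_nonneg_real_iff) auto
  have 1: "(\<lambda>n::int. (1 + \<bar>real_of_int n\<bar>) powr (-3/2)) summable_on range int"
    by (subst summable_on_reindex) (use s in \<open>auto simp: o_def\<close>)
  have 2: "(\<lambda>n::int. (1 + \<bar>real_of_int n\<bar>) powr (-3/2)) summable_on range (\<lambda>n. - int n)"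
    by (subst summable_on_reindex) (use s in \<open>auto simp: o_def inj_on_def\<close>)
  have "(\<lambda>n::int. (1 + \<bar>real_of_int n\<bar>) powr (-3/2)) summable_on (range int \<union> range (\<lambda>n. - int n))"
    using 1 2 summable_on_UnionI[of "{range int, range (\<lambda>n. - int n)}" "\<lambda>n. (1 + \<bar>real_of_int n\<bar>) powr (-3/2)"]
    by (intro summable_on_union) auto
  also have "range int \<union> range (\<lambda>n. - int n) = UNIV"
  proof (intro set_eqI iffI UNIV_I)
    fix n :: int
    show "n \<in> range int \<union> range (\<lambda>n. - int n)" by (cases n rule: int_cases2) auto
  qed
  finally show ?thesis .
qed

text \<open>The exponent 3 of the lattice sum is shared equally by the two coordinates, which
  reduces the double sum to a product of two convergent series.\<close>

lemma summable_on_int_pair_powr: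
  "(\<lambda>(m::int, n::int). (1 + \<bar>real_of_int m\<bar>) powr (-3/2) * (1 + \<bar>real_of_int n\<bar>) powr (-3/2)) summable_on UNIV"
proof -
  let ?g = "\<lambda>n::int. (1 + \<bar>real_of_int n\<bar>) powr (-3/2)"
  have hs: "(?g has_sum infsum ?g UNIV) UNIV" using summable_on_int_powr by (rule has_sum_infsum)
  have "(\<lambda>(m, n). ?g m * ?g n) summable_on (UNIV \<times> UNIV)"
    by (rule summable_on_SigmaI[where g = "\<lambda>m. ?g m * infsum ?g UNIV"])
       (use has_sum_cmult_right[OF hs] summable_on_cmult_left[OF summable_on_int_powr] in auto)
  thus ?thesis by simp
qed

locale weierstrass =
  fixes \<omega>\<^sub>1 \<omega>\<^sub>3 :: complex
  assumes periods: "Im (\<omega>\<^sub>3 / \<omega>\<^sub>1) \<noteq> 0"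
begin

abbreviation "L \<equiv> period_lattice \<omega>\<^sub>1 \<omega>\<^sub>3"
abbreviation "H \<equiv> half_lattice \<omega>\<^sub>1 \<omega>\<^sub>3"
abbreviation "wp \<equiv> weierstrass_p \<omega>\<^sub>1 \<omega>\<^sub>3"
abbreviation "wz \<equiv> weierstrass_zeta \<omega>\<^sub>1 \<omega>\<^sub>3"
abbreviation "ws \<equiv> weierstrass_sigma \<omega>\<^sub>1 \<omega>\<^sub>3"
abbreviation "hp \<equiv> half_period \<omega>\<^sub>1 \<omega>\<^sub>3"
abbreviation "qp \<equiv> quasi_period \<omega>\<^sub>1 \<omega>\<^sub>3"

text \<open>Quantitative independence of the periods over the reals: for \<tau> =
  \<open>\<omega>\<^sub>3 / \<omega>\<^sub>1\<close> the imaginary part of x + y \<tau> controls y,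
  and then the triangle inequality controls x.\<close>

lemma norm_real_combination_ge:
  obtains c where "0 < c" "\<And>x y::real. c * (\<bar>x\<bar> + \<bar>y\<bar>) \<le> norm (of_real x * \<omega>\<^sub>1 + of_real y * \<omega>\<^sub>3)"
proof -
  define \<tau> where "\<tau> = \<omega>\<^sub>3 / \<omega>\<^sub>1"
  have nz: "\<omega>\<^sub>1 \<noteq> 0" using periods by auto
  have im: "0 < \<bar>Im \<tau>\<bar>" using periods by (simp add: \<tau>_def)
  define K where "K = 1 + (norm \<tau> + 1) / \<bar>Im \<tau>\<bar>"
  have K: "0 < K" using im by (auto simp: K_def intro!: add_pos_nonneg)
  have "norm \<omega>\<^sub>1 / K * (\<bar>x\<bar> + \<bar>y\<bar>) \<le> norm (of_real x * \<omega>\<^sub>1 + of_real y * \<omega>\<^sub>3)" for x y :: real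
  proof -
    define N where "N = norm (of_real x + of_real y * \<tau>)"
    have y: "\<bar>y\<bar> \<le> N / \<bar>Im \<tau>\<bar>"
      using abs_Im_le_cmod[of "of_real x + of_real y * \<tau>"] im by (simp add: N_def field_simps abs_mult)
    have "\<bar>x\<bar> \<le> N + \<bar>y\<bar> * norm \<tau>"
      using norm_triangle_ineq4[of "of_real x + of_real y * \<tau>" "of_real y * \<tau>"] by (simp add: N_def norm_mult)
    hence "\<bar>x\<bar> + \<bar>y\<bar> \<le> N + \<bar>y\<bar> * (norm \<tau> + 1)" by (simp add: algebra_simps)
    also have "\<dots> \<le> N + N / \<bar>Im \<tau>\<bar> * (norm \<tau> + 1)" by (intro add_left_mono mult_right_mono y) auto
    also have "\<dots> = N * K" by (simp add: K_def algebra_simps)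
    finally have "(\<bar>x\<bar> + \<bar>y\<bar>) / K \<le> N" using K by (simp add: field_simps)
    hence "norm \<omega>\<^sub>1 * ((\<bar>x\<bar> + \<bar>y\<bar>) / K) \<le> norm \<omega>\<^sub>1 * N" by (intro mult_left_mono) auto
    also have "norm \<omega>\<^sub>1 * N = norm (of_real x * \<omega>\<^sub>1 + of_real y * \<omega>\<^sub>3)"
      using nz by (simp add: N_def \<tau>_def distrib_left mult.left_commute mult.commute flip: norm_mult)
    finally show ?thesis by simp
  qed
  thus ?thesis using that[of "norm \<omega>\<^sub>1 / K"] nz K by auto
qed

lemma real_combination_eq_0:
  assumes "of_real x * \<omega>\<^sub>1 + of_real y * \<omega>\<^sub>3 = 0" shows "x = 0" "y = 0"
proof -
  obtain c where "0 < c" "\<And>x y::real. c * (\<bar>x\<bar> + \<bar>y\<bar>) \<le> norm (of_real x * \<omega>\<^sub>1 + of_real y * \<omega>\<^sub>3)"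
    using norm_real_combination_ge by blast
  from this(1) this(2)[of x y] have "\<bar>x\<bar> + \<bar>y\<bar> \<le> 0" using assms by (simp add: mult_le_0_iff)
  thus "x = 0" "y = 0" by auto
qed

lemma L_I: "of_int m * (2 * \<omega>\<^sub>1) + of_int n * (2 * \<omega>\<^sub>3) \<in> L"
  by (auto simp: period_lattice_def)

lemma L_0 [simp]: "0 \<in> L" using L_I[of 0 0] by simp

lemma L_add: assumes "v \<in> L" "w \<in> L" shows "v + w \<in> L"
proof -
  from assms obtain m n m' n' where "v = of_int m * (2 * \<omega>\<^sub>1) + of_int n * (2 * \<omega>\<^sub>3)"
    "w = of_int m' * (2 * \<omega>\<^sub>1) + of_int n' * (2 * \<omega>\<^sub>3)" by (auto simp: period_lattice_def)
  hence "v + w = of_int (m + m') * (2 * \<omega>\<^sub>1) + of_int (n + n') * (2 * \<omega>\<^sub>3)" by (simp add: algebra_simps)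
  thus ?thesis by (metis L_I)
qed

lemma L_minus_iff [simp]: "- w \<in> L \<longleftrightarrow> w \<in> L"
proof -
  have "- w \<in> L" if "w \<in> L" for w
  proof -
    from that obtain m n where "w = of_int m * (2 * \<omega>\<^sub>1) + of_int n * (2 * \<omega>\<^sub>3)" by (auto simp: period_lattice_def)
    hence "- w = of_int (- m) * (2 * \<omega>\<^sub>1) + of_int (- n) * (2 * \<omega>\<^sub>3)" by simp
    thus ?thesis by (metis L_I)
  qed
  from this[of w] this[of "- w"] show ?thesis by auto
qed

lemma L_diff: "v \<in> L \<Longrightarrow> w \<in> L \<Longrightarrow> v - w \<in> L"
  using L_add[of v "- w"] by simp

lemma L_add_iff [simp]: "w \<in> L \<Longrightarrow> z + w \<in> L \<longleftrightarrow> z \<in> L" "w \<in> L \<Longrightarrow> w + z \<in> L \<longleftrightarrow> z \<in> L"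
  "w \<in> L \<Longrightarrow> z - w \<in> L \<longleftrightarrow> z \<in> L" "w \<in> L \<Longrightarrow> w - z \<in> L \<longleftrightarrow> z \<in> L"
proof -
  assume w: "w \<in> L"
  show 1: "z + w \<in> L \<longleftrightarrow> z \<in> L" using L_add[of z w] L_diff[of "z + w" w] w by auto
  thus "w + z \<in> L \<longleftrightarrow> z \<in> L" by (simp add: add.commute)
  show "z - w \<in> L \<longleftrightarrow> z \<in> L" using L_diff[of z w] L_add[of "z - w" w] w by auto
  show "w - z \<in> L \<longleftrightarrow> z \<in> L" using L_diff[of w z] L_diff[of w "w - z"] w by auto
qed

lemma H_iff: "z \<in> H \<longleftrightarrow> 2 * z \<in> L"
proof -
  have "2 * z = of_int m * (2 * \<omega>\<^sub>1) + of_int n * (2 * \<omega>\<^sub>3) \<longleftrightarrow> z = of_int m * \<omega>\<^sub>1 + of_int n * \<omega>\<^sub>3" for m n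
  proof -
    have "of_int m * (2 * \<omega>\<^sub>1) + of_int n * (2 * \<omega>\<^sub>3) = 2 * (of_int m * \<omega>\<^sub>1 + of_int n * \<omega>\<^sub>3)"
      by (simp add: algebra_simps)
    thus ?thesis by (metis mult_cancel_left zero_neq_numeral)
  qed
  thus ?thesis by (auto simp: half_lattice_def period_lattice_def)
qed

lemma L_subset_H: "L \<subseteq> H"
proof
  fix z assume "z \<in> L"
  thus "z \<in> H" using L_add[of z z] by (simp add: H_iff)
qed

lemma hp_in_H [simp]: "hp i \<in> H" and double_hp [simp]: "2 * hp i \<in> L"
proof -
  have "2 * hp i \<in> L"
    using L_I[of 1 0] L_I[of "-1" "-1"] L_I[of 0 1] by (auto simp: half_period_def algebra_simps)
  thus "2 * hp i \<in> L" "hp i \<in> H" by (auto simp: H_iff)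
qed

lemma countable_L: "countable L" and countable_H: "countable H"
proof -
  have "L = (\<lambda>(m, n). of_int m * (2 * \<omega>\<^sub>1) + of_int n * (2 * \<omega>\<^sub>3)) ` (UNIV :: (int \<times> int) set)"
    by (auto simp: period_lattice_def)
  thus "countable L" by (metis countableI_type countable_image)
  have "H = (\<lambda>(m, n). of_int m * \<omega>\<^sub>1 + of_int n * \<omega>\<^sub>3) ` (UNIV :: (int \<times> int) set)"
    by (auto simp: half_lattice_def)
  thus "countable H" by (metis countableI_type countable_image)
qed

lemma finite_H_bounded: "finite {w \<in> H. norm w \<le> R}"
proof -
  obtain c where c: "0 < c" "\<And>x y::real. c * (\<bar>x\<bar> + \<bar>y\<bar>) \<le> norm (of_real x * \<omega>\<^sub>1 + of_real y * \<omega>\<^sub>3)"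
    using norm_real_combination_ge by blast
  define N where "N = \<lceil>R / c\<rceil>"
  have "{w \<in> H. norm w \<le> R} \<subseteq> (\<lambda>(m, n). of_int m * \<omega>\<^sub>1 + of_int n * \<omega>\<^sub>3) ` ({-N..N} \<times> {-N..N})"
  proof
    fix w assume "w \<in> {w \<in> H. norm w \<le> R}"
    then obtain m n where w: "w = of_int m * \<omega>\<^sub>1 + of_int n * \<omega>\<^sub>3" "norm w \<le> R"
      by (auto simp: half_lattice_def)
    have "c * (\<bar>real_of_int m\<bar> + \<bar>real_of_int n\<bar>) \<le> R" using c(2)[of m n] w by simp
    hence "\<bar>real_of_int m\<bar> + \<bar>real_of_int n\<bar> \<le> R / c" using c(1) by (simp add: field_simps)
    also have "\<dots> \<le> of_int N" by (simp add: N_def)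
    finally have "\<bar>m\<bar> + \<bar>n\<bar> \<le> N" by linarith
    thus "w \<in> (\<lambda>(m, n). of_int m * \<omega>\<^sub>1 + of_int n * \<omega>\<^sub>3) ` ({-N..N} \<times> {-N..N})"
      using w by (intro image_eqI[of _ _ "(m, n)"]) auto
  qed
  thus ?thesis by (rule finite_subset) auto
qed

lemma finite_L_bounded: "finite {w \<in> L. norm w \<le> R}"
  by (rule finite_subset[OF _ finite_H_bounded[of R]]) (use L_subset_H in auto)

lemma not_islimpt_H: "\<not> z islimpt H"
proof
  assume "z islimpt H"
  hence "infinite (H \<inter> ball z 1)" by (simp add: islimpt_eq_infinite_ball)
  moreover have "finite (H \<inter> ball z 1)"
  proof (rule finite_subset[OF _ finite_H_bounded[of "norm z + 1"]])
    show "H \<inter> ball z 1 \<subseteq> {w \<in> H. norm w \<le> norm z + 1}"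
    proof clarify
      fix w assume "w \<in> ball z 1"
      thus "norm w \<le> norm z + 1" using norm_triangle_ineq2[of w z] by (simp add: dist_norm norm_minus_commute)
    qed
  qed
  ultimately show False by blast
qed

lemma not_islimpt_L: "\<not> z islimpt L"
  using not_islimpt_H islimpt_subset L_subset_H by blast

lemma closed_H: "closed H" and closed_L: "closed L"
  using not_islimpt_H not_islimpt_L unfolding closed_limpt by blast+

lemma open_Compl_H [simp]: "open (- H)" and open_Compl_L [simp]: "open (- L)"
  using closed_H closed_L by auto

lemma connected_Compl_H: "connected (- H)" and connected_Compl_L: "connected (- L)"
  by (intro path_connected_imp_connected path_connected_complement_countable countable_H countable_L; simp)+

lemma summable_L: "(\<lambda>w. 1 / norm w ^ 3) summable_on (L - {0})"
proof -
  obtain c where c: "0 < c" "\<And>x y::real. c * (\<bar>x\<bar> + \<bar>y\<bar>) \<le> norm (of_real x * \<omega>\<^sub>1 + of_real y * \<omega>\<^sub>3)"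
    using norm_real_combination_ge by blast
  define \<phi> where "\<phi> = (\<lambda>(m::int, n::int). of_int m * (2 * \<omega>\<^sub>1) + of_int n * (2 * \<omega>\<^sub>3))"
  have inj: "inj_on \<phi> A" for A
  proof (rule inj_onI, clarify)
    fix m n m' n' assume "\<phi> (m, n) = \<phi> (m', n')"
    hence "of_real (2 * of_int (m - m')) * \<omega>\<^sub>1 + of_real (2 * of_int (n - n')) * \<omega>\<^sub>3 = 0"
      by (simp add: \<phi>_def algebra_simps)
    from real_combination_eq_0[OF this] show "m = m' \<and> n = n'" by auto
  qed
  have img: "L - {0} = \<phi> ` (UNIV - {(0, 0)})"
  proof -
    have "L = range \<phi>" by (auto simp: period_lattice_def \<phi>_def)
    moreover have "\<phi> (0, 0) = 0" by (simp add: \<phi>_def)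
    ultimately show ?thesis using image_set_diff[OF inj[of UNIV], of UNIV "{(0, 0)}"] by simp
  qed
  have le: "1 / norm (\<phi> p) ^ 3 \<le> 1 / c ^ 3 * (case p of (m, n) \<Rightarrow> (1 + \<bar>real_of_int m\<bar>) powr (-3/2) * (1 + \<bar>real_of_int n\<bar>) powr (-3/2))"
    if "p \<noteq> (0, 0)" for p
  proof (cases p)
    case (Pair m n)
    define a b where "a = \<bar>real_of_int m\<bar>" and "b = \<bar>real_of_int n\<bar>"
    have ab: "0 \<le> a" "0 \<le> b" "1 \<le> a + b" using that Pair by (auto simp: a_def b_def)
    \<comment> \<open>A non-zero pair has a + b >= 1; the factor 2 is that of the periods
      \<open>2 * \<omega>\<^sub>1\<close> and \<open>2 * \<omega>\<^sub>3\<close>.\<close>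
    have "c * (1 + a + b) \<le> c * (2 * a + 2 * b)" using c(1) ab by (intro mult_left_mono) auto
    also have "\<dots> \<le> norm (\<phi> p)"
      using c(2)[of "2 * m" "2 * n"] by (simp add: \<phi>_def Pair a_def b_def abs_mult mult_ac)
    finally have n: "c * (1 + a + b) \<le> norm (\<phi> p)" .
    have "((1 + a) * (1 + b)) powr (3/2) \<le> ((1 + a + b)\<^sup>2) powr (3/2)"
      using ab by (intro powr_mono2) (auto simp: power2_eq_square algebra_simps)
    also have "\<dots> = (1 + a + b) ^ 3"
      using ab by (simp add: powr_powr flip: powr_numeral)
    finally have p: "((1 + a) * (1 + b)) powr (3/2) \<le> (1 + a + b) ^ 3" .
    have pos: "0 < ((1 + a) * (1 + b)) powr (3/2)" using ab by auto
    have "c ^ 3 * ((1 + a) * (1 + b)) powr (3/2) \<le> (c * (1 + a + b)) ^ 3"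
      using p c(1) by (simp add: power_mult_distrib)
    also have "\<dots> \<le> norm (\<phi> p) ^ 3" by (intro power_mono n) (use c(1) ab in auto)
    finally have "1 / norm (\<phi> p) ^ 3 \<le> 1 / (c ^ 3 * ((1 + a) * (1 + b)) powr (3/2))"
    proof (rule divide_left_mono)
      have "0 < c * (1 + a + b)" using c(1) ab by (intro mult_pos_pos) auto
      hence "0 < norm (\<phi> p)" using n by linarith
      thus "0 < norm (\<phi> p) ^ 3 * (c ^ 3 * ((1 + a) * (1 + b)) powr (3/2))"
        using pos c(1) by (intro mult_pos_pos zero_less_power)
    qed auto
    also have "\<dots> = 1 / c ^ 3 * ((1 + a) powr (-3/2) * (1 + b) powr (-3/2))"
      using ab powr_mult[of "1 + a" "1 + b" "3/2"] by (simp add: powr_minus divide_simps)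
    finally show ?thesis by (simp add: Pair a_def b_def)
  qed
  have "(\<lambda>p. 1 / norm (\<phi> p) ^ 3) summable_on (UNIV - {(0, 0)})"
  proof (rule summable_on_comparison_test)
    show "(\<lambda>p. 1 / c ^ 3 * (case p of (m, n) \<Rightarrow> (1 + \<bar>real_of_int m\<bar>) powr (-3/2) * (1 + \<bar>real_of_int n\<bar>) powr (-3/2)))
        summable_on (UNIV - {(0, 0)})"
      by (intro summable_on_cmult_right summable_on_subset_banach[OF summable_on_int_pair_powr]) auto
  qed (use le in auto)
  thus ?thesis unfolding img by (subst summable_on_reindex[OF inj]) (simp add: o_def)
qed

lemma L_distance:
  assumes "z \<notin> L - {0}"
  obtains r c where "0 < r" "0 < c" "\<And>w y. w \<in> L - {0} \<Longrightarrow> y \<in> cball z r \<Longrightarrow> c * norm w \<le> norm (y - w)"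
proof -
  define R where "R = 2 * (norm z + 1)"
  have R: "0 < R" by (simp add: R_def add_nonneg_pos)
  have "finite {w \<in> L - {0}. norm w \<le> R}" by (rule finite_subset[OF _ finite_L_bounded[of R]]) auto
  from finite_set_avoid[OF this, of z] obtain d where d: "0 < d"
    and dw: "\<And>w. w \<in> L - {0} \<Longrightarrow> norm w \<le> R \<Longrightarrow> d \<le> dist z w" using assms by fastforce
  define r where "r = min 1 (d / 2)"
  define c where "c = min (1 / 2) (d / 2 / R)"
  show thesis
  proof (rule that[of r c])
    show "0 < r" "0 < c" using d R by (auto simp: r_def c_def)
    fix w y assume w: "w \<in> L - {0}" and y: "y \<in> cball z r"
    show "c * norm w \<le> norm (y - w)"
    proof (cases "norm w \<le> R")
      case True
      have "c * norm w \<le> d / 2 / R * R" using True R d by (intro mult_mono) (auto simp: c_def)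
      also have "\<dots> = d / 2" using R by simp
      also have "\<dots> \<le> dist z w - dist z y" using dw[OF w True] y d by (auto simp: r_def)
      also have "\<dots> \<le> norm (y - w)" using dist_triangle[of z w y] by (simp add: dist_norm)
      finally show ?thesis .
    next
      case False
      have "norm y \<le> norm z + 1"
        using y norm_triangle_ineq2[of y z] by (auto simp: r_def dist_norm norm_minus_commute)
      hence "norm y \<le> norm w / 2" using False by (simp add: R_def)
      hence "1 / 2 * norm w \<le> norm (y - w)" using norm_triangle_ineq2[of w y] by (simp add: norm_minus_commute)
      moreover have "c * norm w \<le> 1 / 2 * norm w" by (intro mult_right_mono) (auto simp: c_def)
      ultimately show ?thesis by linarith
    qed
  qed
qed

definition wz_reg where "wz_reg z = (\<Sum>\<^sub>\<infinity>w\<in>L - {0}. 1 / (z - w) + 1 / w + z / w ^ 2)"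
definition wp_reg where "wp_reg z = (\<Sum>\<^sub>\<infinity>w\<in>L - {0}. 1 / (z - w) ^ 2 - 1 / w ^ 2)"
text \<open>A sum over the whole lattice with cubic decay, so that its periodicity is a mere
  reindexing. The periodicity of \<wp> and the quasi-periodicity of \<zeta> are obtained from it by
  integration.\<close>

definition dwp where "dwp z = (\<Sum>\<^sub>\<infinity>w\<in>L. - 2 / (z - w) ^ 3)"

lemma wz_eq: "wz z = 1 / z + wz_reg z" and wp_eq: "wp z = 1 / z ^ 2 + wp_reg z"
  by (simp_all add: weierstrass_zeta_def wz_reg_def weierstrass_p_def wp_reg_def)

text \<open>The subtracted terms do their work over a common denominator: the first term is y^2 /
  (w^2 (y - w)), the second is y times terms of the same decay, and |w|^(-3) is summable.\<close>

lemma wz_wp_term_bounds: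
  fixes w y :: complex
  assumes w: "w \<noteq> 0" and c: "0 < c" "c * norm w \<le> norm (y - w)" and R: "norm y \<le> R"
  shows "norm (1 / (y - w) + 1 / w + y / w ^ 2) \<le> R ^ 2 / c * (1 / norm w ^ 3)"
    and "norm (1 / (y - w) ^ 2 - 1 / w ^ 2) \<le> R * (1 / c ^ 2 + 1 / c) * (1 / norm w ^ 3)"
proof -
  have cw: "0 < c * norm w" using w c by auto
  hence pos: "0 < norm (y - w)" using c by linarith
  hence nz: "y - w \<noteq> 0" by auto
  have R0: "0 \<le> R" using R norm_ge_zero[of y] by linarith
  have inv: "1 / norm (y - w) \<le> 1 / (c * norm w)" using c(2) cw pos by (intro divide_left_mono) auto
  have "1 / (y - w) + 1 / w + y / w ^ 2 = y ^ 2 * (1 / w ^ 2) * (1 / (y - w))"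
  proof -
    have "1 / h + 1 / w + (w + h) / w ^ 2 = (w + h) ^ 2 * (1 / w ^ 2) * (1 / h)" if "h \<noteq> 0" for h
      using that w by (simp add: field_simps power2_eq_square)
    from this[OF nz] show ?thesis by simp
  qed
  hence "norm (1 / (y - w) + 1 / w + y / w ^ 2) = norm y ^ 2 * (1 / norm w ^ 2) * (1 / norm (y - w))"
    by (simp add: norm_mult norm_divide norm_power)
  also have "\<dots> \<le> R ^ 2 * (1 / norm w ^ 2) * (1 / (c * norm w))"
    by (intro mult_mono power_mono R inv) (use R0 in auto)
  also have "\<dots> = R ^ 2 / c * (1 / norm w ^ 3)" by (simp add: power2_eq_square power3_eq_cube)
  finally show "norm (1 / (y - w) + 1 / w + y / w ^ 2) \<le> R ^ 2 / c * (1 / norm w ^ 3)" .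
  have "1 / (y - w) ^ 2 - 1 / w ^ 2 = y * ((1 / (y - w)) ^ 2 * (1 / w) - (1 / (y - w)) * (1 / w) ^ 2)"
  proof -
    have "1 / h ^ 2 - 1 / w ^ 2 = (w + h) * ((1 / h) ^ 2 * (1 / w) - (1 / h) * (1 / w) ^ 2)" if "h \<noteq> 0" for h
      using that w by (simp add: field_simps power2_eq_square)
    from this[OF nz] show ?thesis by simp
  qed
  also have "norm \<dots> \<le> norm y * (norm ((1 / (y - w)) ^ 2 * (1 / w)) + norm ((1 / (y - w)) * (1 / w) ^ 2))"
    unfolding norm_mult[of y] by (intro mult_left_mono norm_triangle_ineq4) auto
  also have "\<dots> = norm y * ((1 / norm (y - w)) ^ 2 * (1 / norm w) + (1 / norm (y - w)) * (1 / norm w) ^ 2)"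
    by (simp add: norm_mult norm_divide norm_power)
  also have "\<dots> \<le> R * ((1 / (c * norm w)) ^ 2 * (1 / norm w) + (1 / (c * norm w)) * (1 / norm w) ^ 2)"
    by (intro mult_mono add_mono power_mono R inv) (use R0 cw in auto)
  also have "\<dots> = R * (1 / c ^ 2 + 1 / c) * (1 / norm w ^ 3)"
    using w c by (simp add: field_simps power2_eq_square power3_eq_cube)
  finally show "norm (1 / (y - w) ^ 2 - 1 / w ^ 2) \<le> R * (1 / c ^ 2 + 1 / c) * (1 / norm w ^ 3)" .
qed

lemma wz_reg_wp_reg_derivative:
  assumes z: "z \<notin> L - {0}"
  shows "(wz_reg has_field_derivative - wp_reg z) (at z)"
    and "(wp_reg has_field_derivative (\<Sum>\<^sub>\<infinity>w\<in>L - {0}. - 2 / (z - w) ^ 3)) (at z)"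
    and "(\<lambda>w. - 2 / (z - w) ^ 3) summable_on (L - {0})"
    and "(\<lambda>w. 1 / (z - w) ^ 2 - 1 / w ^ 2) summable_on (L - {0})"
    and "(\<lambda>w. 1 / (z - w) + 1 / w + z / w ^ 2) summable_on (L - {0})"
proof -
  obtain r c where r: "0 < r" and c: "0 < c"
    and cw: "\<And>w y. w \<in> L - {0} \<Longrightarrow> y \<in> cball z r \<Longrightarrow> c * norm w \<le> norm (y - w)"
    using L_distance[OF z] by blast
  define R where "R = norm z + r"
  have R: "norm y \<le> R" if "y \<in> cball z r" for y
    using that norm_triangle_ineq2[of y z] by (simp add: R_def dist_norm norm_minus_commute)
  have nz: "y - w \<noteq> 0" if "w \<in> L - {0}" "y \<in> cball z r" for y w
  proof -
    have "0 < c * norm w" using that c by auto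
    thus ?thesis using cw[OF that] by auto
  qed
  have b: "norm (1 / (y - w) + 1 / w + y / w ^ 2) \<le> R ^ 2 / c * (1 / norm w ^ 3)"
      "norm (1 / (y - w) ^ 2 - 1 / w ^ 2) \<le> R * (1 / c ^ 2 + 1 / c) * (1 / norm w ^ 3)"
    if "w \<in> L - {0}" "y \<in> cball z r" for y w
    using wz_wp_term_bounds[OF _ c cw[OF that] R[OF that(2)]] that by auto
  have d1: "((\<lambda>y. 1 / (y - w) + 1 / w + y / w ^ 2) has_field_derivative - (1 / (y - w) ^ 2 - 1 / w ^ 2)) (at y)"
    if "w \<in> L - {0}" "y \<in> cball z r" for y w
    using nz[OF that] that by (auto intro!: derivative_eq_intros simp: field_simps power2_eq_square)
  have d2: "((\<lambda>y. 1 / (y - w) ^ 2 - 1 / w ^ 2) has_field_derivative - 2 / (y - w) ^ 3) (at y)"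
    if "w \<in> L - {0}" "y \<in> cball z r" for y w
    using DERIV_diff[OF has_field_derivative_inverse_square DERIV_const, of y w "1 / w ^ 2"] nz[OF that] by simp
  note 1 = has_field_derivative_infsum[OF r b(1) summable_on_cmult_right[OF summable_L] d1]
  note 2 = has_field_derivative_infsum[OF r b(2) summable_on_cmult_right[OF summable_L] d2]
  show "(wz_reg has_field_derivative - wp_reg z) (at z)"
    unfolding wz_reg_def[abs_def] wp_reg_def infsum_uminus[symmetric] using 1(1) .
  show "(wp_reg has_field_derivative (\<Sum>\<^sub>\<infinity>w\<in>L - {0}. - 2 / (z - w) ^ 3)) (at z)"
    unfolding wp_reg_def[abs_def] using 2(1) .
  show "(\<lambda>w. - 2 / (z - w) ^ 3) summable_on (L - {0})" using 2(2) .
  show "(\<lambda>w. 1 / (z - w) ^ 2 - 1 / w ^ 2) summable_on (L - {0})" using 1(2) by (subst (asm) summable_on_uminus)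
  have zin: "z \<in> cball z r" using r by simp
  have "(\<lambda>w. R ^ 2 / c * (1 / norm w ^ 3)) summable_on (L - {0})" by (rule summable_on_cmult_right[OF summable_L])
  hence "(\<lambda>w. norm (1 / (z - w) + 1 / w + z / w ^ 2)) summable_on (L - {0})"
    by (rule summable_on_comparison_test) (rule b(1)[OF _ zin], assumption, rule norm_ge_zero)
  thus "(\<lambda>w. 1 / (z - w) + 1 / w + z / w ^ 2) summable_on (L - {0})" by (rule abs_summable_summable)
qed

lemma wz_derivative:
  assumes "z \<notin> L" shows "(wz has_field_derivative - wp z) (at z)"
proof -
  have "z \<noteq> 0" using assms by auto
  have "((\<lambda>z. 1 / z + wz_reg z) has_field_derivative - 1 / z ^ 2 + - wp_reg z) (at z)"
    using \<open>z \<noteq> 0\<close> assms by (intro DERIV_add wz_reg_wp_reg_derivative(1))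
      (auto intro!: derivative_eq_intros simp: power2_eq_square field_simps)
  thus ?thesis by (simp add: wz_eq[abs_def] wp_eq)
qed

lemma dwp_eq:
  assumes "z \<notin> L" shows "dwp z = - 2 / z ^ 3 + (\<Sum>\<^sub>\<infinity>w\<in>L - {0}. - 2 / (z - w) ^ 3)"
proof -
  have "(\<Sum>\<^sub>\<infinity>w\<in>insert 0 (L - {0}). - 2 / (z - w) ^ 3) = - 2 / (z - 0) ^ 3 + (\<Sum>\<^sub>\<infinity>w\<in>L - {0}. - 2 / (z - w) ^ 3)"
    by (rule infsum_insert) (use wz_reg_wp_reg_derivative(3)[of z] assms in auto)
  moreover have "insert 0 (L - {0}) = L" by auto
  ultimately show ?thesis by (simp add: dwp_def)
qed

lemma wp_derivative:
  assumes "z \<notin> L" shows "(wp has_field_derivative dwp z) (at z)"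
proof -
  have "z \<noteq> 0" using assms by auto
  have "((\<lambda>z. 1 / z ^ 2 + wp_reg z) has_field_derivative - 2 / z ^ 3 + (\<Sum>\<^sub>\<infinity>w\<in>L - {0}. - 2 / (z - w) ^ 3)) (at z)"
    using \<open>z \<noteq> 0\<close> assms by (intro DERIV_add wz_reg_wp_reg_derivative(2))
      (auto intro!: derivative_eq_intros simp: divide_simps eval_nat_numeral)
  thus ?thesis by (simp add: wp_eq[abs_def] dwp_eq[OF assms])
qed

lemma wz_holomorphic: "wz holomorphic_on - L" and wp_holomorphic: "wp holomorphic_on - L"
  using wz_derivative wp_derivative by (auto simp: holomorphic_on_open)

lemma deriv_wp: "z \<notin> L \<Longrightarrow> deriv wp z = dwp z"
  by (rule DERIV_imp_deriv) (rule wp_derivative)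

lemma dwp_holomorphic: "dwp holomorphic_on - L"
  by (rule holomorphic_transform[OF holomorphic_deriv[OF wp_holomorphic open_Compl_L]]) (simp add: deriv_wp)

lemma bij_betw_uminus_L: "bij_betw uminus (L - {0}) (L - {0})"
  by (rule bij_betw_byWitness[where f' = uminus]) auto

lemma wz_odd: "wz (- z) = - wz z"
proof -
  have "wz_reg (- z) = (\<Sum>\<^sub>\<infinity>w\<in>L - {0}. 1 / (- z - - w) + 1 / - w + - z / (- w) ^ 2)"
    unfolding wz_reg_def by (rule infsum_reindex_bij_betw[OF bij_betw_uminus_L, symmetric])
  also have "\<dots> = (\<Sum>\<^sub>\<infinity>w\<in>L - {0}. - (1 / (z - w) + 1 / w + z / w ^ 2))"
  proof (rule infsum_cong)
    fix w
    have "- z - - w = - (z - w)" by simp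
    thus "1 / (- z - - w) + 1 / - w + - z / (- w) ^ 2 = - (1 / (z - w) + 1 / w + z / w ^ 2)"
      by (simp only: minus_divide_right[symmetric]) simp
  qed
  finally have "wz_reg (- z) = - wz_reg z" by (simp only: wz_reg_def infsum_uminus)
  thus ?thesis by (simp add: wz_eq)
qed

lemma wp_even: "wp (- z) = wp z"
proof -
  have "wp_reg (- z) = (\<Sum>\<^sub>\<infinity>w\<in>L - {0}. 1 / (- z - - w) ^ 2 - 1 / (- w) ^ 2)"
    unfolding wp_reg_def by (rule infsum_reindex_bij_betw[OF bij_betw_uminus_L, symmetric])
  also have "\<dots> = wp_reg z"
    unfolding wp_reg_def by (intro infsum_cong) (simp add: power2_commute)
  finally show ?thesis by (simp add: wp_eq)
qed

lemma bij_betw_plus_L: "v \<in> L \<Longrightarrow> bij_betw (\<lambda>w. w + v) L L"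
  by (rule bij_betw_byWitness[where f' = "\<lambda>w. w - v"]) auto

lemma dwp_periodic: assumes "v \<in> L" shows "dwp (z + v) = dwp z"
proof -
  have "dwp (z + v) = (\<Sum>\<^sub>\<infinity>w\<in>L. - 2 / (z + v - (w + v)) ^ 3)"
    unfolding dwp_def by (rule infsum_reindex_bij_betw[OF bij_betw_plus_L[OF assms], symmetric])
  thus ?thesis by (simp add: dwp_def)
qed

lemma hp_notin_L: "k \<in> {1, 2, 3} \<Longrightarrow> hp k \<notin> L"
proof
  assume k: "k \<in> {1, 2, 3}" and "hp k \<in> L"
  then obtain m n where mn: "hp k = of_int m * (2 * \<omega>\<^sub>1) + of_int n * (2 * \<omega>\<^sub>3)" by (auto simp: period_lattice_def)
  obtain a b :: int where ab: "hp k = of_int a * \<omega>\<^sub>1 + of_int b * \<omega>\<^sub>3" "odd a \<or> odd b"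
    using k that[of 1 0] that[of "-1" "-1"] that[of 0 1] by (auto simp: half_period_def)
  have "of_real (of_int (a - 2 * m)) * \<omega>\<^sub>1 + of_real (of_int (b - 2 * n)) * \<omega>\<^sub>3 = 0"
    using mn ab(1) by (simp add: algebra_simps)
  from real_combination_eq_0[OF this] have "a = 2 * m" "b = 2 * n" by auto
  thus False using ab(2) by simp
qed

lemma L_induct [consumes 1, case_names zero step]:
  assumes v: "v \<in> L" and 0: "P 0"
    and step: "\<And>v k. v \<in> L \<Longrightarrow> k \<in> {1, 3} \<Longrightarrow> P v \<Longrightarrow> P (v + 2 * hp k) \<and> P (v - 2 * hp k)"
  shows "P v"
proof -
  have row: "P (of_int m * (2 * \<omega>\<^sub>1) + of_int 0 * (2 * \<omega>\<^sub>3))" for m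
  proof (induction m rule: int_induct[where k = 0])
    case base thus ?case using 0 by simp
  next
    case (step1 m)
    from step[OF L_I _ step1(2), of 1] show ?case by (simp add: half_period_def algebra_simps)
  next
    case (step2 m)
    from step[OF L_I _ step2(2), of 1] show ?case by (simp add: half_period_def algebra_simps)
  qed
  have "P (of_int m * (2 * \<omega>\<^sub>1) + of_int n * (2 * \<omega>\<^sub>3))" for m n
  proof (induction n rule: int_induct[where k = 0])
    case base thus ?case using row by simp
  next
    case (step1 n)
    from step[OF L_I _ step1(2), of 3] show ?case by (simp add: half_period_def algebra_simps)
  next
    case (step2 n)
    from step[OF L_I _ step2(2), of 3] show ?case by (simp add: half_period_def algebra_simps)
  qed
  thus ?thesis using v by (auto simp: period_lattice_def)
qed

lemma constant_on_Compl_L: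
  assumes "\<And>z. z \<notin> L \<Longrightarrow> (f has_field_derivative 0) (at z)" "x \<notin> L" "y \<notin> L"
  shows "f x = f y"
  by (rule DERIV_zero_connected_constant[OF connected_Compl_L open_Compl_L finite.emptyI])
     (use assms in \<open>auto intro!: continuous_at_imp_continuous_on DERIV_isCont\<close>)

lemma shifted_derivative:
  fixes f :: "complex \<Rightarrow> complex"
  assumes "(f has_field_derivative D) (at (z + v))"
  shows "((\<lambda>z. f (z + v)) has_field_derivative D) (at z)"
  using assms by (simp add: DERIV_shift)

text \<open>The difference has derivative 0 on a connected set, and at z = - \<open>hp k\<close> it
  vanishes by evenness. The same evaluation for the odd function \<zeta> produces the constant 2
  \<eta>_k.\<close>

lemma wp_periodic_half: "k \<in> {1, 2, 3} \<Longrightarrow> z \<notin> L \<Longrightarrow> wp (z + 2 * hp k) = wp z"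
proof -
  assume k: "k \<in> {1, 2, 3}" and z: "z \<notin> L"
  let ?v = "2 * hp k"
  have "((\<lambda>z. wp (z + ?v) - wp z) has_field_derivative dwp (z + ?v) - dwp z) (at z)" if "z \<notin> L" for z
    by (intro DERIV_diff shifted_derivative wp_derivative) (use that in auto)
  hence "((\<lambda>z. wp (z + ?v) - wp z) has_field_derivative 0) (at z)" if "z \<notin> L" for z
    using that dwp_periodic[of ?v] by simp
  from constant_on_Compl_L[OF this, of z "- hp k"] show ?thesis
    using z hp_notin_L[OF k] wp_even[of "hp k"] by simp
qed

lemma wp_periodic: assumes "v \<in> L" "z \<notin> L" shows "wp (z + v) = wp z"
  using assms(1)
proof (induction rule: L_induct)
  case zero show ?case by simp
next
  case (step v k)
  have k: "k \<in> {1, 2, 3}" using step by auto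
  show ?case
    using wp_periodic_half[OF k, of "z + v"] wp_periodic_half[OF k, of "z + (v - 2 * hp k)"] step assms(2)
    by (auto simp: algebra_simps L_diff)
qed

lemma wz_reg_0 [simp]: "wz_reg 0 = 0"
  unfolding wz_reg_def by (rule infsum_0) auto

lemma wz_quasi_periodic:
  assumes z: "z \<notin> L" and k: "k \<le> 3" shows "wz (z + 2 * hp k) = wz z + 2 * qp k"
proof (cases "k = 0")
  case True thus ?thesis by (simp add: quasi_period_def half_period_def wz_eq)
next
  case False
  hence k: "k \<in> {1, 2, 3}" using k by auto
  let ?v = "2 * hp k"
  have "((\<lambda>z. wz (z + ?v) - wz z) has_field_derivative - wp (z + ?v) - (- wp z)) (at z)" if "z \<notin> L" for z
    by (intro DERIV_diff shifted_derivative wz_derivative) (use that in auto)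
  hence "((\<lambda>z. wz (z + ?v) - wz z) has_field_derivative 0) (at z)" if "z \<notin> L" for z
    using that wp_periodic[of ?v] by simp
  from constant_on_Compl_L[OF this, of z "- hp k"] show ?thesis
    using z hp_notin_L[OF k] wz_odd[of "hp k"] by (simp add: quasi_period_def diff_eq_eq add.commute)
qed

lemma qp_2: "qp 2 = - qp 1 - qp 3"
proof -
  have nL: "hp 2 \<notin> L" using hp_notin_L[of 2] by simp
  have "wz (hp 2 + 2 * hp 1 + 2 * hp 3) = wz (hp 2) + 2 * qp 1 + 2 * qp 3"
    using nL by (simp add: wz_quasi_periodic)
  moreover have "hp 2 + 2 * hp 1 + 2 * hp 3 = - hp 2" by (simp add: half_period_def)
  ultimately have "2 * (qp 2 + qp 1 + qp 3) = 0"
    using wz_odd[of "hp 2"] unfolding quasi_period_def by algebra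
  hence "qp 2 + qp 1 + qp 3 = 0" by (simp only: mult_eq_0_iff) simp
  thus ?thesis by algebra
qed

lemma qp_0: "qp 0 = 0"
  by (simp add: quasi_period_def half_period_def wz_eq)

subsection \<open>The sigma function\<close>

text \<open>In the disc of radius R the finitely many factors with |w| <= 2 R are kept. All others
  satisfy |z / w| < 1/2, so principal logarithms are available and the rest of the product is the
  exponential of an absolutely convergent sum. Holomorphy, zeros and logarithmic derivative of
  \<sigma> are read off from this form.\<close>

lemma ws_local:
  assumes R: "0 < R"
  defines "A \<equiv> {w \<in> L - {0}. norm w \<le> 2 * R}"
  obtains T where "T 0 = 0"
    "\<And>z. z \<in> ball 0 R \<Longrightarrow> (T has_field_derivative (\<Sum>\<^sub>\<infinity>w\<in>L - {0} - A. 1 / (z - w) + 1 / w + z / w ^ 2)) (at z)"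
    "\<And>z. z \<in> ball 0 R \<Longrightarrow> ws z = z * (\<Prod>w\<in>A. (1 - z / w) * exp (z / w + z ^ 2 / (2 * w ^ 2))) * exp (T z)"
proof -
  define a where "a = (\<lambda>w z::complex. Ln (1 - z / w) + (z / w + z ^ 2 / (2 * w ^ 2)))"
  define X where "X = L - {0} - A"
  have finA: "finite A" unfolding A_def by (rule finite_subset[OF _ finite_L_bounded[of "2 * R"]]) auto
  have far: "1 / 2 * norm w \<le> norm (y - w)" "w \<noteq> 0" "norm (y / w) < 1 / 2"
    if "w \<in> X" "y \<in> ball 0 R" for w y
  proof -
    show w: "w \<noteq> 0" using that by (auto simp: X_def)
    have "norm y < norm w / 2" using that by (auto simp: X_def A_def)
    thus "1 / 2 * norm w \<le> norm (y - w)" "norm (y / w) < 1 / 2"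
      using norm_triangle_ineq2[of w y] w by (auto simp: norm_minus_commute norm_divide field_simps)
  qed
  have ne: "1 - y / w \<notin> \<real>\<^sub>\<le>\<^sub>0" if "w \<in> X" "y \<in> ball 0 R" for w y
    using far(3)[OF that] abs_Re_le_cmod[of "y / w"] by (auto simp: complex_nonpos_Reals_iff)
  have da: "(a w has_field_derivative 1 / (y - w) + 1 / w + y / w ^ 2) (at y)"
    if "w \<in> X" "y \<in> ball 0 R" for w y
  proof -
    have nz: "y - w \<noteq> 0" "w \<noteq> 0" using far[OF that] by auto
    have 1: "((\<lambda>z. 1 - z / w) has_field_derivative - 1 / w) (at y)"
      using nz by (auto intro!: derivative_eq_intros)
    have 2: "((\<lambda>z. Ln (1 - z / w)) has_field_derivative inverse (1 - y / w) * (- 1 / w)) (at y)"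
      by (rule DERIV_chain2[OF has_field_derivative_Ln[OF ne[OF that]] 1])
    have 3: "((\<lambda>z. z / w + z ^ 2 / (2 * w ^ 2)) has_field_derivative 1 / w + y / w ^ 2) (at y)"
      using nz by (auto intro!: derivative_eq_intros simp: power2_eq_square)
    have "1 - y / w = - (y - w) / w" using nz by (simp add: field_simps)
    hence 4: "inverse (1 - y / w) * (- 1 / w) = 1 / (y - w)" using nz by (simp add: divide_simps)
    show ?thesis unfolding a_def using DERIV_add[OF 2 3] unfolding 4 by (simp add: add.assoc)
  qed
  have ba: "norm (a w y) \<le> 2 * R ^ 3 * (1 / norm w ^ 3)" if "w \<in> X" "y \<in> ball 0 R" for w y
  proof -
    \<comment> \<open>\<open>a w\<close> vanishes at 0 and its derivative is a term of the
      \<zeta>-series; integrating that bound costs one more factor R.\<close>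
    have "norm (a w y - a w 0) \<le> R ^ 2 / (1 / 2) * (1 / norm w ^ 3) * norm (y - 0)"
    proof (rule field_differentiable_bound[of "ball 0 R"])
      fix z :: complex assume z: "z \<in> ball 0 R"
      show "(a w has_field_derivative 1 / (z - w) + 1 / w + z / w ^ 2) (at z within ball 0 R)"
        by (rule has_field_derivative_at_within[OF da[OF that(1) z]])
      show "norm (1 / (z - w) + 1 / w + z / w ^ 2) \<le> R ^ 2 / (1 / 2) * (1 / norm w ^ 3)"
        by (rule wz_wp_term_bounds(1)) (use far[OF that(1) z] z in auto)
    qed (use that R in auto)
    also have "\<dots> \<le> R ^ 2 / (1 / 2) * (1 / norm w ^ 3) * R"
      by (rule mult_left_mono) (use that in auto)
    finally show ?thesis by (simp add: a_def power2_eq_square power3_eq_cube mult_ac)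
  qed
  have summ: "(\<lambda>w. 2 * R ^ 3 * (1 / norm w ^ 3)) summable_on X"
    by (intro summable_on_cmult_right summable_on_subset_banach[OF summable_L]) (auto simp: X_def)
  define T where "T = (\<lambda>z. \<Sum>\<^sub>\<infinity>w\<in>X. a w z)"
  have expa: "exp (a w z) = (1 - z / w) * exp (z / w + z ^ 2 / (2 * w ^ 2))" if "w \<in> X" "z \<in> ball 0 R" for w z
  proof -
    have "1 - z / w \<noteq> 0" using ne[OF that] by auto
    thus ?thesis by (simp add: a_def exp_add)
  qed
  show thesis
  proof (rule that[of T])
    show "T 0 = 0" unfolding T_def by (rule infsum_0) (simp add: a_def)
    fix z :: complex assume z: "z \<in> ball 0 R"
    then obtain r where r: "0 < r" "cball z r \<subseteq> ball 0 R" by (meson open_ball open_contains_cball)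
    show "(T has_field_derivative (\<Sum>\<^sub>\<infinity>w\<in>L - {0} - A. 1 / (z - w) + 1 / w + z / w ^ 2)) (at z)"
      unfolding T_def X_def[symmetric]
    proof (rule has_field_derivative_infsum(1)[OF r(1) _ summ])
      fix w y assume w: "w \<in> X" and "y \<in> cball z r"
      hence y: "y \<in> ball 0 R" using r(2) by blast
      show "norm (a w y) \<le> 2 * R ^ 3 * (1 / norm w ^ 3)" by (rule ba[OF w y])
      show "(a w has_field_derivative 1 / (y - w) + 1 / w + y / w ^ 2) (at y)" by (rule da[OF w y])
    qed
    let ?E = "\<lambda>w. (1 - z / w) * exp (z / w + z ^ 2 / (2 * w ^ 2))"
    let ?F = "finite_subsets_at_top (L - {0})"
    have "(\<lambda>w. norm (a w z)) summable_on X"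
      by (rule summable_on_comparison_test[OF summ]) (rule ba[OF _ z], assumption, rule norm_ge_zero)
    hence "((\<lambda>w. a w z) has_sum T z) X" unfolding T_def by (rule has_sum_infsum[OF abs_summable_summable])
    hence "((\<lambda>w. if w \<in> X then a w z else 0) has_sum T z) (L - {0})"
      by (subst has_sum_cong_neutral[where T = X and g = "\<lambda>w. a w z"]) (auto simp: X_def)
    hence lim: "((\<lambda>Y. \<Sum>w\<in>Y. if w \<in> X then a w z else 0) \<longlongrightarrow> T z) ?F" by (simp add: has_sum_def)
    have lim2: "((\<lambda>Y. (\<Prod>w\<in>A. ?E w) * exp (\<Sum>w\<in>Y. if w \<in> X then a w z else 0)) \<longlongrightarrow> (\<Prod>w\<in>A. ?E w) * exp (T z)) ?F"
      by (intro tendsto_intros lim)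
    have ev: "\<forall>\<^sub>F Y in ?F. (\<Prod>w\<in>A. ?E w) * exp (\<Sum>w\<in>Y. if w \<in> X then a w z else 0) = (\<Prod>w\<in>Y. ?E w)"
      unfolding eventually_finite_subsets_at_top
    proof (intro exI[of _ A] conjI allI impI finA)
      show "A \<subseteq> L - {0}" by (auto simp: A_def)
      fix Y assume Y: "finite Y \<and> A \<subseteq> Y \<and> Y \<subseteq> L - {0}"
      have YA: "Y - A \<subseteq> X" using Y by (auto simp: X_def)
      have "(\<Sum>w\<in>Y. if w \<in> X then a w z else 0) = (\<Sum>w\<in>Y - A. a w z)"
        using Y YA by (intro sum.mono_neutral_cong_right) (auto simp: X_def)
      hence "exp (\<Sum>w\<in>Y. if w \<in> X then a w z else 0) = (\<Prod>w\<in>Y - A. ?E w)"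
      proof -
        assume eq: "(\<Sum>w\<in>Y. if w \<in> X then a w z else 0) = (\<Sum>w\<in>Y - A. a w z)"
        have "exp (\<Sum>w\<in>Y - A. a w z) = (\<Prod>w\<in>Y - A. exp (a w z))" using Y by (intro exp_sum) auto
        also have "\<dots> = (\<Prod>w\<in>Y - A. ?E w)" by (rule prod.cong[OF refl]) (rule expa[OF subsetD[OF YA] z])
        finally show ?thesis unfolding eq .
      qed
      thus "(\<Prod>w\<in>A. ?E w) * exp (\<Sum>w\<in>Y. if w \<in> X then a w z else 0) = (\<Prod>w\<in>Y. ?E w)"
        using Y prod.subset_diff[of A Y ?E] by (simp only: mult.commute)
    qed
    have "Lim ?F (\<lambda>Y. \<Prod>w\<in>Y. ?E w) = (\<Prod>w\<in>A. ?E w) * exp (T z)"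
      by (rule tendsto_Lim) (use Lim_transform_eventually[OF lim2 ev] in auto)
    thus "ws z = z * (\<Prod>w\<in>A. ?E w) * exp (T z)" by (simp add: weierstrass_sigma_def)
  qed
qed

lemma ws_holomorphic: "ws holomorphic_on UNIV"
proof -
  have "ws field_differentiable (at z)" for z
  proof -
    define R where "R = norm z + 1"
    have R: "0 < R" "z \<in> ball 0 R" by (auto simp: R_def add_nonneg_pos)
    define A where "A = {w \<in> L - {0}. norm w \<le> 2 * R}"
    obtain T where "T 0 = 0" and T: "\<And>z. z \<in> ball 0 R \<Longrightarrow> (T has_field_derivative (\<Sum>\<^sub>\<infinity>w\<in>L - {0} - A. 1 / (z - w) + 1 / w + z / w ^ 2)) (at z)"
      "\<And>z. z \<in> ball 0 R \<Longrightarrow> ws z = z * (\<Prod>w\<in>A. (1 - z / w) * exp (z / w + z ^ 2 / (2 * w ^ 2))) * exp (T z)"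
      by (rule ws_local[OF R(1), folded A_def]) blast
    have "T holomorphic_on ball 0 R" using T(1) unfolding holomorphic_on_open[OF open_ball] by blast
    hence "(\<lambda>z. z * (\<Prod>w\<in>A. (1 - z / w) * exp (z / w + z ^ 2 / (2 * w ^ 2))) * exp (T z)) holomorphic_on ball 0 R"
      by (intro holomorphic_intros) (auto simp: A_def)
    hence "ws holomorphic_on ball 0 R" by (rule holomorphic_transform) (simp add: T(2))
    thus ?thesis using R(2) by (meson centre_in_ball holomorphic_on_imp_differentiable_at open_ball)
  qed
  thus ?thesis by (simp add: holomorphic_on_def)
qed

lemma ws_continuous: "isCont ws z"
  using ws_holomorphic by (meson UNIV_I continuous_on_eq_continuous_at holomorphic_on_imp_continuous_on open_UNIV)

lemma ws_eq_0_iff: "ws z = 0 \<longleftrightarrow> z \<in> L"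
proof -
  define R where "R = norm z + 1"
  have R: "0 < R" "z \<in> ball 0 R" by (auto simp: R_def add_nonneg_pos)
  define A where "A = {w \<in> L - {0}. norm w \<le> 2 * R}"
  have finA: "finite A" unfolding A_def by (rule finite_subset[OF _ finite_L_bounded[of "2 * R"]]) auto
  obtain T where "T 0 = 0" "\<And>z. z \<in> ball 0 R \<Longrightarrow> (T has_field_derivative (\<Sum>\<^sub>\<infinity>w\<in>L - {0} - A. 1 / (z - w) + 1 / w + z / w ^ 2)) (at z)"
    and T: "\<And>z. z \<in> ball 0 R \<Longrightarrow> ws z = z * (\<Prod>w\<in>A. (1 - z / w) * exp (z / w + z ^ 2 / (2 * w ^ 2))) * exp (T z)"
    by (rule ws_local[OF R(1), folded A_def]) blast
  have "ws z = 0 \<longleftrightarrow> z = 0 \<or> z \<in> A"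
    unfolding T[OF R(2)] using finA by (auto simp: A_def prod_zero_iff)
  also have "\<dots> \<longleftrightarrow> z \<in> L" by (auto simp: A_def R_def)
  finally show ?thesis .
qed

lemma ws_derivative:
  assumes z: "z \<notin> L" shows "(ws has_field_derivative ws z * wz z) (at z)"
proof -
  define R where "R = norm z + 1"
  have R: "0 < R" "z \<in> ball 0 R" by (auto simp: R_def add_nonneg_pos)
  define A where "A = {w \<in> L - {0}. norm w \<le> 2 * R}"
  have finA: "finite A" unfolding A_def by (rule finite_subset[OF _ finite_L_bounded[of "2 * R"]]) auto
  define E where "E = (\<lambda>w z::complex. (1 - z / w) * exp (z / w + z ^ 2 / (2 * w ^ 2)))"
  define t where "t = (\<lambda>w z::complex. 1 / (z - w) + 1 / w + z / w ^ 2)"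
  obtain T where "T 0 = 0" and T': "\<And>z. z \<in> ball 0 R \<Longrightarrow> (T has_field_derivative (\<Sum>\<^sub>\<infinity>w\<in>L - {0} - A. 1 / (z - w) + 1 / w + z / w ^ 2)) (at z)"
     "\<And>z. z \<in> ball 0 R \<Longrightarrow> ws z = z * (\<Prod>w\<in>A. (1 - z / w) * exp (z / w + z ^ 2 / (2 * w ^ 2))) * exp (T z)"
    by (rule ws_local[OF R(1), folded A_def]) blast
  have T: "\<And>z. z \<in> ball 0 R \<Longrightarrow> (T has_field_derivative (\<Sum>\<^sub>\<infinity>w\<in>L - {0} - A. t w z)) (at z)"
    "\<And>z. z \<in> ball 0 R \<Longrightarrow> ws z = z * (\<Prod>w\<in>A. E w z) * exp (T z)"
    using T' by (simp_all add: t_def E_def)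
  have dE: "(E w has_field_derivative E w z * t w z) (at z)" if w: "w \<in> A" for w
  proof -
    have nz: "w \<noteq> 0" "z - w \<noteq> 0" using w z by (auto simp: A_def)
    have d: "(E w has_field_derivative (- 1 / w) * exp (z / w + z ^ 2 / (2 * w ^ 2)) +
        exp (z / w + z ^ 2 / (2 * w ^ 2)) * (1 / w + z / w ^ 2) * (1 - z / w)) (at z)"
      unfolding E_def using nz
      by (auto intro!: derivative_eq_intros simp: power2_eq_square)
    have F: "- 1 / w + (1 / w + z / w ^ 2) * (1 - z / w) = (1 - z / w) * t w z"
    proof -
      have "1 - z / w = - (z - w) / w" using nz by (simp add: field_simps)
      moreover have "- h / w * (1 / h) = - 1 / w" if "h \<noteq> 0" for h using that by simp
      ultimately have "(1 - z / w) * (1 / (z - w)) = - 1 / w" using nz(2) by metis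
      thus ?thesis by (simp add: t_def algebra_simps)
    qed
    have aux: "a * X + X * u * v = v * X * T" if "a + u * v = v * T" for a X u v T :: complex
      using that by algebra
    show ?thesis by (rule DERIV_cong[OF d]) (unfold E_def, rule aux[OF F])
  qed
  have dP: "((\<lambda>z. \<Prod>w\<in>B. E w z) has_field_derivative (\<Prod>w\<in>B. E w z) * (\<Sum>w\<in>B. t w z)) (at z)" if "finite B" "B \<subseteq> A" for B
    using that
  proof (induction B rule: finite_induct)
    case (insert w B)
    have "((\<lambda>z. E w z * (\<Prod>w\<in>B. E w z)) has_field_derivative
       E w z * t w z * (\<Prod>w\<in>B. E w z) + (\<Prod>w\<in>B. E w z) * (\<Sum>w\<in>B. t w z) * E w z) (at z)"
      by (rule DERIV_mult) (use insert dE in auto)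
    thus ?case using insert.hyps by (simp add: algebra_simps)
  qed simp
  have sum: "wz_reg z = (\<Sum>w\<in>A. t w z) + (\<Sum>\<^sub>\<infinity>w\<in>L - {0} - A. t w z)"
  proof -
    have s: "(\<lambda>w. t w z) summable_on (L - {0})" using wz_reg_wp_reg_derivative(5)[of z] z by (simp add: t_def)
    have "infsum (\<lambda>w. t w z) (A \<union> (L - {0} - A)) = infsum (\<lambda>w. t w z) A + infsum (\<lambda>w. t w z) (L - {0} - A)"
      by (rule infsum_Un_disjoint) (use finA s in \<open>auto intro: summable_on_cofin_subset\<close>)
    moreover have "A \<union> (L - {0} - A) = L - {0}" by (auto simp: A_def)
    ultimately show ?thesis using finA by (simp add: wz_reg_def t_def)
  qed
  have "((\<lambda>z. z * (\<Prod>w\<in>A. E w z) * exp (T z)) has_field_derivative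
     (1 * (\<Prod>w\<in>A. E w z) + (\<Prod>w\<in>A. E w z) * (\<Sum>w\<in>A. t w z) * z) * exp (T z) +
      exp (T z) * (\<Sum>\<^sub>\<infinity>w\<in>L - {0} - A. t w z) * (z * (\<Prod>w\<in>A. E w z))) (at z)"
    by (intro DERIV_mult DERIV_ident dP finA order_refl DERIV_chain2[OF DERIV_exp] T(1) R)
  also have "(1 * (\<Prod>w\<in>A. E w z) + (\<Prod>w\<in>A. E w z) * (\<Sum>w\<in>A. t w z) * z) * exp (T z) +
      exp (T z) * (\<Sum>\<^sub>\<infinity>w\<in>L - {0} - A. t w z) * (z * (\<Prod>w\<in>A. E w z)) = ws z * wz z"
    using z by (auto simp: T(2)[OF R(2)] wz_eq sum field_simps)
  finally have "((\<lambda>z. z * (\<Prod>w\<in>A. E w z) * exp (T z)) has_field_derivative ws z * wz z) (at z)" .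
  thus ?thesis
    by (rule DERIV_cong_ev[THEN iffD1, rotated -1])
       (use eventually_nhds_in_open[OF open_ball R(2)] T(2) in \<open>auto elim: eventually_mono\<close>)
qed

lemma ws_over_id_tendsto: "((\<lambda>z. ws z / z) \<longlongrightarrow> 1) (at 0)"
proof -
  define A where "A = {w \<in> L - {0}. norm w \<le> 2 * (1::real)}"
  obtain T where T0: "T 0 = 0"
    and T: "\<And>z. z \<in> ball 0 1 \<Longrightarrow> (T has_field_derivative (\<Sum>\<^sub>\<infinity>w\<in>L - {0} - A. 1 / (z - w) + 1 / w + z / w ^ 2)) (at z)"
      "\<And>z. z \<in> ball 0 1 \<Longrightarrow> ws z = z * (\<Prod>w\<in>A. (1 - z / w) * exp (z / w + z ^ 2 / (2 * w ^ 2))) * exp (T z)"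
    by (rule ws_local[OF zero_less_one, folded A_def]) blast
  have cT: "isCont T 0" using DERIV_isCont[OF T(1), of 0] by simp
  have "isCont (\<lambda>z. (\<Prod>w\<in>A. (1 - z / w) * exp (z / w + z ^ 2 / (2 * w ^ 2))) * exp (T z)) 0"
    by (intro continuous_intros cT) (auto simp: A_def)
  hence "((\<lambda>z. (\<Prod>w\<in>A. (1 - z / w) * exp (z / w + z ^ 2 / (2 * w ^ 2))) * exp (T z)) \<longlongrightarrow> 1) (at 0)"
    by (simp add: isCont_def T0)
  thus ?thesis
  proof (rule Lim_transform_eventually)
    have "\<forall>\<^sub>F z in at 0. z \<in> ball (0::complex) 1 - {0}" by (rule eventually_at_in_open) auto
    thus "\<forall>\<^sub>F z in at 0. (\<Prod>w\<in>A. (1 - z / w) * exp (z / w + z ^ 2 / (2 * w ^ 2))) * exp (T z) = ws z / z"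
      by eventually_elim (simp add: T(2))
  qed
qed

text \<open>The quotient \<sigma>(-z) / \<sigma>(z) has logarithmic derivative - \<zeta>(-z) -
  \<zeta>(z) = 0, hence is constant, and \<sigma>(z) / z -> 1 at 0 makes the constant -1.\<close>

lemma ws_odd: "ws (- z) = - ws z"
proof (cases "z \<in> L")
  case True
  hence "- z \<in> L" by simp
  thus ?thesis using True ws_eq_0_iff by (metis neg_0_equal_iff_equal)
next
  case False
  have d: "((\<lambda>z. ws (- z) / ws z) has_field_derivative 0) (at z)" if z: "z \<notin> L" for z
  proof -
    have mz: "- z \<notin> L" using z by simp
    have "((\<lambda>z. ws (- z)) has_field_derivative ws (- z) * wz (- z) * - 1) (at z)"
      by (rule DERIV_chain2[where f = ws and g = uminus, OF ws_derivative[OF mz]])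
         (auto intro!: derivative_eq_intros)
    from DERIV_divide[OF this ws_derivative[OF z]] show ?thesis using z by (simp add: ws_eq_0_iff wz_odd)
  qed
  have c: "ws (- y) / ws y = ws (- z) / ws z" if "y \<notin> L" for y
    by (rule constant_on_Compl_L[OF d that False])
  have evL: "\<forall>\<^sub>F y in at 0. y \<notin> L" using not_islimpt_L[of 0] by (simp add: islimpt_iff_eventually)
  have lim: "((\<lambda>y. - (ws (- y) / (- y)) / (ws y / y)) \<longlongrightarrow> - 1 / 1) (at 0)"
  proof (intro tendsto_intros ws_over_id_tendsto)
    have "filterlim uminus (at 0) (at (0::complex))"
      by (rule filterlim_atI) (auto intro!: tendsto_eq_intros simp: eventually_at_filter)
    thus "((\<lambda>y. ws (- y) / - y) \<longlongrightarrow> 1) (at 0)" by (rule filterlim_compose[OF ws_over_id_tendsto])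
  qed auto
  have "\<forall>\<^sub>F y in at 0. - (ws (- y) / (- y)) / (ws y / y) = ws (- z) / ws z"
    using evL
  proof eventually_elim
    case (elim y)
    hence "y \<noteq> 0" by auto
    thus ?case using c[OF elim] by simp
  qed
  from Lim_transform_eventually[OF lim this] have "((\<lambda>y. ws (- z) / ws z) \<longlongrightarrow> - 1 / 1) (at (0::complex))" .
  hence "ws (- z) / ws z = - 1" by (simp add: tendsto_const_iff)
  thus ?thesis using False by (simp add: ws_eq_0_iff field_simps)
qed

text \<open>Again a quotient with derivative 0. Its value is computed at z = - \<open>hp k\<close>,
  where the oddness of \<sigma> is the source of the sign.\<close>

lemma ws_quasi_periodic:
  assumes k: "k \<in> {1, 2, 3}" shows "ws (z + 2 * hp k) = - exp (2 * qp k * (z + hp k)) * ws z"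
proof (cases "z \<in> L")
  case True thus ?thesis by (metis (no_types) L_add_iff(1) double_hp mult_zero_right ws_eq_0_iff)
next
  case False
  have d: "((\<lambda>z. ws (z + 2 * hp k) / (exp (2 * qp k * z) * ws z)) has_field_derivative 0) (at z)" if z: "z \<notin> L" for z
  proof -
    have zk: "z + 2 * hp k \<notin> L" using z by simp
    have 1: "((\<lambda>z. ws (z + 2 * hp k)) has_field_derivative ws (z + 2 * hp k) * wz (z + 2 * hp k)) (at z)"
      by (rule shifted_derivative[OF ws_derivative[OF zk]])
    have 2: "((\<lambda>z. exp (2 * qp k * z) * ws z) has_field_derivative
        exp (2 * qp k * z) * (2 * qp k) * ws z + ws z * wz z * exp (2 * qp k * z)) (at z)"
      by (rule DERIV_mult[OF _ ws_derivative[OF z]]) (auto intro!: derivative_eq_intros)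
    show ?thesis
      by (rule DERIV_cong[OF DERIV_divide[OF 1 2]])
         (use z k in \<open>auto simp: ws_eq_0_iff wz_quasi_periodic algebra_simps\<close>)
  qed
  have "ws (z + 2 * hp k) / (exp (2 * qp k * z) * ws z) = ws (- hp k + 2 * hp k) / (exp (2 * qp k * - hp k) * ws (- hp k))"
    by (rule constant_on_Compl_L[OF d False]) (use hp_notin_L[OF k] in auto)
  also have "\<dots> = - exp (2 * qp k * hp k)"
    using hp_notin_L[OF k] by (simp add: ws_odd ws_eq_0_iff exp_minus field_simps)
  finally show ?thesis using False by (simp add: ws_eq_0_iff field_simps exp_add)
qed

end

subsection \<open>Elliptic functions\<close>

lemma holomorphic_extension_discrete:
  fixes f :: "complex \<Rightarrow> complex"
  assumes disc: "\<And>z. \<not> z islimpt Z" and hol: "f holomorphic_on - Z"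
    and lim: "\<And>z. z \<in> Z \<Longrightarrow> \<exists>l. (f \<longlongrightarrow> l) (at z)"
  obtains g where "g holomorphic_on UNIV" "\<And>z. z \<notin> Z \<Longrightarrow> g z = f z"
proof -
  have ev: "\<forall>\<^sub>F y in at z. y \<notin> Z" for z using disc[of z] by (simp add: islimpt_iff_eventually)
  define g where "g z = (if z \<in> Z then Lim (at z) f else f z)" for z
  have gf: "\<forall>\<^sub>F y in at z. f y = g y" for z using ev[of z] by eventually_elim (simp add: g_def)
  have g_lim: "(g \<longlongrightarrow> g z) (at z)" if z: "z \<in> Z" for z
  proof -
    obtain l where l: "(f \<longlongrightarrow> l) (at z)" using lim[OF z] ..
    hence "g z = l" using z by (simp add: g_def tendsto_Lim)
    with Lim_transform_eventually[OF l gf] show ?thesis by simp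
  qed
  have "g field_differentiable (at z)" for z
  proof -
    obtain e where e: "0 < e" "\<And>y. y \<in> ball z e \<Longrightarrow> y \<noteq> z \<Longrightarrow> y \<notin> Z"
      using ev[of z] unfolding eventually_at by (auto simp: dist_commute)
    define K where "K = (if z \<in> Z then {z} else {})"
    have "g holomorphic_on ball z e"
    proof (rule no_isolated_singularity')
      show "finite K" by (simp add: K_def)
      show "(g \<longlongrightarrow> g w) (at w within ball z e)" if "w \<in> K" for w
        using that g_lim[of w] by (auto intro: tendsto_within_subset simp: K_def split: if_splits)
      have sub: "ball z e - K \<subseteq> - Z"
      proof
        fix x assume "x \<in> ball z e - K"
        thus "x \<in> - Z" using e(2)[of x] by (cases "x = z") (auto simp: K_def split: if_splits)
      qed
      show "g holomorphic_on ball z e - K"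
        by (rule holomorphic_transform[OF holomorphic_on_subset[OF hol sub]]) (use sub in \<open>auto simp: g_def\<close>)
    qed auto
    thus ?thesis using e(1) by (meson centre_in_ball holomorphic_on_imp_differentiable_at open_ball)
  qed
  hence "g holomorphic_on UNIV" by (simp add: holomorphic_on_def)
  thus thesis by (rule that) (simp add: g_def)
qed

context weierstrass begin

lemma period_cell: obtains C where "compact C" "\<And>z. \<exists>v\<in>L. z + v \<in> C"
proof (rule that)
  show "compact ((\<lambda>(x, y). of_real x * \<omega>\<^sub>1 + of_real y * \<omega>\<^sub>3) ` ({0..2} \<times> {0..2::real}))"
    by (intro compact_continuous_image compact_Times compact_Icc) (auto intro!: continuous_intros simp: case_prod_unfold)
  fix z
  have nz: "\<omega>\<^sub>1 \<noteq> 0" using periods by auto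
  define t where "t = \<omega>\<^sub>3 / \<omega>\<^sub>1"
  define y where "y = Im (z / \<omega>\<^sub>1) / Im t"
  define x where "x = Re (z / \<omega>\<^sub>1) - y * Re t"
  have "Im t \<noteq> 0" using periods by (simp add: t_def)
  hence "z / \<omega>\<^sub>1 = of_real x + of_real y * t"
    by (simp add: complex_eq_iff x_def y_def)
  hence z: "z = of_real x * \<omega>\<^sub>1 + of_real y * \<omega>\<^sub>3" using nz by (simp add: t_def field_simps)
  define m n where "m = \<lfloor>x / 2\<rfloor>" and "n = \<lfloor>y / 2\<rfloor>"
  have "0 \<le> x - 2 * of_int m" "x - 2 * of_int m \<le> 2" "0 \<le> y - 2 * of_int n" "y - 2 * of_int n \<le> 2"
    unfolding m_def n_def by linarith+
  moreover have "z + (of_int (- m) * (2 * \<omega>\<^sub>1) + of_int (- n) * (2 * \<omega>\<^sub>3)) =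
      of_real (x - 2 * of_int m) * \<omega>\<^sub>1 + of_real (y - 2 * of_int n) * \<omega>\<^sub>3"
    unfolding z by (simp add: algebra_simps)
  ultimately show "\<exists>v\<in>L. z + v \<in> (\<lambda>(x, y). of_real x * \<omega>\<^sub>1 + of_real y * \<omega>\<^sub>3) ` ({0..2} \<times> {0..2::real})"
    by (intro bexI[of _ "of_int (- m) * (2 * \<omega>\<^sub>1) + of_int (- n) * (2 * \<omega>\<^sub>3)", OF _ L_I]
        image_eqI[of _ _ "(x - 2 * of_int m, y - 2 * of_int n)"]) auto
qed

lemma periodic_L:
  assumes Z: "\<And>z v. v \<in> L \<Longrightarrow> z \<notin> Z \<Longrightarrow> z + v \<notin> Z"
    and per: "\<And>z k. k \<in> {1, 3} \<Longrightarrow> z \<notin> Z \<Longrightarrow> f (z + 2 * hp k) = f z"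
    and v: "v \<in> L" and z: "z \<notin> Z"
  shows "f (z + v) = f z"
  using v
proof (induction rule: L_induct)
  case zero show ?case by simp
next
  case (step v k)
  have "v - 2 * hp k \<in> L" using step by (simp add: L_diff)
  from per[OF step(2) Z[OF step(1) z]] per[OF step(2) Z[OF this z]] step show ?case
    by (simp add: algebra_simps)
qed

text \<open>Liouville's theorem. A limit is demanded at one representative of each singular class;
  periodicity transports it to the others, the singularities are removed, and a compact period cell
  gives boundedness.\<close>

lemma elliptic_constant:
  assumes Z: "\<And>z v. v \<in> L \<Longrightarrow> z \<notin> Z \<Longrightarrow> z + v \<notin> Z" and disc: "\<And>z. \<not> z islimpt Z"
    and hol: "f holomorphic_on - Z"
    and per: "\<And>z k. k \<in> {1, 3} \<Longrightarrow> z \<notin> Z \<Longrightarrow> f (z + 2 * hp k) = f z"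
    and lim: "\<And>z. z \<in> Z \<Longrightarrow> \<exists>z0 l. z - z0 \<in> L \<and> (f \<longlongrightarrow> l) (at z0)"
  shows "\<exists>c. \<forall>z. z \<notin> Z \<longrightarrow> f z = c"
proof -
  have perL: "f (z + v) = f z" if "v \<in> L" "z \<notin> Z" for z v
    by (rule periodic_L[where Z = Z and f = f]) (fact Z per that)+
  have ev: "\<forall>\<^sub>F y in at z. y \<notin> Z" for z using disc[of z] by (simp add: islimpt_iff_eventually)
  have lim': "\<exists>l. (f \<longlongrightarrow> l) (at z)" if z: "z \<in> Z" for z
  proof -
    obtain z0 l where z0: "z - z0 \<in> L" and l: "(f \<longlongrightarrow> l) (at z0)" using lim[OF z] by blast
    have "((\<lambda>y. f (y - (z - z0))) \<longlongrightarrow> l) (at z)"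
    proof (rule filterlim_compose[OF l])
      show "filterlim (\<lambda>y. y - (z - z0)) (at z0) (at z)"
        by (rule filterlim_atI) (auto intro!: tendsto_eq_intros simp: eventually_at_filter)
    qed
    moreover have "\<forall>\<^sub>F y in at z. f (y - (z - z0)) = f y"
      using ev[of z]
    proof eventually_elim
      case (elim y)
      have "- (z - z0) \<in> L" using z0 by (simp only: L_minus_iff)
      from perL[OF this elim] show ?case by (simp only: diff_conv_add_uminus)
    qed
    ultimately have "(f \<longlongrightarrow> l) (at z)" by (rule Lim_transform_eventually)
    thus ?thesis ..
  qed
  obtain g where g_hol: "g holomorphic_on UNIV" and g: "\<And>z. z \<notin> Z \<Longrightarrow> g z = f z"
    using holomorphic_extension_discrete[OF disc hol lim'] by blast
  have g_cont: "isCont g z" for z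
    by (rule field_differentiable_imp_continuous_at, rule holomorphic_on_imp_differentiable_at[OF g_hol open_UNIV UNIV_I])
  have g_per: "g (z + v) = g z" if v: "v \<in> L" for z v
  proof (cases "z \<in> Z")
    case False thus ?thesis using perL[OF v False] Z[OF v False] by (simp add: g)
  next
    case True
    have "isCont (\<lambda>y. g (y + v) - g y) z"
      by (intro continuous_intros isCont_o2[OF _ g_cont] g_cont)
    hence "((\<lambda>y. g (y + v) - g y) \<longlongrightarrow> g (z + v) - g z) (at z)" by (simp add: isCont_def)
    moreover have "\<forall>\<^sub>F y in at z. g (y + v) - g y = 0"
      using ev[of z] by eventually_elim (use perL[OF v] Z[OF v] in \<open>simp add: g\<close>)
    ultimately have "((\<lambda>y. 0) \<longlongrightarrow> g (z + v) - g z) (at z)" by (rule Lim_transform_eventually)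
    thus ?thesis by (simp add: tendsto_const_iff)
  qed
  obtain P where P: "compact P" "\<And>z. \<exists>v\<in>L. z + v \<in> P" using period_cell by blast
  have "compact (g ` P)"
    by (intro P(1) compact_continuous_image continuous_at_imp_continuous_on) (auto intro: g_cont)
  hence "bounded (g ` P)" by (rule compact_imp_bounded)
  moreover have "range g \<subseteq> g ` P"
  proof clarify
    fix z
    obtain v where "v \<in> L" "z + v \<in> P" using P(2) by blast
    thus "g z \<in> g ` P" using g_per[of v z] by (metis imageI)
  qed
  ultimately have "bounded (range g)" by (rule bounded_subset)
  with g_hol have "g constant_on UNIV" by (rule Liouville_theorem)
  then obtain c where "\<And>z. g z = c" by (auto simp: constant_on_def)
  thus ?thesis by (metis g)
qed

lemma eventually_not_H: "\<forall>\<^sub>F y in at z. y \<notin> H" and eventually_not_L: "\<forall>\<^sub>F y in at z. y \<notin> L"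
  using not_islimpt_H not_islimpt_L by (simp_all add: islimpt_iff_eventually)

lemma wz_continuous: "z \<notin> L \<Longrightarrow> isCont wz z" and wp_continuous: "z \<notin> L \<Longrightarrow> isCont wp z"
  using wz_derivative wp_derivative DERIV_isCont by blast+

lemma regular_parts_continuous: "isCont wz_reg 0" "isCont wp_reg 0"
  using wz_reg_wp_reg_derivative(1,2)[of 0] DERIV_isCont by auto

lemma wp_times_square_tendsto: "((\<lambda>z. z ^ 2 * wp z) \<longlongrightarrow> 1) (at 0)"
proof -
  have "((\<lambda>z. 1 + z ^ 2 * wp_reg z) \<longlongrightarrow> 1 + 0 ^ 2 * wp_reg 0) (at 0)"
    using regular_parts_continuous(2) by (intro tendsto_intros) (simp_all add: isCont_def)
  hence "((\<lambda>z. 1 + z ^ 2 * wp_reg z) \<longlongrightarrow> 1) (at 0)" by simp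
  thus ?thesis
    by (rule Lim_transform_eventually) (auto simp: eventually_at_filter wp_eq algebra_simps)
qed

lemma wz_times_id_tendsto: "((\<lambda>z. z * wz z) \<longlongrightarrow> 1) (at 0)"
proof -
  have "((\<lambda>z. 1 + z * wz_reg z) \<longlongrightarrow> 1 + 0 * wz_reg 0) (at 0)"
    using regular_parts_continuous(1) by (intro tendsto_intros) (simp_all add: isCont_def)
  hence "((\<lambda>z. 1 + z * wz_reg z) \<longlongrightarrow> 1) (at 0)" by simp
  thus ?thesis
    by (rule Lim_transform_eventually) (auto simp: eventually_at_filter wz_eq algebra_simps)
qed

lemma dwp_times_cube_tendsto: "((\<lambda>z. z ^ 3 * dwp z) \<longlongrightarrow> - 2) (at 0)"
proof -
  have "closed (L - {0})" unfolding closed_limpt using not_islimpt_L islimpt_subset[of _ "L - {0}" L] by blast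
  hence o: "open (- (L - {0}))" by (rule open_Compl)
  have "wp_reg holomorphic_on - (L - {0})"
    unfolding holomorphic_on_open[OF o] using wz_reg_wp_reg_derivative(2) by blast
  hence "continuous_on (- (L - {0})) (deriv wp_reg)"
    using holomorphic_deriv[OF _ o] holomorphic_on_imp_continuous_on by blast
  hence c: "(deriv wp_reg \<longlongrightarrow> deriv wp_reg 0) (at 0)"
    using o by (simp add: continuous_on_eq_continuous_at isCont_def)
  have "((\<lambda>z. - 2 + z ^ 3 * deriv wp_reg z) \<longlongrightarrow> - 2 + 0 ^ 3 * deriv wp_reg 0) (at 0)"
    by (intro tendsto_intros c)
  hence "((\<lambda>z. - 2 + z ^ 3 * deriv wp_reg z) \<longlongrightarrow> - 2) (at 0)" by simp
  thus ?thesis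
  proof (rule Lim_transform_eventually)
    show "\<forall>\<^sub>F z in at 0. - 2 + z ^ 3 * deriv wp_reg z = z ^ 3 * dwp z"
      using eventually_not_L
    proof eventually_elim
      case (elim z)
      hence "z \<noteq> 0" by auto
      moreover have "deriv wp_reg z = (\<Sum>\<^sub>\<infinity>w\<in>L - {0}. - 2 / (z - w) ^ 3)"
        by (rule DERIV_imp_deriv, rule wz_reg_wp_reg_derivative(2)) (use elim in auto)
      ultimately have "dwp z = - 2 / z ^ 3 + deriv wp_reg z" by (simp only: dwp_eq[OF elim])
      thus ?case using \<open>z \<noteq> 0\<close> by (simp add: right_diff_distrib)
    qed
  qed
qed

subsection \<open>The addition formula\<close>

lemma difference_quotient_tendsto:
  assumes "(f has_field_derivative D) (at a)" shows "((\<lambda>z. (f z - f a) / (z - a)) \<longlongrightarrow> D) (at a)"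
  using assms by (simp add: has_field_derivative_iff)

lemma ws_shift_tendsto: "((\<lambda>z. ws (z - a) / (z - a)) \<longlongrightarrow> 1) (at a)"
proof (rule filterlim_compose[OF ws_over_id_tendsto])
  show "filterlim (\<lambda>z. z - a) (at 0) (at a)"
    by (rule filterlim_atI) (auto intro!: tendsto_eq_intros simp: eventually_at_filter)
qed

text \<open>The quotient of the two sides is elliptic in z with singular classes 0, y and -y. As y
  is not in H, the last two are inequivalent and simple zeros of the denominator, matched by zeros
  of \<wp>(z) - \<wp>(y). The constant is the limit - 1 / \<sigma>(y)^2 at 0.\<close>

lemma wp_diff_generic:
  assumes y: "y \<notin> H" and x: "x \<notin> L" "x + y \<notin> L" "x - y \<notin> L"
  shows "wp x - wp y = - ws (x + y) * ws (x - y) / (ws x ^ 2 * ws y ^ 2)"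
proof -
  have yL: "y \<notin> L" "- y \<notin> L" using y L_subset_H by auto
  have "2 * y \<notin> L" using y by (simp add: H_iff)
  hence y2: "y + y \<notin> L" by (simp only: mult_2 not_False_eq_True)
  define Z where "Z = {z. z \<in> L \<or> z + y \<in> L \<or> z - y \<in> L}"
  define f where "f z = (wp z - wp y) * ws z ^ 2 / (ws (z + y) * ws (z - y))" for z
  have Zper: "z + v \<notin> Z" if "v \<in> L" "z \<notin> Z" for z v
    using that L_add_iff(1)[of v z] L_add_iff(1)[of v "z + y"] L_add_iff(1)[of v "z - y"]
    by (simp add: Z_def algebra_simps)
  have disc: "\<not> z islimpt Z" for z
  proof -
    have "filterlim (\<lambda>t. t + a) (at (z + a)) (at z)" for a :: complex
      by (rule filterlim_atI) (auto intro!: tendsto_eq_intros simp: eventually_at_filter)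
    from eventually_compose_filterlim[OF eventually_not_L this]
    have ev: "\<forall>\<^sub>F t in at z. t + a \<notin> L" for a .
    have "\<forall>\<^sub>F t in at z. t \<notin> Z"
      using ev[of 0] ev[of y] ev[of "- y"] by eventually_elim (simp add: Z_def)
    thus ?thesis by (simp add: islimpt_iff_eventually)
  qed
  have hol: "f holomorphic_on - Z"
    unfolding f_def
    by (intro holomorphic_intros holomorphic_on_subset[OF wp_holomorphic] holomorphic_on_subset[OF ws_holomorphic]
        holomorphic_on_compose_gen[OF _ ws_holomorphic, unfolded o_def])
       (auto simp: Z_def ws_eq_0_iff)
  have per: "f (z + 2 * hp k) = f z" if k: "k \<in> {1, 3}" and z: "z \<notin> Z" for z k
  proof -
    have k': "k \<in> {1, 2, 3}" using k by auto
    have zL: "z \<notin> L" using z by (auto simp: Z_def)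
    have e: "ws (z + 2 * hp k + y) = - exp (2 * qp k * (z + y + hp k)) * ws (z + y)"
       "ws (z + 2 * hp k - y) = - exp (2 * qp k * (z - y + hp k)) * ws (z - y)"
      using ws_quasi_periodic[OF k', of "z + y"] ws_quasi_periodic[OF k', of "z - y"] by (simp_all add: algebra_simps)
    have ee: "exp (2 * qp k * (z + y + hp k)) * exp (2 * qp k * (z - y + hp k)) = exp (2 * qp k * (z + hp k)) ^ 2"
      by (simp add: exp_add[symmetric] power2_eq_square algebra_simps)
    have "f (z + 2 * hp k) = (wp z - wp y) * (exp (2 * qp k * (z + hp k)) ^ 2 * ws z ^ 2) /
        ((exp (2 * qp k * (z + y + hp k)) * exp (2 * qp k * (z - y + hp k))) * (ws (z + y) * ws (z - y)))"
      unfolding f_def e ws_quasi_periodic[OF k', of z] wp_periodic[OF double_hp zL]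
      by (simp add: power_mult_distrib mult_ac)
    also have "\<dots> = f z" unfolding ee f_def by simp
    finally show ?thesis .
  qed
  have lim0: "(f \<longlongrightarrow> - 1 / ws y ^ 2) (at 0)"
  proof -
    have "((\<lambda>z. (z ^ 2 * wp z - z ^ 2 * wp y) * (ws z / z) ^ 2 / (ws (z + y) * ws (z - y))) \<longlongrightarrow>
        (1 - 0 ^ 2 * wp y) * 1 ^ 2 / (ws (0 + y) * ws (0 - y))) (at 0)"
    proof (intro tendsto_intros wp_times_square_tendsto ws_over_id_tendsto)
      show "((\<lambda>z. ws (z + y)) \<longlongrightarrow> ws (0 + y)) (at 0)" "((\<lambda>z. ws (z - y)) \<longlongrightarrow> ws (0 - y)) (at 0)"
        by (rule isCont_tendsto_compose[OF ws_continuous], intro tendsto_intros)+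
    qed (use yL in \<open>auto simp: ws_eq_0_iff\<close>)
    moreover have "(1 - 0 ^ 2 * wp y) * 1 ^ 2 / (ws (0 + y) * ws (0 - y)) = - 1 / ws y ^ 2"
      by (simp add: ws_odd power2_eq_square)
    ultimately have "((\<lambda>z. (z ^ 2 * wp z - z ^ 2 * wp y) * (ws z / z) ^ 2 / (ws (z + y) * ws (z - y))) \<longlongrightarrow> - 1 / ws y ^ 2) (at 0)"
      by simp
    thus ?thesis
      by (rule Lim_transform_eventually)
         (auto simp: eventually_at_filter f_def power_divide right_diff_distrib[symmetric])
  qed
  have lim1: "\<exists>l. (f \<longlongrightarrow> l) (at a)" if a: "a = y \<or> a = - y" for a
  proof -
    have aL: "a \<notin> L" "a + a \<notin> L" using a yL y2 by (auto simp: minus_add_distrib[symmetric] simp del: minus_add_distrib)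
    have wpa: "wp y = wp a" using a wp_even by auto
    have eq: "ws (z + y) * ws (z - y) = ws (z + a) * ws (z - a)" for z using a by auto
    have "((\<lambda>z. ((wp z - wp a) / (z - a)) * ws z ^ 2 / (ws (z + a) * (ws (z - a) / (z - a)))) \<longlongrightarrow>
        dwp a * ws a ^ 2 / (ws (a + a) * 1)) (at a)"
    proof (intro tendsto_intros ws_shift_tendsto difference_quotient_tendsto wp_derivative aL)
      show "((\<lambda>z. ws (z + a)) \<longlongrightarrow> ws (a + a)) (at a)" "(ws \<longlongrightarrow> ws a) (at a)"
        by (rule isCont_tendsto_compose[OF ws_continuous], intro tendsto_intros)+
    qed (use aL in \<open>auto simp: ws_eq_0_iff\<close>)
    hence "(f \<longlongrightarrow> dwp a * ws a ^ 2 / (ws (a + a) * 1)) (at a)"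
      by (rule Lim_transform_eventually) (auto simp: eventually_at_filter f_def wpa eq)
    thus ?thesis ..
  qed
  have lim: "\<exists>z0 l. z - z0 \<in> L \<and> (f \<longlongrightarrow> l) (at z0)" if "z \<in> Z" for z
  proof -
    have "z - 0 \<in> L \<or> z - - y \<in> L \<or> z - y \<in> L" using that by (auto simp: Z_def)
    thus ?thesis using lim0 lim1 by metis
  qed
  have "\<exists>c. \<forall>z. z \<notin> Z \<longrightarrow> f z = c"
    by (rule elliptic_constant) (fact Zper disc hol per lim)+
  then obtain c where c: "\<And>z. z \<notin> Z \<Longrightarrow> f z = c" by blast
  have "\<forall>\<^sub>F z in at 0. f z = c"
    using disc[of 0] c by (auto simp: islimpt_iff_eventually elim: eventually_mono)
  from Lim_transform_eventually[OF lim0 this] have "((\<lambda>z. c) \<longlongrightarrow> - 1 / ws y ^ 2) (at (0::complex))" .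
  hence "c = - 1 / ws y ^ 2" by (simp add: tendsto_const_iff)
  with c[of x] have "f x = - 1 / ws y ^ 2" using x by (simp add: Z_def)
  moreover have "ws x \<noteq> 0" "ws (x + y) \<noteq> 0" "ws (x - y) \<noteq> 0" "ws y \<noteq> 0" using x yL by (auto simp: ws_eq_0_iff)
  ultimately show ?thesis unfolding f_def by (simp add: field_simps) 
qed

lemma wp_diff_generic':
  assumes y: "y \<notin> H" and x: "x \<notin> L"
  shows "wp x - wp y = - ws (x + y) * ws (x - y) / (ws x ^ 2 * ws y ^ 2)"
proof (cases "x + y \<in> L \<or> x - y \<in> L")
  case False thus ?thesis using wp_diff_generic[OF y x] by auto
next
  case True
  have yL: "y \<notin> L" using y L_subset_H by auto
  have "wp x = wp y"
  proof (cases "x - y \<in> L")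
    case True thus ?thesis using wp_periodic[OF True yL] by simp
  next
    case False
    hence "x + y \<in> L" using True by auto
    from wp_periodic[OF this, of "- y"] show ?thesis using yL by (simp add: wp_even)
  qed
  moreover have "ws (x + y) * ws (x - y) = 0" using True by (auto simp: ws_eq_0_iff)
  ultimately show ?thesis by simp
qed

text \<open>The points y of H outside L are limits of generic ones, and both sides are continuous in
  y.\<close>

lemma wp_diff:
  assumes x: "x \<notin> L" and y: "y \<notin> L"
  shows "wp x - wp y = - ws (x + y) * ws (x - y) / (ws x ^ 2 * ws y ^ 2)"
proof -
  have 1: "((\<lambda>z. wp x - wp z) \<longlongrightarrow> wp x - wp y) (at y)"
    using wp_continuous[OF y] by (intro tendsto_intros) (simp add: isCont_def)
  have 2: "((\<lambda>z. - ws (x + z) * ws (x - z) / (ws x ^ 2 * ws z ^ 2)) \<longlongrightarrow>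
      - ws (x + y) * ws (x - y) / (ws x ^ 2 * ws y ^ 2)) (at y)"
    by (intro tendsto_intros isCont_tendsto_compose[OF ws_continuous]) (use x y in \<open>auto simp: ws_eq_0_iff\<close>)
  have "\<forall>\<^sub>F z in at y. wp x - wp z = - ws (x + z) * ws (x - z) / (ws x ^ 2 * ws z ^ 2)"
    using eventually_not_H[of y] by eventually_elim (rule wp_diff_generic'[OF _ x])
  from Lim_transform_eventually[OF 1 this] show ?thesis
    by (rule tendsto_unique[OF trivial_limit_at _ 2])
qed

lemma wp_eq_iff:
  assumes "x \<notin> L" "y \<notin> L" shows "wp x = wp y \<longleftrightarrow> x + y \<in> L \<or> x - y \<in> L"
proof -
  have "wp x = wp y \<longleftrightarrow> - ws (x + y) * ws (x - y) / (ws x ^ 2 * ws y ^ 2) = 0"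
    using wp_diff[OF assms] by (metis eq_iff_diff_eq_0)
  thus ?thesis using assms by (simp add: ws_eq_0_iff)
qed

text \<open>The addition formula divided by z - x, in the limit z -> x.\<close>

lemma dwp_eq_ws:
  assumes x: "x \<notin> L" shows "dwp x = - ws (2 * x) / ws x ^ 4"
proof -
  have "((\<lambda>z. - ws (z + x) * (ws (z - x) / (z - x)) / (ws z ^ 2 * ws x ^ 2)) \<longlongrightarrow> - ws (x + x) * 1 / (ws x ^ 2 * ws x ^ 2)) (at x)"
    by (intro tendsto_intros ws_shift_tendsto isCont_tendsto_compose[OF ws_continuous])
       (use x in \<open>auto simp: ws_eq_0_iff\<close>)
  moreover have "\<forall>\<^sub>F z in at x. - ws (z + x) * (ws (z - x) / (z - x)) / (ws z ^ 2 * ws x ^ 2) = (wp z - wp x) / (z - x)"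
    using eventually_not_L[of x] by eventually_elim (simp add: wp_diff[OF _ x])
  ultimately have "((\<lambda>z. (wp z - wp x) / (z - x)) \<longlongrightarrow> - ws (x + x) * 1 / (ws x ^ 2 * ws x ^ 2)) (at x)"
    by (rule Lim_transform_eventually)
  with difference_quotient_tendsto[OF wp_derivative[OF x]]
  have "dwp x = - ws (x + x) * 1 / (ws x ^ 2 * ws x ^ 2)" by (rule tendsto_unique[rotated]) simp
  moreover have "x + x = 2 * x" "ws x ^ 2 * ws x ^ 2 = ws x ^ 4" by (simp_all flip: power_add)
  ultimately show ?thesis by (simp only: mult_1_right)
qed

lemma dwp_eq_0_iff: "x \<notin> L \<Longrightarrow> dwp x = 0 \<longleftrightarrow> x \<in> H"
  by (simp add: dwp_eq_ws ws_eq_0_iff H_iff)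

text \<open>The addition formula differentiated logarithmically in x; it converts between \<wp>' and
  sums of \<zeta>-values, the form in which the kernel is differentiated.\<close>

lemma dwp_eq_zeta:
  assumes x: "x \<notin> L" and y: "y \<notin> L" and xy: "x + y \<notin> L" "x - y \<notin> L"
  shows "dwp x = (wp x - wp y) * (wz (x + y) + wz (x - y) - 2 * wz x)"
proof -
  have ev: "\<forall>\<^sub>F z in nhds x. wp z - wp y = - ws (z + y) * ws (z - y) / (ws z ^ 2 * ws y ^ 2)"
    using eventually_nhds_in_open[OF open_Compl_L, of x] x wp_diff[OF _ y] by (auto elim!: eventually_mono)
  have d1: "((\<lambda>z. ws (z + y)) has_field_derivative ws (x + y) * wz (x + y)) (at x)"
    "((\<lambda>z. ws (z - y)) has_field_derivative ws (x - y) * wz (x - y)) (at x)"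
    using shifted_derivative[OF ws_derivative[OF xy(1)]] shifted_derivative[of ws _ x "- y"] ws_derivative[OF xy(2)] by auto
  have nz: "ws x \<noteq> 0" "ws y \<noteq> 0" using x y by (auto simp: ws_eq_0_iff)
  have "((\<lambda>z. - (ws (z + y) * ws (z - y)) / (ws z ^ 2 * ws y ^ 2)) has_field_derivative
     ((- (ws (x + y) * wz (x + y) * ws (x - y) + ws (x - y) * wz (x - y) * ws (x + y))) * (ws x ^ 2 * ws y ^ 2)
       - (- (ws (x + y) * ws (x - y))) * (of_nat 2 * (ws x * wz x * ws x ^ (2 - Suc 0)) * ws y ^ 2)) /
      ((ws x ^ 2 * ws y ^ 2) * (ws x ^ 2 * ws y ^ 2))) (at x)"
    by (intro DERIV_divide DERIV_minus DERIV_mult d1 DERIV_cmult_right DERIV_power ws_derivative x) (use nz in auto)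
  moreover have "((\<lambda>z. wp z - wp y) has_field_derivative dwp x) (at x)"
    using DERIV_diff[OF wp_derivative[OF x] DERIV_const] by simp
  hence "((\<lambda>z. - (ws (z + y) * ws (z - y)) / (ws z ^ 2 * ws y ^ 2)) has_field_derivative dwp x) (at x)"
    by (rule DERIV_cong_ev[THEN iffD1, rotated -1]) (use ev in auto)
  ultimately have "dwp x = ((- (ws (x + y) * wz (x + y) * ws (x - y) + ws (x - y) * wz (x - y) * ws (x + y))) * (ws x ^ 2 * ws y ^ 2)
       - (- (ws (x + y) * ws (x - y))) * (of_nat 2 * (ws x * wz x * ws x ^ (2 - Suc 0)) * ws y ^ 2)) /
      ((ws x ^ 2 * ws y ^ 2) * (ws x ^ 2 * ws y ^ 2))"
    using DERIV_unique by blast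
  also have "\<dots> = (- ws (x + y) * ws (x - y) / (ws x ^ 2 * ws y ^ 2)) * (wz (x + y) + wz (x - y) - 2 * wz x)"
    using nz by (simp add: divide_simps power2_eq_square) (simp add: algebra_simps)
  finally show ?thesis unfolding wp_diff[OF x y] .
qed

lemma H_cases: assumes "z \<in> H" obtains i where "i \<le> 3" "z - hp i \<in> L"
proof -
  from assms obtain m n where z: "z = of_int m * \<omega>\<^sub>1 + of_int n * \<omega>\<^sub>3" by (auto simp: half_lattice_def)
  define a b where "a = m div 2" and "b = n div 2"
  have mn: "m = 2 * a + m mod 2" "n = 2 * b + n mod 2" by (simp_all add: a_def b_def)
  have cases: "m mod 2 = 0 \<or> m mod 2 = 1" "n mod 2 = 0 \<or> n mod 2 = 1" by auto
  have z': "z = of_int a * (2 * \<omega>\<^sub>1) + of_int b * (2 * \<omega>\<^sub>3) + of_int (m mod 2) * \<omega>\<^sub>1 + of_int (n mod 2) * \<omega>\<^sub>3"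
    unfolding z by (subst mn(1), subst mn(2)) (simp add: algebra_simps)
  from cases consider "m mod 2 = 0" "n mod 2 = 0" | "m mod 2 = 1" "n mod 2 = 0" | "m mod 2 = 0" "n mod 2 = 1"
    | "m mod 2 = 1" "n mod 2 = 1" by blast
  thus thesis
  proof cases
    case 1 thus ?thesis using L_I[of a b] by (intro that[of 0]) (simp_all add: z' half_period_def)
  next
    case 2 thus ?thesis using L_I[of a b] by (intro that[of 1]) (simp_all add: z' half_period_def)
  next
    case 3 thus ?thesis using L_I[of a b] by (intro that[of 3]) (simp_all add: z' half_period_def)
  next
    \<comment> \<open>\<open>\<omega>\<^sub>1 + \<omega>\<^sub>3\<close> equals \<open>hp 2\<close>
      plus both periods, hence the shift of the coefficients by 1.\<close>
    case 4 thus ?thesis using L_I[of "a + 1" "b + 1"] by (intro that[of 2]) (simp_all add: z' half_period_def algebra_simps)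
  qed
qed

subsection \<open>The differential equation and the half-periods\<close>

definition e where "e i = wp (hp i)"

lemma H_add_L: "v \<in> L \<Longrightarrow> z + v \<in> H \<longleftrightarrow> z \<in> H"
  using L_add_iff(1)[of "2 * v" "2 * z"] L_add[of v v] by (simp add: H_iff distrib_left)

lemma H_add_hp [simp]: "z + hp i \<in> H \<longleftrightarrow> z \<in> H" "z - hp i \<in> H \<longleftrightarrow> z \<in> H" "- z \<in> H \<longleftrightarrow> z \<in> H"
  by (simp_all add: H_iff distrib_left right_diff_distrib)

lemma notin_H_imp_notin_L: "z \<notin> H \<Longrightarrow> z \<notin> L"
  using L_subset_H by blast

lemma hp_add_notin_L:
  assumes "i \<in> {1, 2, 3}" "j \<in> {1, 2, 3}" "i \<noteq> j"
  shows "hp i + hp j \<notin> L" "hp i - hp j \<notin> L"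
proof -
  have "\<exists>k\<in>{1, 2, 3}. hp i + hp j = - hp k"
    using assms by (auto simp: half_period_def)
  thus 1: "hp i + hp j \<notin> L" using hp_notin_L by (metis L_minus_iff)
  have "hp i - hp j = hp i + hp j - 2 * hp j" by simp
  thus "hp i - hp j \<notin> L" using 1 L_add_iff(3)[OF double_hp] by metis
qed

lemma e_distinct: "i \<in> {1, 2, 3} \<Longrightarrow> j \<in> {1, 2, 3} \<Longrightarrow> i \<noteq> j \<Longrightarrow> e i \<noteq> e j"
  unfolding e_def by (subst wp_eq_iff) (use hp_notin_L hp_add_notin_L in auto)

lemma wp_ne_e: assumes "z \<notin> H" "i \<in> {1, 2, 3}" shows "wp z \<noteq> e i"
proof -
  have "z + hp i \<notin> L" "z - hp i \<notin> L" using assms notin_H_imp_notin_L by (metis H_add_hp(1,2))+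
  thus ?thesis using wp_eq_iff[of z "hp i"] assms hp_notin_L notin_H_imp_notin_L by (simp add: e_def)
qed

text \<open>The case y = \<open>hp i\<close>, with \<zeta>(z - \<omega>_i) rewritten as \<zeta>(z +
  \<omega>_i) - 2 \<eta>_i. The last factor is thus half the logarithmic derivative of \<wp> -
  e_i.\<close>

lemma dwp_eq_zeta_half:
  assumes "z \<notin> H" "i \<in> {1, 2, 3}"
  shows "dwp z = 2 * (wp z - e i) * (wz (z + hp i) - wz z - qp i)"
proof -
  have n: "z + hp i \<notin> L" "z - hp i \<notin> L" "z \<notin> L" using assms notin_H_imp_notin_L by (metis H_add_hp(1,2))+
  have "z - hp i + 2 * hp i = z + hp i" by simp
  with wz_quasi_periodic[OF n(2), of i] have "wz (z + hp i) = wz (z - hp i) + 2 * qp i" using assms(2) by auto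
  thus ?thesis using dwp_eq_zeta[OF n(3) hp_notin_L[OF assms(2)] n(1,2)] by (simp add: e_def algebra_simps)
qed

text \<open>Constancy of an elliptic quotient, whose value 4 = (-2)^2 is the limit at 0. At a
  half-period it stays finite because \<wp>' / (\<wp> - e_i) is a combination of \<zeta>-values with
  a simple pole, while \<wp>' has a zero there.\<close>

lemma wp_differential_equation:
  assumes "z \<notin> H"
  shows "dwp z ^ 2 = 4 * (wp z - e 1) * (wp z - e 2) * (wp z - e 3)"
proof -
  define f where "f z = dwp z ^ 2 / ((wp z - e 1) * (wp z - e 2) * (wp z - e 3))" for z
  have Zper: "z + v \<notin> H" if "v \<in> L" "z \<notin> H" for z v using that H_add_L by blast
  have sub: "- H \<subseteq> - L" using L_subset_H by auto
  have hol: "f holomorphic_on - H"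
    unfolding f_def
    by (intro holomorphic_intros holomorphic_on_subset[OF wp_holomorphic sub] holomorphic_on_subset[OF dwp_holomorphic sub])
       (auto simp: wp_ne_e)
  have per: "f (z + 2 * hp k) = f z" if "k \<in> {1, 3}" "z \<notin> H" for z k
    using that by (simp add: f_def wp_periodic dwp_periodic notin_H_imp_notin_L)
  have lim0: "(f \<longlongrightarrow> 4) (at 0)"
  proof -
    have "((\<lambda>z. (z ^ 3 * dwp z) ^ 2 / ((z ^ 2 * wp z - z ^ 2 * e 1) * (z ^ 2 * wp z - z ^ 2 * e 2) * (z ^ 2 * wp z - z ^ 2 * e 3)))
        \<longlongrightarrow> (- 2) ^ 2 / ((1 - 0 ^ 2 * e 1) * (1 - 0 ^ 2 * e 2) * (1 - 0 ^ 2 * e 3))) (at 0)"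
      by (intro tendsto_intros wp_times_square_tendsto dwp_times_cube_tendsto) auto
    hence l: "((\<lambda>z. (z ^ 3 * dwp z) ^ 2 / ((z ^ 2 * wp z - z ^ 2 * e 1) * (z ^ 2 * wp z - z ^ 2 * e 2) * (z ^ 2 * wp z - z ^ 2 * e 3)))
        \<longlongrightarrow> 4) (at 0)" by simp
    show ?thesis
    proof (rule Lim_transform_eventually[OF l])
      show "\<forall>\<^sub>F z in at 0. (z ^ 3 * dwp z) ^ 2 / ((z ^ 2 * wp z - z ^ 2 * e 1) * (z ^ 2 * wp z - z ^ 2 * e 2) * (z ^ 2 * wp z - z ^ 2 * e 3)) = f z"
        unfolding eventually_at_filter
      proof (intro always_eventually allI impI)
        fix z :: complex assume z: "z \<noteq> 0"
        have "(z ^ 3 * dwp z) ^ 2 / ((z ^ 2 * wp z - z ^ 2 * e 1) * (z ^ 2 * wp z - z ^ 2 * e 2) * (z ^ 2 * wp z - z ^ 2 * e 3))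
            = (z ^ 6 * dwp z ^ 2) / (z ^ 6 * ((wp z - e 1) * (wp z - e 2) * (wp z - e 3)))"
          by (simp add: power_mult_distrib right_diff_distrib[symmetric] power_mult[symmetric]) (simp add: mult_ac eval_nat_numeral)
        also have "\<dots> = f z" using z by (simp add: f_def)
        finally show "(z ^ 3 * dwp z) ^ 2 / ((z ^ 2 * wp z - z ^ 2 * e 1) * (z ^ 2 * wp z - z ^ 2 * e 2) * (z ^ 2 * wp z - z ^ 2 * e 3)) = f z" .
      qed
    qed
  qed
  have lim1: "\<exists>l. (f \<longlongrightarrow> l) (at (hp i))" if ijk: "(i, j, k) \<in> {(1::nat, 2::nat, 3::nat), (2, 1, 3), (3, 1, 2)}" for i j k
  proof -
    have i: "i \<in> {1, 2, 3}" using ijk by auto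
    define a where "a = hp i"
    have aL: "a \<notin> L" using hp_notin_L[OF i] by (simp add: a_def)
    have d0: "dwp a = 0" using dwp_eq_0_iff[OF aL] by (simp add: a_def)
    have dist: "i \<noteq> j" "i \<noteq> k" "j \<in> {1, 2, 3}" "k \<in> {1, 2, 3}"
      using ijk by auto
    have "(dwp has_field_derivative deriv dwp a) (at a)"
      by (rule holomorphic_derivI[OF dwp_holomorphic open_Compl_L]) (use aL in auto)
    from difference_quotient_tendsto[OF this] have l1: "((\<lambda>z. dwp z / (z - a)) \<longlongrightarrow> deriv dwp a) (at a)"
      by (simp add: d0)
    have l2: "((\<lambda>z. (z - a) * wz (z - a)) \<longlongrightarrow> 1) (at a)"
    proof (rule filterlim_compose[OF wz_times_id_tendsto])
      show "filterlim (\<lambda>z. z - a) (at 0) (at a)"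
        by (rule filterlim_atI) (auto intro!: tendsto_eq_intros simp: eventually_at_filter)
    qed
    have l3: "(wz \<longlongrightarrow> wz a) (at a)" "(wp \<longlongrightarrow> e i) (at a)"
      using wz_continuous[OF aL] wp_continuous[OF aL] by (simp_all add: isCont_def e_def a_def)
    have "((\<lambda>z. (dwp z / (z - a)) * (2 * ((z - a) * wz (z - a) + (z - a) * (qp i - wz z))) / ((wp z - e j) * (wp z - e k)))
       \<longlongrightarrow> deriv dwp a * (2 * (1 + (a - a) * (qp i - wz a))) / ((e i - e j) * (e i - e k))) (at a)"
      by (intro tendsto_intros l1 l2 l3) (use e_distinct i dist in auto)
    moreover have "\<forall>\<^sub>F z in at a. (dwp z / (z - a)) * (2 * ((z - a) * wz (z - a) + (z - a) * (qp i - wz z))) / ((wp z - e j) * (wp z - e k)) = f z"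
      using eventually_not_H eventually_neq_at_within[of a a]
    proof eventually_elim
      case (elim z)
      have z: "z - a \<notin> L" using elim notin_H_imp_notin_L by (simp add: a_def)
      have i3: "i \<le> 3" using i by auto
      have "z - a + 2 * a = z + a" by simp
      with wz_quasi_periodic[OF z i3] have w: "wz (z - a) = wz (z + hp i) - 2 * qp i"
        by (simp only: a_def add_diff_cancel_right')
      have "(dwp z / (z - a)) * (2 * ((z - a) * wz (z - a) + (z - a) * (qp i - wz z)))
          = dwp z * (2 * (wz (z - a) + (qp i - wz z)))"
        using elim by (simp add: distrib_left[symmetric])
      also have "\<dots> = dwp z * (2 * (wz (z + hp i) - wz z - qp i))" by (simp add: w)
      also have "\<dots> = dwp z ^ 2 / (wp z - e i)"
      proof -
        have "p * (2 * b) = p ^ 2 / x" if "p = 2 * x * b" "x \<noteq> 0" for p x b :: complex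
          using that by (simp add: power2_eq_square)
        from this[OF dwp_eq_zeta_half[OF elim(1) i]] wp_ne_e[OF elim(1) i] show ?thesis by simp
      qed
      finally have 1: "(dwp z / (z - a)) * (2 * ((z - a) * wz (z - a) + (z - a) * (qp i - wz z))) = dwp z ^ 2 / (wp z - e i)" .
      have "(wp z - e i) * ((wp z - e j) * (wp z - e k)) = (wp z - e 1) * (wp z - e 2) * (wp z - e 3)"
        using ijk by (auto simp: mult_ac)
      thus ?case unfolding 1 f_def by simp
    qed
    ultimately show ?thesis unfolding a_def[symmetric] by (intro exI, rule Lim_transform_eventually)
  qed
  have lim: "\<exists>z0 l. z - z0 \<in> L \<and> (f \<longlongrightarrow> l) (at z0)" if z: "z \<in> H" for z
  proof -
    obtain i where i: "i \<le> 3" "z - hp i \<in> L" using H_cases[OF z] by blast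
    then consider "i = 0" | "i = 1" | "i = 2" | "i = 3" by linarith
    hence "\<exists>l. (f \<longlongrightarrow> l) (at (hp i))"
    proof cases
      case 1 thus ?thesis using lim0 by (auto simp: half_period_def)
    next
      case 2 thus ?thesis using lim1[of 1 2 3] by simp
    next
      case 3 thus ?thesis using lim1[of 2 1 3] by simp
    next
      case 4 thus ?thesis using lim1[of 3 1 2] by simp
    qed
    thus ?thesis using i by blast
  qed
  have "\<exists>c. \<forall>z. z \<notin> H \<longrightarrow> f z = c"
    by (rule elliptic_constant) (fact Zper not_islimpt_H hol per lim)+
  then obtain c where c: "\<And>z. z \<notin> H \<Longrightarrow> f z = c" by blast
  have "\<forall>\<^sub>F z in at 0. f z = c" using eventually_not_H[of 0] by eventually_elim (rule c)
  from Lim_transform_eventually[OF lim0 this] have "c = 4" by (simp add: tendsto_const_iff)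
  hence f4: "dwp z ^ 2 / ((wp z - e 1) * (wp z - e 2) * (wp z - e 3)) = 4" using c[OF assms] by (simp add: f_def)
  have "(wp z - e 1) * (wp z - e 2) * (wp z - e 3) \<noteq> 0"
    using wp_ne_e[OF assms, of 1] wp_ne_e[OF assms, of 2] wp_ne_e[OF assms, of 3] by simp
  with f4 show ?thesis by (simp only: divide_eq_eq mult.assoc) simp
qed

lemma dwp_nonzero: "z \<notin> H \<Longrightarrow> dwp z \<noteq> 0"
  using dwp_eq_0_iff notin_H_imp_notin_L by blast

lemma dwp_derivative:
  assumes z: "z \<notin> H"
  shows "(dwp has_field_derivative
    2 * ((wp z - e 1) * (wp z - e 2) + (wp z - e 1) * (wp z - e 3) + (wp z - e 2) * (wp z - e 3))) (at z)"
proof -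
  have zL: "z \<notin> L" using z by (rule notin_H_imp_notin_L)
  have d: "(dwp has_field_derivative deriv dwp z) (at z)"
    by (rule holomorphic_derivI[OF dwp_holomorphic open_Compl_L]) (use zL in auto)
  note dw = DERIV_diff[OF wp_derivative[OF zL] DERIV_const]
  have "((\<lambda>z. 4 * ((wp z - e 1) * (wp z - e 2) * (wp z - e 3))) has_field_derivative
     4 * (((dwp z - 0) * (wp z - e 2) + (dwp z - 0) * (wp z - e 1)) * (wp z - e 3) + (dwp z - 0) * ((wp z - e 1) * (wp z - e 2)))) (at z)"
    by (intro DERIV_cmult DERIV_mult dw)
  moreover have "((\<lambda>z. dwp z ^ 2) has_field_derivative of_nat 2 * (deriv dwp z * dwp z ^ (2 - Suc 0))) (at z)"
    by (rule DERIV_power[OF d])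
  hence "((\<lambda>z. 4 * ((wp z - e 1) * (wp z - e 2) * (wp z - e 3))) has_field_derivative 2 * (deriv dwp z * dwp z)) (at z)"
    by (rule DERIV_cong_ev[THEN iffD1, rotated -1])
       (use eventually_nhds_in_open[OF open_Compl_H, of z] z wp_differential_equation in
         \<open>auto elim!: eventually_mono simp: mult.assoc\<close>)
  ultimately have eq: "2 * (deriv dwp z * dwp z) =
      4 * (((dwp z - 0) * (wp z - e 2) + (dwp z - 0) * (wp z - e 1)) * (wp z - e 3) + (dwp z - 0) * ((wp z - e 1) * (wp z - e 2)))"
    using DERIV_unique by blast
  have cancel: "D = 2 * (x * y + x * t + y * t)" if "2 * (D * p) = 4 * (((p - 0) * y + (p - 0) * x) * t + (p - 0) * (x * y))" "p \<noteq> 0"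
    for D p x y t :: complex
  proof -
    have "p * (D - 2 * (x * y + x * t + y * t)) = 0" using that(1) by algebra
    thus ?thesis using that(2) by simp
  qed
  have "deriv dwp z = 2 * ((wp z - e 1) * (wp z - e 2) + (wp z - e 1) * (wp z - e 3) + (wp z - e 2) * (wp z - e 3))"
    by (rule cancel[OF eq dwp_nonzero[OF z]])
  with d show ?thesis by simp
qed

lemma wz_shift_derivative:
  assumes "z \<notin> H" shows "((\<lambda>z. wz (z + hp i)) has_field_derivative - wp (z + hp i)) (at z)"
proof -
  have "z + hp i \<notin> L" using assms notin_H_imp_notin_L by (metis H_add_hp(1))
  thus ?thesis by (intro shifted_derivative wz_derivative)
qed

text \<open>The shift \<wp>(z + \<omega>_i) - e_i = (e_i - e_j) (e_i - e_k) / (\<wp>(z) - e_i),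
  cleared of denominators. It comes from differentiating \<open>dwp_eq_zeta_half\<close>, since the
  derivative of the last factor there is \<wp>(z) - \<wp>(z + \<omega>_i).\<close>

lemma wp_half_shift:
  assumes z: "z \<notin> H" and ijk: "(i, j, k) \<in> {(1::nat, 2::nat, 3::nat), (2, 1, 3), (3, 1, 2)}"
  shows "(wp z - e i) * (wp (z + hp i) + wp z - e j - e k) = (wp z - e j) * (wp z - e k)"
proof -
  have i: "i \<in> {1, 2, 3}" using ijk by auto
  have zL: "z \<notin> L" using z by (rule notin_H_imp_notin_L)
  define B where "B z = wz (z + hp i) - wz z - qp i" for z
  have dB: "(B has_field_derivative - wp (z + hp i) - (- wp z)) (at z)"
    unfolding B_def[abs_def] using DERIV_diff[OF DERIV_diff[OF wz_shift_derivative[OF z] wz_derivative[OF zL]] DERIV_const] by simp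
  have "((\<lambda>z. 2 * (wp z - e i) * B z) has_field_derivative
      2 * (dwp z - 0) * B z + (- wp (z + hp i) - (- wp z)) * (2 * (wp z - e i))) (at z)"
    by (intro DERIV_mult dB DERIV_cmult DERIV_diff wp_derivative zL DERIV_const)
  moreover have "((\<lambda>z. 2 * (wp z - e i) * B z) has_field_derivative
      2 * ((wp z - e 1) * (wp z - e 2) + (wp z - e 1) * (wp z - e 3) + (wp z - e 2) * (wp z - e 3))) (at z)"
    by (rule DERIV_cong_ev[THEN iffD1, rotated -1, OF dwp_derivative[OF z]])
       (use eventually_nhds_in_open[OF open_Compl_H, of z] z dwp_eq_zeta_half[OF _ i] in
         \<open>auto elim!: eventually_mono simp: B_def\<close>)
  ultimately have 1: "2 * (dwp z - 0) * B z + (- wp (z + hp i) - (- wp z)) * (2 * (wp z - e i)) =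
      2 * ((wp z - e 1) * (wp z - e 2) + (wp z - e 1) * (wp z - e 3) + (wp z - e 2) * (wp z - e 3))"
    using DERIV_unique by blast
  have 2: "dwp z = 2 * (wp z - e i) * B z" using dwp_eq_zeta_half[OF z i] by (simp add: B_def)
  have perm: "(wp z - e 1) * (wp z - e 2) + (wp z - e 1) * (wp z - e 3) + (wp z - e 2) * (wp z - e 3) =
      (wp z - e i) * (wp z - e j) + (wp z - e i) * (wp z - e k) + (wp z - e j) * (wp z - e k)"
    "4 * (wp z - e 1) * (wp z - e 2) * (wp z - e 3) = 4 * (wp z - e i) * (wp z - e j) * (wp z - e k)"
    using ijk by (auto simp: algebra_simps)
  have 3: "dwp z ^ 2 = 4 * (wp z - e i) * (wp z - e j) * (wp z - e k)"
    using wp_differential_equation[OF z] perm(2) by simp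
  have aux: "x * (s + w - a - b) = y * t"
    if "2 * (p - 0) * B + (- s - (- w)) * (2 * x) = 2 * (x * y + x * t + y * t)" "p = 2 * x * B"
      "p ^ 2 = 4 * x * y * t" "x \<noteq> 0" "y = w - a" "t = w - b" for x y t s w a b p B :: complex
  proof -
    have "x * B ^ 2 * x * 4 = 4 * x * y * t" using that(2,3) by algebra
    hence "4 * x * (x * B ^ 2 - y * t) = 0" by algebra
    hence "x * B ^ 2 = y * t" using that(4) by simp
    thus ?thesis using that(1,2,5,6) by algebra
  qed
  show ?thesis by (rule aux[OF 1[unfolded perm] 2 3]) (use wp_ne_e[OF z i] in auto)
qed

text \<open>Differentiating \<wp>'(z) = - \<sigma>(2 z) / \<sigma>(z)^4 gives \<wp>'' / \<wp>' = 2
  \<zeta>(2 z) - 4 \<zeta>(z); by the differential equation the left side is also the sum of half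
  the logarithmic derivatives of the \<wp> - e_i. The constants drop out since \<eta>_1 + \<eta>_2 +
  \<eta>_3 = 0.\<close>

lemma wz_duplication:
  assumes z: "z \<notin> H"
  shows "2 * wz (2 * z) = wz z + wz (z + hp 1) + wz (z + hp 2) + wz (z + hp 3)"
proof -
  have zL: "z \<notin> L" using z by (rule notin_H_imp_notin_L)
  have z2L: "2 * z \<notin> L" using z by (simp add: H_iff)
  have nz: "ws z \<noteq> 0" "dwp z \<noteq> 0" using zL dwp_nonzero[OF z] by (simp_all add: ws_eq_0_iff)
  have d2: "((\<lambda>z. ws (2 * z)) has_field_derivative ws (2 * z) * wz (2 * z) * 2) (at z)"
    by (rule DERIV_chain2[where f = ws and g = "\<lambda>z. 2 * z", OF ws_derivative[OF z2L]])
       (auto intro!: derivative_eq_intros)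
  have "((\<lambda>z. - ws (2 * z) / ws z ^ 4) has_field_derivative
     (- (ws (2 * z) * wz (2 * z) * 2) * ws z ^ 4 - (- ws (2 * z)) * (of_nat 4 * (ws z * wz z * ws z ^ (4 - Suc 0)))) / (ws z ^ 4 * ws z ^ 4)) (at z)"
    by (intro DERIV_divide DERIV_minus d2 DERIV_power ws_derivative zL) (use nz in auto)
  hence "((\<lambda>z. - ws (2 * z) / ws z ^ 4) has_field_derivative dwp z * (2 * wz (2 * z) - 4 * wz z)) (at z)"
    by (rule DERIV_cong) (use nz in \<open>simp add: dwp_eq_ws[OF zL] field_simps eval_nat_numeral\<close>)
  moreover have "((\<lambda>z. - ws (2 * z) / ws z ^ 4) has_field_derivative
      2 * ((wp z - e 1) * (wp z - e 2) + (wp z - e 1) * (wp z - e 3) + (wp z - e 2) * (wp z - e 3))) (at z)"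
    by (rule DERIV_cong_ev[THEN iffD1, rotated -1, OF dwp_derivative[OF z]])
       (use eventually_nhds_in_open[OF open_Compl_L, of z] zL dwp_eq_ws in \<open>auto elim!: eventually_mono\<close>)
  ultimately have 1: "dwp z * (2 * wz (2 * z) - 4 * wz z) =
      2 * ((wp z - e 1) * (wp z - e 2) + (wp z - e 1) * (wp z - e 3) + (wp z - e 2) * (wp z - e 3))"
    using DERIV_unique by blast
  define B where "B i = wz (z + hp i) - wz z - qp i" for i
  have B: "dwp z = 2 * (wp z - e i) * B i" if "i \<in> {1, 2, 3}" for i
    using dwp_eq_zeta_half[OF z that] by (simp add: B_def)
  have aux: "2 * w - 4 * v = b1 + b2 + b3"
    if 1: "p * (2 * w - 4 * v) = 2 * (x * y + x * t + y * t)" and b: "p = 2 * x * b1" "p = 2 * y * b2" "p = 2 * t * b3"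
      and p: "p ^ 2 = 4 * x * y * t" "p \<noteq> 0" for p w v x y t b1 b2 b3 :: complex
  proof -
    have xyt: "x \<noteq> 0" "y \<noteq> 0" "t \<noteq> 0" using b p(2) by auto
    have "x * (p * b1 - 2 * y * t) = 0" "y * (p * b2 - 2 * x * t) = 0" "t * (p * b3 - 2 * x * y) = 0"
      using b p(1) by algebra+
    hence "p * b1 = 2 * y * t" "p * b2 = 2 * x * t" "p * b3 = 2 * x * y" using xyt by auto
    hence "p * (2 * w - 4 * v - (b1 + b2 + b3)) = 0" using 1 by algebra
    thus ?thesis using p(2) by simp
  qed
  have "2 * wz (2 * z) - 4 * wz z = B 1 + B 2 + B 3"
    by (rule aux[OF 1 B B B wp_differential_equation[OF z] nz(2)]) auto
  thus ?thesis by (simp add: B_def qp_2 algebra_simps)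
qed

end

subsection \<open>The kernel function\<close>

text \<open>The coordinates are \<open>X = \<wp>(x)\<close>, \<open>Y = \<wp>(y)\<close>:
  \<open>d\<^sub>i = X - e\<^sub>i\<close>, \<open>f\<^sub>i = Y - e\<^sub>i\<close>, \<open>p = \<wp>'(x)\<close>, \<open>q = \<wp>'(y)\<close>.\<close>

lemma kernel_identity_algebra:
  fixes a0 a1 a2 a3 \<tau> d1 d2 d3 f1 f2 f3 \<delta> p q u1 u2 u3 v1 v2 v3 r s X Y :: complex
  assumes nz: "d1 \<noteq> 0" "d2 \<noteq> 0" "d3 \<noteq> 0" "f1 \<noteq> 0" "f2 \<noteq> 0" "f3 \<noteq> 0" "\<delta> \<noteq> 0"
    and f: "f1 = d1 + \<delta>" "f2 = d2 + \<delta>" "f3 = d3 + \<delta>" "Y = X + \<delta>"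
    and u: "p = 2 * d1 * u1" "p = 2 * d2 * u2" "p = 2 * d3 * u3" "p = - \<delta> * r"
    and v: "q = 2 * f1 * v1" "q = 2 * f2 * v2" "q = 2 * f3 * v3" "q = \<delta> * s"
    and pq: "p ^ 2 = 4 * d1 * d2 * d3" "q ^ 2 = 4 * f1 * f2 * f3"
    and \<tau>: "a0 = 2 * \<tau> - a1 - a2 - a3"
  shows "(a1 * u1 + a2 * u2 + a3 * u3 - \<tau> * r) ^ 2
      - ((\<tau> - a1) * v1 + (\<tau> - a2) * v2 + (\<tau> - a3) * v3 - \<tau> * s) ^ 2
    = a0 ^ 2 * X + a1 ^ 2 * (X - d2 - d3 + u1 ^ 2) + a2 ^ 2 * (X - d1 - d3 + u2 ^ 2) + a3 ^ 2 * (X - d1 - d2 + u3 ^ 2)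
      - ((\<tau> - a0) ^ 2 * Y + (\<tau> - a1) ^ 2 * (Y - f2 - f3 + v1 ^ 2) + (\<tau> - a2) ^ 2 * (Y - f1 - f3 + v2 ^ 2)
         + (\<tau> - a3) ^ 2 * (Y - f1 - f2 + v3 ^ 2))"
proof -
  have prod: "x * y = t" if "P = 2 * A * x" "P = 2 * B * y" "P ^ 2 = 4 * A * B * t" "A \<noteq> 0" "B \<noteq> 0"
    for x y t A B P :: complex
  proof -
    have "4 * A * B * (x * y - t) = 0" using that(1-3) by algebra
    thus ?thesis using that(4,5) by simp
  qed
  have prod2: "D * (x * y) = 2 * t" if "P = 2 * A * x" "P = D * y" "P ^ 2 = 4 * A * t" "A \<noteq> 0"
    for x y t A D P :: complex
  proof -
    have "2 * A * (D * (x * y) - 2 * t) = 0" using that(1-3) by algebra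
    thus ?thesis using that(4) by simp
  qed
  \<comment> \<open>Cross products of the halved logarithmic derivatives are polynomial because p^2
    = 4 d1 d2 d3; only their squares stay, and these are the shifted values \<wp>(x + \<omega>_i) up
    to linear terms.\<close>
  have uu: "u1 * u2 = d3" "u1 * u3 = d2" "u2 * u3 = d1"
    using prod[OF u(1) u(2) _ nz(1,2), of d3] prod[OF u(1) u(3) _ nz(1,3), of d2] prod[OF u(2) u(3) _ nz(2,3), of d1] pq
    by (simp_all add: mult_ac)
  have vv: "v1 * v2 = f3" "v1 * v3 = f2" "v2 * v3 = f1"
    using prod[OF v(1) v(2) _ nz(4,5), of f3] prod[OF v(1) v(3) _ nz(4,6), of f2] prod[OF v(2) v(3) _ nz(5,6), of f1] pq
    by (simp_all add: mult_ac)
  have ur: "- \<delta> * (u1 * r) = 2 * (d2 * d3)" "- \<delta> * (u2 * r) = 2 * (d1 * d3)" "- \<delta> * (u3 * r) = 2 * (d1 * d2)"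
    using prod2[OF u(1) u(4) _ nz(1), of "d2 * d3"] prod2[OF u(2) u(4) _ nz(2), of "d1 * d3"]
      prod2[OF u(3) u(4) _ nz(3), of "d1 * d2"] pq by (simp_all add: mult_ac)
  have vs: "\<delta> * (v1 * s) = 2 * (f2 * f3)" "\<delta> * (v2 * s) = 2 * (f1 * f3)" "\<delta> * (v3 * s) = 2 * (f1 * f2)"
    using prod2[OF v(1) v(4) _ nz(4), of "f2 * f3"] prod2[OF v(2) v(4) _ nz(5), of "f1 * f3"]
      prod2[OF v(3) v(4) _ nz(6), of "f1 * f2"] pq by (simp_all add: mult_ac)
  have rr: "\<delta> ^ 2 * r ^ 2 = 4 * d1 * d2 * d3" "\<delta> ^ 2 * s ^ 2 = 4 * f1 * f2 * f3"
    using u(4) v(4) pq by (simp_all flip: power_mult_distrib)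
  define A where "A = 2 * (a1 * a2 * d3 + a1 * a3 * d2 + a2 * a3 * d1)"
  define B where "B = 2 * ((\<tau> - a1) * (\<tau> - a2) * f3 + (\<tau> - a1) * (\<tau> - a3) * f2 + (\<tau> - a2) * (\<tau> - a3) * f1)"
  have sq1: "(a1 * u1 + a2 * u2 + a3 * u3 - \<tau> * r) ^ 2 = a1 ^ 2 * u1 ^ 2 + a2 ^ 2 * u2 ^ 2 + a3 ^ 2 * u3 ^ 2 + A
      - 2 * \<tau> * (a1 * (u1 * r) + a2 * (u2 * r) + a3 * (u3 * r)) + \<tau> ^ 2 * r ^ 2"
    unfolding A_def uu[symmetric] by (simp add: power2_eq_square algebra_simps)
  have sq2: "((\<tau> - a1) * v1 + (\<tau> - a2) * v2 + (\<tau> - a3) * v3 - \<tau> * s) ^ 2 =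
      (\<tau> - a1) ^ 2 * v1 ^ 2 + (\<tau> - a2) ^ 2 * v2 ^ 2 + (\<tau> - a3) ^ 2 * v3 ^ 2 + B
      - 2 * \<tau> * ((\<tau> - a1) * (v1 * s) + (\<tau> - a2) * (v2 * s) + (\<tau> - a3) * (v3 * s)) + \<tau> ^ 2 * s ^ 2"
    unfolding B_def vv[symmetric] by (simp add: power2_eq_square algebra_simps)
  \<comment> \<open>The poles at \<delta> = Y - X = 0 are cleared by \<delta>^2, after which a
    polynomial identity remains.\<close>
  have "\<delta> ^ 2 * ((A - 2 * \<tau> * (a1 * (u1 * r) + a2 * (u2 * r) + a3 * (u3 * r)) + \<tau> ^ 2 * r ^ 2)
      - (B - 2 * \<tau> * ((\<tau> - a1) * (v1 * s) + (\<tau> - a2) * (v2 * s) + (\<tau> - a3) * (v3 * s)) + \<tau> ^ 2 * s ^ 2))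
    = \<delta> ^ 2 * (A - B) + 2 * \<tau> * \<delta> * (a1 * (- \<delta> * (u1 * r)) + a2 * (- \<delta> * (u2 * r)) + a3 * (- \<delta> * (u3 * r)))
      + \<tau> ^ 2 * (\<delta> ^ 2 * r ^ 2)
      + 2 * \<tau> * \<delta> * ((\<tau> - a1) * (\<delta> * (v1 * s)) + (\<tau> - a2) * (\<delta> * (v2 * s)) + (\<tau> - a3) * (\<delta> * (v3 * s)))
      - \<tau> ^ 2 * (\<delta> ^ 2 * s ^ 2)"
    by (simp add: power2_eq_square algebra_simps)
  also have "\<dots> = \<delta> ^ 2 * (a0 ^ 2 * X + a1 ^ 2 * (X - d2 - d3) + a2 ^ 2 * (X - d1 - d3) + a3 ^ 2 * (X - d1 - d2)
      - ((\<tau> - a0) ^ 2 * Y + (\<tau> - a1) ^ 2 * (Y - f2 - f3) + (\<tau> - a2) ^ 2 * (Y - f1 - f3)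
         + (\<tau> - a3) ^ 2 * (Y - f1 - f2)))"
    unfolding ur vs rr A_def B_def f \<tau> by algebra
  finally have "(A - 2 * \<tau> * (a1 * (u1 * r) + a2 * (u2 * r) + a3 * (u3 * r)) + \<tau> ^ 2 * r ^ 2)
      - (B - 2 * \<tau> * ((\<tau> - a1) * (v1 * s) + (\<tau> - a2) * (v2 * s) + (\<tau> - a3) * (v3 * s)) + \<tau> ^ 2 * s ^ 2)
    = a0 ^ 2 * X + a1 ^ 2 * (X - d2 - d3) + a2 ^ 2 * (X - d1 - d3) + a3 ^ 2 * (X - d1 - d2)
      - ((\<tau> - a0) ^ 2 * Y + (\<tau> - a1) ^ 2 * (Y - f2 - f3) + (\<tau> - a2) ^ 2 * (Y - f1 - f3)
         + (\<tau> - a3) ^ 2 * (Y - f1 - f2))"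
    using nz(7) by simp
  thus ?thesis unfolding sq1 sq2 by (simp add: distrib_left algebra_simps)
qed

context weierstrass begin

text \<open>The squared brackets are the logarithmic derivatives of the kernel in x and in y.
  Neither square is separated, but their difference is a function of x minus a function of y; this
  separation is what lets the kernel intertwine two equations of equal energy.\<close>

lemma kernel_identity:
  fixes a :: "nat \<Rightarrow> complex"
  assumes x: "x \<notin> H" and y: "y \<notin> H" and xy: "x + y \<notin> L" "y - x \<notin> L" and \<tau>: "a 0 + a 1 + a 2 + a 3 = 2 * \<tau>"
  shows "((\<Sum>i\<le>3. a i * wz (x + hp i)) - \<tau> * (wz (x + y) - wz (y - x)) - (\<Sum>i\<le>3. a i * qp i)) ^ 2
     - ((\<Sum>i\<le>3. (\<tau> - a i) * wz (y + hp i)) - \<tau> * (wz (x + y) + wz (y - x)) - (\<Sum>i\<le>3. (\<tau> - a i) * qp i)) ^ 2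
     = (\<Sum>i\<le>3. a i ^ 2 * wp (x + hp i)) - (\<Sum>i\<le>3. (\<tau> - a i) ^ 2 * wp (y + hp i))"
proof -
  have sum4: "(\<Sum>i\<le>3. g i) = g 0 + g 1 + g 2 + g 3" for g :: "nat \<Rightarrow> complex"
    by (simp add: eval_nat_numeral)
  define U where "U i = wz (x + hp i) - wz x - qp i" for i
  define V where "V i = wz (y + hp i) - wz y - qp i" for i
  define r where "r = wz (x + y) + wz (x - y) - 2 * wz x"
  define s where "s = wz (y + x) + wz (y - x) - 2 * wz y"
  have xL: "x \<notin> L" and yL: "y \<notin> L" using x y notin_H_imp_notin_L by blast+
  have xy': "x - y \<notin> L" using xy(2) L_minus_iff[of "x - y"] by simp
  have ne: "wp y - wp x \<noteq> 0" using wp_eq_iff[OF yL xL] xy by (simp add: add.commute)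
  have u: "dwp x = 2 * (wp x - e i) * U i" if "i \<in> {1, 2, 3}" for i
    unfolding U_def by (rule dwp_eq_zeta_half[OF x that])
  have v: "dwp y = 2 * (wp y - e i) * V i" if "i \<in> {1, 2, 3}" for i
    unfolding V_def by (rule dwp_eq_zeta_half[OF y that])
  have r: "dwp x = - (wp y - wp x) * r" using dwp_eq_zeta[OF xL yL xy(1) xy'] by (simp add: r_def)
  have s: "dwp y = (wp y - wp x) * s" using dwp_eq_zeta[OF yL xL _ xy(2)] xy(1) by (simp add: s_def add.commute)
  have shift: "wp (z + hp i) = wp z - (wp z - e j) - (wp z - e k) + W ^ 2"
    if z: "z \<notin> H" and ijk: "(i, j, k) \<in> {(1, 2, 3), (2, 1, 3), (3, 1, 2)}" and W: "dwp z = 2 * (wp z - e i) * W" for z i j k W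
  proof -
    have i: "i \<in> {1, 2, 3}" using ijk by auto
    have nz: "wp z - e i \<noteq> 0" using wp_ne_e[OF z i] by simp
    have "dwp z ^ 2 = 4 * (wp z - e i) * (wp z - e j) * (wp z - e k)"
      using wp_differential_equation[OF z] ijk by (auto simp: algebra_simps)
    hence "4 * (wp z - e i) * ((wp z - e i) * W ^ 2 - (wp z - e j) * (wp z - e k)) = 0"
      using W by algebra
    hence "(wp z - e i) * W ^ 2 = (wp z - e j) * (wp z - e k)" using nz by simp
    also have "\<dots> = (wp z - e i) * (wp (z + hp i) + wp z - e j - e k)" using wp_half_shift[OF z ijk] by simp
    finally have "W ^ 2 = wp (z + hp i) + wp z - e j - e k" using nz by simp
    thus ?thesis by (simp add: algebra_simps)
  qed
  have h0: "hp 0 = 0" by (simp add: half_period_def)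
  have P: "(\<Sum>i\<le>3. a i * wz (x + hp i)) - \<tau> * (wz (x + y) - wz (y - x)) - (\<Sum>i\<le>3. a i * qp i)
      = a 1 * U 1 + a 2 * U 2 + a 3 * U 3 - \<tau> * r"
  proof -
    have a0: "a 0 = 2 * \<tau> - a 1 - a 2 - a 3" using \<tau> by algebra
    have "wz (y - x) = - wz (x - y)" using wz_odd[of "x - y"] by simp
    thus ?thesis unfolding sum4 a0 h0 qp_0 U_def r_def by (simp add: algebra_simps)
  qed
  have R: "(\<Sum>i\<le>3. (\<tau> - a i) * wz (y + hp i)) - \<tau> * (wz (x + y) + wz (y - x)) - (\<Sum>i\<le>3. (\<tau> - a i) * qp i)
      = (\<tau> - a 1) * V 1 + (\<tau> - a 2) * V 2 + (\<tau> - a 3) * V 3 - \<tau> * s"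
  proof -
    have a0: "a 0 = 2 * \<tau> - a 1 - a 2 - a 3" using \<tau> by algebra
    show ?thesis unfolding sum4 a0 h0 qp_0 V_def s_def by (simp add: algebra_simps)
  qed
  have a0: "a 0 = 2 * \<tau> - a 1 - a 2 - a 3" using \<tau> by algebra
  have "(a 1 * U 1 + a 2 * U 2 + a 3 * U 3 - \<tau> * r) ^ 2
      - ((\<tau> - a 1) * V 1 + (\<tau> - a 2) * V 2 + (\<tau> - a 3) * V 3 - \<tau> * s) ^ 2
    = a 0 ^ 2 * wp x + a 1 ^ 2 * (wp x - (wp x - e 2) - (wp x - e 3) + U 1 ^ 2) + a 2 ^ 2 * (wp x - (wp x - e 1) - (wp x - e 3) + U 2 ^ 2)
       + a 3 ^ 2 * (wp x - (wp x - e 1) - (wp x - e 2) + U 3 ^ 2)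
      - ((\<tau> - a 0) ^ 2 * wp y + (\<tau> - a 1) ^ 2 * (wp y - (wp y - e 2) - (wp y - e 3) + V 1 ^ 2)
        + (\<tau> - a 2) ^ 2 * (wp y - (wp y - e 1) - (wp y - e 3) + V 2 ^ 2)
         + (\<tau> - a 3) ^ 2 * (wp y - (wp y - e 1) - (wp y - e 2) + V 3 ^ 2))"
    by (rule kernel_identity_algebra[where \<delta> = "wp y - wp x" and p = "dwp x" and q = "dwp y",
          OF _ _ _ _ _ _ ne _ _ _ _ u u u r v v v s wp_differential_equation[OF x] wp_differential_equation[OF y] a0])
       (use wp_ne_e[OF x] wp_ne_e[OF y] in auto)
  also have "\<dots> = (\<Sum>i\<le>3. a i ^ 2 * wp (x + hp i)) - (\<Sum>i\<le>3. (\<tau> - a i) ^ 2 * wp (y + hp i))"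
    unfolding sum4 h0 using shift[OF x _ u, of 1 2 3] shift[OF x _ u, of 2 1 3] shift[OF x _ u, of 3 1 2]
      shift[OF y _ v, of 1 2 3] shift[OF y _ v, of 2 1 3] shift[OF y _ v, of 3 1 2] by simp
  finally show ?thesis unfolding P R .
qed

end

subsection \<open>Restriction to a line\<close>

lemma real_primitive:
  fixes f :: "real \<Rightarrow> complex"
  assumes "continuous_on UNIV f"
  obtains F where "\<And>s. (F has_vector_derivative f s) (at s)"
proof
  define F where "F = (\<lambda>s. integral {0..s} f - integral {s..0} f)"
  fix s :: real
  define N where "N = \<bar>s\<bar> + 1"
  have c: "continuous_on {a..b} f" for a b using assms continuous_on_subset by blast
  have int: "f integrable_on {a..b}" for a b by (rule integrable_continuous_real[OF c])
  have F: "F r = integral {- N..r} f - integral {- N..0} f" if "r \<in> {- N<..<N}" for r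
  proof (cases "0 \<le> r")
    case True
    have "integral {- N..0} f + integral {0..r} f = integral {- N..r} f"
      by (rule Henstock_Kurzweil_Integration.integral_combine) (use True int in \<open>auto simp: N_def\<close>)
    moreover have "integral {r..0} f = 0" using True by (cases "r = 0") auto
    ultimately show ?thesis by (simp add: F_def algebra_simps)
  next
    case False
    have "integral {- N..r} f + integral {r..0} f = integral {- N..0} f"
      by (rule Henstock_Kurzweil_Integration.integral_combine) (use False that int in auto)
    moreover have "integral {0..r} f = 0" using False by auto
    ultimately show ?thesis by (simp add: F_def algebra_simps)
  qed
  have s: "s \<in> {- N<..<N}" by (auto simp: N_def)
  have "((\<lambda>u. integral {- N..u} f) has_vector_derivative f s) (at s within {- N..N})"
    by (rule integral_has_vector_derivative[OF c]) (use s in auto)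
  hence "((\<lambda>u. integral {- N..u} f) has_vector_derivative f s) (at s within {- N<..<N})"
    by (rule has_vector_derivative_within_subset) auto
  hence "((\<lambda>u. integral {- N..u} f) has_vector_derivative f s) (at s)"
    by (simp only: at_within_open[OF s open_greaterThanLessThan])
  hence "((\<lambda>u. integral {- N..u} f - integral {- N..0} f) has_vector_derivative f s - 0) (at s)"
    by (intro has_vector_derivative_diff has_vector_derivative_const)
  hence "((\<lambda>u. integral {- N..u} f - integral {- N..0} f) has_vector_derivative f s) (at s)" by simp
  thus "(F has_vector_derivative f s) (at s)"
    by (rule has_vector_derivative_transform_within_open[OF _ open_greaterThanLessThan s]) (use F in auto)
qed

lemma has_vector_derivative_along_line:
  fixes f :: "complex \<Rightarrow> complex"
  assumes "(f has_field_derivative D) (at (a + of_real s * b))"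
  shows "((\<lambda>s. f (a + of_real s * b)) has_vector_derivative b * D) (at s within A)"
proof -
  have "((\<lambda>s. a + of_real s * b) has_vector_derivative b) (at s within A)"
    by (auto intro!: derivative_eq_intros)
  from field_vector_diff_chain_within[OF this has_field_derivative_at_within[OF assms]]
  show ?thesis by (simp add: o_def)
qed

lemma has_vector_derivative_compose_linear:
  fixes f :: "real \<Rightarrow> complex"
  assumes "(f has_vector_derivative D) (at (r * s + t))"
  shows "((\<lambda>s. f (r * s + t)) has_vector_derivative of_real r * D) (at s within A)"
proof -
  have "((\<lambda>s. r * s + t) has_vector_derivative r) (at s within A)"
    by (auto intro!: derivative_eq_intros simp flip: has_real_derivative_iff_has_vector_derivative)
  from vector_diff_chain_within[OF this has_vector_derivative_at_within[OF assms]]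
  show ?thesis by (simp add: o_def scaleR_conv_of_real)
qed

lemma constant_if_vector_derivative_zero:
  fixes f :: "real \<Rightarrow> complex"
  assumes "\<And>s. (f has_vector_derivative 0) (at s)" shows "f a = f b"
proof -
  obtain c where "\<And>x. x \<in> UNIV \<Longrightarrow> f x = c"
    by (rule has_vector_derivative_zero_constant[OF convex_UNIV]) (use assms in auto)
  thus ?thesis by simp
qed

text \<open>The whole line avoids the half-lattice, so that branches of log \<sigma> exist on all of
  the reals and a shift by the period becomes s -> s + 1. For a segment of length one period the
  condition follows by periodicity.\<close>

locale weierstrass_line = weierstrass +
  fixes x\<^sub>0 :: complex and k :: nat
  assumes k: "k \<in> {1, 3}" and line: "\<And>s::real. x\<^sub>0 + of_real s * (2 * hp k) \<notin> H"
begin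

definition p where "p = 2 * hp k"
definition X where "X s = x\<^sub>0 + of_real s * p" for s :: real

lemma X_notin_H: "X s \<notin> H" using line by (simp add: X_def p_def)

lemma X_plus_X: "X s + X t = 2 * X ((s + t) / 2)"
  by (simp add: X_def algebra_simps)

lemma X_plus_X_notin_L: "X s + X t \<notin> L"
  using X_notin_H[of "(s + t) / 2"] unfolding X_plus_X H_iff .

lemma X_hp_notin_L: "X s + hp i \<notin> L"
  using X_notin_H[of s] notin_H_imp_notin_L by (metis H_add_hp(1))

lemma p_in_L: "p \<in> L" by (simp add: p_def)

lemma real_multiple_p_in_L: assumes "of_real t * p \<in> L" shows "t \<in> \<int>"
proof -
  from assms obtain m n where mn: "of_real t * p = of_int m * (2 * \<omega>\<^sub>1) + of_int n * (2 * \<omega>\<^sub>3)"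
    by (auto simp: period_lattice_def)
  consider "k = 1" | "k = 3" using k by blast
  thus ?thesis
  proof cases
    case 1
    have "of_real (2 * t - 2 * m) * \<omega>\<^sub>1 + of_real (- 2 * n) * \<omega>\<^sub>3 = 0"
      using mn[unfolded p_def, unfolded 1] by (simp add: half_period_def algebra_simps)
    from real_combination_eq_0(1)[OF this] show ?thesis by simp
  next
    case 2
    have "of_real (- 2 * m) * \<omega>\<^sub>1 + of_real (2 * t - 2 * n) * \<omega>\<^sub>3 = 0"
      using mn[unfolded p_def, unfolded 2] by (simp add: half_period_def algebra_simps)
    from real_combination_eq_0(2)[OF this] show ?thesis by simp
  qed
qed

lemma tp_notin_L: "0 < t \<Longrightarrow> t < 1 \<Longrightarrow> of_real t * p \<notin> L"
  using real_multiple_p_in_L[of t] by (auto elim!: Ints_cases)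

lemma p_nonzero: "p \<noteq> 0"
  using hp_notin_L[of k] k by (auto simp: p_def)

lemma wz_p: "z \<notin> L \<Longrightarrow> wz (z + p) = wz z + 2 * qp k"
  using wz_quasi_periodic[of z k] k by (auto simp: p_def)

lemma wz_X_derivative:
  "((\<lambda>s. wz (X s + hp i)) has_vector_derivative p * - wp (X s + hp i)) (at s within A)"
proof -
  have "((\<lambda>s. wz ((x\<^sub>0 + hp i) + of_real s * p)) has_vector_derivative p * - wp ((x\<^sub>0 + hp i) + of_real s * p)) (at s within A)"
    by (rule has_vector_derivative_along_line, rule wz_derivative)
       (use X_hp_notin_L[of s i] in \<open>simp add: X_def algebra_simps\<close>)
  thus ?thesis by (simp add: X_def algebra_simps)
qed

lemma wz_2X_derivative:
  "((\<lambda>r. wz (2 * x\<^sub>0 + of_real r * p)) has_vector_derivative p * - wp (2 * x\<^sub>0 + of_real r * p)) (at r within A)"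
proof (rule has_vector_derivative_along_line, rule wz_derivative)
  show "2 * x\<^sub>0 + of_real r * p \<notin> L"
    using X_plus_X_notin_L[of "r / 2" "r / 2"] by (simp add: X_def algebra_simps)
qed

lemma wp_X_derivative:
  "((\<lambda>s. wp (X s + hp i)) has_vector_derivative p * dwp (X s + hp i)) (at s within A)"
proof -
  have "((\<lambda>s. wp ((x\<^sub>0 + hp i) + of_real s * p)) has_vector_derivative p * dwp ((x\<^sub>0 + hp i) + of_real s * p)) (at s within A)"
    by (rule has_vector_derivative_along_line, rule wp_derivative)
       (use X_hp_notin_L[of s i] in \<open>simp add: X_def algebra_simps\<close>)
  thus ?thesis by (simp add: X_def algebra_simps)
qed

lemma X_continuous:
  "continuous_on UNIV (\<lambda>s. wz (X s + hp i))" "continuous_on UNIV (\<lambda>s. wp (X s + hp i))"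
  "continuous_on UNIV (\<lambda>r. wz (2 * x\<^sub>0 + of_real r * p))" "continuous_on UNIV (\<lambda>r. wp (2 * x\<^sub>0 + of_real r * p))"
proof -
  show "continuous_on UNIV (\<lambda>s. wz (X s + hp i))" "continuous_on UNIV (\<lambda>s. wp (X s + hp i))"
    "continuous_on UNIV (\<lambda>r. wz (2 * x\<^sub>0 + of_real r * p))"
    by (rule continuous_on_vector_derivative; rule wz_X_derivative wp_X_derivative wz_2X_derivative)+
  have "2 * x\<^sub>0 + of_real r * p \<notin> L" for r
    using X_plus_X_notin_L[of "r / 2" "r / 2"] by (simp add: X_def algebra_simps)
  thus "continuous_on UNIV (\<lambda>r. wp (2 * x\<^sub>0 + of_real r * p))"
    by (intro continuous_on_compose2[OF holomorphic_on_imp_continuous_on[OF wp_holomorphic]] continuous_intros) auto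
qed

end

lemma sum_le_3: "(\<Sum>i\<le>(3::nat). g i) = g 0 + g 1 + g 2 + (g 3 :: complex)"
  by (simp add: eval_nat_numeral)

text \<open>Here - \<tau> = j - 1/2 > -1, so \<sigma>(t p)^(-\<tau>) is integrable at both ends of
  the period. The sum condition makes the quasi-periods of the \<zeta>-terms cancel, so that the
  kernel is periodic along the line.\<close>

locale weierstrass_kernel = weierstrass_line +
  fixes a :: "nat \<Rightarrow> complex" and \<tau> :: complex and j :: nat
  assumes \<tau>_eq: "\<tau> = 1 / 2 - of_nat j" and sum_a: "(\<Sum>i\<le>3. a i) = 2 * \<tau>"
begin

definition b where "b i = \<tau> - a i"
definition wzX where "wzX i s = wz (X s + hp i)"
definition wpX where "wpX i s = wp (X s + hp i)"
definition wz2 where "wz2 r = wz (2 * x\<^sub>0 + of_real r * p)"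
definition wp2 where "wp2 r = wp (2 * x\<^sub>0 + of_real r * p)"

lemmas X_cont = X_continuous[folded wzX_def wpX_def wz2_def wp2_def]
lemmas X_cont' [continuous_intros] = X_cont[THEN continuous_on_compose2, OF _ subset_UNIV]

lemma X_deriv:
  "(wzX i has_vector_derivative p * - wpX i s) (at s within A)"
  "(wz2 has_vector_derivative p * - wp2 r) (at r within A)"
  using wz_X_derivative wz_2X_derivative by (simp_all add: wzX_def[abs_def] wpX_def wz2_def[abs_def] wp2_def)

definition lam where "lam i = (SOME F. \<forall>s. (F has_vector_derivative p * wzX i s) (at s))"
definition lam2 where "lam2 = (SOME F. \<forall>s. (F has_vector_derivative p * wz2 s) (at s))"

lemma lam_deriv: "(lam i has_vector_derivative p * wzX i s) (at s)"
  and lam2_deriv: "(lam2 has_vector_derivative p * wz2 s) (at s)"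
proof -
  have "\<exists>F. \<forall>s. (F has_vector_derivative p * wzX i s) (at s)"
    by (rule real_primitive[of "\<lambda>s. p * wzX i s"]) (auto intro!: continuous_intros)
  thus "(lam i has_vector_derivative p * wzX i s) (at s)"
    unfolding lam_def by (rule someI2_ex) auto
  have "\<exists>F. \<forall>s. (F has_vector_derivative p * wz2 s) (at s)"
    by (rule real_primitive[of "\<lambda>s. p * wz2 s"]) (auto intro!: continuous_intros)
  thus "(lam2 has_vector_derivative p * wz2 s) (at s)"
    unfolding lam2_def by (rule someI2_ex) auto
qed

lemma lam_cont: "continuous_on UNIV (lam i)" "continuous_on UNIV lam2"
  by (rule continuous_on_vector_derivative; rule has_vector_derivative_at_within; rule lam_deriv lam2_deriv)+

lemmas lam_cont' [continuous_intros] = lam_cont[THEN continuous_on_compose2, OF _ subset_UNIV]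

text \<open>With \<open>x = X s\<close> and \<open>y = x + t p\<close>, the kernel is \<open>exp (g s t)\<close> times \<open>\<sigma>(t p)\<^bsup>-\<tau>\<^esup>\<close>, where
  \<open>exp (lam i s)\<close> stands for \<open>\<sigma>(x + \<omega>\<^sub>i)\<close> and \<open>exp (lam2 (2 * s + t))\<close> for \<open>\<sigma>(x + y)\<close>. The last term of \<open>g\<close> is the
  exponential correction without which \<open>kernel_pde\<close> fails.\<close>

definition g where
  "g s t = (\<Sum>i\<le>3. a i * lam i s) + (\<Sum>i\<le>3. b i * lam i (s + t)) - \<tau> * lam2 (2 * s + t)
     - of_real t * (p * (\<Sum>i\<le>3. b i * qp i))"
text \<open>With t fixed, s moves x and y together: up to the factor p, \<open>Dk\<close> is the
  derivative of the logarithm of the kernel in the diagonal direction and is free of \<sigma>(y -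
  x). \<open>Rk\<close> is the derivative in t without the singular part - \<tau> \<zeta>(t
  p).\<close>

definition Dk where
  "Dk s t = (\<Sum>i\<le>3. a i * wzX i s) + (\<Sum>i\<le>3. b i * wzX i (s + t)) - 2 * \<tau> * wz2 (2 * s + t)"
definition Rk where
  "Rk s t = (\<Sum>i\<le>3. b i * wzX i (s + t)) - \<tau> * wz2 (2 * s + t) - (\<Sum>i\<le>3. b i * qp i)"
definition Dks where
  "Dks s t = - (\<Sum>i\<le>3. a i * wpX i s) - (\<Sum>i\<le>3. b i * wpX i (s + t)) + 4 * \<tau> * wp2 (2 * s + t)"
definition Dkt where
  "Dkt s t = - (\<Sum>i\<le>3. b i * wpX i (s + t)) + 2 * \<tau> * wp2 (2 * s + t)"

lemma shift_deriv:
  fixes h :: "real \<Rightarrow> complex"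
  assumes "\<And>r. (h has_vector_derivative h' r) (at r)"
  shows "((\<lambda>s. h (s + t)) has_vector_derivative h' (s + t)) (at s within A)"
    and "((\<lambda>t. h (s + t)) has_vector_derivative h' (s + t)) (at t within B)"
    and "((\<lambda>s. h (2 * s + t)) has_vector_derivative 2 * h' (2 * s + t)) (at s within A)"
    and "((\<lambda>t. h (2 * s + t)) has_vector_derivative h' (2 * s + t)) (at t within B)"
  using has_vector_derivative_compose_linear[of h "h' (s + t)" 1 s t] has_vector_derivative_compose_linear[of h "h' (s + t)" 1 t s]
    has_vector_derivative_compose_linear[of h "h' (2 * s + t)" 2 s t] has_vector_derivative_compose_linear[of h "h' (2 * s + t)" 1 t "2 * s"]
    assms by (simp_all add: add.commute)

lemmas deriv_intros = has_vector_derivative_add has_vector_derivative_diff has_vector_derivative_sum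
  has_vector_derivative_mult_right has_vector_derivative_const

lemma g_deriv_s: "((\<lambda>s. g s t) has_vector_derivative p * Dk s t) (at s within A)"
proof -
  have "((\<lambda>s. g s t) has_vector_derivative (\<Sum>i\<le>3. a i * (p * wzX i s)) + (\<Sum>i\<le>3. b i * (p * wzX i (s + t)))
     - \<tau> * (2 * (p * wz2 (2 * s + t))) - 0) (at s within A)"
    unfolding g_def
    by (intro deriv_intros shift_deriv lam_deriv lam2_deriv has_vector_derivative_at_within[OF lam_deriv])
  thus ?thesis by (rule has_vector_derivative_eq_rhs) (simp add: Dk_def algebra_simps sum_distrib_left)
qed

lemma g_deriv_t: "((\<lambda>t. g s t) has_vector_derivative p * Rk s t) (at t within A)"
proof -
  have 1: "((\<lambda>t. of_real t * (p * (\<Sum>i\<le>3. b i * qp i))) has_vector_derivative p * (\<Sum>i\<le>3. b i * qp i)) (at t within A)"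
    by (auto intro!: derivative_eq_intros)
  have "((\<lambda>t. g s t) has_vector_derivative 0 + (\<Sum>i\<le>3. b i * (p * wzX i (s + t)))
     - \<tau> * (p * wz2 (2 * s + t)) - p * (\<Sum>i\<le>3. b i * qp i)) (at t within A)"
    unfolding g_def
    by (intro deriv_intros shift_deriv lam_deriv lam2_deriv 1)
  thus ?thesis by (rule has_vector_derivative_eq_rhs) (simp add: Rk_def algebra_simps sum_distrib_left)
qed

lemma Dk_deriv_s: "((\<lambda>s. Dk s t) has_vector_derivative p * Dks s t) (at s within A)"
proof -
  have "((\<lambda>s. Dk s t) has_vector_derivative (\<Sum>i\<le>3. a i * (p * - wpX i s)) + (\<Sum>i\<le>3. b i * (p * - wpX i (s + t)))
     - 2 * \<tau> * (2 * (p * - wp2 (2 * s + t)))) (at s within A)"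
    unfolding Dk_def by (intro deriv_intros shift_deriv X_deriv)
  thus ?thesis by (rule has_vector_derivative_eq_rhs) (simp add: Dks_def algebra_simps sum_distrib_left sum_negf)
qed

lemma Dk_deriv_t: "((\<lambda>t. Dk s t) has_vector_derivative p * Dkt s t) (at t within A)"
proof -
  have "((\<lambda>t. Dk s t) has_vector_derivative 0 + (\<Sum>i\<le>3. b i * (p * - wpX i (s + t)))
     - 2 * \<tau> * (p * - wp2 (2 * s + t))) (at t within A)"
    unfolding Dk_def by (intro deriv_intros shift_deriv X_deriv)
  thus ?thesis by (rule has_vector_derivative_eq_rhs) (simp add: Dkt_def algebra_simps sum_distrib_left sum_negf)
qed

text \<open>For x = X s and y = X (s + t) the operator \<partial>x^2 - \<partial>y^2 becomes
  \<partial>s^2 - 2 \<partial>s \<partial>t up to the factor p^2; the left side is the result of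
  applying it to the kernel, divided by the kernel. With D = P + Q one has D^2 - 2 D Q = P^2 - Q^2,
  the difference computed by \<open>kernel_identity\<close>; the derivative terms turn a^2 into a (a
  - 1). Since t is differentiated only once, one integration by parts will do.\<close>

lemma kernel_pde:
  assumes t: "0 < t" "t < 1"
  shows "Dks s t + Dk s t ^ 2 - 2 * Dkt s t - 2 * Dk s t * (Rk s t - \<tau> * wz (of_real t * p))
    = (\<Sum>i\<le>3. a i * (a i - 1) * wpX i s) - (\<Sum>i\<le>3. b i * (b i - 1) * wpX i (s + t))"
proof -
  have yx: "X (s + t) - X s = of_real t * p" by (simp add: X_def algebra_simps)
  have xy: "X s + X (s + t) = 2 * x\<^sub>0 + of_real (2 * s + t) * p" by (simp add: X_def algebra_simps)
  have \<tau>': "a 0 + a 1 + a 2 + a 3 = 2 * \<tau>" using sum_a by (simp add: sum_le_3)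
  have "Dk s t = (\<Sum>i\<le>3. a i * wzX i s) - \<tau> * (wz2 (2 * s + t) - wz (of_real t * p)) - (\<Sum>i\<le>3. a i * qp i)
      + (Rk s t - \<tau> * wz (of_real t * p))"
    unfolding Dk_def Rk_def sum_le_3 b_def qp_2 qp_0 by (simp add: algebra_simps)
  moreover have "Rk s t - \<tau> * wz (of_real t * p) = (\<Sum>i\<le>3. (\<tau> - a i) * wzX i (s + t))
       - \<tau> * (wz2 (2 * s + t) + wz (of_real t * p)) - (\<Sum>i\<le>3. (\<tau> - a i) * qp i)"
    unfolding Rk_def b_def by (simp add: algebra_simps)
  moreover have "((\<Sum>i\<le>3. a i * wzX i s) - \<tau> * (wz2 (2 * s + t) - wz (of_real t * p)) - (\<Sum>i\<le>3. a i * qp i)) ^ 2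
     - ((\<Sum>i\<le>3. (\<tau> - a i) * wzX i (s + t)) - \<tau> * (wz2 (2 * s + t) + wz (of_real t * p)) - (\<Sum>i\<le>3. (\<tau> - a i) * qp i)) ^ 2
     = (\<Sum>i\<le>3. a i ^ 2 * wpX i s) - (\<Sum>i\<le>3. (\<tau> - a i) ^ 2 * wpX i (s + t))"
    using kernel_identity[OF X_notin_H X_notin_H X_plus_X_notin_L, of "s + t" s a \<tau>] \<tau>' tp_notin_L[OF t]
    by (simp only: yx xy wzX_def wpX_def wz2_def simp_thms True_implies_equals)
  moreover have "Dks s t - 2 * Dkt s t = (\<Sum>i\<le>3. b i * wpX i (s + t)) - (\<Sum>i\<le>3. a i * wpX i s)"
    by (simp add: Dks_def Dkt_def algebra_simps)
  moreover have "ks + D ^ 2 - 2 * kt - 2 * D * Q = S + T"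
    if "D = P + Q" "Q = R" "P ^ 2 - R ^ 2 = T" "ks - 2 * kt = S" for D P Q R S T ks kt :: complex
    using that by algebra
  ultimately have 1: "Dks s t + Dk s t ^ 2 - 2 * Dkt s t - 2 * Dk s t * (Rk s t - \<tau> * wz (of_real t * p))
     = ((\<Sum>i\<le>3. b i * wpX i (s + t)) - (\<Sum>i\<le>3. a i * wpX i s)) +
       ((\<Sum>i\<le>3. a i ^ 2 * wpX i s) - (\<Sum>i\<le>3. (\<tau> - a i) ^ 2 * wpX i (s + t)))"
    by blast
  show ?thesis unfolding 1 sum_le_3 b_def by (simp add: power2_eq_square algebra_simps)
qed

lemma wzX_add_1: "wzX i (s + 1) = wzX i s + 2 * qp k"
  using wz_p[OF X_hp_notin_L, of s i] by (simp add: wzX_def X_def algebra_simps)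

lemma wz2_add_1: "wz2 (r + 1) = wz2 r + 2 * qp k"
proof -
  have "2 * x\<^sub>0 + of_real r * p \<notin> L"
    using X_plus_X_notin_L[of "r / 2" "r / 2"] by (simp add: X_def algebra_simps)
  from wz_p[OF this] show ?thesis by (simp add: wz2_def algebra_simps)
qed

lemma sum_b: "(\<Sum>i\<le>3. b i) = 2 * \<tau>"
  using sum_a by (simp add: b_def sum_subtractf)

text \<open>At t = 0 the points x and y coincide, and as a_i + b_i = \<tau> the duplication formula
  cancels everything. Together with \<open>Dk_1\<close> this removes the boundary terms in the
  integration by parts.\<close>

lemma Dk_0: "Dk s 0 = 0"
proof -
  have "2 * wz2 (2 * s) = (\<Sum>i\<le>3. wzX i s)"
    using wz_duplication[OF X_notin_H, of s]
    by (simp add: sum_le_3 wzX_def wz2_def X_def half_period_def algebra_simps)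
  hence "Dk s 0 = (\<Sum>i\<le>3. a i * wzX i s) + (\<Sum>i\<le>3. b i * wzX i s) - \<tau> * (\<Sum>i\<le>3. wzX i s)"
    by (simp add: Dk_def algebra_simps)
  thus ?thesis by (simp add: b_def sum_distrib_left sum.distrib[symmetric] left_diff_distrib sum_subtractf)
qed

lemma Dk_1: "Dk s 1 = 0"
proof -
  have "Dk s 1 = Dk s 0 + 2 * qp k * (\<Sum>i\<le>3. b i) - 4 * \<tau> * qp k"
    using wz2_add_1[of "2 * s"]
    by (simp add: Dk_def wzX_add_1 distrib_left sum.distrib sum_distrib_left sum_distrib_right mult_ac)
  thus ?thesis by (simp add: Dk_0 sum_b)
qed

lemma Dk_periodic: "Dk (s + 1) t = Dk s t"
proof -
  have "wzX i (s + 1 + t) = wzX i (s + t) + 2 * qp k" for i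
    using wzX_add_1[of i "s + t"] by (simp add: algebra_simps)
  moreover have "wz2 (2 * (s + 1) + t) = wz2 (2 * s + t) + 4 * qp k"
    using wz2_add_1[of "2 * s + t"] wz2_add_1[of "2 * s + t + 1"] by (simp add: algebra_simps)
  ultimately have "Dk (s + 1) t = Dk s t + 2 * qp k * (\<Sum>i\<le>3. a i) + 2 * qp k * (\<Sum>i\<le>3. b i) - 8 * \<tau> * qp k"
    by (simp add: Dk_def wzX_add_1 distrib_left sum.distrib sum_distrib_left sum_distrib_right mult_ac)
  thus ?thesis by (simp add: sum_a sum_b)
qed

lemma Rk_periodic: "Rk (s + 1) t = Rk s t"
proof -
  have "wzX i (s + 1 + t) = wzX i (s + t) + 2 * qp k" for i
    using wzX_add_1[of i "s + t"] by (simp add: algebra_simps)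
  moreover have "wz2 (2 * (s + 1) + t) = wz2 (2 * s + t) + 4 * qp k"
    using wz2_add_1[of "2 * s + t"] wz2_add_1[of "2 * s + t + 1"] by (simp add: algebra_simps)
  ultimately have "Rk (s + 1) t = Rk s t + 2 * qp k * (\<Sum>i\<le>3. b i) - 4 * \<tau> * qp k"
    by (simp add: Rk_def distrib_left sum.distrib sum_distrib_left sum_distrib_right mult_ac)
  thus ?thesis by (simp add: sum_b)
qed

text \<open>The functions \<open>lam\<close> are known through their derivatives only, so
  periodicity has to be integrated: at t = 0 the function g is constant in s, and from there the
  periodic t-derivative takes over.\<close>

lemma g_periodic: "g (s + 1) t = g s t"
proof -
  have "((\<lambda>s. g s 0) has_vector_derivative 0) (at s)" for s
    using g_deriv_s[of 0 s UNIV] by (simp add: Dk_0)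
  hence 0: "g (s + 1) 0 = g s 0" by (rule constant_if_vector_derivative_zero)
  have "((\<lambda>t. g (s + 1) t - g s t) has_vector_derivative 0) (at t)" for t
    using has_vector_derivative_diff[OF g_deriv_t[of "s + 1" t UNIV] g_deriv_t[of s t UNIV]] by (simp add: Rk_periodic)
  hence "g (s + 1) t - g s t = g (s + 1) 0 - g s 0" by (rule constant_if_vector_derivative_zero)
  thus ?thesis using 0 by simp
qed

text \<open>\<open>Zw t\<close> is \<open>p \<zeta>(t p)\<close> without its poles at \<open>t = 0, 1\<close>, so that \<open>(t (1 - t))\<^bsup>-\<tau>\<^esup> \<rho> t\<close> is a branch
  of \<open>\<sigma>(t p)\<^bsup>-\<tau>\<^esup>\<close>, up to a constant factor.\<close>

definition Zw where
  "Zw t = (if t \<le> 1 / 2 then p * wz_reg (of_real t * p) - 1 / (of_real t - 1)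
     else p * wz_reg (of_real (t - 1) * p) + 2 * p * qp k - 1 / of_real t)" for t :: real

lemma Zw_eq:
  assumes "0 < t" "t < 1" shows "Zw t = p * wz (of_real t * p) - 1 / of_real t - 1 / (of_real t - 1)"
proof -
  have t0: "of_real t \<noteq> (0::complex)" "of_real t - 1 \<noteq> (0::complex)" "of_real (t - 1) \<noteq> (0::complex)" using assms by auto
  have "wz (of_real t * p) = wz (of_real (t - 1) * p) + 2 * qp k"
  proof -
    have "of_real (t - 1) * p = of_real t * p - p" by (simp add: algebra_simps)
    moreover have "of_real t * p - p \<notin> L" using tp_notin_L[OF assms] p_in_L by simp
    ultimately show ?thesis using wz_p[of "of_real t * p - p"] by simp
  qed
  hence "p * wz (of_real t * p) = p * (1 / (of_real (t - 1) * p)) + p * wz_reg (of_real (t - 1) * p) + 2 * p * qp k"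
    by (simp add: wz_eq distrib_left mult_ac)
  also have "p * (1 / (of_real (t - 1) * p)) = 1 / (of_real t - 1)" using p_nonzero t0 by simp
  finally have 2: "p * wz (of_real t * p) = 1 / (of_real t - 1) + p * wz_reg (of_real (t - 1) * p) + 2 * p * qp k" .
  have 1: "p * wz (of_real t * p) = 1 / of_real t + p * wz_reg (of_real t * p)"
    using p_nonzero t0 by (simp add: wz_eq distrib_left)
  show ?thesis
    by (cases "t \<le> 1 / 2") (simp_all only: Zw_def if_True if_False, simp_all add: 1, insert 1 2, simp add: algebra_simps)
qed

lemma Zw_continuous: "continuous_on {0..1} Zw"
proof -
  have wr: "continuous_on (- (L - {0})) wz_reg"
    using wz_reg_wp_reg_derivative(1) by (auto intro!: continuous_at_imp_continuous_on DERIV_isCont)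
  have ints: "of_real t * p \<notin> L - {0}" if "\<bar>t\<bar> < 1" for t :: real
    using real_multiple_p_in_L[of t] that by (auto elim!: Ints_cases)
  have 1: "continuous_on {0..1/2} (\<lambda>t::real. p * wz_reg (of_real t * p) - 1 / (of_real t - 1))"
    by (intro continuous_intros continuous_on_compose2[OF wr]) (use ints in auto)
  have 2: "continuous_on {1/2..1} (\<lambda>t::real. p * wz_reg (of_real (t - 1) * p) + 2 * p * qp k - 1 / of_real t)"
    by (intro continuous_intros continuous_on_compose2[OF wr]) (use ints[of "_ - 1"] in auto)
  \<comment> \<open>Both branches are p \<zeta>(t p) minus its poles; they match at t = 1/2 because
    p \<eta>_k = p \<zeta>(p / 2) = 2 + p \<open>wz_reg\<close> (p / 2).\<close>
  have half: "p * wz_reg (of_real (1/2) * p) - 1 / (of_real (1/2) - 1)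
      = p * wz_reg (of_real (1/2 - 1) * p) + 2 * p * qp k - 1 / of_real (1/2)"
  proof -
    have arg: "of_real (1/2) * p = p / 2" "of_real (1/2 - 1) * p = - (p / 2)" by simp_all
    have q: "p * qp k = 2 + p * wz_reg (p / 2)"
      using p_nonzero by (simp add: quasi_period_def p_def wz_eq distrib_left)
    have "wz_reg (- (p / 2)) = - wz_reg (p / 2)"
      using wz_odd[of "p / 2"] by (simp add: wz_eq)
    moreover have "1 / (of_real (1/2) - 1 :: complex) = - 2" "1 / of_real (1/2) = (2::complex)" by simp_all
    ultimately show ?thesis unfolding arg using q by (simp add: mult.assoc)
  qed
  have half': "p * wz_reg (of_real t * p) - 1 / (of_real t - 1)
      = p * wz_reg (of_real (t - 1) * p) + 2 * p * qp k - 1 / of_real t"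
    if "t \<in> {0..1/2} \<and> \<not> t \<le> 1/2 \<or> t \<in> {1/2..1} \<and> t \<le> 1/2" for t :: real
  proof -
    have "t = 1/2" using that by auto
    thus ?thesis using half by (simp only:)
  qed
  have "continuous_on ({0..1/2} \<union> {1/2..1}) Zw"
    unfolding Zw_def
    by (rule continuous_on_cases[OF _ _ 1 2]) (auto simp del: of_real_diff intro: half')
  moreover have "{0..1/2} \<union> {1/2..1} = {0..1::real}" by auto
  ultimately show ?thesis by simp
qed

definition \<rho> where "\<rho> t = exp (- \<tau> * integral {0..t} Zw)" for t :: real

lemma \<rho>_continuous: "continuous_on {0..1} \<rho>"
  unfolding \<rho>_def
  by (intro continuous_intros indefinite_integral_continuous_1 integrable_continuous_real Zw_continuous)

lemmas \<rho>_continuous' [continuous_intros] = continuous_on_compose2[OF \<rho>_continuous]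

lemma \<rho>_deriv:
  assumes t: "0 < t" "t < 1" shows "(\<rho> has_vector_derivative - \<tau> * Zw t * \<rho> t) (at t)"
proof -
  have "((\<lambda>u. integral {0..u} Zw) has_vector_derivative Zw t) (at t within {0..1})"
    by (rule integral_has_vector_derivative[OF Zw_continuous]) (use t in auto)
  hence "((\<lambda>u. integral {0..u} Zw) has_vector_derivative Zw t) (at t within {0<..<1})"
    by (rule has_vector_derivative_within_subset) auto
  moreover have "at t within {0<..<1} = at t" using t by (intro at_within_open) auto
  ultimately have "((\<lambda>u. - \<tau> * integral {0..u} Zw) has_vector_derivative - \<tau> * Zw t) (at t)"
    by (intro has_vector_derivative_mult_right) simp
  from field_vector_diff_chain_at[OF this DERIV_exp]
  show ?thesis by (simp add: \<rho>_def[abs_def] o_def mult_ac)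
qed

end

subsection \<open>The integral transform\<close>

lemma has_vector_derivative_quotient_tendsto:
  fixes f :: "real \<Rightarrow> complex"
  assumes "(f has_vector_derivative D) (at c within A)"
  shows "((\<lambda>t. (f t - f c) / of_real (t - c)) \<longlongrightarrow> D) (at c within A)"
proof -
  have "((\<lambda>t. (f t - f c - (t - c) *\<^sub>R D) /\<^sub>R norm (t - c)) \<longlongrightarrow> 0) (at c within A)"
    using assms by (simp add: has_vector_derivative_def has_derivative_within divide_inverse diff_diff_eq)
  hence "((\<lambda>t. norm ((f t - f c - (t - c) *\<^sub>R D) /\<^sub>R norm (t - c))) \<longlongrightarrow> 0) (at c within A)"
    by (rule tendsto_norm_zero)
  moreover have "\<forall>\<^sub>F t in at c within A. norm ((f t - f c - (t - c) *\<^sub>R D) /\<^sub>R norm (t - c))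
      = norm ((f t - f c) / of_real (t - c) - D)"
    unfolding eventually_at_filter
  proof (intro always_eventually allI impI)
    fix t :: real assume t: "t \<noteq> c"
    hence "(f t - f c) / of_real (t - c) - D = (f t - f c - (t - c) *\<^sub>R D) / of_real (t - c)"
      by (simp add: scaleR_conv_of_real divide_simps del: of_real_diff)
    thus "norm ((f t - f c - (t - c) *\<^sub>R D) /\<^sub>R norm (t - c)) = norm ((f t - f c) / of_real (t - c) - D)"
      by (simp add: norm_mult norm_inverse divide_inverse mult.commute del: of_real_diff)
  qed
  ultimately have "((\<lambda>t. norm ((f t - f c) / of_real (t - c) - D)) \<longlongrightarrow> 0) (at c within A)"
    by (rule Lim_transform_eventually)
  hence "((\<lambda>t. (f t - f c) / of_real (t - c) - D) \<longlongrightarrow> 0) (at c within A)" by (rule tendsto_norm_zero_cancel)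
  thus ?thesis by (rule LIM_zero_cancel)
qed

context weierstrass_kernel begin

definition Va where "Va s = p ^ 2 * (\<Sum>i\<le>3. a i * (a i - 1) * wpX i s)"
definition Vb where "Vb s = p ^ 2 * (\<Sum>i\<le>3. b i * (b i - 1) * wpX i s)"

text \<open>The weight \<open>(t (1 - t))\<^bsup>-\<tau>\<^esup> \<rho> t dt\<close> after the substitution \<open>t = sin\<^sup>2 \<theta>\<close>, regular because
  \<open>- \<tau> = j - 1 / 2\<close>.\<close>

definition om :: "real \<Rightarrow> complex" where
  "om \<theta> = of_real (2 * (sin \<theta> * cos \<theta>) ^ (2 * j)) * \<rho> ((sin \<theta>)\<^sup>2)"

lemma sin_sq_range: "(sin \<theta>)\<^sup>2 \<in> {0..1::real}"
  by (simp add: abs_square_le_1)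

lemma sin_sq_interior:
  assumes "0 < \<theta>" "\<theta> < pi / 2"
  shows "0 < (sin \<theta>)\<^sup>2 \<and> (sin \<theta>)\<^sup>2 < 1 \<and> 0 < sin \<theta> \<and> 0 < cos \<theta>"
proof -
  have s: "0 < sin \<theta>" "0 < cos \<theta>" using sin_gt_zero[of \<theta>] cos_gt_zero[of \<theta>] assms by auto
  have "0 < (cos \<theta>)\<^sup>2" using s by simp
  hence "(sin \<theta>)\<^sup>2 < 1" using sin_cos_squared_add[of \<theta>] by linarith
  thus ?thesis using s by simp
qed

lemma om_continuous: "continuous_on A om"
  unfolding om_def using sin_sq_range by (intro continuous_intros) auto

lemmas om_continuous' [continuous_intros] = om_continuous[THEN continuous_on_compose2, OF _ subset_UNIV]

lemma g_continuous: "continuous_on A (\<lambda>(s, t). g s t)"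
  and Dk_continuous: "continuous_on A (\<lambda>(s, t). Dk s t)"
  and Dks_continuous: "continuous_on A (\<lambda>(s, t). Dks s t)"
  unfolding g_def Dk_def Dks_def case_prod_unfold by (intro continuous_intros)+

lemma continuous_on_uncurried:
  assumes "continuous_on UNIV (\<lambda>(s, t). h s t)" "continuous_on A u" "continuous_on A v"
  shows "continuous_on A (\<lambda>x. h (u x) (v x))"
  using continuous_on_compose2[OF assms(1) continuous_on_Pair[OF assms(2,3)]] by simp

lemmas gD_continuous' [continuous_intros] =
  continuous_on_uncurried[OF g_continuous] continuous_on_uncurried[OF Dk_continuous] continuous_on_uncurried[OF Dks_continuous]

lemma exp_g_deriv_s: "((\<lambda>s. exp (g s t)) has_vector_derivative exp (g s t) * (p * Dk s t)) (at s within A)"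
  using field_vector_diff_chain_within[OF g_deriv_s[of t s A] has_field_derivative_at_within[OF DERIV_exp]] by (simp add: o_def mult.commute)

lemma exp_g_deriv_t: "((\<lambda>t. exp (g s t)) has_vector_derivative exp (g s t) * (p * Rk s t)) (at t within A)"
  using field_vector_diff_chain_within[OF g_deriv_t[of s t A] has_field_derivative_at_within[OF DERIV_exp]] by (simp add: o_def mult.commute)

lemma has_vector_derivative_sin_sq_compose:
  assumes "(h has_vector_derivative (D :: complex)) (at ((sin \<theta>)\<^sup>2))"
  shows "((\<lambda>\<theta>. h ((sin \<theta>)\<^sup>2)) has_vector_derivative of_real (2 * (sin \<theta> * cos \<theta>)) * D) (at \<theta>)"
proof -
  have "((\<lambda>\<theta>. (sin \<theta>)\<^sup>2) has_vector_derivative 2 * (sin \<theta> * cos \<theta>)) (at \<theta>)"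
    by (auto intro!: derivative_eq_intros simp flip: has_real_derivative_iff_has_vector_derivative)
  from vector_diff_chain_at[OF this assms] show ?thesis by (simp add: o_def scaleR_conv_of_real)
qed

text \<open>This is (t (1 - t))^(-\<tau>) at t = sin^2 \<theta>; the exponent 2 j - 1 is written as
  a quotient because it is -1 for j = 0.\<close>

definition wt :: "real \<Rightarrow> real" where "wt \<theta> = (sin \<theta> * cos \<theta>) ^ (2 * j) / (sin \<theta> * cos \<theta>)"

lemma wt_deriv:
  assumes "0 < \<theta>" "\<theta> < pi / 2"
  shows "(wt has_real_derivative (2 * real j - 1) * (cos \<theta> ^ 2 - sin \<theta> ^ 2) / (sin \<theta> * cos \<theta>) * wt \<theta>) (at \<theta>)"
proof -
  have nz: "sin \<theta> * cos \<theta> \<noteq> 0" using sin_sq_interior[OF assms] by auto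
  have sc: "((\<lambda>\<theta>. sin \<theta> * cos \<theta>) has_real_derivative cos \<theta> ^ 2 - sin \<theta> ^ 2) (at \<theta>)"
    by (auto intro!: derivative_eq_intros simp: power2_eq_square)
  have "((\<lambda>\<theta>. (sin \<theta> * cos \<theta>) ^ (2 * j) / (sin \<theta> * cos \<theta>)) has_real_derivative
     (of_nat (2 * j) * ((cos \<theta> ^ 2 - sin \<theta> ^ 2) * (sin \<theta> * cos \<theta>) ^ (2 * j - Suc 0)) * (sin \<theta> * cos \<theta>)
       - (sin \<theta> * cos \<theta>) ^ (2 * j) * (cos \<theta> ^ 2 - sin \<theta> ^ 2)) / ((sin \<theta> * cos \<theta>) * (sin \<theta> * cos \<theta>))) (at \<theta>)"
    by (intro DERIV_divide DERIV_power sc nz)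
  moreover have "(of_nat (2 * j) * (D * x ^ (2 * j - Suc 0)) * x - x ^ (2 * j) * D) / (x * x)
      = (2 * real j - 1) * D / x * (x ^ (2 * j) / x)" if "x \<noteq> 0" for x D :: real
  proof (cases "j = 0")
    case True thus ?thesis using that by (simp add: field_simps)
  next
    case False
    hence "x ^ (2 * j - Suc 0) * x = x ^ (2 * j)" by (metis Suc_pred mult_pos_pos neq0_conv power_Suc2 zero_less_numeral)
    hence "of_nat (2 * j) * (D * x ^ (2 * j - Suc 0)) * x = of_nat (2 * j) * D * x ^ (2 * j)" by (simp add: mult_ac)
    thus ?thesis using that by (simp add: field_simps)
  qed
  ultimately show ?thesis using nz by (simp add: wt_def[abs_def])
qed

lemma om_eq_wt: "om \<theta> = of_real (wt \<theta> * (2 * (sin \<theta> * cos \<theta>))) * \<rho> ((sin \<theta>)\<^sup>2)"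
  if "0 < \<theta>" "\<theta> < pi / 2"
  using sin_sq_interior[OF that] by (simp add: om_def wt_def)

text \<open>\<open>Dk\<close> vanishes at t = 0 and t = 1, and t = sin^2 \<theta> is quadratic
  there, so the zero outweighs the denominator. This keeps the boundary term continuous even for j =
  0, where the weight itself is singular.\<close>

lemma Dk_over_sin_cos_tendsto:
  "((\<lambda>\<theta>. Dk s ((sin \<theta>)\<^sup>2) / of_real (sin \<theta> * cos \<theta>)) \<longlongrightarrow> 0) (at 0 within {0..pi/2})"
  "((\<lambda>\<theta>. Dk s ((sin \<theta>)\<^sup>2) / of_real (sin \<theta> * cos \<theta>)) \<longlongrightarrow> 0) (at (pi/2) within {0..pi/2})"
proof -
  have ev: "\<forall>\<^sub>F \<theta> in at c within {0..pi/2}. 0 < \<theta> \<and> \<theta> < pi / 2" if "c = 0 \<or> c = pi / 2" for c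
  proof -
    have "\<forall>\<^sub>F \<theta> in at c. \<theta> \<noteq> 0 \<and> \<theta> \<noteq> pi / 2"
      by (intro eventually_conj eventually_neq_at_within)
    thus ?thesis unfolding eventually_at_filter[of _ c "{0..pi/2}"] eventually_at_filter[of _ c UNIV]
      by (rule eventually_mono) (use that in auto)
  qed
  have fl: "filterlim (\<lambda>\<theta>. (sin \<theta>)\<^sup>2) (at ((sin c)\<^sup>2)) (at c within {0..pi/2})" if c: "c = 0 \<or> c = pi / 2" for c
  proof (rule filterlim_atI)
    show "((\<lambda>\<theta>. (sin \<theta>)\<^sup>2) \<longlongrightarrow> (sin c)\<^sup>2) (at c within {0..pi/2})" by (intro tendsto_intros)
    show "\<forall>\<^sub>F \<theta> in at c within {0..pi/2}. (sin \<theta>)\<^sup>2 \<noteq> (sin c)\<^sup>2"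
      using ev[OF c] by eventually_elim (use sin_sq_interior c in fastforce)
  qed
  have "((\<lambda>\<theta>. (Dk s ((sin \<theta>)\<^sup>2) - Dk s 0) / of_real ((sin \<theta>)\<^sup>2 - 0)) \<longlongrightarrow> p * Dkt s 0) (at 0 within {0..pi/2})"
    using filterlim_compose[OF has_vector_derivative_quotient_tendsto[OF Dk_deriv_t[of s 0 UNIV]] fl[of 0, simplified]] .
  hence "((\<lambda>\<theta>. (Dk s ((sin \<theta>)\<^sup>2) - Dk s 0) / of_real ((sin \<theta>)\<^sup>2 - 0) * of_real (sin \<theta> / cos \<theta>))
      \<longlongrightarrow> p * Dkt s 0 * of_real (sin 0 / cos 0)) (at 0 within {0..pi/2})"
    by (intro tendsto_intros) auto
  hence "((\<lambda>\<theta>. (Dk s ((sin \<theta>)\<^sup>2) - Dk s 0) / of_real ((sin \<theta>)\<^sup>2 - 0) * of_real (sin \<theta> / cos \<theta>)) \<longlongrightarrow> 0) (at 0 within {0..pi/2})"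
    by simp
  thus "((\<lambda>\<theta>. Dk s ((sin \<theta>)\<^sup>2) / of_real (sin \<theta> * cos \<theta>)) \<longlongrightarrow> 0) (at 0 within {0..pi/2})"
  proof (rule Lim_transform_eventually)
    show "\<forall>\<^sub>F \<theta> in at 0 within {0..pi/2}. (Dk s ((sin \<theta>)\<^sup>2) - Dk s 0) / of_real ((sin \<theta>)\<^sup>2 - 0) * of_real (sin \<theta> / cos \<theta>)
        = Dk s ((sin \<theta>)\<^sup>2) / of_real (sin \<theta> * cos \<theta>)"
      using ev[of 0, OF disjI1[OF refl]]
    proof eventually_elim
      case (elim \<theta>)
      thus ?case using sin_sq_interior[of \<theta>] by (simp add: Dk_0 power2_eq_square field_simps)
    qed
  qed
  have "((\<lambda>\<theta>. (Dk s ((sin \<theta>)\<^sup>2) - Dk s 1) / of_real ((sin \<theta>)\<^sup>2 - 1)) \<longlongrightarrow> p * Dkt s 1) (at (pi/2) within {0..pi/2})"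
    using filterlim_compose[OF has_vector_derivative_quotient_tendsto[OF Dk_deriv_t[of s 1 UNIV]] fl[of "pi/2", simplified]] .
  hence "((\<lambda>\<theta>. (Dk s ((sin \<theta>)\<^sup>2) - Dk s 1) / of_real ((sin \<theta>)\<^sup>2 - 1) * of_real (- cos \<theta> / sin \<theta>))
      \<longlongrightarrow> p * Dkt s 1 * of_real (- cos (pi/2) / sin (pi/2))) (at (pi/2) within {0..pi/2})"
    by (intro tendsto_intros) auto
  hence "((\<lambda>\<theta>. (Dk s ((sin \<theta>)\<^sup>2) - Dk s 1) / of_real ((sin \<theta>)\<^sup>2 - 1) * of_real (- cos \<theta> / sin \<theta>)) \<longlongrightarrow> 0) (at (pi/2) within {0..pi/2})"
    by simp
  thus "((\<lambda>\<theta>. Dk s ((sin \<theta>)\<^sup>2) / of_real (sin \<theta> * cos \<theta>)) \<longlongrightarrow> 0) (at (pi/2) within {0..pi/2})"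
  proof (rule Lim_transform_eventually)
    show "\<forall>\<^sub>F \<theta> in at (pi/2) within {0..pi/2}. (Dk s ((sin \<theta>)\<^sup>2) - Dk s 1) / of_real ((sin \<theta>)\<^sup>2 - 1) * of_real (- cos \<theta> / sin \<theta>)
        = Dk s ((sin \<theta>)\<^sup>2) / of_real (sin \<theta> * cos \<theta>)"
      using ev[of "pi/2", OF disjI2[OF refl]]
    proof eventually_elim
      case (elim \<theta>)
      have 1: "(sin \<theta>)\<^sup>2 - 1 = - (cos \<theta>)\<^sup>2" by (simp add: sin_squared_eq)
      show ?case unfolding 1 using sin_sq_interior[of \<theta>] elim by (simp add: Dk_1 power2_eq_square field_simps)
    qed
  qed
qed

text \<open>The integrand is the \<theta>-derivative of Y, which is twice the s-derivative of the
  weighted kernel times f: it is the contribution of the mixed term 2 \<partial>s \<partial>t. Y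
  vanishes at both ends.\<close>

lemma boundary_integral:
  fixes f f1 :: "real \<Rightarrow> complex"
  assumes f: "\<And>s. (f has_vector_derivative f1 s) (at s)"
  shows "((\<lambda>\<theta>. om \<theta> * exp (g s ((sin \<theta>)\<^sup>2)) * (2 * p * ((p * Dkt s ((sin \<theta>)\<^sup>2) + Dk s ((sin \<theta>)\<^sup>2) *
      (p * (Rk s ((sin \<theta>)\<^sup>2) - \<tau> * wz (of_real ((sin \<theta>)\<^sup>2) * p)))) * f (s + (sin \<theta>)\<^sup>2)
      + Dk s ((sin \<theta>)\<^sup>2) * f1 (s + (sin \<theta>)\<^sup>2)))) has_integral 0) {0..pi/2}"
proof -
  define S where "S = (\<lambda>\<theta>. (sin \<theta>)\<^sup>2 :: real)"
  define Y where "Y = (\<lambda>\<theta>. 2 * p * Dk s (S \<theta>) * of_real (wt \<theta>) * (\<rho> (S \<theta>) * exp (g s (S \<theta>)) * f (s + S \<theta>)))"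
  have fc: "continuous_on UNIV f"
    by (rule continuous_on_vector_derivative; rule has_vector_derivative_at_within; rule f)
  have fcS: "continuous_on {0..pi/2} (\<lambda>\<theta>. f (s + S \<theta>))"
    unfolding S_def by (rule continuous_on_compose2[OF fc]) (auto intro!: continuous_intros)
  have contS: "continuous_on A S" for A unfolding S_def by (intro continuous_intros)
  have rS: "continuous_on {0..pi/2} (\<lambda>\<theta>. \<rho> (S \<theta>))"
    by (rule \<rho>_continuous'[OF contS]) (use sin_sq_range in \<open>auto simp: S_def\<close>)
  have cont: "continuous_on {0..pi/2} (\<lambda>\<theta>. of_real ((sin \<theta> * cos \<theta>) ^ (2 * j)) * (\<rho> (S \<theta>) * exp (g s (S \<theta>)) * f (s + S \<theta>)))"
    by (intro continuous_intros rS fcS contS)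
  have Y_eq: "Y \<theta> = 2 * p * (Dk s ((sin \<theta>)\<^sup>2) / of_real (sin \<theta> * cos \<theta>)) *
      (of_real ((sin \<theta> * cos \<theta>) ^ (2 * j)) * (\<rho> (S \<theta>) * exp (g s (S \<theta>)) * f (s + S \<theta>)))" for \<theta>
    by (simp add: Y_def wt_def S_def)
  have d: "(Y has_vector_derivative om \<theta> * exp (g s (S \<theta>)) * (2 * p * ((p * Dkt s (S \<theta>) + Dk s (S \<theta>) *
      (p * (Rk s (S \<theta>) - \<tau> * wz (of_real (S \<theta>) * p)))) * f (s + S \<theta>)
      + Dk s (S \<theta>) * f1 (s + S \<theta>)))) (at \<theta>)" if \<theta>: "0 < \<theta>" "\<theta> < pi / 2" for \<theta>
  proof -
    define c where "c = sin \<theta> * cos \<theta>"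
    have pos: "0 < sin \<theta>" "0 < cos \<theta>" "0 < S \<theta>" "S \<theta> < 1" "c \<noteq> 0"
      using sin_sq_interior[OF \<theta>] by (auto simp: S_def c_def)
    define v where "v = of_real ((cos \<theta> ^ 2 - sin \<theta> ^ 2) / c) * (2 * of_nat j - 1 :: complex)"
    have dD: "((\<lambda>\<theta>. Dk s (S \<theta>)) has_vector_derivative of_real (2 * c) * (p * Dkt s (S \<theta>))) (at \<theta>)"
      using has_vector_derivative_sin_sq_compose[OF Dk_deriv_t] by (simp add: S_def c_def)
    have dr: "((\<lambda>\<theta>. \<rho> (S \<theta>)) has_vector_derivative of_real (2 * c) * (- \<tau> * Zw (S \<theta>) * \<rho> (S \<theta>))) (at \<theta>)"
      using has_vector_derivative_sin_sq_compose[OF \<rho>_deriv, of \<theta>] pos by (simp add: S_def c_def)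
    have de: "((\<lambda>\<theta>. exp (g s (S \<theta>))) has_vector_derivative of_real (2 * c) * (exp (g s (S \<theta>)) * (p * Rk s (S \<theta>)))) (at \<theta>)"
      using has_vector_derivative_sin_sq_compose[OF exp_g_deriv_t] by (simp add: S_def c_def)
    have df: "((\<lambda>\<theta>. f (s + S \<theta>)) has_vector_derivative of_real (2 * c) * f1 (s + S \<theta>)) (at \<theta>)"
      using has_vector_derivative_sin_sq_compose[of "\<lambda>t. f (s + t)" "f1 (s + (sin \<theta>)\<^sup>2)" \<theta>]
        shift_deriv(2)[of f f1, OF f] by (simp add: S_def c_def)
    have dw: "((\<lambda>\<theta>. complex_of_real (wt \<theta>)) has_vector_derivative v * of_real (wt \<theta>)) (at \<theta>)"
      by (rule has_vector_derivative_eq_rhs[OF has_vector_derivative_of_real[OF wt_deriv[OF \<theta>]]])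
         (simp add: v_def c_def)
    \<comment> \<open>The logarithmic derivative of \<open>wt\<close> supplies exactly the two poles
      that \<open>Zw\<close> takes away from p \<zeta>(t p).\<close>
    have vz: "v + of_real (2 * c) * (- \<tau> * Zw (S \<theta>)) = of_real (2 * c) * (- \<tau> * (p * wz (of_real (S \<theta>) * p)))"
    proof -
      have S1: "S \<theta> - 1 = - (cos \<theta>)\<^sup>2" by (simp add: S_def sin_squared_eq)
      have e: "2 * c * (1 / S \<theta> + 1 / (S \<theta> - 1)) = 2 * (cos \<theta> ^ 2 - sin \<theta> ^ 2) / c"
      proof -
        have "2 * (x * y) * (1 / x\<^sup>2 + 1 / - y\<^sup>2) = 2 * (y\<^sup>2 - x\<^sup>2) / (x * y)" if "x \<noteq> 0" "y \<noteq> 0" for x y :: real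
          using that by (simp add: field_simps power2_eq_square)
        from this[of "sin \<theta>" "cos \<theta>"] pos show ?thesis unfolding S1 by (simp only: c_def S_def simp_thms True_implies_equals)
      qed
      have "of_real (2 * c) * (1 / of_real (S \<theta>) + 1 / (of_real (S \<theta>) - 1)) = (of_real (2 * (cos \<theta> ^ 2 - sin \<theta> ^ 2) / c) :: complex)"
        using arg_cong[OF e, of complex_of_real] by (simp only: of_real_1 of_real_add of_real_diff of_real_divide of_real_mult)
      moreover have "v = of_real (2 * (cos \<theta> ^ 2 - sin \<theta> ^ 2) / c) * (- \<tau>)"
        by (simp add: v_def \<tau>_eq algebra_simps)
      moreover have "w + m * (- \<tau> * (z - x - y)) = m * (- \<tau> * z)"
        if "m * (x + y) = n" "w = n * (- \<tau>)" for w m x y z n :: complex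
        unfolding that(2) that(1)[symmetric] by (simp add: algebra_simps)
      ultimately show ?thesis unfolding Zw_eq[OF pos(3,4)] by blast
    qed
    have om: "om \<theta> = of_real (wt \<theta>) * of_real (2 * c) * \<rho> (S \<theta>)"
      using om_eq_wt[OF \<theta>] by (simp add: c_def S_def)
    have "(Y has_vector_derivative 2 * p * Dk s (S \<theta>) * of_real (wt \<theta>) *
        (\<rho> (S \<theta>) * exp (g s (S \<theta>)) * (of_real (2 * c) * f1 (s + S \<theta>)) +
         (\<rho> (S \<theta>) * (of_real (2 * c) * (exp (g s (S \<theta>)) * (p * Rk s (S \<theta>)))) +
          of_real (2 * c) * (- \<tau> * Zw (S \<theta>) * \<rho> (S \<theta>)) * exp (g s (S \<theta>))) * f (s + S \<theta>)) +
        (2 * p * Dk s (S \<theta>) * (v * of_real (wt \<theta>)) + 2 * p * (of_real (2 * c) * (p * Dkt s (S \<theta>))) * of_real (wt \<theta>)) *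
         (\<rho> (S \<theta>) * exp (g s (S \<theta>)) * f (s + S \<theta>))) (at \<theta>)"
      unfolding Y_def
      by (intro has_vector_derivative_mult has_vector_derivative_mult_right dD dr de df dw)
    moreover have "2 * p * D * w *
        (r * E * (c2 * F1) + (r * (c2 * (E * (p * R))) + c2 * (- \<tau> * Z * r) * E) * F) +
        (2 * p * D * (v * w) + 2 * p * (c2 * (p * Dt)) * w) * (r * E * F)
       = (w * c2 * r) * E * (2 * p * ((p * Dt + D * (p * (R - \<tau> * W))) * F + D * F1))"
      if "v + c2 * (- \<tau> * Z) = c2 * (- \<tau> * (p * W))" for D w r E F F1 R Z Dt W c2 :: complex
      using that by algebra
    from this[OF vz] have "2 * p * Dk s (S \<theta>) * of_real (wt \<theta>) *
        (\<rho> (S \<theta>) * exp (g s (S \<theta>)) * (of_real (2 * c) * f1 (s + S \<theta>)) +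
         (\<rho> (S \<theta>) * (of_real (2 * c) * (exp (g s (S \<theta>)) * (p * Rk s (S \<theta>)))) +
          of_real (2 * c) * (- \<tau> * Zw (S \<theta>) * \<rho> (S \<theta>)) * exp (g s (S \<theta>))) * f (s + S \<theta>)) +
        (2 * p * Dk s (S \<theta>) * (v * of_real (wt \<theta>)) + 2 * p * (of_real (2 * c) * (p * Dkt s (S \<theta>))) * of_real (wt \<theta>)) *
         (\<rho> (S \<theta>) * exp (g s (S \<theta>)) * f (s + S \<theta>))
      = om \<theta> * exp (g s (S \<theta>)) * (2 * p * ((p * Dkt s (S \<theta>) + Dk s (S \<theta>) *
      (p * (Rk s (S \<theta>) - \<tau> * wz (of_real (S \<theta>) * p)))) * f (s + S \<theta>)
      + Dk s (S \<theta>) * f1 (s + S \<theta>)))" unfolding om .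
    ultimately show ?thesis by simp
  qed
  have Y0: "Y 0 = 0" "Y (pi/2) = 0" by (simp_all add: Y_def S_def Dk_0 Dk_1)
  have lim: "(Y \<longlongrightarrow> Y c) (at c within {0..pi/2})" if c: "c = 0 \<or> c = pi / 2" for c
  proof -
    have cin: "c \<in> {0..pi/2}" using c pi_half_ge_zero by fastforce
    have A: "((\<lambda>\<theta>. Dk s ((sin \<theta>)\<^sup>2) / of_real (sin \<theta> * cos \<theta>)) \<longlongrightarrow> 0) (at c within {0..pi/2})"
      using Dk_over_sin_cos_tendsto[of s] c by blast
    have B: "((\<lambda>\<theta>. of_real ((sin \<theta> * cos \<theta>) ^ (2 * j)) * (\<rho> (S \<theta>) * exp (g s (S \<theta>)) * f (s + S \<theta>))) \<longlongrightarrow>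
      of_real ((sin c * cos c) ^ (2 * j)) * (\<rho> (S c) * exp (g s (S c)) * f (s + S c))) (at c within {0..pi/2})"
      using cont cin unfolding continuous_on_def by blast
    note tendsto_mult[OF tendsto_mult[OF tendsto_const[of "2 * p"] A] B]
    moreover have "Y c = 0" using c Y0 by blast
    ultimately show ?thesis unfolding Y_eq[symmetric] by simp
  qed
  have Yc: "continuous_on {0..pi/2} Y"
    unfolding continuous_on_def
  proof
    fix c assume c: "c \<in> {0..pi/2}"
    show "(Y \<longlongrightarrow> Y c) (at c within {0..pi/2})"
    proof (cases "c = 0 \<or> c = pi / 2")
      case True thus ?thesis by (rule lim)
    next
      case False
      hence "0 < c" "c < pi / 2" using c by auto
      from has_vector_derivative_continuous[OF d[OF this]] have "isCont Y c" .
      thus ?thesis unfolding isCont_def by (rule tendsto_within_subset) simp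
    qed
  qed
  have "((\<lambda>\<theta>. om \<theta> * exp (g s (S \<theta>)) * (2 * p * ((p * Dkt s (S \<theta>) + Dk s (S \<theta>) *
      (p * (Rk s (S \<theta>) - \<tau> * wz (of_real (S \<theta>) * p)))) * f (s + S \<theta>)
      + Dk s (S \<theta>) * f1 (s + S \<theta>)))) has_integral Y (pi/2) - Y 0) {0..pi/2}"
    by (rule fundamental_theorem_of_calculus_interior[OF _ Yc]) (use d in auto)
  thus ?thesis by (simp add: Y0 S_def)
qed

text \<open>F is the integral over y = X (s + t). After two differentiations under the integral the
  kernel equation exchanges the potential in y for the one in x, and the remainder is the vanishing
  boundary integral. The value F 0 is returned because it decides whether the image is
  non-trivial.\<close>

lemma kernel_transform:
  fixes f f1 :: "real \<Rightarrow> complex" and \<kappa> m :: complex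
  assumes f: "\<And>s. (f has_vector_derivative f1 s) (at s)"
    and f1: "\<And>s. (f1 has_vector_derivative (Vb s + \<kappa>) * f s) (at s)"
    and per: "\<And>s. f (s + 1) = m * f s"
  obtains F F1 where "hill_sol (\<lambda>s. Va s + \<kappa>) F F1" "F 1 = m * F 0" "F1 1 = m * F1 0"
    "F 0 = integral {0..pi/2} (\<lambda>\<theta>. om \<theta> * exp (g 0 ((sin \<theta>)\<^sup>2)) * f ((sin \<theta>)\<^sup>2))"
proof -
  define S where "S = (\<lambda>\<theta>. (sin \<theta>)\<^sup>2 :: real)"
  define f2 where "f2 s = (Vb s + \<kappa>) * f s" for s
  define N where "N s \<theta> = om \<theta> * exp (g s (S \<theta>))" for s \<theta>
  define J0 where "J0 s \<theta> = N s \<theta> * f (s + S \<theta>)" for s \<theta>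
  define J1 where "J1 s \<theta> = N s \<theta> * (p * Dk s (S \<theta>) * f (s + S \<theta>) + f1 (s + S \<theta>))" for s \<theta>
  define J2 where "J2 s \<theta> = N s \<theta> * ((p * Dk s (S \<theta>)) * (p * Dk s (S \<theta>) * f (s + S \<theta>) + f1 (s + S \<theta>))
      + (p * Dk s (S \<theta>) * f1 (s + S \<theta>) + p * (p * Dks s (S \<theta>)) * f (s + S \<theta>) + f2 (s + S \<theta>)))" for s \<theta>
  have per1: "f1 (s + 1) = m * f1 s" for s
  proof -
    have "((\<lambda>s. f (s + 1)) has_vector_derivative f1 (s + 1)) (at s)" by (rule shift_deriv(1)[of f f1, OF f])
    moreover have "((\<lambda>s. f (s + 1)) has_vector_derivative m * f1 s) (at s)"
      unfolding per by (rule has_vector_derivative_mult_right[OF f])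
    ultimately show ?thesis by (rule vector_derivative_unique_at)
  qed
  have fc [continuous_intros]: "continuous_on A (\<lambda>x. f (u x))" if "continuous_on A u" for A and u :: "'b::topological_space \<Rightarrow> real"
    by (rule continuous_on_compose2[OF continuous_on_vector_derivative[of UNIV f f1] that])
       (auto intro: has_vector_derivative_at_within f)
  have f1c [continuous_intros]: "continuous_on A (\<lambda>x. f1 (u x))" if "continuous_on A u" for A and u :: "'b::topological_space \<Rightarrow> real"
    by (rule continuous_on_compose2[OF continuous_on_vector_derivative[of UNIV f1 f2] that])
       (auto intro: has_vector_derivative_at_within f1 simp: f2_def)
  have f2c [continuous_intros]: "continuous_on A (\<lambda>x. f2 (u x))" if "continuous_on A u" for A and u :: "'b::topological_space \<Rightarrow> real"
    unfolding f2_def Vb_def using that by (intro continuous_intros)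
  have Sc [continuous_intros]: "continuous_on A (\<lambda>x. S (u x))" if "continuous_on A u" for A and u :: "'b::topological_space \<Rightarrow> real"
    unfolding S_def by (rule continuous_on_compose2[OF _ that, of UNIV "\<lambda>\<theta>. (sin \<theta>)\<^sup>2"]) (auto intro!: continuous_intros)
  have dN: "((\<lambda>s. N s \<theta>) has_vector_derivative N s \<theta> * (p * Dk s (S \<theta>))) (at s within {0..1})" for s \<theta>
    unfolding N_def mult.assoc by (rule has_vector_derivative_mult_right[OF exp_g_deriv_s])
  have dJ0: "((\<lambda>s. J0 s \<theta>) has_vector_derivative J1 s \<theta>) (at s within {0..1})" for s \<theta>
    unfolding J0_def
    by (rule has_vector_derivative_eq_rhs[OF has_vector_derivative_mult[OF dN shift_deriv(1)[of f f1, OF f]]])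
       (simp add: J1_def algebra_simps)
  have dJ1: "((\<lambda>s. J1 s \<theta>) has_vector_derivative J2 s \<theta>) (at s within {0..1})" for s \<theta>
  proof -
    have "((\<lambda>s. p * Dk s (S \<theta>) * f (s + S \<theta>) + f1 (s + S \<theta>)) has_vector_derivative
       p * Dk s (S \<theta>) * f1 (s + S \<theta>) + p * (p * Dks s (S \<theta>)) * f (s + S \<theta>) + f2 (s + S \<theta>)) (at s within {0..1})"
      by (intro has_vector_derivative_add has_vector_derivative_mult has_vector_derivative_mult_right Dk_deriv_s
          shift_deriv(1)[of f f1, OF f] shift_deriv(1)[of f1 f2]) (simp add: f2_def f1)
    from has_vector_derivative_mult[OF dN this] show ?thesis unfolding J1_def
      by (rule has_vector_derivative_eq_rhs) (simp add: J2_def algebra_simps)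
  qed
  have c0: "continuous_on A (\<lambda>(s, \<theta>). J0 s \<theta>)" "continuous_on A (\<lambda>(s, \<theta>). J1 s \<theta>)" "continuous_on A (\<lambda>(s, \<theta>). J2 s \<theta>)" for A
    unfolding J0_def J1_def J2_def N_def case_prod_unfold by (intro continuous_intros)+
  have cs: "continuous_on A (J0 s)" "continuous_on A (J1 s)" "continuous_on A (J2 s)" for A s
    unfolding J0_def J1_def J2_def N_def by (intro continuous_intros)+
  define F where "F s = integral {0..pi/2} (J0 s)" for s
  define F1 where "F1 s = integral {0..pi/2} (J1 s)" for s
  have dF: "(F has_vector_derivative F1 s) (at s within {0..1})" if "s \<in> {0..1}" for s
    unfolding F_def F1_def box_real(2)[of 0 "pi/2", symmetric]
    by (rule leibniz_rule_vector_derivative[OF dJ0]) (use that c0 cs in \<open>auto intro!: integrable_continuous_real\<close>)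
  have dF1: "(F1 has_vector_derivative integral {0..pi/2} (J2 s)) (at s within {0..1})" if "s \<in> {0..1}" for s
    unfolding F1_def box_real(2)[of 0 "pi/2", symmetric]
    by (rule leibniz_rule_vector_derivative[OF dJ1]) (use that c0 cs in \<open>auto intro!: integrable_continuous_real\<close>)
  have ode: "integral {0..pi/2} (J2 s) = (Va s + \<kappa>) * F s" for s
  proof -
    have "((\<lambda>\<theta>. J2 s \<theta> - (Va s + \<kappa>) * J0 s \<theta>) has_integral 0) {0..pi/2}"
    proof (rule has_integral_spike_finite[OF _ _ boundary_integral[OF f, of s]])
      show "finite {0, pi/2}" by simp
      fix \<theta> assume "\<theta> \<in> {0..pi/2} - {0, pi/2}"
      hence \<theta>: "0 < S \<theta>" "S \<theta> < 1" using sin_sq_interior[of \<theta>] by (auto simp: S_def)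
      define t where "t = S \<theta>"
      have pde: "p ^ 2 * (Dks s t + Dk s t ^ 2 - 2 * Dkt s t - 2 * Dk s t * (Rk s t - \<tau> * wz (of_real t * p))) = Va s - Vb (s + t)"
        unfolding Va_def Vb_def kernel_pde[OF \<theta>, folded t_def] by (simp add: algebra_simps)
      have "n * (p * D * (p * D * x + y) + (p * D * y + p * (p * Ds) * x + (vb + \<kappa>) * x)) - (va + \<kappa>) * (n * x)
          = n * (2 * p * ((p * Dt + D * (p * R)) * x + D * y))"
        if "p ^ 2 * (Ds + D ^ 2 - 2 * Dt - 2 * D * R) = va - vb" for n D x y Ds Dt R va vb :: complex
        using that by algebra
      from this[OF pde, of "N s \<theta>" "f (s + t)" "f1 (s + t)"]
      show "J2 s \<theta> - (Va s + \<kappa>) * J0 s \<theta> = om \<theta> * exp (g s ((sin \<theta>)\<^sup>2)) * (2 * p * ((p * Dkt s ((sin \<theta>)\<^sup>2) + Dk s ((sin \<theta>)\<^sup>2) *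
          (p * (Rk s ((sin \<theta>)\<^sup>2) - \<tau> * wz (of_real ((sin \<theta>)\<^sup>2) * p)))) * f (s + (sin \<theta>)\<^sup>2)
          + Dk s ((sin \<theta>)\<^sup>2) * f1 (s + (sin \<theta>)\<^sup>2)))"
        unfolding J2_def J0_def f2_def t_def N_def S_def .
    qed
    moreover have "((\<lambda>\<theta>. J2 s \<theta> - (Va s + \<kappa>) * J0 s \<theta>) has_integral integral {0..pi/2} (J2 s) - (Va s + \<kappa>) * F s) {0..pi/2}"
      unfolding F_def by (intro has_integral_diff has_integral_mult_right integrable_integral integrable_continuous_real cs)
    ultimately have "integral {0..pi/2} (J2 s) - (Va s + \<kappa>) * F s = 0" by (metis has_integral_unique)
    thus ?thesis by simp
  qed
  have N_per: "N (s + 1) \<theta> = N s \<theta>" for s \<theta> by (simp add: N_def g_periodic)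
  have f_per: "f (s + 1 + t) = m * f (s + t)" "f1 (s + 1 + t) = m * f1 (s + t)" for s t
    using per[of "s + t"] per1[of "s + t"] by (simp_all add: algebra_simps)
  have J_per: "J0 (0 + 1) \<theta> = m * J0 0 \<theta>" "J1 (0 + 1) \<theta> = m * J1 0 \<theta>" for \<theta>
    unfolding J0_def J1_def N_per Dk_periodic f_per by (simp_all add: algebra_simps)
  show thesis
  proof (rule that[of F F1])
    show "hill_sol (\<lambda>s. Va s + \<kappa>) F F1" unfolding hill_sol_def using dF dF1 ode by simp
    show "F 1 = m * F 0" "F1 1 = m * F1 0"
    proof -
      have "J0 1 = (\<lambda>\<theta>. m * J0 0 \<theta>)" "J1 1 = (\<lambda>\<theta>. m * J1 0 \<theta>)" using J_per by (auto simp: fun_eq_iff)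
      thus "F 1 = m * F 0" "F1 1 = m * F1 0" by (simp_all add: F_def F1_def)
    qed
    show "F 0 = integral {0..pi/2} (\<lambda>\<theta>. om \<theta> * exp (g 0 ((sin \<theta>)\<^sup>2)) * f ((sin \<theta>)\<^sup>2))"
      by (simp add: F_def J0_def[abs_def] N_def S_def)
  qed
qed

end

subsection \<open>Traces at large negative energy\<close>

definition hill_trace :: "(real \<Rightarrow> complex) \<Rightarrow> complex" where
  "hill_trace w = hill_y w 1 0 1 + hill_dy w 0 1 1"

text \<open>(F 0, F1 0) gives an eigenvector of the monodromy matrix, whose determinant is the
  Wronskian 1; hence the eigenvalues are m and 1 / m.\<close>

lemma hill_bloch_trace:
  assumes w: "continuous_on {0..1} w" and F: "hill_sol w F F1" "F 1 = m * F 0" "F1 1 = m * F1 0"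
    and nz: "F 0 \<noteq> 0 \<or> F1 0 \<noteq> 0"
  shows "m \<noteq> 0" "hill_trace w = m + 1 / m"
proof -
  define A B C D where "A = hill_y w 1 0 1" "B = hill_y w 0 1 1" "C = hill_dy w 1 0 1" "D = hill_dy w 0 1 1"
  note defs = this
  have W: "A * D - C * B = 1"
    using hill_wronskian[OF hill_y(1)[OF w, of 1 0] hill_y(1)[OF w, of 0 1], of 1] by (simp add: defs hill_y[OF w])
  have e: "A * F 0 + B * F1 0 = m * F 0" "C * F 0 + D * F1 0 = m * F1 0"
    using hill_sol_representation[OF w F(1), of 1] F(2,3) by (simp_all add: defs mult.commute)
  have "(1 - m * (A + D) + m ^ 2) * F 0 = 0" "(1 - m * (A + D) + m ^ 2) * F1 0 = 0"
    using W e by algebra+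
  hence q: "1 - m * (A + D) + m ^ 2 = 0" using nz by auto
  thus m: "m \<noteq> 0" by auto
  have "m * (A + D) = 1 + m ^ 2" using q by algebra
  hence "A + D = (1 + m ^ 2) / m" using m by (simp add: field_simps)
  thus "hill_trace w = m + 1 / m" using m by (simp add: hill_trace_def defs field_simps power2_eq_square)
qed

lemma hill_trace_holomorphic:
  assumes "continuous_on {0..1} V" shows "(\<lambda>\<kappa>. hill_trace (\<lambda>s. V s + \<kappa>)) holomorphic_on UNIV"
proof -
  have "(\<lambda>\<kappa>. hill_trace (\<lambda>s. V s + \<kappa>)) field_differentiable (at \<kappa>)" for \<kappa>
    unfolding hill_trace_def field_differentiable_def
    by (rule exI, rule DERIV_add[OF hill_y_has_field_derivative(1)[OF assms, of 1 0] hill_y_has_field_derivative(2)[OF assms, of 0 1]])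
  thus ?thesis by (simp add: holomorphic_on_def)
qed

text \<open>Laplace's method as a comparison of two pieces. After division by \<open>G 0\<close>,
  the part near \<theta> = 0 is close to a positive integral and at least a constant times exp(- T
  sin^2(\<delta>/2)), while [\<delta>, \<pi>/2] contributes at most a constant times exp(- T sin^2
  \<delta>).\<close>

lemma laplace_nonzero:
  fixes G :: "real \<Rightarrow> complex" and j :: nat
  assumes G: "continuous_on {0..pi/2} G" "G 0 \<noteq> 0"
  obtains T0 where "\<And>T (f :: real \<Rightarrow> complex). T0 \<le> T \<Longrightarrow> continuous_on {0..1} f \<Longrightarrow>
      (\<And>t. t \<in> {0..1} \<Longrightarrow> norm (f t * exp (of_real (T * t)) - 1) \<le> 1 / 8) \<Longrightarrow>
      integral {0..pi/2} (\<lambda>\<theta>. of_real ((sin \<theta> * cos \<theta>) ^ (2 * j)) * G \<theta> * f ((sin \<theta>)\<^sup>2)) \<noteq> 0"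
proof -
  obtain B where B: "\<And>\<theta>. \<theta> \<in> {0..pi/2} \<Longrightarrow> norm (G \<theta> / G 0) \<le> B"
  proof -
    have "bounded ((\<lambda>\<theta>. G \<theta> / G 0) ` {0..pi/2})"
      by (intro compact_imp_bounded compact_continuous_image continuous_intros G compact_Icc) (use G in auto)
    thus ?thesis using that unfolding bounded_iff by blast
  qed
  have B0: "0 \<le> B" using B[of 0] G(2) by simp
  have "(G \<longlongrightarrow> G 0) (at 0 within {0..pi/2})" using G(1) by (auto simp: continuous_on_def)
  hence "((\<lambda>\<theta>. G \<theta> / G 0) \<longlongrightarrow> G 0 / G 0) (at 0 within {0..pi/2})" using G(2) by (intro tendsto_intros)
  hence "\<forall>\<^sub>F \<theta> in at 0 within {0..pi/2}. dist (G \<theta> / G 0) 1 < 1 / 4"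
    using G(2) by (intro tendstoD) auto
  then obtain d where d: "0 < d" "\<And>\<theta>. \<theta> \<in> {0..pi/2} \<Longrightarrow> \<theta> \<noteq> 0 \<Longrightarrow> dist \<theta> 0 < d \<Longrightarrow> dist (G \<theta> / G 0) 1 < 1 / 4"
    unfolding eventually_at by blast
  define \<delta> where "\<delta> = min (d / 2) (pi / 4)"
  have \<delta>: "0 < \<delta>" "\<delta> < pi / 2" using d(1) by (auto simp: \<delta>_def min_def)
  have near: "norm (G \<theta> / G 0 - 1) \<le> 1 / 4" if "\<theta> \<in> {0..\<delta>}" for \<theta>
  proof (cases "\<theta> = 0")
    case False
    have "dist \<theta> 0 < d" using that d(1) by (auto simp: \<delta>_def)
    thus ?thesis using d(2)[of \<theta>] False that \<delta> by (auto simp: dist_norm)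
  qed (use G in auto)
  define s1 where "s1 = (sin (\<delta> / 2))\<^sup>2"
  define s2 where "s2 = (sin \<delta>)\<^sup>2"
  have sin_mono: "(sin x)\<^sup>2 \<le> (sin y)\<^sup>2" if "0 \<le> x" "x \<le> y" "y \<le> pi / 2" for x y
    by (intro power_mono sin_monotone_2pi_le sin_ge_zero) (use that in auto)
  have s12: "s1 < s2"
    unfolding s1_def s2_def by (intro power_strict_mono sin_monotone_2pi sin_ge_zero) (use \<delta> in auto)
  \<comment> \<open>Length of [\<delta>/4, \<delta>/2] times a lower bound of the weight on it; the
    interval stays away from 0, where the weight vanishes if j > 0.\<close>
  define m0 where "m0 = \<delta> / 4 * (sin (\<delta> / 4) * cos (\<delta> / 2)) ^ (2 * j)"
  have m0: "0 < m0" unfolding m0_def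
    by (intro mult_pos_pos zero_less_power sin_gt_zero cos_gt_zero) (use \<delta> in auto)
  \<comment> \<open>Makes T (s2 - s1) at least 2 \<pi> B / m0, so that by exp x > x the exponential
    gap beats the constants.\<close>
  define T0 where "T0 = max 0 ((2 * pi * B / m0) / (s2 - s1))"
  show thesis
  proof (rule that[of T0])
    fix T and f :: "real \<Rightarrow> complex" assume T: "T0 \<le> T" and fc: "continuous_on {0..1} f"
      and f: "\<And>t. t \<in> {0..1} \<Longrightarrow> norm (f t * exp (of_real (T * t)) - 1) \<le> 1 / (8::real)"
    have T00: "0 \<le> T" using T by (simp add: T0_def)
    define S where "S = (\<lambda>\<theta>. (sin \<theta>)\<^sup>2 :: real)"
    define a where "a \<theta> = (sin \<theta> * cos \<theta>) ^ (2 * j) * exp (- T * S \<theta>)" for \<theta>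
    define k where "k \<theta> = G \<theta> / G 0 * (f (S \<theta>) * exp (of_real (T * S \<theta>)))" for \<theta>
    have S01: "S \<theta> \<in> {0..1}" for \<theta> by (simp add: S_def abs_square_le_1)
    have Sc: "continuous_on A S" for A unfolding S_def by (intro continuous_intros)
    have fSc: "continuous_on A (\<lambda>\<theta>. f (S \<theta>))" for A
      by (rule continuous_on_compose2[OF fc Sc]) (use S01 in auto)
    have ac: "continuous_on A a" for A unfolding a_def by (intro continuous_intros Sc)
    have kc: "continuous_on {0..pi/2} k" unfolding k_def using G by (intro continuous_intros Sc fSc) auto
    have akc: "continuous_on {0..pi/2} (\<lambda>\<theta>. of_real (a \<theta>) * k \<theta>)"
      by (intro continuous_intros ac kc)
    have a0: "0 \<le> a \<theta>" for \<theta> by (simp add: a_def)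
    have k1: "norm (k \<theta> - 1) \<le> 1 / 2" if "\<theta> \<in> {0..\<delta>}" for \<theta>
    proof -
      define x where "x = G \<theta> / G 0 - 1"
      define y where "y = f (S \<theta>) * exp (of_real (T * S \<theta>)) - 1"
      have "norm (k \<theta> - 1) = norm (x * y + (x + y))" by (simp add: k_def x_def y_def algebra_simps)
      also have "\<dots> \<le> norm x * norm y + (norm x + norm y)"
        by (intro order_trans[OF norm_triangle_ineq] add_mono norm_triangle_ineq) (simp add: norm_mult)
      also have "\<dots> \<le> 1 / 4 * (1 / 8) + (1 / 4 + 1 / 8)"
        using near[OF that] f[OF S01] by (intro add_mono mult_mono) (auto simp: x_def y_def)
      finally show ?thesis by simp
    qed
    have k2: "norm (k \<theta>) \<le> 2 * B" if "\<theta> \<in> {0..pi/2}" for \<theta>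
    proof -
      have "norm (f (S \<theta>) * exp (of_real (T * S \<theta>))) \<le> 2"
        using f[OF S01[of \<theta>]] norm_triangle_ineq[of "f (S \<theta>) * exp (of_real (T * S \<theta>)) - 1" 1] by simp
      hence "norm (k \<theta>) \<le> B * 2" unfolding k_def norm_mult[of "G \<theta> / G 0"] by (intro mult_mono B that) (use B0 in auto)
      thus ?thesis by simp
    qed
    define I1 where "I1 = integral {0..\<delta>} (\<lambda>\<theta>. of_real (a \<theta>) * k \<theta>)"
    define I2 where "I2 = integral {\<delta>..pi/2} (\<lambda>\<theta>. of_real (a \<theta>) * k \<theta>)"
    define A1 where "A1 = integral {0..\<delta>} a"
    have sub: "{0..\<delta>} \<subseteq> {0..pi/2}" "{\<delta>..pi/2} \<subseteq> {0..pi/2}" using \<delta> by auto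
    have "norm (I1 - of_real A1) = norm (integral {0..\<delta>} (\<lambda>\<theta>. of_real (a \<theta>) * (k \<theta> - 1)))"
    proof -
      have "((\<lambda>\<theta>. of_real (a \<theta>) * k \<theta> - of_real (a \<theta>)) has_integral I1 - of_real A1) {0..\<delta>}"
        unfolding I1_def A1_def
        by (intro has_integral_diff integrable_integral has_integral_of_real integrable_continuous_real ac continuous_on_subset[OF akc sub(1)])
      from integral_unique[OF this] show ?thesis by (simp only: right_diff_distrib mult_1_right)
    qed
    also have "\<dots> \<le> integral {0..\<delta>} (\<lambda>\<theta>. a \<theta> * (1 / 2))"
    proof (rule integral_norm_bound_integral)
      show "(\<lambda>\<theta>. of_real (a \<theta>) * (k \<theta> - 1)) integrable_on {0..\<delta>}"
        by (intro integrable_continuous_real continuous_intros ac continuous_on_subset[OF kc sub(1)])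
      show "(\<lambda>\<theta>. a \<theta> * (1 / 2)) integrable_on {0..\<delta>}"
        by (intro integrable_continuous_real continuous_intros ac)
      fix \<theta> assume "\<theta> \<in> {0..\<delta>}"
      thus "norm (of_real (a \<theta>) * (k \<theta> - 1)) \<le> a \<theta> * (1 / 2)"
        unfolding norm_mult using k1 a0 by (intro mult_mono) auto
    qed
    also have "\<dots> = A1 / 2" by (simp add: A1_def)
    finally have n1: "A1 / 2 \<le> norm I1"
      using norm_triangle_ineq2[of "of_real A1" I1] a0
      by (simp add: norm_minus_commute)
    have "m0 * exp (- T * s1) = integral {\<delta>/4..\<delta>/2} (\<lambda>\<theta>. (sin (\<delta> / 4) * cos (\<delta> / 2)) ^ (2 * j) * exp (- T * s1))"
      using \<delta> by (simp add: m0_def)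
    also have "\<dots> \<le> integral {\<delta>/4..\<delta>/2} a"
    proof (rule integral_le)
      fix \<theta> assume \<theta>: "\<theta> \<in> {\<delta>/4..\<delta>/2}"
      have "0 \<le> sin (\<delta> / 4)" "sin (\<delta> / 4) \<le> sin \<theta>" "0 \<le> cos (\<delta> / 2)" "cos (\<delta> / 2) \<le> cos \<theta>"
        using \<theta> \<delta> by (auto intro!: sin_monotone_2pi_le cos_monotone_0_pi_le sin_ge_zero cos_ge_zero)
      moreover have "S \<theta> \<le> s1" unfolding S_def s1_def by (rule sin_mono) (use \<theta> \<delta> in auto)
      ultimately show "(sin (\<delta> / 4) * cos (\<delta> / 2)) ^ (2 * j) * exp (- T * s1) \<le> a \<theta>"
        unfolding a_def using T00 by (intro mult_mono power_mono) (auto intro!: mult_left_mono)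
    qed (auto intro!: integrable_continuous_real ac)
    also have "\<dots> \<le> A1"
      unfolding A1_def by (rule integral_subset_le) (use \<delta> a0 in \<open>auto intro!: integrable_continuous_real ac\<close>)
    finally have A1: "m0 * exp (- T * s1) \<le> A1" .
    have "norm I2 \<le> integral {\<delta>..pi/2} (\<lambda>\<theta>. exp (- T * s2) * (2 * B))"
      unfolding I2_def
    proof (rule integral_norm_bound_integral)
      fix \<theta> assume \<theta>: "\<theta> \<in> {\<delta>..pi/2}"
      have "s2 \<le> S \<theta>" unfolding S_def s2_def by (rule sin_mono) (use \<theta> \<delta> in auto)
      have "\<bar>sin \<theta> * cos \<theta>\<bar> \<le> 1 * 1" unfolding abs_mult by (intro mult_mono) auto
      hence "(sin \<theta> * cos \<theta>) ^ (2 * j) \<le> 1" by (simp add: power_mult abs_square_le_1 power_le_one)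
      hence "a \<theta> \<le> 1 * exp (- T * s2)"
        unfolding a_def using T00 \<open>s2 \<le> S \<theta>\<close> by (intro mult_mono) (auto intro!: mult_left_mono simp: power_mult)
      thus "norm (of_real (a \<theta>) * k \<theta>) \<le> exp (- T * s2) * (2 * B)"
        unfolding norm_mult using k2[of \<theta>] a0 \<theta> \<delta> by (intro mult_mono) auto
    qed (auto intro!: integrable_continuous_real continuous_on_subset[OF akc sub(2)])
    also have "\<dots> \<le> pi / 2 * (exp (- T * s2) * (2 * B))"
      using \<delta> B0 mult_right_mono[of "pi / 2 - \<delta>" "pi / 2" "2 * B"] by simp
    finally have n2: "norm I2 \<le> pi * B * exp (- T * s2)" by (simp add: mult_ac)
    have "pi * B * exp (- T * s2) < m0 * exp (- T * s1) / 2"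
    proof -
      have "2 * pi * B / m0 \<le> T * (s2 - s1)"
      proof -
        have "2 * pi * B / m0 / (s2 - s1) \<le> T" using T unfolding T0_def by linarith
        moreover have "0 < s2 - s1" using s12 by simp
        ultimately show ?thesis by (simp only: pos_divide_le_eq)
      qed
      also have "\<dots> < exp (T * (s2 - s1))" using exp_ge_add_one_self[of "T * (s2 - s1)"] by linarith
      finally have "2 * pi * B < m0 * exp (T * (s2 - s1))" using m0 by (simp add: field_simps)
      hence "2 * pi * B * exp (- T * s2) < m0 * exp (T * (s2 - s1)) * exp (- T * s2)" by simp
      also have "\<dots> = m0 * exp (- T * s1)" by (simp add: algebra_simps flip: exp_add)
      finally show ?thesis by simp
    qed
    hence "norm I2 < norm I1" using n1 n2 A1 by linarith
    hence "I1 + I2 \<noteq> 0" by (metis add_eq_0_iff norm_minus_cancel order_less_irrefl)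
    moreover have "I1 + I2 = integral {0..pi/2} (\<lambda>\<theta>. of_real (a \<theta>) * k \<theta>)"
      unfolding I1_def I2_def
      by (rule Henstock_Kurzweil_Integration.integral_combine) (use \<delta> in \<open>auto intro!: integrable_continuous_real akc\<close>)
    moreover have "(\<lambda>\<theta>. of_real ((sin \<theta> * cos \<theta>) ^ (2 * j)) * G \<theta> * f ((sin \<theta>)\<^sup>2)) = (\<lambda>\<theta>. G 0 * (of_real (a \<theta>) * k \<theta>))"
    proof
      fix \<theta>
      have "complex_of_real (exp (- T * S \<theta>)) * exp (of_real (T * S \<theta>)) = 1"
        by (simp flip: exp_of_real exp_add)
      moreover have "f ((sin \<theta>)\<^sup>2) = f (S \<theta>)" by (simp add: S_def)
      ultimately show "of_real ((sin \<theta> * cos \<theta>) ^ (2 * j)) * G \<theta> * f ((sin \<theta>)\<^sup>2) = G 0 * (of_real (a \<theta>) * k \<theta>)"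
        using G(2) unfolding a_def k_def by (simp add: mult_ac)
    qed
    ultimately show "integral {0..pi/2} (\<lambda>\<theta>. of_real ((sin \<theta> * cos \<theta>) ^ (2 * j)) * G \<theta> * f ((sin \<theta>)\<^sup>2)) \<noteq> 0"
      using G(2) by simp
  qed
qed

text \<open>If h is the product of two solutions, (h' / 2 + \<sigma>) / h is the logarithmic
  derivative of one of them. Conversely, the relation \<open>Q\<close> turns this quotient q into a
  solution of the Riccati equation q' + q^2 = V + \<kappa>, and since q is periodic, the exponential
  of its primitive is a Bloch solution.\<close>

lemma bloch_from_product:
  fixes V h h1 h2 :: "real \<Rightarrow> complex"
  assumes h: "\<And>s. (h has_vector_derivative h1 s) (at s)" "\<And>s. (h1 has_vector_derivative h2 s) (at s)"
    and nz: "\<And>s. h s \<noteq> 0" and per: "\<And>s. h (s + 1) = h s"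
    and Q: "\<And>s. \<sigma> ^ 2 = h s ^ 2 * (V s + \<kappa>) - h s * h2 s / 2 + h1 s ^ 2 / 4"
  obtains P f m where "\<And>s. (f has_vector_derivative ((h1 s / 2 + \<sigma>) / h s) * f s) (at s)"
    "\<And>s. ((\<lambda>s. ((h1 s / 2 + \<sigma>) / h s) * f s) has_vector_derivative (V s + \<kappa>) * f s) (at s)"
    "\<And>s. f (s + 1) = m * f s" "f = (\<lambda>s. exp (P s))" "P 0 = 0"
    "\<And>s. (P has_vector_derivative (h1 s / 2 + \<sigma>) / h s) (at s)"
proof -
  define q where "q s = (h1 s / 2 + \<sigma>) / h s" for s
  have hc: "continuous_on UNIV h" "continuous_on UNIV h1"
    by (rule continuous_on_vector_derivative; rule has_vector_derivative_at_within; rule h)+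
  have "continuous_on UNIV q" unfolding q_def using hc nz by (intro continuous_intros) auto
  then obtain P0 where P0: "\<And>s. (P0 has_vector_derivative q s) (at s)" by (rule real_primitive) blast
  define P where "P s = P0 s - P0 0" for s
  have P: "(P has_vector_derivative q s) (at s)" for s
    unfolding P_def using has_vector_derivative_diff[OF P0 has_vector_derivative_const[of "P0 0"]] by simp
  have dq: "(q has_vector_derivative (V s + \<kappa>) - q s ^ 2) (at s)" for s
  proof -
    have dinv: "((\<lambda>s. inverse (h s)) has_vector_derivative - (h1 s / h s ^ 2)) (at s)"
      using field_vector_diff_chain_at[OF h(1) DERIV_inverse'[OF DERIV_ident nz]] nz[of s]
      by (simp add: o_def power2_eq_square divide_inverse mult_ac)
    have "((\<lambda>s. (h1 s / 2 + \<sigma>) * inverse (h s)) has_vector_derivative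
      (h1 s / 2 + \<sigma>) * - (h1 s / h s ^ 2) + (h2 s / 2 + 0) * inverse (h s)) (at s)"
      by (intro has_vector_derivative_mult dinv has_vector_derivative_add has_vector_derivative_const
          has_vector_derivative_divide h)
    moreover have "(\<lambda>s. (h1 s / 2 + \<sigma>) * inverse (h s)) = q"
      by (rule ext) (simp only: q_def divide_inverse)
    ultimately have dq: "(q has_vector_derivative (h1 s / 2 + \<sigma>) * - (h1 s / h s ^ 2) + (h2 s / 2 + 0) * inverse (h s)) (at s)"
      by simp
    have eqn: "(d / 2 + \<sigma>) * - (d / x ^ 2) + (d2 / 2 + 0) * inverse x = v - ((d / 2 + \<sigma>) / x) ^ 2"
      if "\<sigma> ^ 2 = x ^ 2 * v - x * d2 / 2 + d ^ 2 / 4" "x \<noteq> 0" for x d d2 v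
    proof -
      have aux: "(D + \<sigma>) * - (2 * D * i ^ 2) + E * i = v - ((D + \<sigma>) * i) ^ 2"
        if "\<sigma> ^ 2 = x ^ 2 * v - x * E + D ^ 2" "x * i = 1" for D E i
        using that by algebra
      have "\<sigma> ^ 2 = x ^ 2 * v - x * (d2 / 2) + (d / 2) ^ 2" using that(1) by (simp add: power_divide)
      note a = aux[OF this right_inverse[OF that(2)]]
      have "2 * (d / 2) = d" by simp
      hence "- (d / x ^ 2) = - (2 * (d / 2) * inverse x ^ 2)" by (simp only: divide_inverse power_inverse)
      thus ?thesis unfolding divide_inverse[of "d / 2 + \<sigma>" x] add_0_right using a by (simp only:)
    qed
    show ?thesis by (rule has_vector_derivative_eq_rhs[OF dq]) (unfold q_def, rule eqn[OF Q nz])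
  qed
  define f where "f s = exp (P s)" for s
  have df: "(f has_vector_derivative q s * f s) (at s)" for s
    using field_vector_diff_chain_at[OF P DERIV_exp, of s] by (simp add: f_def[abs_def] o_def)
  have df1: "((\<lambda>s. q s * f s) has_vector_derivative (V s + \<kappa>) * f s) (at s)" for s
    by (rule has_vector_derivative_eq_rhs[OF has_vector_derivative_mult[OF dq df]])
       (simp add: algebra_simps power2_eq_square)
  have h1_per: "h1 (s + 1) = h1 s" for s
  proof -
    have "((\<lambda>s. h (s + 1)) has_vector_derivative h1 (s + 1)) (at s)"
      using has_vector_derivative_compose_linear[of h "h1 (s + 1)" 1 s 1] h(1) by simp
    hence "(h has_vector_derivative h1 (s + 1)) (at s)" by (simp add: per)
    thus ?thesis using h(1) by (rule vector_derivative_unique_at)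
  qed
  have P_per: "P (s + 1) = P 1 + P s" for s
  proof -
    have "((\<lambda>s. P (s + 1) - P s) has_vector_derivative q (s + 1) - q s) (at s)" for s
      using has_vector_derivative_diff[OF has_vector_derivative_compose_linear[of P "q (s + 1)" 1 s 1] P] P by simp
    hence "((\<lambda>s. P (s + 1) - P s) has_vector_derivative 0) (at s)" for s by (simp add: q_def per h1_per)
    hence "P (s + 1) - P s = P (0 + 1) - P 0" by (rule constant_if_vector_derivative_zero)
    moreover have "P 0 = 0" by (simp add: P_def)
    ultimately show ?thesis by (simp add: algebra_simps)
  qed
  show thesis
  proof (rule that[of f "exp (P 1)" P])
    show "f (s + 1) = exp (P 1) * f s" for s by (simp add: f_def P_per exp_add)
    show "f = (\<lambda>s. exp (P s))" by (simp add: f_def[abs_def])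
    show "P 0 = 0" by (simp add: P_def)
  qed (use df df1 P in \<open>simp_all add: q_def\<close>)
qed

text \<open>\<open>h\<close> plays the role of \<open>\<Xi>\<close>, normalised to be close to \<open>1\<close>, at the energy \<open>- T\<^sup>2\<close>.\<close>

definition nearly_constant_product :: "(real \<Rightarrow> complex) \<Rightarrow> real \<Rightarrow> real \<Rightarrow> bool" where
  "nearly_constant_product V K T \<longleftrightarrow> (\<exists>h h1 h2 q0. \<forall>s.
     (h has_vector_derivative h1 s) (at s) \<and> (h1 has_vector_derivative h2 s) (at s) \<and> h (s + 1) = h s \<and>
     norm (h s - 1) \<le> K / T\<^sup>2 \<and> norm (h1 s) \<le> K / T\<^sup>2 \<and> norm (h2 s) \<le> K / T\<^sup>2 \<and>
     q0 = h s ^ 2 * (V s + of_real (T\<^sup>2)) - h s * h2 s / 2 + h1 s ^ 2 / 4)"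

text \<open>The tolerance 1/8 is the one under which \<open>laplace_nonzero\<close> applies; it also
  forces |m| < 1 for T >= 1, which separates the trace from 2 and -2.\<close>

definition decaying_bloch ::
  "(real \<Rightarrow> complex) \<Rightarrow> real \<Rightarrow> (real \<Rightarrow> complex) \<Rightarrow> (real \<Rightarrow> complex) \<Rightarrow> complex \<Rightarrow> bool" where
  "decaying_bloch V T f f1 m \<longleftrightarrow>
     (\<forall>s. (f has_vector_derivative f1 s) (at s) \<and>
          (f1 has_vector_derivative (V s + of_real (T\<^sup>2)) * f s) (at s) \<and> f (s + 1) = m * f s) \<and>
     f 0 = 1 \<and> (\<forall>t\<in>{0..1}. norm (f t * exp (of_real (T * t)) - 1) \<le> 1 / 8)"

lemma decaying_bloch_trace:
  assumes f: "decaying_bloch V T f f1 m" and V: "continuous_on {0..1} V"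
  shows "m \<noteq> 0" "hill_trace (\<lambda>s. V s + of_real (T\<^sup>2)) = m + 1 / m"
proof -
  have f': "\<And>s. (f has_vector_derivative f1 s) (at s)"
    "\<And>s. (f1 has_vector_derivative (V s + of_real (T\<^sup>2)) * f s) (at s)" "\<And>s. f (s + 1) = m * f s" "f 0 = 1"
    using f by (auto simp: decaying_bloch_def)
  have c: "continuous_on {0..1} (\<lambda>s. V s + of_real (T\<^sup>2))" by (intro continuous_intros V)
  have sol: "hill_sol (\<lambda>s. V s + of_real (T\<^sup>2)) f f1"
    using f'(1,2) by (auto simp: hill_sol_def intro: has_vector_derivative_at_within)
  have "((\<lambda>s. f (s + 1)) has_vector_derivative f1 1) (at 0)"
    using has_vector_derivative_compose_linear[of f "f1 1" 1 0 1] f'(1) by simp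
  moreover have "((\<lambda>s. f (s + 1)) has_vector_derivative m * f1 0) (at 0)"
    unfolding f'(3) by (rule has_vector_derivative_mult_right[OF f'(1)])
  ultimately have "f1 1 = m * f1 0" by (rule vector_derivative_unique_at)
  moreover have "f 1 = m * f 0" using f'(3)[of 0] by simp
  ultimately show "m \<noteq> 0" "hill_trace (\<lambda>s. V s + of_real (T\<^sup>2)) = m + 1 / m"
    by (intro hill_bloch_trace[OF c sol]; simp add: f'(4))+
qed

text \<open>With h close to 1 the constant q0 is close to T^2, its root \<sigma> is close to - T,
  and the logarithmic derivative of the Bloch solution differs from - T by O(1 / T). M bounds |q0 -
  T^2|, K2 bounds T times that difference, and d is a radius on which exp deviates from 1 by at most
  1/8.\<close>

lemma large_bloch:
  fixes V :: "real \<Rightarrow> complex"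
  assumes V: "\<And>s. norm (V s) \<le> B"
  obtains T0 where "\<And>T. T0 \<le> T \<Longrightarrow> nearly_constant_product V K T \<Longrightarrow> \<exists>f f1 m. decaying_bloch V T f f1 m"
proof -
  have "((\<lambda>z::complex. exp z) \<longlongrightarrow> exp 0) (at 0)" by (intro tendsto_intros)
  hence "\<forall>\<^sub>F z in at (0::complex). dist (exp z) 1 < 1 / 8" by (intro tendstoD) auto
  then obtain d where d: "0 < d" "\<And>z::complex. z \<noteq> 0 \<Longrightarrow> dist z 0 < d \<Longrightarrow> dist (exp z) 1 < 1 / 8"
    unfolding eventually_at by blast
  have expd: "norm (exp z - 1) \<le> 1 / 8" if "norm z < d" for z :: complex
    using d(2)[of z] that by (cases "z = 0") (auto simp: dist_norm)
  define M where "M = 5 / 2 * \<bar>K\<bar> + 9 / 4 * B + \<bar>K\<bar> + \<bar>K\<bar> ^ 2"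
  define K2 where "K2 = 2 * (2 * \<bar>K\<bar> + M)"
  define T0 where "T0 = max 1 (max (2 * \<bar>K\<bar> + 1) ((K2 + 1) / d))"
  have B0: "0 \<le> B" using V[of 0] norm_ge_zero order_trans by blast
  have M0: "0 \<le> M" using B0 by (simp add: M_def)
  have K20: "0 \<le> K2" using M0 by (simp add: K2_def)
  show thesis
  proof (rule that[of T0])
    fix T assume T: "T0 \<le> T" and "nearly_constant_product V K T"
    then obtain h h1 h2 q0 where h: "\<And>s. (h has_vector_derivative h1 s) (at s)" "\<And>s. (h1 has_vector_derivative h2 s) (at s)"
      and per: "\<And>s. h (s + 1) = h s"
      and bd: "\<And>s. norm (h s - 1) \<le> K / T\<^sup>2" "\<And>s. norm (h1 s) \<le> K / T\<^sup>2" "\<And>s. norm (h2 s) \<le> K / T\<^sup>2"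
      and q0: "\<And>s. q0 = h s ^ 2 * (V s + of_real (T\<^sup>2)) - h s * h2 s / 2 + h1 s ^ 2 / 4"
      unfolding nearly_constant_product_def by blast
    have T1: "1 \<le> T" "2 * \<bar>K\<bar> + 1 \<le> T" "(K2 + 1) / d \<le> T" using T unfolding T0_def by linarith+
    have TT: "T \<le> T\<^sup>2" using T1(1) by (simp add: power2_eq_square)
    define \<epsilon> where "\<epsilon> = \<bar>K\<bar> / T\<^sup>2"
    have "K / T\<^sup>2 \<le> \<epsilon>" by (simp add: \<epsilon>_def divide_right_mono)
    hence bd': "norm (h s - 1) \<le> \<epsilon>" "norm (h1 s) \<le> \<epsilon>" "norm (h2 s) \<le> \<epsilon>" for s
      using bd[of s] by (auto intro: order_trans)
    have eps: "0 \<le> \<epsilon>" "\<epsilon> \<le> 1 / 2" "\<epsilon> * T\<^sup>2 = \<bar>K\<bar>" "\<epsilon> * T \<le> \<bar>K\<bar>" "\<epsilon> \<le> \<bar>K\<bar>"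
    proof -
      have T2: "1 \<le> T\<^sup>2" "2 * \<bar>K\<bar> \<le> T\<^sup>2" using T1 TT by linarith+
      show "0 \<le> \<epsilon>" by (simp add: \<epsilon>_def)
      show "\<epsilon> \<le> 1 / 2" using T2 T1(1) divide_right_mono[OF T2(2), of "T\<^sup>2"] by (cases "T = 0") (auto simp: \<epsilon>_def)
      show e: "\<epsilon> * T\<^sup>2 = \<bar>K\<bar>" using T1(1) by (simp add: \<epsilon>_def)
      show "\<epsilon> * T \<le> \<bar>K\<bar>" using mult_left_mono[OF TT \<open>0 \<le> \<epsilon>\<close>] e by simp
      show "\<epsilon> \<le> \<bar>K\<bar>" using mult_left_mono[OF T2(1) \<open>0 \<le> \<epsilon>\<close>] e by simp
    qed
    have hn: "1 / 2 \<le> norm (h s)" "norm (h s) \<le> 3 / 2" for s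
      using bd'(1)[of s] eps norm_triangle_ineq2[of 1 "1 - h s"] norm_triangle_ineq2[of "h s" 1] by (auto simp: norm_minus_commute)
    hence nz: "h s \<noteq> 0" for s by (metis norm_zero not_one_le_zero half_gt_zero_iff linorder_not_less zero_less_one)
    \<comment> \<open>The sign selects the decaying solution; then |\<sigma> - T| >= T, and
      \<sigma>^2 - T^2 = (\<sigma> + T) (\<sigma> - T) bounds |\<sigma> + T|.\<close>
    define \<sigma> where "\<sigma> = (if Re (csqrt q0) \<le> 0 then csqrt q0 else - csqrt q0)"
    have sq: "\<sigma> ^ 2 = q0" and Re\<sigma>: "Re \<sigma> \<le> 0" by (auto simp: \<sigma>_def)
    have q0T: "norm (q0 - of_real (T\<^sup>2)) \<le> M"
    proof -
      define s :: real where "s = 0"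
      have "q0 - of_real (T\<^sup>2) = (h s - 1) * (h s + 1) * of_real (T\<^sup>2) + (h s ^ 2 * V s + (- (h s * h2 s / 2) + h1 s ^ 2 / 4))"
        unfolding q0[of s] by (simp add: algebra_simps power2_eq_square)
      also have "norm \<dots> \<le> norm (h s - 1) * norm (h s + 1) * T\<^sup>2 + (norm (h s) ^ 2 * norm (V s) + (norm (h s) * norm (h2 s) / 2 + norm (h1 s) ^ 2 / 4))"
        by (intro order_trans[OF norm_triangle_ineq] add_mono) (auto simp: norm_mult norm_power norm_divide)
      also have "\<dots> \<le> \<epsilon> * (5 / 2) * T\<^sup>2 + ((3 / 2) ^ 2 * B + (3 / 2 * \<epsilon> / 2 + \<epsilon> ^ 2 / 4))"
      proof -
        have "norm (h s + 1) \<le> 5 / 2" using hn(2)[of s] norm_triangle_ineq[of "h s" 1] by simp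
        thus ?thesis using bd'[of s] hn(2)[of s] V[of s] B0 eps(1) T1(1)
          by (intro add_mono mult_mono divide_right_mono power_mono) auto
      qed
      also have "\<dots> \<le> M"
      proof -
        have "\<epsilon> ^ 2 \<le> \<bar>K\<bar> ^ 2" by (intro power_mono eps)
        moreover have "\<epsilon> * (5 / 2) * T\<^sup>2 = 5 / 2 * \<bar>K\<bar>" using eps(3) by (simp add: mult_ac)
        moreover have "(3 / 2) ^ 2 * B = 9 / 4 * B" by (simp add: power2_eq_square)
        moreover have "0 \<le> \<epsilon> ^ 2" by simp
        moreover have "3 / 2 * \<epsilon> / 2 \<le> \<bar>K\<bar>" using eps(1,5) by simp
        ultimately show ?thesis unfolding M_def by linarith
      qed
      finally show ?thesis .
    qed
    have \<sigma>T: "norm (\<sigma> + of_real T) * T \<le> M"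
    proof -
      have "T \<le> - Re (\<sigma> - of_real T)" using Re\<sigma> by simp
      also have "\<dots> \<le> norm (\<sigma> - of_real T)" using abs_Re_le_cmod[of "\<sigma> - of_real T"] by linarith
      finally have "norm (\<sigma> + of_real T) * T \<le> norm (\<sigma> + of_real T) * norm (\<sigma> - of_real T)"
        by (intro mult_left_mono) auto
      also have "\<dots> = norm (q0 - of_real (T\<^sup>2))" by (simp flip: norm_mult sq) (simp add: algebra_simps power2_eq_square)
      finally show ?thesis using q0T by linarith
    qed
    have qT: "norm ((h1 s / 2 + \<sigma>) / h s + of_real T) * T \<le> K2" for s
    proof -
      have "(h1 s / 2 + \<sigma>) / h s + of_real T = (h1 s / 2 + ((\<sigma> + of_real T) + of_real T * (h s - 1))) / h s"
        using nz[of s] by (simp add: field_simps)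
      hence "norm ((h1 s / 2 + \<sigma>) / h s + of_real T) = norm (h1 s / 2 + ((\<sigma> + of_real T) + of_real T * (h s - 1))) / norm (h s)"
        by (simp add: norm_divide)
      also have "\<dots> \<le> (\<epsilon> / 2 + (norm (\<sigma> + of_real T) + T * \<epsilon>)) / (1 / 2)"
      proof (rule frac_le)
        have "norm (h1 s / 2) \<le> \<epsilon> / 2" using bd'(2)[of s] by (simp add: norm_divide)
        moreover have "norm (of_real T * (h s - 1)) \<le> T * \<epsilon>"
          unfolding norm_mult using bd'(1)[of s] T1 by (intro mult_mono) auto
        ultimately show "norm (h1 s / 2 + ((\<sigma> + of_real T) + of_real T * (h s - 1))) \<le> \<epsilon> / 2 + (norm (\<sigma> + of_real T) + T * \<epsilon>)"
          by (intro order_trans[OF norm_triangle_ineq] add_mono order_refl)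
      qed (use hn eps T1 in auto)
      finally have "norm ((h1 s / 2 + \<sigma>) / h s + of_real T) * T \<le> (\<epsilon> / 2 + (norm (\<sigma> + of_real T) + T * \<epsilon>)) / (1 / 2) * T"
        using T1 by (intro mult_right_mono) auto
      also have "\<dots> = \<epsilon> * T + 2 * (norm (\<sigma> + of_real T) * T) + 2 * (\<epsilon> * T\<^sup>2)" by (simp add: algebra_simps power2_eq_square)
      also have "\<dots> \<le> K2" using eps(3,4) \<sigma>T unfolding K2_def by (simp add: algebra_simps)
      finally show ?thesis .
    qed
    have K2T: "K2 / T < d"
    proof -
      have "K2 + 1 \<le> T * d" using T1(3) d(1) by (simp add: field_simps)
      hence "K2 < T * d" by linarith
      thus ?thesis using T1(1) by (simp add: pos_divide_less_eq mult.commute)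
    qed
    have Q: "\<sigma> ^ 2 = h s ^ 2 * (V s + of_real (T\<^sup>2)) - h s * h2 s / 2 + h1 s ^ 2 / 4" for s using sq q0 by simp
    obtain P f m where f: "\<And>s. (f has_vector_derivative ((h1 s / 2 + \<sigma>) / h s) * f s) (at s)"
      "\<And>s. ((\<lambda>s. ((h1 s / 2 + \<sigma>) / h s) * f s) has_vector_derivative (V s + of_real (T\<^sup>2)) * f s) (at s)"
      "\<And>s. f (s + 1) = m * f s" "f = (\<lambda>s. exp (P s))" "P 0 = 0"
      and P: "\<And>s. (P has_vector_derivative (h1 s / 2 + \<sigma>) / h s) (at s)"
      by (rule bloch_from_product[OF h nz per Q]) blast
    have "norm (f t * exp (of_real (T * t)) - 1) \<le> 1 / 8" if t: "t \<in> {0..1}" for t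
    proof -
      have dP: "((\<lambda>t. P t + of_real t * of_real T) has_vector_derivative (h1 s / 2 + \<sigma>) / h s + of_real T) (at s within {0..1})" for s
        by (intro has_vector_derivative_add has_vector_derivative_at_within[OF P]) (auto intro!: derivative_eq_intros)
      have "norm ((P t + of_real t * of_real T) - (P 0 + of_real 0 * of_real T)) \<le> K2 / T * norm (t - 0)"
      proof (rule differentiable_bound[of "{0..1}"])
        fix s :: real assume "s \<in> {0..1}"
        show "((\<lambda>t. P t + of_real t * of_real T) has_derivative (\<lambda>x. x *\<^sub>R ((h1 s / 2 + \<sigma>) / h s + of_real T))) (at s within {0..1})"
          using dP[of s] by (simp add: has_vector_derivative_def)
        have "norm ((h1 s / 2 + \<sigma>) / h s + of_real T) \<le> K2 / T" using qT[of s] T1(1) by (simp add: field_simps)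
        thus "onorm (\<lambda>x. x *\<^sub>R ((h1 s / 2 + \<sigma>) / h s + of_real T)) \<le> K2 / T"
          by (simp add: onorm_scaleR_left onorm_id bounded_linear_ident)
      qed (use t in auto)
      also have "\<dots> \<le> K2 / T * 1" using t K20 T1 by (intro mult_left_mono) auto
      finally have "norm (P t + of_real t * of_real T) < d" using K2T f(5) by simp
      from expd[OF this] show ?thesis unfolding f(4) by (simp add: exp_add mult.commute)
    qed
    moreover have "f 0 = 1" using f(4,5) by simp
    ultimately show "\<exists>f f1 m. decaying_bloch V T f f1 m"
      unfolding decaying_bloch_def using f(1-3)
      by (intro exI[of _ f] exI[of _ "\<lambda>s. ((h1 s / 2 + \<sigma>) / h s) * f s"] exI[of _ m]) simp
  qed
qed

lemma periodic_bounded: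
  fixes f :: "real \<Rightarrow> complex"
  assumes c: "continuous_on {0..1} f" and per: "\<And>s. f (s + 1) = f s"
  obtains B where "\<And>s. norm (f s) \<le> B"
proof -
  have "bounded (f ` {0..1})" by (intro compact_imp_bounded compact_continuous_image c compact_Icc)
  then obtain B where B: "\<And>s. s \<in> {0..1} \<Longrightarrow> norm (f s) \<le> B" unfolding bounded_iff by blast
  have shift: "f (s + of_int n) = f s" for s n
  proof (induction n rule: int_induct[where k = 0])
    case (step1 n) thus ?case using per[of "s + of_int n"] by (simp add: algebra_simps)
  next
    case (step2 n) thus ?case using per[of "s + of_int (n - 1)"] by (simp add: algebra_simps)
  qed simp
  have "norm (f s) \<le> B" for s
  proof -
    have "f s = f (s + of_int (- \<lfloor>s\<rfloor>))" by (simp only: shift)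
    moreover have "s + of_int (- \<lfloor>s\<rfloor>) \<in> {0..1}" by simp linarith
    ultimately show ?thesis using B by metis
  qed
  thus thesis by (rule that)
qed

context weierstrass_kernel begin

lemma V_continuous: "continuous_on A Va" "continuous_on A Vb"
  unfolding Va_def Vb_def by (intro continuous_intros)+

lemma hill_trace_transfer:
  assumes large: "\<And>T. T1 \<le> T \<Longrightarrow> nearly_constant_product Vb K T"
  shows "hill_trace (\<lambda>s. Va s + \<kappa>) = hill_trace (\<lambda>s. Vb s + \<kappa>)"
proof -
  have wp_per: "wpX i (s + 1) = wpX i s" for i s
    using wp_periodic[OF p_in_L X_hp_notin_L, of s i] by (simp add: wpX_def X_def algebra_simps)
  have Vb_per: "Vb (s + 1) = Vb s" for s by (simp add: Vb_def wp_per)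
  obtain B where B: "\<And>s. norm (Vb s) \<le> B" using periodic_bounded[OF V_continuous(2) Vb_per] by blast
  \<comment> \<open>The regular factors of the integrand of F 0, what is left of it besides (sin
    \<theta> cos \<theta>)^(2 j) and f; \<open>G 0\<close> is non-zero as twice a product of
    exponentials.\<close>
  define G where "G \<theta> = 2 * (\<rho> ((sin \<theta>)\<^sup>2) * exp (g 0 ((sin \<theta>)\<^sup>2)))" for \<theta>
  have Gc: "continuous_on {0..pi/2} G"
    unfolding G_def using sin_sq_range by (intro continuous_intros) auto
  have G0: "G 0 \<noteq> 0" by (simp add: G_def \<rho>_def)
  obtain T2 where T2: "\<And>T f. T2 \<le> T \<Longrightarrow> continuous_on {0..1} f \<Longrightarrow>
      (\<And>t. t \<in> {0..1} \<Longrightarrow> norm (f t * exp (of_real (T * t)) - 1) \<le> 1 / 8) \<Longrightarrow>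
      integral {0..pi/2} (\<lambda>\<theta>. of_real ((sin \<theta> * cos \<theta>) ^ (2 * j)) * G \<theta> * f ((sin \<theta>)\<^sup>2)) \<noteq> 0"
    using laplace_nonzero[OF Gc G0, of j] by blast
  obtain T3 where T3: "\<And>T. T3 \<le> T \<Longrightarrow> nearly_constant_product Vb K T \<Longrightarrow> \<exists>f f1 m. decaying_bloch Vb T f f1 m"
    using large_bloch[of Vb B K, OF B] by blast
  define T0 where "T0 = max 1 (max T1 (max T2 T3))"
  have eq: "hill_trace (\<lambda>s. Va s + of_real (T\<^sup>2)) = hill_trace (\<lambda>s. Vb s + of_real (T\<^sup>2))" if T: "T0 \<le> T" for T
  proof -
    have TT: "T1 \<le> T" "T2 \<le> T" "T3 \<le> T" using T by (auto simp: T0_def)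
    obtain f f1 m where bloch: "decaying_bloch Vb T f f1 m" using T3[OF TT(3) large[OF TT(1)]] by blast
    hence f: "\<And>s. (f has_vector_derivative f1 s) (at s)"
      "\<And>s. (f1 has_vector_derivative (Vb s + of_real (T\<^sup>2)) * f s) (at s)" "\<And>s. f (s + 1) = m * f s" "f 0 = 1"
      "\<And>t. t \<in> {0..1} \<Longrightarrow> norm (f t * exp (of_real (T * t)) - 1) \<le> 1 / 8" by (auto simp: decaying_bloch_def)
    have fc: "continuous_on {0..1} f"
      by (rule continuous_on_vector_derivative; rule has_vector_derivative_at_within; rule f)
    obtain F F1 where F: "hill_sol (\<lambda>s. Va s + of_real (T\<^sup>2)) F F1" "F 1 = m * F 0" "F1 1 = m * F1 0"
      and F0: "F 0 = integral {0..pi/2} (\<lambda>\<theta>. om \<theta> * exp (g 0 ((sin \<theta>)\<^sup>2)) * f ((sin \<theta>)\<^sup>2))"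
      by (rule kernel_transform[OF f(1-3)])
    have "F 0 = integral {0..pi/2} (\<lambda>\<theta>. of_real ((sin \<theta> * cos \<theta>) ^ (2 * j)) * G \<theta> * f ((sin \<theta>)\<^sup>2))"
      unfolding F0 om_def G_def by (simp add: mult_ac)
    hence "F 0 \<noteq> 0" using T2[OF TT(2) fc f(5)] by simp
    have ca: "continuous_on {0..1} (\<lambda>s. Va s + of_real (T\<^sup>2))" by (intro continuous_intros V_continuous)
    have "hill_trace (\<lambda>s. Va s + of_real (T\<^sup>2)) = m + 1 / m"
      by (rule hill_bloch_trace(2)[OF ca F]) (use \<open>F 0 \<noteq> 0\<close> in simp)
    thus ?thesis using decaying_bloch_trace(2)[OF bloch V_continuous(2)] by simp
  qed
  define D where "D \<kappa> = hill_trace (\<lambda>s. Va s + \<kappa>) - hill_trace (\<lambda>s. Vb s + \<kappa>)" for \<kappa>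
  have hol: "D holomorphic_on UNIV"
    unfolding D_def[abs_def] by (intro holomorphic_on_diff hill_trace_holomorphic V_continuous)
  \<comment> \<open>The ray of parameters on which the traces agree; it accumulates at its end
    point, as the identity theorem requires.\<close>
  define U where "U = (\<lambda>T. complex_of_real (T\<^sup>2)) ` {T0..}"
  have "D \<kappa> = 0"
  proof (rule analytic_continuation[OF hol open_UNIV connected_UNIV, of U "of_real (T0\<^sup>2)"])
    have "((\<lambda>T. complex_of_real (T\<^sup>2)) \<longlongrightarrow> of_real (T0\<^sup>2)) (at_right T0)" by (intro tendsto_intros)
    show "of_real (T0\<^sup>2) islimpt U"
      unfolding islimpt_def
    proof (intro allI impI)
      fix W assume W: "complex_of_real (T0\<^sup>2) \<in> W" "open W"
      have "\<forall>\<^sub>F T in at_right T0. complex_of_real (T\<^sup>2) \<in> W"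
        using \<open>((\<lambda>T. complex_of_real (T\<^sup>2)) \<longlongrightarrow> of_real (T0\<^sup>2)) (at_right T0)\<close> W by (auto dest: topological_tendstoD)
      moreover have "\<forall>\<^sub>F T in at_right T0. T0 < T" by (simp add: eventually_at_filter)
      ultimately have "\<forall>\<^sub>F T in at_right T0. complex_of_real (T\<^sup>2) \<in> W \<and> T0 < T" by (rule eventually_conj)
      then obtain T where T: "complex_of_real (T\<^sup>2) \<in> W" "T0 < T"
        by (metis (mono_tags, lifting) eventually_happens trivial_limit_at_right_real)
      have "T0\<^sup>2 < T\<^sup>2" using T(2) by (intro power_strict_mono) (auto simp: T0_def)
      hence "complex_of_real (T\<^sup>2) \<noteq> of_real (T0\<^sup>2)" by (metis less_irrefl of_real_eq_iff)
      thus "\<exists>y\<in>U. y \<in> W \<and> y \<noteq> complex_of_real (T0\<^sup>2)" using T by (auto simp: U_def)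
    qed
  qed (use eq in \<open>auto simp: U_def D_def\<close>)
  thus ?thesis by (simp add: D_def)
qed

end

subsection \<open>The doubly periodic solution\<close>

lemma higher_deriv_sum:
  assumes "finite I" "\<And>i. i \<in> I \<Longrightarrow> f i holomorphic_on S" "open S" "z \<in> S"
  shows "(deriv ^^ m) (\<lambda>z. \<Sum>i\<in>I. f i z) z = (\<Sum>i\<in>I. (deriv ^^ m) (f i) z)"
  using assms(1,2)
proof (induction I rule: finite_induct)
  case (insert i I)
  have "(deriv ^^ m) (\<lambda>z. f i z + (\<Sum>i\<in>I. f i z)) z = (deriv ^^ m) (f i) z + (deriv ^^ m) (\<lambda>z. \<Sum>i\<in>I. f i z) z"
    by (rule higher_deriv_add[OF _ _ assms(3,4)]) (use insert in \<open>auto intro!: holomorphic_intros\<close>)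
  thus ?case using insert by simp
qed simp

lemma poly_eq_sum_le:
  fixes q :: "complex poly"
  assumes "degree q \<le> N" shows "poly q x = (\<Sum>k\<le>N. coeff q k * x ^ k)"
proof -
  have "poly q x = (\<Sum>k\<le>degree q. coeff q k * x ^ k)" by (rule poly_altdef)
  also have "\<dots> = (\<Sum>k\<le>N. coeff q k * x ^ k)"
    by (rule sum.mono_neutral_left) (use assms in \<open>auto simp: coeff_eq_0\<close>)
  finally show ?thesis .
qed

context weierstrass begin

lemma hp_diff_notin_L: assumes "i \<le> 3" "i0 \<le> 3" "i \<noteq> i0" shows "hp i - hp i0 \<notin> L"
proof -
  have h0: "hp 0 = 0" by (simp add: half_period_def)
  have "i \<in> {1, 2, 3} \<or> i = 0" "i0 \<in> {1, 2, 3} \<or> i0 = 0" using assms by auto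
  thus ?thesis using hp_notin_L[of i] hp_notin_L[of i0] hp_add_notin_L(2)[of i i0] assms(3) by (auto simp: h0)
qed

lemma wp_at_infinity: "filterlim (\<lambda>x. wp (x + hp i)) at_infinity (at (- hp i))"
proof -
  have "filterlim (\<lambda>z. (z ^ 2 * wp z) / z ^ 2) at_infinity (at 0)"
    by (rule filterlim_divide_at_infinity[OF wp_times_square_tendsto])
       (auto intro!: filterlim_atI tendsto_eq_intros simp: eventually_at_filter)
  hence "filterlim wp at_infinity (at 0)"
    by (rule filterlim_cong[OF refl refl, THEN iffD1, rotated]) (auto simp: eventually_at_filter)
  moreover have "filterlim (\<lambda>x. x + hp i) (at 0) (at (- hp i))"
    by (rule filterlim_atI) (auto intro!: tendsto_eq_intros simp: eventually_at_filter add_eq_0_iff2)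
  ultimately show ?thesis by (rule filterlim_compose)
qed

text \<open>Near the pole - \<open>hp i0\<close> only the block of i0 can be unbounded. It is a
  polynomial in \<wp>(x + \<open>hp i0\<close>), which tends to infinity, so the polynomial is
  constant; its powers being at least 1, the coefficients vanish.\<close>

lemma wp_combination_constant:
  fixes \<beta> :: "nat \<Rightarrow> nat \<Rightarrow> complex" and n :: "nat \<Rightarrow> nat"
  assumes const: "\<And>x. x \<notin> H \<Longrightarrow> (\<Sum>i\<le>3. \<Sum>j<n i. \<beta> i j * wp (x + hp i) ^ (n i - j)) = C"
    and i0: "i0 \<le> 3" and j0: "j0 < n i0"
  shows "\<beta> i0 j0 = 0"
proof -
  define F where "F i x = (\<Sum>j<n i. \<beta> i j * wp (x + hp i) ^ (n i - j))" for i x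
  define q where "q = (\<Sum>j<n i0. monom (\<beta> i0 j) (n i0 - j))"
  have Fq: "F i0 x = poly q (wp (x + hp i0))" for x
    by (simp add: F_def q_def poly_sum poly_monom)
  have lim: "(F i \<longlongrightarrow> F i (- hp i0)) (at (- hp i0))" if "i \<le> 3" "i \<noteq> i0" for i
  proof -
    have "isCont (\<lambda>x. wp (x + hp i)) (- hp i0)"
      by (rule isCont_o2[OF _ wp_continuous]) (use hp_diff_notin_L[OF that(1) i0 that(2)] in \<open>auto intro!: continuous_intros\<close>)
    hence "isCont (F i) (- hp i0)" unfolding F_def[abs_def] by (intro continuous_intros)
    thus ?thesis by (simp add: isCont_def)
  qed
  have "((\<lambda>x. C - (\<Sum>i\<in>{..3} - {i0}. F i x)) \<longlongrightarrow> C - (\<Sum>i\<in>{..3} - {i0}. F i (- hp i0))) (at (- hp i0))"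
    by (intro tendsto_intros lim) auto
  moreover have "\<forall>\<^sub>F x in at (- hp i0). C - (\<Sum>i\<in>{..3} - {i0}. F i x) = F i0 x"
    using eventually_not_H[of "- hp i0"]
  proof eventually_elim
    case (elim x)
    have "F i0 x + (\<Sum>i\<in>{..3} - {i0}. F i x) = C"
      using const[OF elim] sum.remove[of "{..3}" i0 "\<lambda>i. F i x"] i0 by (simp add: F_def)
    thus ?case by (simp add: algebra_simps)
  qed
  ultimately have lim0: "(F i0 \<longlongrightarrow> C - (\<Sum>i\<in>{..3} - {i0}. F i (- hp i0))) (at (- hp i0))"
    by (rule Lim_transform_eventually)
  have "degree q = 0"
  proof (rule ccontr)
    assume "degree q \<noteq> 0"
    hence "filterlim (poly q) at_infinity at_infinity" by (intro filterlim_poly_at_infinity) simp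
    from filterlim_compose[OF this wp_at_infinity] have "filterlim (F i0) at_infinity (at (- hp i0))"
      by (simp add: Fq[abs_def])
    with lim0 show False using not_tendsto_and_filterlim_at_infinity trivial_limit_at by blast
  qed
  hence "coeff q (n i0 - j0) = 0" using j0 by (simp add: coeff_eq_0)
  moreover have "coeff q (n i0 - j0) = (\<Sum>j<n i0. if j = j0 then \<beta> i0 j else 0)"
    unfolding q_def coeff_sum coeff_monom using j0 by (intro sum.cong) auto
  ultimately show ?thesis using j0 by simp
qed

lemma wp_shift_holomorphic: "(\<lambda>x. wp (x + hp i)) holomorphic_on - H"
proof -
  have "wp \<circ> (\<lambda>x. x + hp i) holomorphic_on - H"
    by (rule holomorphic_on_compose_gen[OF _ wp_holomorphic])
       (use notin_H_imp_notin_L H_add_hp(1) in \<open>auto intro!: holomorphic_intros\<close>)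
  thus ?thesis by (simp add: o_def)
qed

lemma potential_holomorphic: "potential \<omega>\<^sub>1 \<omega>\<^sub>3 c holomorphic_on - H"
  unfolding potential_def[abs_def] by (intro holomorphic_intros wp_shift_holomorphic)

end

section \<open>The doubly periodic solution as a polynomial in E\<close>

locale finite_gap = weierstrass +
  fixes l :: "nat \<Rightarrow> int" and c\<^sub>0 :: "complex poly" and b :: "nat \<Rightarrow> nat \<Rightarrow> complex poly" and Q :: "complex poly"
  assumes Xi: "is_Xi \<omega>\<^sub>1 \<omega>\<^sub>3 l c\<^sub>0 b" and Q: "is_Q \<omega>\<^sub>1 \<omega>\<^sub>3 l c\<^sub>0 b Q"
begin

abbreviation "n \<equiv> pole_count l"
definition u where "u = potential \<omega>\<^sub>1 \<omega>\<^sub>3 (\<lambda>i. of_int (l i))"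
definition h where "h = Xi_fun \<omega>\<^sub>1 \<omega>\<^sub>3 l c\<^sub>0 b"
definition xi where "xi k x = coeff c\<^sub>0 k + (\<Sum>i\<le>3. \<Sum>j<n i. coeff (b i j) k * wp (x + hp i) ^ (n i - j))"

lemma h_ode: "x \<notin> H \<Longrightarrow> (deriv ^^ 3) (h E) x - 4 * (u x - E) * deriv (h E) x - 2 * deriv u x * h E x = 0"
  using Xi by (simp add: is_Xi_def h_def u_def Let_def)

lemma Q_eq: "x \<notin> H \<Longrightarrow> poly Q E = (h E x) ^ 2 * (E - u x) + 1 / 2 * h E x * (deriv ^^ 2) (h E) x - 1 / 4 * (deriv (h E) x) ^ 2"
  using Q by (simp add: is_Q_def h_def u_def Let_def)

lemma xi_holomorphic: "xi k holomorphic_on - H"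
  unfolding xi_def[abs_def] by (intro holomorphic_intros wp_shift_holomorphic)

lemma h_holomorphic: "h E holomorphic_on - H"
  unfolding h_def Xi_fun_def[abs_def] by (intro holomorphic_intros wp_shift_holomorphic)

lemma u_holomorphic: "u holomorphic_on - H"
  unfolding u_def by (rule potential_holomorphic)

lemma h_eq_sum_xi:
  assumes "degree c\<^sub>0 \<le> N" "\<And>i j. i \<le> 3 \<Longrightarrow> j < n i \<Longrightarrow> degree (b i j) \<le> N"
  shows "h E x = (\<Sum>k\<le>N. E ^ k * xi k x)"
proof -
  have "h E x = (\<Sum>k\<le>N. coeff c\<^sub>0 k * E ^ k) + (\<Sum>i\<le>3. \<Sum>j<n i. (\<Sum>k\<le>N. coeff (b i j) k * E ^ k) * wp (x + hp i) ^ (n i - j))"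
    unfolding h_def Xi_fun_def using assms by (simp add: poly_eq_sum_le[of _ N])
  also have "(\<Sum>i\<le>3. \<Sum>j<n i. (\<Sum>k\<le>N. coeff (b i j) k * E ^ k) * wp (x + hp i) ^ (n i - j))
      = (\<Sum>k\<le>N. \<Sum>i\<le>3. \<Sum>j<n i. coeff (b i j) k * E ^ k * wp (x + hp i) ^ (n i - j))"
    unfolding sum_distrib_right by (subst (2) sum.swap, subst sum.swap) (rule refl)
  finally show ?thesis by (simp add: xi_def sum.distrib distrib_left sum_distrib_left mult_ac)
qed

lemma h_higher_deriv_sum_xi:
  assumes "degree c\<^sub>0 \<le> N" "\<And>i j. i \<le> 3 \<Longrightarrow> j < n i \<Longrightarrow> degree (b i j) \<le> N" and x: "x \<notin> H"
  shows "(deriv ^^ m) (h E) x = (\<Sum>k\<le>N. E ^ k * (deriv ^^ m) (xi k) x)"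
proof -
  have h: "h E = (\<lambda>x. \<Sum>k\<le>N. E ^ k * xi k x)" by (rule ext, rule h_eq_sum_xi) (fact assms)+
  have "(deriv ^^ m) (h E) x = (\<Sum>k\<le>N. (deriv ^^ m) (\<lambda>x. E ^ k * xi k x) x)"
    unfolding h by (rule higher_deriv_sum[of _ _ "- H"]) (use x in \<open>auto intro!: holomorphic_intros xi_holomorphic\<close>)
  also have "\<dots> = (\<Sum>k\<le>N. E ^ k * (deriv ^^ m) (xi k) x)"
    by (intro sum.cong refl higher_deriv_cmult[OF xi_holomorphic]) (use x in auto)
  finally show ?thesis .
qed

text \<open>The coefficient of E^(N + 1) in the third-order equation is 4 times the derivative of
  the top coefficient \<open>xi N\<close>, which is therefore constant in x; by
  \<open>wp_combination_constant\<close> no b reaches degree N. Hence \<open>c\<^sub>0\<close> alone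
  carries the top degree d, and \<Xi> / E^d tends to 1 for large E.\<close>

lemma coeff_b_eq_0:
  assumes "i \<le> 3" "j < n i" "degree c\<^sub>0 \<le> k" shows "coeff (b i j) k = 0"
proof -
  define A where "A = insert (degree c\<^sub>0) ((\<lambda>(i, j). degree (b i j)) ` Sigma {..3} (\<lambda>i. {..<n i}))"
  define N where "N = Max A"
  have finA: "finite A" unfolding A_def by auto
  have degN: "degree c\<^sub>0 \<le> N" "\<And>i j. i \<le> 3 \<Longrightarrow> j < n i \<Longrightarrow> degree (b i j) \<le> N"
    unfolding N_def by (auto intro!: Max_ge finA simp: A_def)
  have hd: "(deriv ^^ m) (h E) x = (\<Sum>k\<le>N. E ^ k * (deriv ^^ m) (xi k) x)" if "x \<notin> H" for m E x
    by (rule h_higher_deriv_sum_xi) (fact degN that)+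
  have d0: "deriv (xi N) x = 0" if x: "x \<notin> H" for x
  proof -
    define P where "P = (\<Sum>k\<le>N. monom ((deriv ^^ 3) (xi k) x - 4 * u x * deriv (xi k) x - 2 * deriv u x * xi k x) k
        + monom (4 * deriv (xi k) x) (Suc k))"
    have "poly P E = 0" for E
    proof -
      have "poly P E = (\<Sum>k\<le>N. E ^ k * (deriv ^^ 3) (xi k) x) - 4 * (u x - E) * (\<Sum>k\<le>N. E ^ k * deriv (xi k) x)
          - 2 * deriv u x * (\<Sum>k\<le>N. E ^ k * xi k x)"
        unfolding P_def poly_sum poly_add poly_monom sum_distrib_left sum_subtractf[symmetric]
        by (intro sum.cong refl) (simp add: algebra_simps)
      also have "\<dots> = (deriv ^^ 3) (h E) x - 4 * (u x - E) * deriv (h E) x - 2 * deriv u x * h E x"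
        using hd[OF x, of 0 E] hd[OF x, of 1 E] hd[OF x, of 3 E] by simp
      finally show ?thesis using h_ode[OF x] by simp
    qed
    hence "P = 0" using poly_all_0_iff_0 by blast
    hence "coeff P (Suc N) = 0" by simp
    moreover have "coeff P (Suc N) = (\<Sum>k\<le>N. if k = N then 4 * deriv (xi k) x else 0)"
      unfolding P_def coeff_sum coeff_add coeff_monom by (intro sum.cong refl) auto
    ultimately show ?thesis by simp
  qed
  have "xi N constant_on - H"
    by (rule DERIV_zero_connected_constant_on[OF connected_Compl_H open_Compl_H finite.emptyI])
       (use d0 in \<open>auto intro!: holomorphic_on_imp_continuous_on xi_holomorphic holomorphic_derivI[OF xi_holomorphic open_Compl_H, THEN DERIV_cong]\<close>)
  then obtain C where C: "\<And>x. x \<notin> H \<Longrightarrow> xi N x = C" by (auto simp: constant_on_def)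
  have bN: "coeff (b i j) N = 0" if "i \<le> 3" "j < n i" for i j
    by (rule wp_combination_constant[where n = n and C = "C - coeff c\<^sub>0 N", OF _ that])
       (use C in \<open>simp add: xi_def algebra_simps\<close>)
  have N: "N = degree c\<^sub>0"
  proof (rule ccontr)
    assume ne: "N \<noteq> degree c\<^sub>0"
    have "N \<in> A" unfolding N_def by (rule Max_in[OF finA]) (simp add: A_def)
    then obtain i j where ij: "i \<le> 3" "j < n i" "N = degree (b i j)" using ne by (auto simp: A_def)
    hence "lead_coeff (b i j) = 0" using bN by simp
    hence "N = 0" using ij by simp
    thus False using ne degN(1) by simp
  qed
  show ?thesis
  proof (cases "k = N")
    case False
    thus ?thesis using assms(3) degN(2)[OF assms(1,2)] N by (intro coeff_eq_0) simp
  qed (use bN assms in simp)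
qed

lemma xi_degree: "xi (degree c\<^sub>0) = (\<lambda>_. 1)"
  using Xi coeff_b_eq_0 by (auto simp: xi_def is_Xi_def)

lemma degree_b_le: "i \<le> 3 \<Longrightarrow> j < n i \<Longrightarrow> degree (b i j) \<le> degree c\<^sub>0"
  using coeff_b_eq_0 by (intro degree_le) auto

lemma h_higher_deriv:
  assumes "x \<notin> H" shows "(deriv ^^ m) (h E) x = (\<Sum>k\<le>degree c\<^sub>0. E ^ k * (deriv ^^ m) (xi k) x)"
  by (rule h_higher_deriv_sum_xi[OF order_refl degree_b_le assms])

text \<open>If \<Xi>(., E) vanished identically, all coefficients would have the root E in common,
  against their coprimality.\<close>

lemma h_nonzero: obtains x where "x \<notin> H" "h E x \<noteq> 0"
proof (rule ccontr)
  assume "\<not> thesis"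
  hence z: "\<And>x. x \<notin> H \<Longrightarrow> h E x = 0" using that by blast
  have b0: "poly (b i j) E = 0" if "i \<le> 3" "j < n i" for i j
    by (rule wp_combination_constant[where n = n and C = "- poly c\<^sub>0 E", OF _ that])
       (use z in \<open>simp add: h_def Xi_fun_def add_eq_0_iff\<close>)
  obtain x where x: "x \<notin> H" using countable_H uncountable_UNIV_complex by (metis UNIV_eq_I)
  have c0: "poly c\<^sub>0 E = 0" using z[OF x] b0 by (simp add: h_def Xi_fun_def)
  have "is_unit [:- E, 1:]"
  proof -
    have "[:- E, 1:] dvd c\<^sub>0" "\<And>i j. i \<le> 3 \<Longrightarrow> j < n i \<Longrightarrow> [:- E, 1:] dvd b i j"
      using b0 c0 by (simp_all add: poly_eq_0_iff_dvd)
    thus ?thesis using Xi unfolding is_Xi_def by blast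
  qed
  thus False by (simp add: is_unit_iff_degree)
qed

lemma h_periodic:
  assumes "v \<in> L" "z \<notin> H" shows "h E (z + v) = h E z" "u (z + v) = u z" "xi k (z + v) = xi k z"
proof -
  have "wp (z + v + hp i) = wp (z + hp i)" for i
  proof -
    have "z + hp i \<notin> L" using assms(2) notin_H_imp_notin_L by (metis H_add_hp(1))
    from wp_periodic[OF assms(1) this] show ?thesis by (simp add: algebra_simps)
  qed
  thus "h E (z + v) = h E z" "u (z + v) = u z" "xi k (z + v) = xi k z"
    by (simp_all add: h_def Xi_fun_def u_def potential_def xi_def)
qed

end

locale finite_gap_line = finite_gap + weierstrass_line
begin

definition V where "V s = p ^ 2 * u (X s)"

lemma holomorphic_along_X:
  assumes "f holomorphic_on - H"
  shows "((\<lambda>s. f (X s)) has_vector_derivative p * deriv f (X s)) (at s within A)"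
  unfolding X_def
  by (rule has_vector_derivative_along_line, rule holomorphic_derivI[OF assms open_Compl_H])
     (use X_notin_H[of s] in \<open>simp add: X_def\<close>)

lemma holomorphic_along_X2:
  assumes "f holomorphic_on - H"
  shows "((\<lambda>s. p * deriv f (X s)) has_vector_derivative p * (p * (deriv ^^ 2) f (X s))) (at s within A)"
  using has_vector_derivative_mult_right[OF holomorphic_along_X[OF holomorphic_deriv[OF assms open_Compl_H]], of p]
  by (simp add: numeral_2_eq_2)

lemma X_add_1: "X (s + 1) = X s + p" by (simp add: X_def algebra_simps)

lemma h_along_X_periodic: "h E (X (s + 1)) = h E (X s)" "u (X (s + 1)) = u (X s)" "xi m (X (s + 1)) = xi m (X s)"
  using h_periodic[OF p_in_L X_notin_H] by (simp_all add: X_add_1)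

text \<open>For E = - T^2 / p^2 one has V + T^2 = p^2 (u - E), and \<Xi> / E^d is 1 plus a
  polynomial in 1 / E without constant term whose coefficients are periodic along the line, hence
  bounded together with their derivatives.\<close>

lemma large_energy: obtains T1 K where "\<And>T. T1 \<le> T \<Longrightarrow> nearly_constant_product V K T"
proof -
  define d where "d = degree c\<^sub>0"
  have bdd: "\<exists>B. \<forall>s. norm (xi k (X s)) \<le> B \<and> norm (p * deriv (xi k) (X s)) \<le> B \<and> norm (p * (p * (deriv ^^ 2) (xi k) (X s))) \<le> B" for k
  proof -
    note d1 = holomorphic_along_X[OF xi_holomorphic] and d2 = holomorphic_along_X2[OF xi_holomorphic]
    have per0: "xi k (X (s + 1)) = xi k (X s)" for s by (rule h_along_X_periodic(3))
    have per_deriv: "g1 (s + 1) = g1 s" if "\<And>s. (g has_vector_derivative g1 s) (at s)" "\<And>s. g (s + 1) = g s"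
      for g g1 :: "real \<Rightarrow> complex" and s
    proof -
      have "((\<lambda>s. g (s + 1)) has_vector_derivative g1 (s + 1)) (at s)"
        using has_vector_derivative_compose_linear[of g "g1 (s + 1)" 1 s 1] that(1) by simp
      hence "(g has_vector_derivative g1 (s + 1)) (at s)" by (simp add: that(2))
      thus ?thesis using that(1) by (rule vector_derivative_unique_at)
    qed
    note per1 = per_deriv[OF d1 per0]
    note per2 = per_deriv[OF d2 per1]
    have c0: "continuous_on {0..1} (\<lambda>s. xi k (X s))" by (rule continuous_on_vector_derivative[OF d1])
    have c1: "continuous_on {0..1} (\<lambda>s. p * deriv (xi k) (X s))" by (rule continuous_on_vector_derivative[OF d2])
    have "(deriv ^^ 2) (xi k) holomorphic_on - H" by (rule holomorphic_higher_deriv[OF xi_holomorphic open_Compl_H])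
    from continuous_on_vector_derivative[OF holomorphic_along_X[OF this]]
    have c2: "continuous_on {0..1} (\<lambda>s. p * (p * (deriv ^^ 2) (xi k) (X s)))" by (intro continuous_intros)
    obtain B0 where B0: "\<And>s. norm (xi k (X s)) \<le> B0" using periodic_bounded[OF c0 per0] by blast
    obtain B1 where B1: "\<And>s. norm (p * deriv (xi k) (X s)) \<le> B1" using periodic_bounded[OF c1 per1] by blast
    obtain B2 where B2: "\<And>s. norm (p * (p * (deriv ^^ 2) (xi k) (X s))) \<le> B2" using periodic_bounded[OF c2 per2] by blast
    show ?thesis
      by (rule exI[of _ "max B0 (max B1 B2)"]) (use B0 B1 B2 in \<open>auto simp: le_max_iff_disj\<close>)
  qed
  then obtain B where B: "\<And>k s. norm (xi k (X s)) \<le> B k" "\<And>k s. norm (p * deriv (xi k) (X s)) \<le> B k"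
    "\<And>k s. norm (p * (p * (deriv ^^ 2) (xi k) (X s))) \<le> B k" by metis
  have B0: "0 \<le> B k" for k using B(1)[of k 0] norm_ge_zero order_trans by blast
  \<comment> \<open>From 1 / |E| = |p|^2 / T^2; the bound T >= |p| built into \<open>T1\<close>
    ensures |E| >= 1.\<close>
  define K where "K = (\<Sum>k<d. B k) * norm p ^ 2"
  define T1 where "T1 = max 1 (norm p)"
  show thesis
  proof (rule that[of T1 K])
    fix T assume T: "T1 \<le> T"
    define E where "E = - of_real (T\<^sup>2) / p ^ 2"
    have p0: "p \<noteq> 0" by (rule p_nonzero)
    have T0: "1 \<le> T" "norm p \<le> T" using T by (auto simp: T1_def)
    have nE: "norm E = T\<^sup>2 / norm p ^ 2" by (simp add: E_def norm_divide norm_power)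
    have E1: "1 \<le> norm E" using T0 p0 power_mono[OF T0(2), of 2] by (simp add: nE field_simps)
    have E0: "E \<noteq> 0" using E1 by auto
    define g where "g s = h E (X s) / E ^ d" for s
    define g1 where "g1 s = p * deriv (h E) (X s) / E ^ d" for s
    define g2 where "g2 s = p * (p * (deriv ^^ 2) (h E) (X s)) / E ^ d" for s
    have small: "norm ((\<Sum>k<d. E ^ k * y k) / E ^ d) \<le> K / T\<^sup>2" if "\<And>k. norm (y k) \<le> B k" for y
    proof -
      have "norm ((\<Sum>k<d. E ^ k * y k) / E ^ d) = norm (\<Sum>k<d. E ^ k * y k / E ^ d)"
        by (simp add: sum_divide_distrib)
      also have "\<dots> \<le> (\<Sum>k<d. B k / norm E)"
      proof (rule sum_norm_le)
        fix k assume "k \<in> {..<d}"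
        hence k: "Suc k \<le> d" by simp
        have "norm (E ^ k) * norm E \<le> norm (E ^ d)"
          using power_increasing[OF k E1] by (simp add: norm_power mult.commute)
        hence "norm (E ^ k) / norm (E ^ d) \<le> 1 / norm E" using E0 E1 by (simp add: field_simps)
        hence "norm (E ^ k) / norm (E ^ d) * norm (y k) \<le> 1 / norm E * B k"
          using that[of k] by (intro mult_mono) auto
        thus "norm (E ^ k * y k / E ^ d) \<le> B k / norm E" by (simp add: norm_mult norm_divide)
      qed
      also have "\<dots> = K / T\<^sup>2" using p0 by (simp add: K_def nE sum_divide_distrib[symmetric] sum_distrib_right)
      finally show ?thesis .
    qed
    have hd: "(deriv ^^ m) (h E) x = (if m = 0 then E ^ d else 0) + (\<Sum>k<d. E ^ k * (deriv ^^ m) (xi k) x)"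
      if "x \<notin> H" for m x
      using h_higher_deriv[OF that, of m E] by (simp add: d_def xi_degree lessThan_Suc_atMost[symmetric])
    show "nearly_constant_product V K T"
      unfolding nearly_constant_product_def
    proof (rule exI[of _ g], rule exI[of _ g1], rule exI[of _ g2], rule exI[of _ "- (p ^ 2) * poly Q E / E ^ (2 * d)"], intro allI conjI)
      fix s
      show "(g has_vector_derivative g1 s) (at s)"
        unfolding g_def[abs_def] g1_def by (intro has_vector_derivative_divide holomorphic_along_X h_holomorphic)
      show "(g1 has_vector_derivative g2 s) (at s)"
        unfolding g1_def[abs_def] g2_def by (intro has_vector_derivative_divide holomorphic_along_X2 h_holomorphic)
      show "g (s + 1) = g s" by (simp add: g_def h_along_X_periodic)
      have "g s - 1 = (\<Sum>k<d. E ^ k * xi k (X s)) / E ^ d"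
        using E0 hd[OF X_notin_H, of 0 s] by (simp add: g_def field_simps)
      thus "norm (g s - 1) \<le> K / T\<^sup>2" using small[of "\<lambda>k. xi k (X s)"] B by simp
      have "g1 s = (\<Sum>k<d. E ^ k * (p * deriv (xi k) (X s))) / E ^ d"
        using hd[OF X_notin_H, of 1 s] by (simp add: g1_def sum_distrib_left mult_ac)
      thus "norm (g1 s) \<le> K / T\<^sup>2" using small[of "\<lambda>k. p * deriv (xi k) (X s)"] B by simp
      have "g2 s = (\<Sum>k<d. E ^ k * (p * (p * (deriv ^^ 2) (xi k) (X s)))) / E ^ d"
        using hd[OF X_notin_H, of 2 s] by (simp add: g2_def sum_distrib_left mult_ac)
      thus "norm (g2 s) \<le> K / T\<^sup>2" using small[of "\<lambda>k. p * (p * (deriv ^^ 2) (xi k) (X s))"] B by simp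
      have T2: "of_real (T\<^sup>2) = - (p ^ 2) * E" using p0 by (simp add: E_def)
      have Qs: "poly Q E = (h E (X s)) ^ 2 * (E - u (X s)) + 1 / 2 * h E (X s) * (deriv ^^ 2) (h E) (X s) - 1 / 4 * (deriv (h E) (X s)) ^ 2"
        by (rule Q_eq[OF X_notin_H])
      show "- (p ^ 2) * poly Q E / E ^ (2 * d) = g s ^ 2 * (V s + of_real (T\<^sup>2)) - g s * g2 s / 2 + g1 s ^ 2 / 4"
        unfolding Qs g_def g1_def g2_def V_def T2 using E0
        by (simp add: power_divide power_mult power2_eq_square field_simps)
    qed
  qed
qed

end

subsection \<open>The trace along a path in the spectral plane\<close>

text \<open>A function h satisfying the third-order equation is a combination of products of
  solutions. Dually it gives a bilinear form on solutions with coefficients h, - h' / 2 and q = h''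
  / 2 - w h, and the equations for h and q say that the form is conserved.\<close>

lemma product_form_invariant:
  assumes h: "\<And>s. s \<in> {0..1} \<Longrightarrow> (h has_vector_derivative h1 s) (at s within {0..1})"
    "\<And>s. s \<in> {0..1} \<Longrightarrow> (h1 has_vector_derivative 2 * (q s + w s * h s)) (at s within {0..1})"
    "\<And>s. s \<in> {0..1} \<Longrightarrow> (q has_vector_derivative w s * h1 s) (at s within {0..1})"
    and y: "hill_sol w y y'" and z: "hill_sol w z z'" and s: "s \<in> {0..1}"
  shows "h s * (y' s * z' s) - h1 s / 2 * (y s * z' s + y' s * z s) + q s * (y s * z s)
    = h 0 * (y' 0 * z' 0) - h1 0 / 2 * (y 0 * z' 0 + y' 0 * z 0) + q 0 * (y 0 * z 0)"
proof -
  define G where "G s = h s * (y' s * z' s) - h1 s / 2 * (y s * z' s + y' s * z s) + q s * (y s * z s)" for s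
  have "(G has_vector_derivative 0) (at r within {0..1})" if r: "r \<in> {0..1}" for r
  proof -
    have r1: "0 \<le> r" "r \<le> 1" using r by auto
    note y = hill_solD[OF y r1] and z = hill_solD[OF z r1]
    have "(G has_vector_derivative
        (h r * (y' r * (w r * z r) + w r * y r * z' r) + h1 r * (y' r * z' r))
        - (h1 r / 2 * (y r * (w r * z r) + y' r * z' r + (y' r * z' r + w r * y r * z r))
           + 2 * (q r + w r * h r) / 2 * (y r * z' r + y' r * z r))
        + (q r * (y r * z' r + y' r * z r) + w r * h1 r * (y r * z r))) (at r within {0..1})"
      unfolding G_def by (intro has_vector_derivative_add has_vector_derivative_diff has_vector_derivative_mult
        has_vector_derivative_divide h r y z)
    thus ?thesis by (rule has_vector_derivative_eq_rhs) (simp add: field_simps)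
  qed
  then obtain c where "\<And>r. r \<in> {0..1} \<Longrightarrow> G r = c"
    using has_vector_derivative_zero_constant[of "{0..1}" G] by (metis convex_real_interval(5))
  hence "G s = G 0" using s by simp
  thus ?thesis by (simp add: G_def)
qed

text \<open>Conservation of the form on the fundamental solutions. At s = 1, with periodic
  coefficients, it becomes invariance of the form under the monodromy matrix, which the determinant
  1 turns into relations linear in the entries.\<close>

lemma product_form_relations:
  assumes w: "continuous_on {0..1} w"
    and h: "\<And>s. s \<in> {0..1} \<Longrightarrow> (h has_vector_derivative h1 s) (at s within {0..1})"
    "\<And>s. s \<in> {0..1} \<Longrightarrow> (h1 has_vector_derivative 2 * (q s + w s * h s)) (at s within {0..1})"
    "\<And>s. s \<in> {0..1} \<Longrightarrow> (q has_vector_derivative w s * h1 s) (at s within {0..1})"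
  defines "A \<equiv> hill_y w 1 0" and "B \<equiv> hill_y w 0 1" and "C \<equiv> hill_dy w 1 0" and "D \<equiv> hill_dy w 0 1"
  shows "s \<in> {0..1} \<Longrightarrow> h s = h 0 * A s ^ 2 + h1 0 * (A s * B s) + q 0 * B s ^ 2"
    and "A 1 * D 1 - B 1 * C 1 = 1"
    and "h 1 = h 0 \<Longrightarrow> h1 1 = h1 0 \<Longrightarrow> q 1 = q 0 \<Longrightarrow> h 0 * C 1 = - (q 0 * B 1)"
    and "h 1 = h 0 \<Longrightarrow> h1 1 = h1 0 \<Longrightarrow> q 1 = q 0 \<Longrightarrow> h 0 * (D 1 - A 1) = h1 0 * B 1"
    and "h 1 = h 0 \<Longrightarrow> h1 1 = h1 0 \<Longrightarrow> q 1 = q 0 \<Longrightarrow> q 0 * (A 1 - D 1) = h1 0 * C 1"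
proof -
  note defs = A_def B_def C_def D_def
  have sol: "hill_sol w A C" "A 0 = 1" "C 0 = 0" "hill_sol w B D" "B 0 = 0" "D 0 = 1"
    unfolding defs by (rule hill_y[OF w])+
  have W: "A s * D s - C s * B s = 1" if "s \<in> {0..1}" for s
    using hill_wronskian[OF sol(1,4), of s] that sol by simp
  have inv: "h s * (C s * C s) - h1 s / 2 * (A s * C s + C s * A s) + q s * (A s * A s) = q 0"
    "h s * (C s * D s) - h1 s / 2 * (A s * D s + C s * B s) + q s * (A s * B s) = - h1 0 / 2"
    "h s * (D s * D s) - h1 s / 2 * (B s * D s + D s * B s) + q s * (B s * B s) = h 0" if s: "s \<in> {0..1}" for s
    using product_form_invariant[OF h sol(1) sol(1) s] product_form_invariant[OF h sol(1) sol(4) s]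
      product_form_invariant[OF h sol(4) sol(4) s] sol by simp_all
  have aux: "x = Q2 * a ^ 2 + m * (a * b) + Q0 * b ^ 2"
    if "a * d - c * b = 1" "x * (c * c) - x1 / 2 * (a * c + c * a) + y * (a * a) = Q0"
      "x * (c * d) - x1 / 2 * (a * d + c * b) + y * (a * b) = - m / 2"
      "x * (d * d) - x1 / 2 * (b * d + d * b) + y * (b * b) = Q2" for a b c d x x1 y m Q0 Q2 :: complex
  proof -
    have m: "m = - 2 * (x * (c * d)) + x1 * (a * d + c * b) - 2 * (y * (a * b))" using that(3) by (simp add: field_simps)
    have "Q2 * a ^ 2 + m * (a * b) + Q0 * b ^ 2 = x * (a * d - c * b) ^ 2"
      unfolding that(2)[symmetric] that(4)[symmetric] m by (simp add: power2_eq_square field_simps)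
    thus ?thesis using that(1) by simp
  qed
  show "h s = h 0 * A s ^ 2 + h1 0 * (A s * B s) + q 0 * B s ^ 2" if s: "s \<in> {0..1}"
    by (rule aux[OF W[OF s] inv[OF s]])
  show W1: "A 1 * D 1 - B 1 * C 1 = 1" using W[of 1] by (simp add: mult.commute)
  have rel: "x * c = - (y * b) \<and> x * (d - a) = m * b \<and> y * (a - d) = m * c"
    if "a * d - b * c = 1" "x * (c * c) - m / 2 * (a * c + c * a) + y * (a * a) = y"
      "x * (c * d) - m / 2 * (a * d + c * b) + y * (a * b) = - m / 2"
      "x * (d * d) - m / 2 * (b * d + d * b) + y * (b * b) = x" for a b c d x y m :: complex
  proof -
    define m' where "m' = m / 2"
    have "m = 2 * m'" "x * (c * c) - m' * (a * c + c * a) + y * (a * a) = y"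
      "x * (c * d) - m' * (a * d + c * b) + y * (a * b) = - m'"
      "x * (d * d) - m' * (b * d + d * b) + y * (b * b) = x"
      using that(2-4) by (simp_all add: m'_def)
    hence "x * c = - (y * b)" "x * (d - a) = m * b" "y * (a - d) = m * c"
      using that(1) by algebra+
    thus ?thesis by blast
  qed
  assume "h 1 = h 0" "h1 1 = h1 0" "q 1 = q 0"
  hence "h 0 * C 1 = - (q 0 * B 1) \<and> h 0 * (D 1 - A 1) = h1 0 * B 1 \<and> q 0 * (A 1 - D 1) = h1 0 * C 1"
    using rel[OF W1, of "h 0" "h1 0" "q 0"] inv[of 1] by simp
  thus "h 0 * C 1 = - (q 0 * B 1)" "h 0 * (D 1 - A 1) = h1 0 * B 1" "q 0 * (A 1 - D 1) = h1 0 * C 1" by auto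
qed

text \<open>With \<open>A, B, C, D\<close> the entries of the monodromy matrix and \<open>N = (-h\<^sub>1/2, h; -q, h\<^sub>1/2)\<close>, the
  relations say that the two matrices commute; \<open>\<rho>\<close> is the resulting factor of proportionality.\<close>

lemma commuting_matrix_algebra:
  fixes A B C D h h1 q :: complex
  assumes r: "h * C = - (q * B)" "h * (D - A) = h1 * B" "q * (A - D) = h1 * C" and d: "A * D - B * C = 1"
  defines "\<rho> \<equiv> - (h1 * (D - A) / 2 + h * C - q * B) / 2" and "\<alpha> \<equiv> (A + D) / 2" and "R \<equiv> h * q - h1 ^ 2 / 4"
  shows "R * B = \<rho> * h" "R * (D - A) = \<rho> * h1" "R * C = - (\<rho> * q)" "\<rho> ^ 2 = R * (1 - \<alpha> ^ 2)"
    and "R = 0 \<Longrightarrow> h \<noteq> 0 \<or> h1 \<noteq> 0 \<or> q \<noteq> 0 \<Longrightarrow> \<alpha> ^ 2 = 1"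
proof -
  have \<rho>: "4 * \<rho> = - (h1 * (D - A)) - 2 * (h * C) + 2 * (q * B)" by (simp add: \<rho>_def field_simps)
  have R: "4 * R = 4 * (h * q) - h1 ^ 2" by (simp add: R_def)
  have \<alpha>: "2 * \<alpha> = A + D" by (simp add: \<alpha>_def)
  have "4 * (R * B) = 4 * (\<rho> * h)" "4 * (R * (D - A)) = 4 * (\<rho> * h1)" "4 * (R * C) = 4 * - (\<rho> * q)"
    using r \<rho> R by algebra+
  thus "R * B = \<rho> * h" "R * (D - A) = \<rho> * h1" "R * C = - (\<rho> * q)" by (simp_all only: mult_cancel_left) auto
  have "16 * \<rho> ^ 2 = 16 * (R * (1 - \<alpha> ^ 2))" using r \<rho> R \<alpha> d by algebra
  thus "\<rho> ^ 2 = R * (1 - \<alpha> ^ 2)" by simp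
  \<comment> \<open>R is the determinant of the traceless matrix N. For R = 0 the non-zero N is
    nilpotent, and a matrix of determinant 1 commuting with it has the double eigenvalue 1 or
    -1.\<close>
  assume R0: "R = 0" and nz: "h \<noteq> 0 \<or> h1 \<noteq> 0 \<or> q \<noteq> 0"
  have nz': "h \<noteq> 0 \<or> q \<noteq> 0" using R R0 nz by auto
  have "h ^ 2 * (\<alpha> ^ 2 - 1) * 4 = 0" "q ^ 2 * (\<alpha> ^ 2 - 1) * 4 = 0" using r \<alpha> R R0 d by algebra+
  thus "\<alpha> ^ 2 = 1" using nz' by auto
qed

text \<open>A continuous branch of an inverse of F inherits differentiability where F' is non-zero.
  It serves the square root of Q along the path and the logarithm of the multiplier, both of which
  are given as continuous functions only.\<close>

lemma has_vector_derivative_implicit: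
  fixes f :: "real \<Rightarrow> complex" and F :: "complex \<Rightarrow> complex"
  assumes F: "(F has_field_derivative F') (at (f t))" "F' \<noteq> 0"
    and FD: "((\<lambda>s. F (f s)) has_vector_derivative D) (at t)" and f: "isCont f t"
  shows "(f has_vector_derivative D / F') (at t)"
proof -
  obtain G where G: "\<And>z. F z - F (f t) = G z * (z - f t)" "isCont G (f t)" "G (f t) = F'"
    using F(1) unfolding CARAT_DERIV by blast
  have "isCont (\<lambda>s. G (f s)) t" using f G(2) by (rule isCont_o2)
  hence lG: "((\<lambda>s. G (f s)) \<longlongrightarrow> F') (at t)" by (simp add: isCont_def G(3))
  have "((\<lambda>s. (F (f s) - F (f t)) / of_real (s - t) / G (f s)) \<longlongrightarrow> D / F') (at t)"
    by (intro tendsto_divide has_vector_derivative_quotient_tendsto FD lG F(2))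
  moreover have "\<forall>\<^sub>F s in at t. (F (f s) - F (f t)) / of_real (s - t) / G (f s) = (f s - f t) /\<^sub>R (s - t)"
    using tendsto_imp_eventually_ne[OF lG F(2)]
    by eventually_elim (simp add: G(1) scaleR_conv_of_real divide_inverse mult_ac)
  ultimately have "((\<lambda>s. (f s - f t) /\<^sub>R (s - t)) \<longlongrightarrow> D / F') (at t)" by (rule Lim_transform_eventually)
  hence "((\<lambda>s. (f s - f t - (s - t) *\<^sub>R (D / F')) /\<^sub>R (s - t)) \<longlongrightarrow> D / F' - D / F') (at t)"
    by (rule Lim_transform_eventually[OF tendsto_diff[OF _ tendsto_const]])
       (auto simp: eventually_at_filter scaleR_diff_right)
  hence "((\<lambda>s. norm ((f s - f t - (s - t) *\<^sub>R (D / F')) /\<^sub>R (s - t))) \<longlongrightarrow> 0) (at t)"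
    by (intro tendsto_norm_zero) simp
  hence "((\<lambda>s. norm ((f s - f t - (s - t) *\<^sub>R (D / F')) /\<^sub>R norm (s - t))) \<longlongrightarrow> 0) (at t)" by simp
  hence "((\<lambda>s. (f s - f t - (s - t) *\<^sub>R (D / F')) /\<^sub>R norm (s - t)) \<longlongrightarrow> 0) (at t)"
    by (rule tendsto_norm_zero_cancel)
  thus ?thesis
    by (simp add: has_vector_derivative_def has_derivative_within divide_inverse diff_diff_eq bounded_linear_scaleR_left)
qed

lemma periodic_deriv:
  fixes f :: "complex \<Rightarrow> complex"
  assumes f: "f holomorphic_on S" "open S" and S: "\<And>z. z \<in> S \<Longrightarrow> z + v \<in> S"
    and per: "\<And>z. z \<in> S \<Longrightarrow> f (z + v) = m * f z" and z: "z \<in> S"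
  shows "(deriv ^^ j) f (z + v) = m * (deriv ^^ j) f z"
  using z
proof (induction j arbitrary: z)
  case (Suc j)
  let ?g = "(deriv ^^ j) f"
  have g: "?g holomorphic_on S" by (rule holomorphic_higher_deriv[OF f])
  have "((\<lambda>z. ?g (z + v)) has_field_derivative deriv ?g (z + v)) (at z)"
    using holomorphic_derivI[OF g f(2) S[OF Suc.prems], of UNIV] by (simp add: DERIV_shift)
  hence "((\<lambda>z. m * ?g z) has_field_derivative deriv ?g (z + v)) (at z)"
    by (rule has_field_derivative_transform_within_open[OF _ f(2) Suc.prems]) (rule Suc.IH)
  moreover have "((\<lambda>z. m * ?g z) has_field_derivative m * deriv ?g z) (at z)"
    by (rule DERIV_cmult, rule holomorphic_derivI[OF g f(2) Suc.prems])
  ultimately show ?case using DERIV_unique by fastforce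
qed (use per in simp)

text \<open>The Riccati computation of \<open>bloch_from_product\<close> in the complex variable,
  with W in the role of E - u.\<close>

lemma log_derivative_second_order:
  assumes hol: "L holomorphic_on S" "h holomorphic_on S" "open S" and z: "z \<in> S"
    and L: "\<And>y. y \<in> S \<Longrightarrow> h y \<noteq> 0 \<and> deriv L y = L y * ((deriv h y / 2 + s) / h y)"
    and W: "- (s ^ 2) = (h z) ^ 2 * W + 1 / 2 * h z * (deriv ^^ 2) h z - 1 / 4 * (deriv h z) ^ 2"
  shows "(deriv ^^ 2) L z = - W * L z"
proof -
  have nz: "h z \<noteq> 0" using L[OF z] by simp
  note dL = holomorphic_derivI[OF hol(1,3) z, of UNIV] and dh = holomorphic_derivI[OF hol(2,3) z, of UNIV]
  note dh2 = holomorphic_derivI[OF holomorphic_deriv[OF hol(2,3)] hol(3) z, of UNIV]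
  have "((\<lambda>y. L y * ((deriv h y / 2 + s) / h y)) has_field_derivative
      L z * (((deriv (deriv h) z / 2 + 0) * h z - (deriv h z / 2 + s) * deriv h z) / (h z * h z))
      + deriv L z * ((deriv h z / 2 + s) / h z)) (at z)"
    by (intro DERIV_mult' DERIV_divide DERIV_add DERIV_cdivide DERIV_const dL dh dh2 nz)
  hence "(deriv L has_field_derivative
      L z * (((deriv (deriv h) z / 2 + 0) * h z - (deriv h z / 2 + s) * deriv h z) / (h z * h z))
      + deriv L z * ((deriv h z / 2 + s) / h z)) (at z)"
    by (rule has_field_derivative_transform_within_open[OF _ hol(3) z]) (use L in simp)
  hence "(deriv ^^ 2) L z = L z * (((deriv (deriv h) z / 2 + 0) * h z - (deriv h z / 2 + s) * deriv h z) / (h z * h z))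
      + deriv L z * ((deriv h z / 2 + s) / h z)"
    by (simp add: numeral_2_eq_2 DERIV_imp_deriv)
  also have "\<dots> = L z * (((deriv ^^ 2) h z / 2 * h z - (deriv h z) ^ 2 / 4 + s ^ 2) / (h z) ^ 2)"
    unfolding conjunct2[OF L[OF z]] using nz by (simp add: numeral_2_eq_2 field_simps)
  also have "(deriv ^^ 2) h z / 2 * h z - (deriv h z) ^ 2 / 4 + s ^ 2 = - W * (h z) ^ 2"
    using W by (simp add: algebra_simps) 
  finally show ?thesis using nz by simp
qed

section \<open>Zeros of \<Xi> and the equation satisfied by \<Lambda>\<close>

context finite_gap begin

lemma h_entire_in_E:
  assumes "x \<notin> H"
  shows "(\<lambda>E. h E x) holomorphic_on A" "(\<lambda>E. deriv (h E) x) holomorphic_on A" "(\<lambda>E. (deriv ^^ 2) (h E) x) holomorphic_on A"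
proof -
  have "(\<lambda>E. (deriv ^^ m) (h E) x) holomorphic_on A" for m
    unfolding h_higher_deriv[OF assms] by (intro holomorphic_intros)
  from this[of 0] this[of 1] this[of 2] show "(\<lambda>E. h E x) holomorphic_on A" "(\<lambda>E. deriv (h E) x) holomorphic_on A"
    "(\<lambda>E. (deriv ^^ 2) (h E) x) holomorphic_on A" by simp_all
qed

lemma zero_by_continuation:
  assumes "f holomorphic_on - H" "\<xi> islimpt U" "\<xi> \<notin> H" "U \<subseteq> - H" "\<And>z. z \<in> U \<Longrightarrow> f z = 0" "z \<notin> H"
  shows "f z = 0"
  by (rule analytic_continuation[OF assms(1) open_Compl_H connected_Compl_H assms(4) _ assms(2,5)]) (use assms in auto)

lemma h_eventually_nonzero: assumes "z \<notin> H" shows "\<forall>\<^sub>F y in at z. y \<notin> H \<and> h E y \<noteq> 0"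
proof -
  have "\<not> z islimpt {y. y \<notin> H \<and> h E y = 0}"
  proof
    assume "z islimpt {y. y \<notin> H \<and> h E y = 0}"
    hence "h E y = 0" if "y \<notin> H" for y
      by (rule zero_by_continuation[OF h_holomorphic _ assms]) (use that in auto)
    moreover obtain y where "y \<notin> H" "h E y \<noteq> 0" by (rule h_nonzero)
    ultimately show False by blast
  qed
  hence "\<forall>\<^sub>F y in at z. \<not> (y \<notin> H \<and> h E y = 0)" by (simp add: islimpt_iff_eventually)
  with eventually_not_H[of z] show ?thesis by eventually_elim auto
qed

lemma Lambda_nonzero: assumes "is_Lambda H (h E) s F" obtains x where "x \<notin> H" "F x \<noteq> 0"
proof -
  obtain x where x: "x \<notin> H" "h E x \<noteq> 0" by (rule h_nonzero)
  then obtain e r P where e: "0 < e" and "\<forall>y\<in>ball x e. r y ^ 2 = h E y \<and> (P has_field_derivative s / h E y) (at y) \<and> F y = r y * exp (P y)"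
    using assms unfolding is_Lambda_def by blast
  hence "r x ^ 2 = h E x" "F x = r x * exp (P x)" by auto
  hence "F x \<noteq> 0" using x(2) by auto
  thus thesis using x(1) that by blast
qed

text \<open>The zeros of \<Xi> outside H are isolated, and the defect of the equation is
  continuous.\<close>

lemma second_order_ode_extends:
  assumes F: "F holomorphic_on - H" and nz: "\<And>z. z \<notin> H \<Longrightarrow> h E z \<noteq> 0 \<Longrightarrow> (deriv ^^ 2) F z = (u z - E) * F z"
    and z: "z \<notin> H"
  shows "(deriv ^^ 2) F z = (u z - E) * F z"
proof (cases "h E z = 0")
  case True
  define G where "G y = (deriv ^^ 2) F y - (u y - E) * F y" for y
  have "G holomorphic_on - H"
    unfolding G_def[abs_def] by (intro holomorphic_intros holomorphic_higher_deriv F u_holomorphic open_Compl_H)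
  hence "isCont G z"
    using z holomorphic_on_imp_differentiable_at[of G "- H" z] field_differentiable_imp_continuous_at by auto
  moreover have "\<forall>\<^sub>F y in at z. 0 = G y"
    using h_eventually_nonzero[OF z, of E] by eventually_elim (simp add: G_def nz)
  hence "(G \<longlongrightarrow> 0) (at z)" using Lim_transform_eventually[OF tendsto_const] by blast
  ultimately have "G z = 0" using LIM_unique unfolding isCont_def by blast
  thus ?thesis by (simp add: G_def)
qed (use nz z in simp)

lemma Lambda_solution:
  assumes F: "is_Lambda H (h E) s F" and s: "s ^ 2 = - poly Q E" and z: "z \<notin> H"
  shows "(deriv ^^ 2) F z = (u z - E) * F z"
proof (rule second_order_ode_extends[OF _ _ z])
  show hol: "F holomorphic_on - H" using F by (simp add: is_Lambda_def)
  fix z assume z: "z \<notin> H" "h E z \<noteq> 0"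
  then obtain e r P where e: "0 < e" and r: "r holomorphic_on ball z e"
    and rP: "\<And>y. y \<in> ball z e \<Longrightarrow> r y ^ 2 = h E y \<and> (P has_field_derivative s / h E y) (at y) \<and> F y = r y * exp (P y)"
    using F unfolding is_Lambda_def by blast
  define S where "S = ball z e \<inter> (- H \<inter> h E -` (- {0}))"
  have opS: "open S" unfolding S_def
    by (intro open_Int open_ball continuous_open_preimage holomorphic_on_imp_continuous_on h_holomorphic open_Compl_H) auto
  have zS: "z \<in> S" using z e by (auto simp: S_def)
  have sub: "S \<subseteq> - H" by (auto simp: S_def)
  have dL: "deriv F y = F y * ((deriv (h E) y / 2 + s) / h E y)" if y: "y \<in> S" for y
  proof -
    have yb: "y \<in> ball z e" and hy: "h E y \<noteq> 0" using y by (auto simp: S_def)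
    have dr: "(r has_field_derivative deriv r y) (at y)" by (rule holomorphic_derivI[OF r open_ball yb])
    have "((\<lambda>y. r y ^ 2) has_field_derivative 2 * r y * deriv r y) (at y)"
      by (auto intro!: derivative_eq_intros dr)
    hence "(h E has_field_derivative 2 * r y * deriv r y) (at y)"
      by (rule has_field_derivative_transform_within_open[OF _ open_ball yb]) (use rP in blast)
    hence h': "deriv (h E) y = 2 * r y * deriv r y" by (rule DERIV_imp_deriv)
    have "((\<lambda>y. r y * exp (P y)) has_field_derivative deriv r y * exp (P y) + r y * (exp (P y) * (s / h E y))) (at y)"
      using rP[OF yb] by (auto intro!: derivative_eq_intros dr)
    hence "(F has_field_derivative deriv r y * exp (P y) + r y * (exp (P y) * (s / h E y))) (at y)"
      by (rule has_field_derivative_transform_within_open[OF _ open_ball yb]) (use rP in simp)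
    hence F': "deriv F y = deriv r y * exp (P y) + r y * (exp (P y) * (s / h E y))" by (rule DERIV_imp_deriv)
    have r2: "h E y = r y ^ 2" and Ly: "F y = r y * exp (P y)" using rP[OF yb] by auto
    have "r y \<noteq> 0" using r2 hy by auto
    thus ?thesis unfolding F' h' r2 Ly by (simp add: field_simps power2_eq_square)
  qed
  have "(deriv ^^ 2) F z = - (E - u z) * F z"
  proof (rule log_derivative_second_order[OF holomorphic_on_subset[OF hol sub] holomorphic_on_subset[OF h_holomorphic sub] opS zS])
    show "- (s ^ 2) = (h E z) ^ 2 * (E - u z) + 1 / 2 * h E z * (deriv ^^ 2) (h E) z - 1 / 4 * (deriv (h E) z) ^ 2"
      using Q_eq[OF z(1), of E] s by simp
  qed (use dL in \<open>auto simp: S_def\<close>)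
  thus "(deriv ^^ 2) F z = (u z - E) * F z" by simp
qed

end

section \<open>Bloch solutions and the integral of \<Xi> over a period\<close>

context finite_gap_line begin

lemma X_0_plus_p: "X 1 = X 0 + p" using X_add_1[of 0] by simp

lemma X_limit_point: "X (1 / 2) islimpt X ` {0..1}"
proof -
  have "((\<lambda>s. X s) \<longlongrightarrow> X (1 / 2)) (at (1 / 2))"
    unfolding X_def by (intro tendsto_intros)
  note lim = this
  have "\<forall>\<^sub>F s in at (1 / 2 :: real). s \<in> {0<..<1} \<and> s \<noteq> 1 / 2"
    by (auto simp: eventually_at_filter intro!: eventually_mono[OF eventually_nhds_in_open[of "{0<..<1::real}" "1 / 2"]])
  hence ev: "\<forall>\<^sub>F s in at (1 / 2 :: real). X s \<in> X ` {0..1} - {X (1 / 2)}"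
  proof eventually_elim
    case (elim s)
    have "X s - X (1 / 2) = of_real (s - 1 / 2) * p" by (simp add: X_def algebra_simps)
    also have "\<dots> \<noteq> 0" using p_nonzero elim by (simp del: of_real_diff)
    finally show ?case using elim by auto
  qed
  show ?thesis
  proof (rule islimptI)
    fix T assume "X (1 / 2) \<in> T" "open T"
    from eventually_conj[OF ev topological_tendstoD[OF lim this(2,1)]]
    have "\<exists>s. X s \<in> X ` {0..1} - {X (1 / 2)} \<and> X s \<in> T"
      by (rule eventually_happens'[rotated]) simp
    thus "\<exists>y\<in>X ` {0..1}. y \<in> T \<and> y \<noteq> X (1 / 2)" by blast
  qed
qed

lemma zero_along_line:
  assumes "f holomorphic_on - H" "\<And>s. s \<in> {0..1} \<Longrightarrow> f (X s) = 0" "z \<notin> H" shows "f z = 0"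
  by (rule zero_by_continuation[OF assms(1) X_limit_point X_notin_H]) (use assms X_notin_H in auto)

lemma V_continuous: "continuous_on A V"
proof -
  have "continuous_on UNIV (\<lambda>s. u (X s))" by (rule continuous_on_vector_derivative[OF holomorphic_along_X[OF u_holomorphic]])
  thus ?thesis unfolding V_def[abs_def] by (intro continuous_intros) (rule continuous_on_subset, auto)
qed

text \<open>One point with F non-zero is enough: if both initial values at X 0 were 0, F would
  vanish on the segment and hence everywhere off H.\<close>

lemma bloch_trace:
  assumes F: "F holomorphic_on - H" "\<And>z. z \<notin> H \<Longrightarrow> (deriv ^^ 2) F z = (u z - E) * F z"
    and nz: "x \<notin> H" "F x \<noteq> 0" and per: "\<And>z. z \<notin> H \<Longrightarrow> F (z + p) = m * F z"
  shows "m \<noteq> 0" "hill_trace (\<lambda>s. V s + - (p ^ 2) * E) = m + 1 / m"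
proof -
  let ?w = "\<lambda>s. V s + - (p ^ 2) * E"
  have c: "continuous_on {0..1} ?w" by (intro continuous_intros V_continuous)
  have sol: "hill_sol ?w (\<lambda>s. F (X s)) (\<lambda>s. p * deriv F (X s))"
    unfolding hill_sol_def
  proof (intro ballI conjI)
    fix s :: real
    show "((\<lambda>s. F (X s)) has_vector_derivative p * deriv F (X s)) (at s within {0..1})"
      by (rule holomorphic_along_X[OF F(1)])
    show "((\<lambda>s. p * deriv F (X s)) has_vector_derivative ?w s * F (X s)) (at s within {0..1})"
      by (rule has_vector_derivative_eq_rhs[OF holomorphic_along_X2[OF F(1)]])
         (simp add: F(2)[OF X_notin_H] V_def power2_eq_square algebra_simps)
  qed
  have d: "deriv F (z + p) = m * deriv F z" if "z \<notin> H" for z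
    using periodic_deriv[OF F(1) open_Compl_H, of p m z 1] per that H_add_L[OF p_in_L] by simp
  have nz: "F (X 0) \<noteq> 0 \<or> p * deriv F (X 0) \<noteq> 0"
  proof (rule ccontr)
    assume "\<not> ?thesis"
    hence "F (X s) = 0" if "s \<in> {0..1}" for s
      using hill_sol_unique(1)[OF c sol] that by simp
    from zero_along_line[OF F(1) this nz(1)] nz(2) show False by blast
  qed
  show "m \<noteq> 0" "hill_trace ?w = m + 1 / m"
    by (rule hill_bloch_trace[OF c sol _ _ nz]; simp add: X_0_plus_p per d X_notin_H)+
qed

text \<open>An even derivative of \<wp> of positive order has a periodic primitive, so only the
  constant and the terms with j = 0, whose primitive is - \<zeta>, contribute. This is the origin of
  the combination \<omega>_k c - \<eta>_k a.\<close>

lemma h_integral: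
  assumes "derivative_expansion \<omega>\<^sub>1 \<omega>\<^sub>3 l c\<^sub>0 b c a"
  shows "((\<lambda>s. p * h E (X s)) has_integral 2 * (hp k * poly c E - qp k * poly (a_total l a) E)) {0..1}"
proof -
  define D where "D j = (if j = 0 then (\<lambda>z. - wz z) else (deriv ^^ (2 * j - 1)) wp)" for j :: nat
  have D: "(D j has_field_derivative (deriv ^^ (2 * j)) wp z) (at z)" if z: "z \<notin> L" for j z
  proof (cases j)
    case 0 thus ?thesis using DERIV_minus[OF wz_derivative[OF z]] by (simp add: D_def)
  next
    case (Suc i)
    have "(deriv ^^ (2 * j - 1)) wp holomorphic_on - L" by (intro holomorphic_higher_deriv wp_holomorphic open_Compl_L)
    from holomorphic_derivI[OF this open_Compl_L, of z UNIV] z Suc show ?thesis by (simp add: D_def)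
  qed
  have DX: "((\<lambda>s. D j (X s + hp i)) has_vector_derivative p * (deriv ^^ (2 * j)) wp (X s + hp i)) (at s within {0..1})" for i j s
  proof -
    have "((\<lambda>s. D j ((x\<^sub>0 + hp i) + of_real s * p)) has_vector_derivative p * (deriv ^^ (2 * j)) wp ((x\<^sub>0 + hp i) + of_real s * p)) (at s within {0..1})"
      by (rule has_vector_derivative_along_line, rule D) (use X_hp_notin_L[of s i] in \<open>simp add: X_def algebra_simps\<close>)
    thus ?thesis by (simp add: X_def algebra_simps)
  qed
  have per: "D j (z + p) = D j z - (if j = 0 then 2 * qp k else 0)" if z: "z \<notin> L" for j z
  proof (cases "j = 0")
    case False
    have "(deriv ^^ (2 * j - 1)) wp (z + p) = 1 * (deriv ^^ (2 * j - 1)) wp z"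
      by (rule periodic_deriv[OF wp_holomorphic open_Compl_L]) (use z p_in_L wp_periodic[OF p_in_L] L_add_iff in auto)
    with False show ?thesis by (simp add: D_def)
  qed (simp add: D_def wz_p[OF z])
  define F where "F s = of_real s * (p * poly c E) + (\<Sum>i\<le>3. \<Sum>j<n i. poly (a i j) E * D j (X s + hp i))" for s
  have "((\<lambda>s. p * h E (X s)) has_integral F 1 - F 0) {0..1}"
  proof (rule fundamental_theorem_of_calculus)
    fix s :: real
    have "((\<lambda>s. of_real s * (p * poly c E)) has_vector_derivative p * poly c E) (at s within {0..1})"
      by (auto intro!: derivative_eq_intros)
    hence "(F has_vector_derivative p * poly c E + (\<Sum>i\<le>3. \<Sum>j<n i. poly (a i j) E * (p * (deriv ^^ (2 * j)) wp (X s + hp i)))) (at s within {0..1})"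
      unfolding F_def[abs_def] by (intro has_vector_derivative_add has_vector_derivative_sum has_vector_derivative_mult_right DX)
    moreover have "h E (X s) = poly c E + (\<Sum>i\<le>3. \<Sum>j<n i. poly (a i j) E * (deriv ^^ (2 * j)) wp (X s + hp i))"
      using assms X_notin_H[of s] by (simp add: derivative_expansion_def h_def)
    ultimately show "(F has_vector_derivative p * h E (X s)) (at s within {0..1})"
      by (simp add: distrib_left sum_distrib_left mult_ac)
  qed simp
  moreover have "F 1 - F 0 = 2 * (hp k * poly c E - qp k * poly (a_total l a) E)"
  proof -
    have e: "D j (X 1 + hp i) = D j (X 0 + hp i) - (if j = 0 then 2 * qp k else 0)" for i j
      using per[OF X_hp_notin_L[of 0 i], of j] by (simp add: X_0_plus_p add_ac)
    have "F 1 - F 0 = p * poly c E + (\<Sum>i\<le>3. \<Sum>j<n i. poly (a i j) E * (D j (X 1 + hp i) - D j (X 0 + hp i)))"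
      by (simp add: F_def sum_subtractf right_diff_distrib)
    also have "(\<Sum>i\<le>3. \<Sum>j<n i. poly (a i j) E * (D j (X 1 + hp i) - D j (X 0 + hp i)))
        = (\<Sum>i\<le>3. \<Sum>j<n i. if j = 0 then - (2 * qp k) * poly (a i 0) E else 0)"
      by (intro sum.cong refl) (simp add: e)
    also have "\<dots> = (\<Sum>i\<le>3. if 0 < n i then - (2 * qp k) * poly (a i 0) E else 0)"
      by (intro sum.cong refl) (simp add: sum.delta)
    also have "\<dots> = (\<Sum>i | i \<le> 3 \<and> 0 < n i. - (2 * qp k) * poly (a i 0) E)"
      by (subst sum.inter_filter[symmetric]) auto
    also have "\<dots> = - (2 * qp k) * poly (a_total l a) E"
      by (simp add: a_total_def poly_sum sum_distrib_left)
    finally show ?thesis by (simp add: p_def algebra_simps)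
  qed
  ultimately show ?thesis by simp
qed

section \<open>The monodromy matrix as an entire function of E\<close>

abbreviation "W E \<equiv> \<lambda>s. V s + - (p ^ 2) * E"

definition "mA E = hill_y (W E) 1 0 1"
definition "mB E = hill_y (W E) 0 1 1"
definition "mC E = hill_dy (W E) 1 0 1"
definition "mD E = hill_dy (W E) 0 1 1"
definition "\<alpha> E = (mA E + mD E) / 2"
text \<open>The coefficient h'' / 2 - w h of the conserved quadratic form, taken along the
  line.\<close>

definition "q E s = p * (p * (deriv ^^ 2) (h E) (X s)) / 2 - W E s * h E (X s)"
definition "\<rho> E = - (p * deriv (h E) (X 0) * (mD E - mA E) / 2 + h E (X 0) * mC E - q E 0 * mB E) / 2"

lemma hill_trace_W: "hill_trace (W E) = 2 * \<alpha> E"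
  by (simp add: hill_trace_def \<alpha>_def mA_def mD_def)

lemma W_continuous: "continuous_on A (W E)"
  by (intro continuous_intros V_continuous)

text \<open>The third-order equation h''' = 4 w h' + 2 w' h is the same as q' = w h'.\<close>

lemma q_derivative: "(q E has_vector_derivative W E s * (p * deriv (h E) (X s))) (at s within A)"
proof -
  have "(deriv ^^ 3) (h E) (X s) = deriv ((deriv ^^ 2) (h E)) (X s)" by (simp add: numeral_3_eq_3 numeral_2_eq_2)
  hence h3: "deriv ((deriv ^^ 2) (h E)) (X s) = 4 * (u (X s) - E) * deriv (h E) (X s) + 2 * deriv u (X s) * h E (X s)"
    using h_ode[OF X_notin_H, of E s] by (simp add: algebra_simps)
  have d2: "(deriv ^^ 2) (h E) holomorphic_on - H" by (intro holomorphic_higher_deriv h_holomorphic open_Compl_H)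
  have "(q E has_vector_derivative p * (p * (p * deriv ((deriv ^^ 2) (h E)) (X s))) / 2
      - (W E s * (p * deriv (h E) (X s)) + (p ^ 2 * (p * deriv u (X s)) + 0) * h E (X s))) (at s within A)"
    unfolding q_def[abs_def] V_def
    by (intro has_vector_derivative_diff has_vector_derivative_divide has_vector_derivative_mult_right
        has_vector_derivative_mult has_vector_derivative_add has_vector_derivative_const holomorphic_along_X d2 h_holomorphic u_holomorphic)
  thus ?thesis
    by (rule has_vector_derivative_eq_rhs) (simp add: h3 V_def power2_eq_square field_simps)
qed

lemma derivatives_along_X_periodic:
  "deriv (h E) (X 1) = deriv (h E) (X 0)" "(deriv ^^ 2) (h E) (X 1) = (deriv ^^ 2) (h E) (X 0)"
proof -
  have "(deriv ^^ j) (h E) (X 0 + p) = 1 * (deriv ^^ j) (h E) (X 0)" for j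
    by (rule periodic_deriv[OF h_holomorphic open_Compl_H]) (use X_notin_H H_add_L[OF p_in_L] h_periodic[OF p_in_L] in auto)
  from this[of 1] this[of 2] show "deriv (h E) (X 1) = deriv (h E) (X 0)" "(deriv ^^ 2) (h E) (X 1) = (deriv ^^ 2) (h E) (X 0)"
    by (simp_all add: X_0_plus_p)
qed

lemma monodromy_relations:
  shows "s \<in> {0..1} \<Longrightarrow> h E (X s) = h E (X 0) * hill_y (W E) 1 0 s ^ 2
      + p * deriv (h E) (X 0) * (hill_y (W E) 1 0 s * hill_y (W E) 0 1 s) + q E 0 * hill_y (W E) 0 1 s ^ 2"
    and "mA E * mD E - mB E * mC E = 1" and "h E (X 0) * mC E = - (q E 0 * mB E)"
    and "h E (X 0) * (mD E - mA E) = p * deriv (h E) (X 0) * mB E" and "q E 0 * (mA E - mD E) = p * deriv (h E) (X 0) * mC E"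
proof -
  have d2: "((\<lambda>s. p * deriv (h E) (X s)) has_vector_derivative 2 * (q E s + W E s * h E (X s))) (at s within {0..1})" for s
    by (rule has_vector_derivative_eq_rhs[OF holomorphic_along_X2[OF h_holomorphic]]) (simp add: q_def)
  note rel = product_form_relations[of "W E" "\<lambda>s. h E (X s)" "\<lambda>s. p * deriv (h E) (X s)" "q E",
      OF W_continuous holomorphic_along_X[OF h_holomorphic] d2 q_derivative]
  have per: "h E (X 1) = h E (X 0)" "p * deriv (h E) (X 1) = p * deriv (h E) (X 0)" "q E 1 = q E 0"
    using h_along_X_periodic(1)[of E 0] h_along_X_periodic(2)[of 0] by (simp_all add: derivatives_along_X_periodic q_def V_def)
  show "s \<in> {0..1} \<Longrightarrow> h E (X s) = h E (X 0) * hill_y (W E) 1 0 s ^ 2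
      + p * deriv (h E) (X 0) * (hill_y (W E) 1 0 s * hill_y (W E) 0 1 s) + q E 0 * hill_y (W E) 0 1 s ^ 2"
    by (rule rel(1))
  show "mA E * mD E - mB E * mC E = 1" unfolding mA_def mB_def mC_def mD_def by (rule rel(2))
  show "h E (X 0) * mC E = - (q E 0 * mB E)" unfolding mB_def mC_def by (rule rel(3)[OF per])
  show "h E (X 0) * (mD E - mA E) = p * deriv (h E) (X 0) * mB E" unfolding mA_def mB_def mD_def by (rule rel(4)[OF per])
  show "q E 0 * (mA E - mD E) = p * deriv (h E) (X 0) * mC E" unfolding mA_def mC_def mD_def by (rule rel(5)[OF per])
qed

text \<open>Up to p^2 the spectral polynomial is the determinant of the conserved form, which
  explains why the monodromy degenerates at its zeros.\<close>

lemma R_eq: "h E (X 0) * q E 0 - (p * deriv (h E) (X 0)) ^ 2 / 4 = p ^ 2 * poly Q E"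
  unfolding Q_eq[OF X_notin_H, of E 0] by (simp add: q_def V_def power2_eq_square field_simps)

lemma monodromy_proportional:
  shows "p ^ 2 * poly Q E * mB E = \<rho> E * h E (X 0)"
    "p ^ 2 * poly Q E * (mD E - mA E) = \<rho> E * (p * deriv (h E) (X 0))"
    "p ^ 2 * poly Q E * mC E = - (\<rho> E * q E 0)" "\<rho> E ^ 2 = p ^ 2 * poly Q E * (1 - \<alpha> E ^ 2)"
    and "poly Q E = 0 \<Longrightarrow> \<alpha> E ^ 2 = 1"
proof -
  note alg = commuting_matrix_algebra[OF monodromy_relations(3-5,2), of E, unfolded R_eq, folded \<rho>_def \<alpha>_def]
  show "p ^ 2 * poly Q E * mB E = \<rho> E * h E (X 0)"
    "p ^ 2 * poly Q E * (mD E - mA E) = \<rho> E * (p * deriv (h E) (X 0))"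
    "p ^ 2 * poly Q E * mC E = - (\<rho> E * q E 0)" "\<rho> E ^ 2 = p ^ 2 * poly Q E * (1 - \<alpha> E ^ 2)"
    by (fact alg(1-4))+
  assume "poly Q E = 0"
  hence R: "p ^ 2 * poly Q E = 0" by simp
  \<comment> \<open>A form with all coefficients 0 at X 0 would make \<Xi> vanish on the whole
    segment.\<close>
  have "h E (X 0) \<noteq> 0 \<or> p * deriv (h E) (X 0) \<noteq> 0 \<or> q E 0 \<noteq> 0"
  proof (rule ccontr)
    assume "\<not> ?thesis"
    hence "h E (X s) = 0" if "s \<in> {0..1}" for s using monodromy_relations(1)[OF that, of E] by simp
    from zero_along_line[OF h_holomorphic this] show False using h_nonzero[of E] by blast
  qed
  from alg(5)[OF R this] show "\<alpha> E ^ 2 = 1" .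
qed

lemma monodromy_entry_derivatives:
  fixes y0 y1 E :: complex
  defines "I1 \<equiv> integral {0..1} (\<lambda>r. hill_y (W E) y0 y1 r * hill_y (W E) 1 0 r)"
    and "I2 \<equiv> integral {0..1} (\<lambda>r. hill_y (W E) y0 y1 r * hill_y (W E) 0 1 r)"
  shows "((\<lambda>E. hill_y (W E) y0 y1 1) has_field_derivative (mB E * I1 - mA E * I2) * - (p ^ 2)) (at E)"
    and "((\<lambda>E. hill_dy (W E) y0 y1 1) has_field_derivative (mD E * I1 - mC E * I2) * - (p ^ 2)) (at E)"
proof -
  have l: "((\<lambda>E. - (p ^ 2) * E) has_field_derivative - (p ^ 2)) (at E)" by (auto intro!: derivative_eq_intros)
  note d = hill_y_has_field_derivative[OF V_continuous, of y0 y1 "- (p ^ 2) * E"]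
  show "((\<lambda>E. hill_y (W E) y0 y1 1) has_field_derivative (mB E * I1 - mA E * I2) * - (p ^ 2)) (at E)"
    unfolding mA_def mB_def I1_def I2_def by (rule DERIV_chain2[OF d(1) l])
  show "((\<lambda>E. hill_dy (W E) y0 y1 1) has_field_derivative (mD E * I1 - mC E * I2) * - (p ^ 2)) (at E)"
    unfolding mC_def mD_def I1_def I2_def by (rule DERIV_chain2[OF d(2) l])
qed

lemma monodromy_holomorphic: "mA holomorphic_on A" "mB holomorphic_on A" "mC holomorphic_on A" "mD holomorphic_on A"
proof -
  have hol: "(\<lambda>E. hill_y (W E) y0 y1 1) holomorphic_on A" "(\<lambda>E. hill_dy (W E) y0 y1 1) holomorphic_on A" for y0 y1
    unfolding holomorphic_on_def field_differentiable_def
    using has_field_derivative_at_within[OF monodromy_entry_derivatives(1)[of y0 y1]]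
      has_field_derivative_at_within[OF monodromy_entry_derivatives(2)[of y0 y1]] by blast+
  show "mA holomorphic_on A" unfolding mA_def[abs_def] by (rule hol)
  show "mB holomorphic_on A" unfolding mB_def[abs_def] by (rule hol)
  show "mC holomorphic_on A" unfolding mC_def[abs_def] by (rule hol)
  show "mD holomorphic_on A" unfolding mD_def[abs_def] by (rule hol)
qed

lemma \<alpha>_holomorphic: "\<alpha> holomorphic_on A"
  unfolding \<alpha>_def[abs_def] by (intro holomorphic_intros monodromy_holomorphic) simp

lemma \<rho>_holomorphic: "\<rho> holomorphic_on A"
  unfolding \<rho>_def[abs_def] q_def[abs_def]
  by (intro holomorphic_intros monodromy_holomorphic h_entire_in_E X_notin_H) simp_all

text \<open>The derivative of the trace is the integral of a quadratic form in the fundamental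
  solutions with coefficients proportional to B, D - A and - C. These are in turn proportional to
  the coefficients of the conserved form, so the integrand is a multiple of \<Xi> and only its
  period integral is left.\<close>

lemma \<alpha>_derivative:
  assumes \<Theta>: "((\<lambda>s. p * h E (X s)) has_integral 2 * \<Theta>) {0..1}"
  shows "p * poly Q E * deriv \<alpha> E = - (\<rho> E * \<Theta>)"
proof -
  let ?f = "hill_y (W E) 1 0" and ?g = "hill_y (W E) 0 1"
  define I11 where "I11 = integral {0..1} (\<lambda>r. ?f r * ?f r)"
  define I12 where "I12 = integral {0..1} (\<lambda>r. ?f r * ?g r)"
  define I22 where "I22 = integral {0..1} (\<lambda>r. ?g r * ?g r)"
  have cont: "continuous_on {0..1} ?f" "continuous_on {0..1} ?g"
    by (rule hill_sol_continuous(1)[OF hill_y(1)[OF W_continuous]])+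
  have I: "((\<lambda>r. ?f r * ?f r) has_integral I11) {0..1}" "((\<lambda>r. ?f r * ?g r) has_integral I12) {0..1}"
    "((\<lambda>r. ?g r * ?g r) has_integral I22) {0..1}"
    unfolding I11_def I12_def I22_def
    by (intro integrable_integral integrable_continuous_real continuous_intros cont)+
  have "((\<lambda>s. p * (h E (X 0) * (?f s * ?f s) + p * deriv (h E) (X 0) * (?f s * ?g s) + q E 0 * (?g s * ?g s)))
      has_integral p * (h E (X 0) * I11 + p * deriv (h E) (X 0) * I12 + q E 0 * I22)) {0..1}"
    by (intro has_integral_mult_right has_integral_add I)
  hence "((\<lambda>s. p * h E (X s)) has_integral p * (h E (X 0) * I11 + p * deriv (h E) (X 0) * I12 + q E 0 * I22)) {0..1}"
  proof (rule has_integral_eq[rotated])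
    fix s :: real assume s: "s \<in> {0..1}"
    show "p * (h E (X 0) * (?f s * ?f s) + p * deriv (h E) (X 0) * (?f s * ?g s) + q E 0 * (?g s * ?g s)) = p * h E (X s)"
      unfolding monodromy_relations(1)[OF s, of E] power2_eq_square by (rule refl)
  qed
  hence J: "2 * \<Theta> = p * (h E (X 0) * I11 + p * deriv (h E) (X 0) * I12 + q E 0 * I22)"
    using \<Theta> has_integral_unique by blast
  have I21: "integral {0..1} (\<lambda>r. ?g r * ?f r) = I12" by (simp add: I12_def mult.commute)
  have "(\<alpha> has_field_derivative ((mB E * I11 - mA E * I12) * - (p ^ 2) + (mD E * I12 - mC E * I22) * - (p ^ 2)) / 2) (at E)"
    unfolding \<alpha>_def[abs_def] mA_def[abs_def] mD_def[abs_def]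
    using DERIV_cdivide[OF DERIV_add[OF monodromy_entry_derivatives(1)[of 1 0 E] monodromy_entry_derivatives(2)[of 0 1 E]], of 2]
    by (simp only: I21 I11_def[symmetric] I12_def[symmetric] I22_def[symmetric] mA_def[symmetric] mD_def[symmetric])
  hence "deriv \<alpha> E = ((mB E * I11 - mA E * I12) * - (p ^ 2) + (mD E * I12 - mC E * I22) * - (p ^ 2)) / 2"
    by (rule DERIV_imp_deriv)
  hence d: "2 * deriv \<alpha> E = (mB E * I11 - mA E * I12) * - (p ^ 2) + (mD E * I12 - mC E * I22) * - (p ^ 2)"
    by (simp only: times_divide_eq_right, intro nonzero_mult_div_cancel_left) simp
  have aux: "P = 0 \<or> 2 * (P * R * \<delta>) = 2 * - (r * t)"
    if "2 * \<delta> = (b * i1 - a * i2) * - (P ^ 2) + (d * i2 - c * i3) * - (P ^ 2)" "2 * t = P * (x * i1 + y * i2 + z * i3)"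
      "P ^ 2 * R * b = r * x" "P ^ 2 * R * (d - a) = r * y" "P ^ 2 * R * c = - (r * z)"
    for P R \<delta> r t a b c d i1 i2 i3 x y z :: complex
  proof -
    have "P * R * (2 * \<delta>) = - P * (P ^ 2 * R * b * i1 + P ^ 2 * R * (d - a) * i2 - P ^ 2 * R * c * i3)"
      unfolding that(1) by (simp add: algebra_simps)
    also have "\<dots> = - r * (2 * t)" unfolding that(2-5) by (simp add: algebra_simps)
    finally show ?thesis by simp
  qed
  have "2 * (p * poly Q E * deriv \<alpha> E) = 2 * - (\<rho> E * \<Theta>)"
    using aux[OF d J monodromy_proportional(1-3)] p_nonzero by blast
  thus ?thesis by (simp only: mult_cancel_left) simp
qed

text \<open>Far out on the negative energies the multiplier has modulus below 1, so the trace is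
  neither 2 nor -2 there. This excludes that \<rho> vanishes identically.\<close>

lemma trace_not_constant: obtains E where "\<alpha> E ^ 2 \<noteq> 1"
proof -
  obtain T1 K where large: "\<And>T. T1 \<le> T \<Longrightarrow> nearly_constant_product V K T"
    using large_energy by blast
  obtain B where B: "\<And>s. norm (V s) \<le> B"
    using periodic_bounded[of V] V_continuous h_along_X_periodic(2) unfolding V_def by metis
  obtain T0 where T0: "\<And>T. T0 \<le> T \<Longrightarrow> nearly_constant_product V K T \<Longrightarrow> \<exists>f f1 m. decaying_bloch V T f f1 m"
    using large_bloch[of V B K, OF B] by blast
  define T where "T = max 1 (max T0 T1)"
  have T: "1 \<le> T" "T0 \<le> T" "T1 \<le> T" by (auto simp: T_def)
  obtain f f1 m where bloch: "decaying_bloch V T f f1 m" using T0[OF T(2) large[OF T(3)]] by blast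
  define E where "E = - of_real (T\<^sup>2) / p ^ 2"
  have W: "W E = (\<lambda>s. V s + of_real (T\<^sup>2))" using p_nonzero by (simp add: E_def)
  have m: "m \<noteq> 0" "hill_trace (W E) = m + 1 / m"
    unfolding W by (rule decaying_bloch_trace[OF bloch V_continuous])+
  have f1: "f 1 = m" "norm (f 1 * exp (of_real T) - 1) \<le> 1 / 8"
    using bloch[unfolded decaying_bloch_def] by (auto dest!: spec[of _ 0] bspec[of _ _ 1])
  have "norm m * exp T \<le> 9 / 8"
  proof -
    have "norm (m * exp (of_real T)) \<le> norm (m * exp (of_real T) - 1) + 1"
      using norm_triangle_sub[of "m * exp (of_real T)" 1] by simp
    thus ?thesis using f1 by (simp add: norm_mult)
  qed
  moreover have "2 \<le> exp T" using exp_ge_add_one_self[of T] T(1) by linarith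
  hence "norm m * 2 \<le> norm m * exp T" by (intro mult_left_mono) auto
  ultimately have nm: "norm m < 1" by linarith
  have "\<alpha> E ^ 2 \<noteq> 1"
  proof
    assume "\<alpha> E ^ 2 = 1"
    hence "(m + 1 / m) ^ 2 = 4" using m(2) hill_trace_W[of E] by (simp add: power_mult_distrib)
    hence "(m ^ 2 - 1) ^ 2 = 0" using m(1) by (simp add: power2_eq_square field_simps)
    hence "norm m ^ 2 = 1" by (simp flip: norm_power)
    thus False using nm norm_ge_zero[of m] by (auto simp: power2_eq_1_iff)
  qed
  thus thesis by (rule that)
qed

text \<open>Differentiating \<rho>^2 = p^2 Q (1 - \<alpha>^2) and inserting the derivative of
  \<alpha> gives the claim multiplied by \<rho>. Entire functions form an integral domain: if the
  claim failed somewhere, \<rho> would vanish identically and \<alpha>^2 would be 1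
  throughout.\<close>

lemma \<rho>_derivative:
  assumes Q0: "Q \<noteq> 0" and \<Theta>: "\<Theta> holomorphic_on UNIV" "\<And>E. ((\<lambda>s. p * h E (X s)) has_integral 2 * \<Theta> E) {0..1}"
  shows "2 * poly Q E * deriv \<rho> E = poly (pderiv Q) E * \<rho> E + 2 * p * poly Q E * \<alpha> E * \<Theta> E"
proof -
  define G where "G E = 2 * poly Q E * deriv \<rho> E - poly (pderiv Q) E * \<rho> E - 2 * p * poly Q E * \<alpha> E * \<Theta> E" for E
  have \<rho>': "(\<rho> has_field_derivative deriv \<rho> E) (at E)" and \<alpha>': "(\<alpha> has_field_derivative deriv \<alpha> E) (at E)" for E
    by (rule holomorphic_derivI[OF \<rho>_holomorphic open_UNIV UNIV_I]) (rule holomorphic_derivI[OF \<alpha>_holomorphic open_UNIV UNIV_I])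
  have G_hol: "G holomorphic_on UNIV"
    unfolding G_def[abs_def] by (intro holomorphic_intros \<rho>_holomorphic \<alpha>_holomorphic \<Theta>(1) open_UNIV)
  have \<rho>G: "\<rho> E * G E = 0" for E
  proof -
    have "((\<lambda>E. \<rho> E ^ 2) has_field_derivative 2 * \<rho> E * deriv \<rho> E) (at E)"
      by (auto intro!: derivative_eq_intros \<rho>')
    moreover have "((\<lambda>E. p ^ 2 * poly Q E * (1 - \<alpha> E ^ 2)) has_field_derivative
        p ^ 2 * poly (pderiv Q) E * (1 - \<alpha> E ^ 2) - p ^ 2 * poly Q E * (2 * \<alpha> E * deriv \<alpha> E)) (at E)"
      by (auto intro!: derivative_eq_intros \<alpha>')
    ultimately have "2 * \<rho> E * deriv \<rho> E = p ^ 2 * poly (pderiv Q) E * (1 - \<alpha> E ^ 2) - p ^ 2 * poly Q E * (2 * \<alpha> E * deriv \<alpha> E)"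
      unfolding monodromy_proportional(4) by (rule DERIV_unique)
    thus ?thesis using monodromy_proportional(4)[of E] \<alpha>_derivative[OF \<Theta>(2), of E] unfolding G_def by algebra
  qed
  have "G E = 0"
  proof (rule ccontr)
    assume "G E \<noteq> 0"
    hence GE: "E \<in> G -` (- {0})" by simp
    have opG: "open (G -` (- {0}))"
      using continuous_open_preimage[OF holomorphic_on_imp_continuous_on[OF G_hol] open_UNIV open_Compl[OF closed_singleton]] by simp
    have "\<rho> E = 0" for E
      by (rule analytic_continuation_open[OF opG open_UNIV _ connected_UNIV subset_UNIV \<rho>_holomorphic, of "\<lambda>_. 0"])
         (use GE \<rho>G in \<open>auto simp: mult_eq_0_iff\<close>)
    hence one: "\<alpha> E ^ 2 - 1 = 0" if "poly Q E \<noteq> 0" for E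
      using monodromy_proportional(4)[of E] that p_nonzero by simp
    obtain E1 where "poly Q E1 \<noteq> 0" using Q0 poly_all_0_iff_0 by blast
    hence QE: "E1 \<in> poly Q -` (- {0})" by simp
    have opQ: "open (poly Q -` (- {0}))"
      using continuous_open_preimage[OF continuous_on_poly[OF continuous_on_id] open_UNIV open_Compl[OF closed_singleton], of Q] by simp
    have "\<alpha> E ^ 2 - 1 = 0" for E
      by (rule analytic_continuation_open[OF opQ open_UNIV _ connected_UNIV subset_UNIV, of "\<lambda>E. \<alpha> E ^ 2 - 1" "\<lambda>_. 0"])
         (use QE one in \<open>auto intro!: holomorphic_intros \<alpha>_holomorphic\<close>)
    thus False using trace_not_constant by (metis eq_iff_diff_eq_0)
  qed
  thus ?thesis by (simp add: G_def algebra_simps)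
qed

lemma spectral_trace:
  assumes expansion: "derivative_expansion \<omega>\<^sub>1 \<omega>\<^sub>3 l c\<^sub>0 b c a"
    and E0: "hill_trace (W E\<^sub>0) = 2 * \<epsilon>" "\<epsilon> ^ 2 = 1"
    and path: "spectral_path Q E\<^sub>0 E g r"
  shows "\<exists>I. has_spectral_integral \<omega>\<^sub>1 \<omega>\<^sub>3 k c (a_total l a) g r I \<and> hill_trace (W E) = 2 * \<epsilon> * cos I"
proof -
  define \<Theta> where "\<Theta> E = hp k * poly c E - qp k * poly (a_total l a) E" for E
  have \<Theta>_hol: "\<Theta> holomorphic_on UNIV" unfolding \<Theta>_def[abs_def] by (intro holomorphic_intros)
  have \<Theta>: "((\<lambda>s. p * h E (X s)) has_integral 2 * \<Theta> E) {0..1}" for E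
    unfolding \<Theta>_def by (rule h_integral[OF expansion])
  have g: "valid_path g" "g 0 = E\<^sub>0" "g 1 = E" and gQ: "\<And>t. 0 < t \<Longrightarrow> t < 1 \<Longrightarrow> poly Q (g t) \<noteq> 0"
    and r: "continuous_on {0..1} r" "\<And>t. t \<in> {0..1} \<Longrightarrow> r t ^ 2 = poly Q (g t)"
    using path by (auto simp: spectral_path_def pathstart_def pathfinish_def)
  from g(1) obtain S D where gc: "continuous_on {0..1} g" and S: "finite S"
    and D: "\<And>t. t \<in> {0..1} - S \<Longrightarrow> (g has_vector_derivative D t) (at t)"
    unfolding valid_path_def piecewise_C1_differentiable_on_def C1_differentiable_on_def by blast
  have Q0: "Q \<noteq> 0" using gQ[of "1 / 2"] by auto
  have \<alpha>g: "continuous_on {0..1} (\<lambda>t. \<alpha> (g t))" and \<rho>g: "continuous_on {0..1} (\<lambda>t. \<rho> (g t))"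
    using continuous_on_compose2[OF holomorphic_on_imp_continuous_on[OF \<alpha>_holomorphic] gc subset_UNIV]
      continuous_on_compose2[OF holomorphic_on_imp_continuous_on[OF \<rho>_holomorphic] gc subset_UNIV] by auto
  have Qg: "continuous_on {0..1} (\<lambda>t. poly Q (g t))" by (intro continuous_intros gc)
  \<comment> \<open>The value 0 is the limit at a zero of Q: there \<alpha>^2 = 1, and \<beta>^2 = 1
    - \<alpha>^2 holds along the whole path.\<close>
  define \<beta> where "\<beta> t = (if poly Q (g t) = 0 then 0 else \<rho> (g t) / (p * r t))" for t
  have \<beta>_sq: "\<beta> t ^ 2 = 1 - \<alpha> (g t) ^ 2" if t: "t \<in> {0..1}" for t
  proof (cases "poly Q (g t) = 0")
    case True
    thus ?thesis using monodromy_proportional(5)[OF True] by (simp add: \<beta>_def)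
  next
    case False
    hence "\<beta> t ^ 2 = \<rho> (g t) ^ 2 / (p ^ 2 * poly Q (g t))"
      using r(2)[OF t] by (simp add: \<beta>_def power_divide power_mult_distrib)
    thus ?thesis using monodromy_proportional(4)[of "g t"] False p_nonzero by simp
  qed
  have \<beta>c: "continuous_on {0..1} \<beta>"
    unfolding continuous_on_def
  proof
    fix t :: real assume t: "t \<in> {0..1}"
    show "(\<beta> \<longlongrightarrow> \<beta> t) (at t within {0..1})"
    proof (cases "poly Q (g t) = 0")
      case True
      have "((\<lambda>s. sqrt (norm (1 - \<alpha> (g s) ^ 2))) \<longlongrightarrow> sqrt (norm (1 - \<alpha> (g t) ^ 2))) (at t within {0..1})"
        by (intro tendsto_intros) (use \<alpha>g t in \<open>auto simp: continuous_on_def\<close>)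
      moreover have "\<forall>\<^sub>F s in at t within {0..1}. sqrt (norm (1 - \<alpha> (g s) ^ 2)) = norm (\<beta> s)"
        by (auto simp: eventually_at_filter norm_power simp flip: \<beta>_sq)
      ultimately have "((\<lambda>s. norm (\<beta> s)) \<longlongrightarrow> sqrt (norm (1 - \<alpha> (g t) ^ 2))) (at t within {0..1})"
        by (rule Lim_transform_eventually)
      hence "((\<lambda>s. norm (\<beta> s)) \<longlongrightarrow> 0) (at t within {0..1})"
        using monodromy_proportional(5)[OF True] by simp
      moreover have "\<beta> t = 0" using True by (simp add: \<beta>_def)
      ultimately show ?thesis by (simp add: tendsto_norm_zero_iff)
    next
      case False
      have r0: "r t \<noteq> 0" using r(2)[OF t] False by auto
      have "((\<lambda>s. \<rho> (g s) / (p * r s)) \<longlongrightarrow> \<rho> (g t) / (p * r t)) (at t within {0..1})"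
        by (intro tendsto_intros) (use \<rho>g r(1) t r0 p_nonzero in \<open>auto simp: continuous_on_def\<close>)
      moreover have "\<forall>\<^sub>F s in at t within {0..1}. \<rho> (g s) / (p * r s) = \<beta> s"
        using tendsto_imp_eventually_ne[OF Qg[unfolded continuous_on_def, rule_format, OF t] False]
        by eventually_elim (simp add: \<beta>_def)
      ultimately have "(\<beta> \<longlongrightarrow> \<rho> (g t) / (p * r t)) (at t within {0..1})" by (rule Lim_transform_eventually)
      thus ?thesis using False by (simp add: \<beta>_def)
    qed
  qed
  define z where "z t = \<alpha> (g t) + \<i> * \<beta> t" for t
  have z_inv: "z t * (\<alpha> (g t) - \<i> * \<beta> t) = 1" if "t \<in> {0..1}" for t
    using \<beta>_sq[OF that] by (simp add: z_def power2_eq_square algebra_simps)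
  have zc: "continuous_on {0..1} z" unfolding z_def[abs_def] by (intro continuous_intros \<alpha>g \<beta>c)
  \<comment> \<open>z has the inverse \<alpha> - i \<beta> and so never vanishes; hence it has a
    logarithm that is continuous up to both end points.\<close>
  obtain \<phi> where \<phi>: "continuous_on {0..1} \<phi>" "\<And>t. t \<in> {0..1} \<Longrightarrow> z t = exp (\<phi> t)"
    using continuous_logarithm_on_contractible[OF zc convex_imp_contractible[OF convex_real_interval(5)]] z_inv
    by (metis mult_zero_left zero_neq_one)
  have deriv: "(\<phi> has_vector_derivative \<i> * (\<Theta> (g t) / r t * vector_derivative g (at t within {0..1}))) (at t)"
    if t: "t \<in> {0<..<1} - S" for t
  proof -
    have t01: "t \<in> {0<..<1}" and ti: "t \<in> {0..1}" using t by auto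
    have gd: "(g has_vector_derivative D t) (at t)" using t by (intro D) auto
    have vd: "vector_derivative g (at t within {0..1}) = D t"
      by (rule vector_derivative_at_within_ivl[OF gd]) (use t in auto)
    have Qt: "poly Q (g t) \<noteq> 0" using gQ t by auto
    have rt: "r t \<noteq> 0" and r2: "r t ^ 2 = poly Q (g t)" using r(2)[OF ti] Qt by auto
    have isC: "isCont r t" "isCont \<phi> t"
      using r(1) \<phi>(1) t01 by (auto intro!: continuous_on_interior)
    have Qd: "((\<lambda>s. poly Q (g s)) has_vector_derivative D t * poly (pderiv Q) (g t)) (at t)"
      using field_vector_diff_chain_at[OF gd poly_DERIV[of Q "g t"]] by (simp add: o_def)
    have "((\<lambda>s. r s ^ 2) has_vector_derivative D t * poly (pderiv Q) (g t)) (at t)"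
      by (rule has_vector_derivative_transform_within_open[OF Qd open_greaterThanLessThan t01]) (use r(2) in auto)
    hence rd: "(r has_vector_derivative D t * poly (pderiv Q) (g t) / (2 * r t)) (at t)"
      by (intro has_vector_derivative_implicit[where F = "\<lambda>x. x ^ 2"] isC(1)) (use rt in \<open>auto intro!: derivative_eq_intros\<close>)
    have \<alpha>d: "((\<lambda>s. \<alpha> (g s)) has_vector_derivative D t * deriv \<alpha> (g t)) (at t)"
      using field_vector_diff_chain_at[OF gd holomorphic_derivI[OF \<alpha>_holomorphic open_UNIV UNIV_I]] by (simp add: o_def)
    have "((\<lambda>E. \<rho> E / (p * poly Q E)) has_field_derivative
        (deriv \<rho> (g t) * (p * poly Q (g t)) - \<rho> (g t) * (p * poly (pderiv Q) (g t))) / ((p * poly Q (g t)) * (p * poly Q (g t)))) (at (g t))"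
      by (intro DERIV_divide DERIV_cmult poly_DERIV holomorphic_derivI[OF \<rho>_holomorphic open_UNIV UNIV_I])
         (use Qt p_nonzero in auto)
    from field_vector_diff_chain_at[OF gd this]
    have Fd: "((\<lambda>s. \<rho> (g s) / (p * poly Q (g s))) has_vector_derivative D t *
        ((deriv \<rho> (g t) * (p * poly Q (g t)) - \<rho> (g t) * (p * poly (pderiv Q) (g t))) / ((p * poly Q (g t)) * (p * poly Q (g t))))) (at t)"
      by (simp add: o_def)
    have "((\<lambda>s. \<rho> (g s) / (p * poly Q (g s)) * r s) has_vector_derivative
        \<rho> (g t) / (p * poly Q (g t)) * (D t * poly (pderiv Q) (g t) / (2 * r t)) + D t *
        ((deriv \<rho> (g t) * (p * poly Q (g t)) - \<rho> (g t) * (p * poly (pderiv Q) (g t))) / ((p * poly Q (g t)) * (p * poly Q (g t)))) * r t) (at t)"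
      by (rule has_vector_derivative_mult[OF Fd rd])
    hence \<beta>d: "(\<beta> has_vector_derivative
        \<rho> (g t) / (p * poly Q (g t)) * (D t * poly (pderiv Q) (g t) / (2 * r t)) + D t *
        ((deriv \<rho> (g t) * (p * poly Q (g t)) - \<rho> (g t) * (p * poly (pderiv Q) (g t))) / ((p * poly Q (g t)) * (p * poly Q (g t)))) * r t) (at t)"
    proof (rule has_vector_derivative_transform_within_open[OF _ open_greaterThanLessThan t01])
      fix s :: real assume s: "s \<in> {0<..<1}"
      have "poly Q (g s) = r s ^ 2" "poly Q (g s) \<noteq> 0" using r(2)[of s] gQ[of s] s by auto
      thus "\<rho> (g s) / (p * poly Q (g s)) * r s = \<beta> s" by (auto simp: \<beta>_def power2_eq_square)
    qed
    have aux: "P1 / (P * R) * (d * R' / (2 * x)) + d * ((P2 * (P * R) - P1 * (P * R')) / ((P * R) * (P * R))) * x = al * (d * th / x)"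
      if "2 * R * P2 = R' * P1 + 2 * P * R * al * th" "x ^ 2 = R" "P \<noteq> 0" "R \<noteq> 0" "x \<noteq> 0"
      for P1 P2 P R R' d x al th :: complex
    proof -
      have "P1 / (P * R) * (d * R' / (2 * x)) + d * ((P2 * (P * R) - P1 * (P * R')) / ((P * R) * (P * R))) * x
          = d * (P1 * R' + (2 * R * P2 - 2 * (P1 * R')) * x ^ 2 / R) / (2 * P * R * x)"
        using that(3-5) by (simp add: field_simps power2_eq_square)
      also have "\<dots> = d * (P1 * R' + (2 * R * P2 - 2 * (P1 * R'))) / (2 * P * R * x)" using that(2,4) by simp
      also have "\<dots> = al * (d * th / x)" unfolding that(1) using that(3-5) by (simp add: field_simps)
      finally show ?thesis .
    qed
    have \<beta>d': "(\<beta> has_vector_derivative \<alpha> (g t) * (D t * \<Theta> (g t) / r t)) (at t)"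
      by (rule has_vector_derivative_eq_rhs[OF \<beta>d], rule aux[OF \<rho>_derivative[OF Q0 \<Theta>_hol \<Theta>] r2 p_nonzero Qt rt])
    have \<alpha>d': "((\<lambda>s. \<alpha> (g s)) has_vector_derivative - \<beta> t * (D t * \<Theta> (g t) / r t)) (at t)"
    proof (rule has_vector_derivative_eq_rhs[OF \<alpha>d])
      have "deriv \<alpha> (g t) = - (\<rho> (g t) * \<Theta> (g t)) / (p * poly Q (g t))"
        using \<alpha>_derivative[OF \<Theta>, of "g t"] p_nonzero Qt by (simp add: field_simps)
      thus "D t * deriv \<alpha> (g t) = - \<beta> t * (D t * \<Theta> (g t) / r t)"
        using Qt rt p_nonzero unfolding r2[symmetric] by (simp add: \<beta>_def r2[symmetric] power2_eq_square field_simps)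
    qed
    have "(z has_vector_derivative - \<beta> t * (D t * \<Theta> (g t) / r t) + \<i> * (\<alpha> (g t) * (D t * \<Theta> (g t) / r t))) (at t)"
      unfolding z_def[abs_def] by (intro has_vector_derivative_add has_vector_derivative_mult_right \<alpha>d' \<beta>d')
    hence "((\<lambda>s. exp (\<phi> s)) has_vector_derivative - \<beta> t * (D t * \<Theta> (g t) / r t) + \<i> * (\<alpha> (g t) * (D t * \<Theta> (g t) / r t))) (at t)"
      by (rule has_vector_derivative_transform_within_open[OF _ open_greaterThanLessThan t01]) (use \<phi>(2) in auto)
    hence "(\<phi> has_vector_derivative (- \<beta> t * (D t * \<Theta> (g t) / r t) + \<i> * (\<alpha> (g t) * (D t * \<Theta> (g t) / r t))) / exp (\<phi> t)) (at t)"
      by (intro has_vector_derivative_implicit[where F = exp] isC(2)) (auto intro!: derivative_eq_intros)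
    moreover have "- \<beta> t * (D t * \<Theta> (g t) / r t) + \<i> * (\<alpha> (g t) * (D t * \<Theta> (g t) / r t)) = \<i> * (D t * \<Theta> (g t) / r t) * exp (\<phi> t)"
      by (simp add: \<phi>(2)[OF ti, symmetric] z_def algebra_simps)
    ultimately show ?thesis by (simp add: vd mult_ac)
  qed
  define I where "I = - \<i> * (\<phi> 1 - \<phi> 0)"
  \<comment> \<open>The theorem asks for continuity of \<phi> on the closed interval and for
    derivatives off a finite set; thus the improper integral exists without any estimate near the
    zeros of Q.\<close>
  have "((\<lambda>t. \<i> * (\<Theta> (g t) / r t * vector_derivative g (at t within {0..1}))) has_integral (\<phi> 1 - \<phi> 0)) {0..1}"
    by (rule fundamental_theorem_of_calculus_interior_strong[OF S _ deriv \<phi>(1)]) auto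
  from has_integral_mult_right[OF this, of "- \<i>"]
  have int: "has_spectral_integral \<omega>\<^sub>1 \<omega>\<^sub>3 k c (a_total l a) g r I"
    by (simp add: has_spectral_integral_def I_def \<Theta>_def mult.assoc[symmetric])
  have \<alpha>0: "\<alpha> E\<^sub>0 = \<epsilon>" using E0(1) unfolding hill_trace_W by simp
  have "\<beta> 0 = 0" using \<beta>_sq[of 0] E0(2) by (simp add: g(2) \<alpha>0)
  hence z0: "z 0 = \<epsilon>" by (simp add: z_def g(2) \<alpha>0)
  have e0: "exp (\<phi> 0) = \<epsilon>" and e1: "exp (\<phi> 1) = z 1" using \<phi>(2)[of 0] \<phi>(2)[of 1] z0 by auto
  have \<epsilon>0: "\<epsilon> \<noteq> 0" using E0(2) by auto
  have inv\<epsilon>: "1 / \<epsilon> = \<epsilon>" using E0(2) \<epsilon>0 by (simp add: field_simps power2_eq_square)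
  have z1: "z 1 \<noteq> 0" using e1 by (metis exp_not_eq_zero)
  have inv: "1 / z 1 = \<alpha> E - \<i> * \<beta> 1" using z_inv[of 1] z1 by (simp add: g(3) field_simps)
  have "cos I = (exp (\<phi> 1 - \<phi> 0) + exp (\<phi> 0 - \<phi> 1)) / 2"
    by (simp add: cos_exp_eq I_def mult.assoc[symmetric])
  also have "\<dots> = (z 1 * (1 / \<epsilon>) + \<epsilon> * (1 / z 1)) / 2" by (simp add: exp_diff e0 e1)
  also have "\<dots> = \<epsilon> * \<alpha> E" unfolding inv inv\<epsilon> by (simp add: z_def g(3) algebra_simps)
  finally have "2 * \<epsilon> * cos I = 2 * \<epsilon> ^ 2 * \<alpha> E" by (simp add: power2_eq_square)
  hence "hill_trace (W E) = 2 * \<epsilon> * cos I" unfolding hill_trace_W by (simp add: E0(2))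
  thus ?thesis using int by blast
qed

end

subsection \<open>Existence of \<open>\<Lambda>\<close> and its multiplier\<close>

context weierstrass begin

lemma wp_double_pole: "((\<lambda>x. (x - a) ^ 2 * wp (x + hp i)) \<longlongrightarrow> (if a + hp i \<in> L then 1 else 0)) (at a)"
proof (cases "a + hp i \<in> L")
  case True
  have "((\<lambda>x. (x - a) ^ 2 * wp (x - a)) \<longlongrightarrow> 1) (at a)"
    using filterlim_compose[OF wp_times_square_tendsto, of "\<lambda>x. x - a" "at a"]
    by (rule meta_mp) (auto intro!: filterlim_atI tendsto_eq_intros simp: eventually_at_filter)
  moreover have "\<forall>\<^sub>F x in at a. (x - a) ^ 2 * wp (x - a) = (x - a) ^ 2 * wp (x + hp i)"
    using eventually_not_H[of a]
  proof eventually_elim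
    case (elim x)
    have "x + hp i \<notin> L" using elim notin_H_imp_notin_L by (metis H_add_hp(1))
    hence "x - a \<notin> L" using L_add[OF True, of "x - a"] by (auto simp: algebra_simps)
    from wp_periodic[OF True this] show ?case by (simp add: algebra_simps)
  qed
  ultimately show ?thesis using True Lim_transform_eventually by fastforce
next
  case False
  have "isCont (\<lambda>x. wp (x + hp i)) a"
    by (rule isCont_o2[OF _ wp_continuous]) (use False in \<open>auto intro!: continuous_intros\<close>)
  hence "((\<lambda>x. (x - a) ^ 2 * wp (x + hp i)) \<longlongrightarrow> (a - a) ^ 2 * wp (a + hp i)) (at a)"
    by (intro tendsto_intros) (simp add: isCont_def)
  thus ?thesis using False by simp
qed

lemma wp_shift_meromorphic: "(\<lambda>x. wp (x + hp i)) meromorphic_on {a}"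
proof -
  obtain e where e: "0 < e" "\<And>y. y \<in> ball a e \<Longrightarrow> y \<noteq> a \<Longrightarrow> y \<notin> H"
    using eventually_not_H[of a] unfolding eventually_at by (auto simp: dist_commute)
  have iso: "isolated_singularity_at (\<lambda>x. (x - a) ^ 2 * wp (x + hp i)) a"
    by (rule isolated_singularity_at_holomorphic[of _ "ball a e"])
       (use e in \<open>auto intro!: holomorphic_intros holomorphic_on_subset[OF wp_shift_holomorphic]\<close>)
  have "not_essential (\<lambda>x. (x - a) ^ 2 * wp (x + hp i)) a"
    unfolding not_essential_def using wp_double_pole by blast
  with iso have "(\<lambda>x. (x - a) ^ 2 * wp (x + hp i)) meromorphic_on {a}" by (simp add: meromorphic_at_iff)
  hence "(\<lambda>x. (x - a) ^ 2 * wp (x + hp i) / (x - a) ^ 2) meromorphic_on {a}"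
    by (rule meromorphic_on_divide) (intro meromorphic_intros)
  moreover have "(\<lambda>x. (x - a) ^ 2 * wp (x + hp i) / (x - a) ^ 2) meromorphic_on {a} \<longleftrightarrow> (\<lambda>x. wp (x + hp i)) meromorphic_on {a}"
    by (rule meromorphic_on_cong) (auto simp: eventually_at_filter)
  ultimately show ?thesis by (simp only:)
qed

end

section \<open>Residues of the logarithmic derivative of \<Lambda>\<close>

context finite_gap begin

lemma h_factorization:
  obtains e g and N :: int where "0 < e" "g holomorphic_on ball a e" "\<And>y. y \<in> ball a e \<Longrightarrow> g y \<noteq> 0"
    "\<And>y. y \<in> ball a e \<Longrightarrow> y \<noteq> a \<Longrightarrow> y \<notin> H \<and> h E y = g y * (y - a) powi N"
proof -
  have mer: "h E meromorphic_on {a}"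
    unfolding h_def Xi_fun_def[abs_def] by (intro meromorphic_intros wp_shift_meromorphic)
  obtain d where d: "0 < d" "\<And>y. y \<in> ball a d \<Longrightarrow> y \<noteq> a \<Longrightarrow> y \<notin> H"
    using eventually_not_H[of a] unfolding eventually_at by (auto simp: dist_commute)
  have freq: "\<exists>\<^sub>F w in at a. h E w \<noteq> 0"
  proof (rule ccontr)
    assume "\<not> ?thesis"
    hence "\<forall>\<^sub>F w in at a. h E w = 0" by (simp add: frequently_def)
    then obtain d' where d': "0 < d'" "\<And>y. y \<in> ball a d' \<Longrightarrow> y \<noteq> a \<Longrightarrow> h E y = 0"
      unfolding eventually_at by (auto simp: dist_commute)
    define U where "U = ball a (min d d') - {a}"
    have "a islimpt ball a (min d d')" using d(1) d'(1) by (simp add: islimpt_ball)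
    hence "U \<noteq> {}" by (auto simp: islimpt_def U_def)
    then obtain \<xi> where \<xi>: "\<xi> \<in> U" by blast
    have "open U" by (simp add: U_def open_delete)
    hence "\<xi> islimpt U" using \<xi> by (simp add: interior_limit_point interior_open)
    hence "h E z = 0" if "z \<notin> H" for z
      by (rule zero_by_continuation[OF h_holomorphic _ _ _ _ that]) (use \<xi> d d' in \<open>auto simp: U_def\<close>)
    thus False using h_nonzero[of E] by blast
  qed
  define g where "g = zor_poly (h E) a"
  define N where "N = zorder (h E) a"
  obtain r where "g a \<noteq> 0" "r > 0" "g holomorphic_on cball a r"
    "\<And>w. w \<in> cball a r - {a} \<Longrightarrow> h E w = g w * (w - a) powi N \<and> g w \<noteq> 0"
    using zorder_exist[OF meromorphic_on_isolated_singularity[OF mer] meromorphic_on_not_essential[OF mer] freq]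
    unfolding g_def N_def by blast
  note r = this
  show thesis
  proof (rule that[of "min d r" g N])
    show "g holomorphic_on ball a (min d r)" by (rule holomorphic_on_subset[OF r(3)]) auto
    show "g y \<noteq> 0" if "y \<in> ball a (min d r)" for y using r(1,4) that by (cases "y = a") auto
    show "y \<notin> H \<and> h E y = g y * (y - a) powi N" if "y \<in> ball a (min d r)" "y \<noteq> a" for y
      using r(4)[of y] d(2)[of y] that by auto
  qed (use d r in auto)
qed

text \<open>Distinct half-periods are inequivalent, so at most one of the four summands has a pole
  at a; m is the corresponding l_i, and 0 if there is none.\<close>

lemma u_double_pole:
  "\<exists>m. (a \<notin> H \<longrightarrow> m = 0) \<and> ((\<lambda>x. (x - a) ^ 2 * (u x - E)) \<longlongrightarrow> of_int (m * (m + 1))) (at a)"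
proof -
  define v where "v i = (if a + hp i \<in> L then of_int (l i * (l i + 1)) else 0 :: complex)" for i
  have "((\<lambda>x. (\<Sum>i\<le>3. of_int (l i) * (of_int (l i) + 1) * ((x - a) ^ 2 * wp (x + hp i))) - (x - a) ^ 2 * E)
      \<longlongrightarrow> (\<Sum>i\<le>3. of_int (l i) * (of_int (l i) + 1) * (if a + hp i \<in> L then 1 else 0)) - (a - a) ^ 2 * E) (at a)"
    by (intro tendsto_intros wp_double_pole)
  moreover have "(\<Sum>i\<le>3. of_int (l i) * (of_int (l i) + 1) * (if a + hp i \<in> L then 1 else 0)) - (a - a) ^ 2 * E = (\<Sum>i\<le>3. v i)"
    by (simp add: v_def) (intro sum.cong refl, simp)
  moreover have "(\<lambda>x. (\<Sum>i\<le>3. of_int (l i) * (of_int (l i) + 1) * ((x - a) ^ 2 * wp (x + hp i))) - (x - a) ^ 2 * E)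
      = (\<lambda>x. (x - a) ^ 2 * (u x - E))"
    by (rule ext) (simp add: u_def potential_def right_diff_distrib sum_distrib_left mult_ac)
  ultimately have lim: "((\<lambda>x. (x - a) ^ 2 * (u x - E)) \<longlongrightarrow> (\<Sum>i\<le>3. v i)) (at a)" by simp
  show ?thesis
  proof (cases "\<exists>i\<le>3. a + hp i \<in> L")
    case True
    then obtain i where i: "i \<le> 3" "a + hp i \<in> L" by blast
    have "v j = 0" if "j \<in> {..3} - {i}" for j
    proof -
      have "a + hp j \<notin> L"
        using L_diff[of "a + hp j" "a + hp i"] i hp_diff_notin_L[of j i] that by auto
      thus ?thesis by (simp add: v_def)
    qed
    hence "(\<Sum>i\<le>3. v i) = v i" using i by (subst sum.remove[of _ i]) auto
    also have "\<dots> = of_int (l i * (l i + 1))" using i by (simp add: v_def)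
    finally have "((\<lambda>x. (x - a) ^ 2 * (u x - E)) \<longlongrightarrow> of_int (l i * (l i + 1))) (at a)" using lim by simp
    moreover have "a \<in> H" using notin_H_imp_notin_L[of "a + hp i"] i by auto
    ultimately show ?thesis by blast
  next
    case False
    hence "(\<Sum>i\<le>3. v i) = 0" by (intro sum.neutral) (auto simp: v_def)
    with lim show ?thesis by (intro exI[of _ 0]) simp
  qed
qed

text \<open>Both the zeros of \<open>\<Xi>\<close> and the half-periods are at most simple poles of the logarithmic derivative
  of \<open>\<Lambda>\<close>, and the Riccati equation makes the residue a root of \<open>X\<^sup>2 - X = m (m + 1)\<close>.\<close>

lemma logarithmic_derivative_pole:
  assumes s: "s ^ 2 = - poly Q E"
  obtains N :: int and e \<phi> where "0 < e" "\<phi> holomorphic_on ball a e" "\<phi> a = of_int N" "a \<notin> H \<Longrightarrow> N \<in> {0, 1}"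
    "\<And>y. y \<in> ball a e \<Longrightarrow> y \<noteq> a \<Longrightarrow> y \<notin> H \<and> h E y \<noteq> 0 \<and> (deriv (h E) y / 2 + s) / h E y = \<phi> y / (y - a)"
proof -
  obtain e g and n' :: int where e: "0 < e" and g: "g holomorphic_on ball a e" and g0: "\<And>y. y \<in> ball a e \<Longrightarrow> g y \<noteq> 0"
    and hg: "\<And>y. y \<in> ball a e \<Longrightarrow> y \<noteq> a \<Longrightarrow> y \<notin> H \<and> h E y = g y * (y - a) powi n'"
    by (rule h_factorization[of a E], rule that) blast+
  define B where "B = ball a e - {a}"
  have opB: "open B" by (simp add: B_def open_delete)
  have hB: "y \<notin> H" "h E y = g y * (y - a) powi n'" "h E y \<noteq> 0" if "y \<in> B" for y
    using hg[of y] g0[of y] that by (auto simp: B_def)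
  have evB: "\<forall>\<^sub>F y in at a. y \<in> B"
    using eventually_at_in_open'[of "ball a e" a] e by (auto simp: B_def eventually_at_filter)
  have aB: "a \<in> ball a e" using e by simp
  obtain m where m: "a \<notin> H \<longrightarrow> m = 0" and um: "((\<lambda>x. (x - a) ^ 2 * (u x - E)) \<longlongrightarrow> of_int (m * (m + 1))) (at a)"
    using u_double_pole[of a E] by (elim exE conjE)
  \<comment> \<open>At a zero of \<Xi> of order at least 2 every term in the formula for Q tends to
    0, also at a half-period, where the double pole of u is compensated. So such zeros force s =
    0.\<close>
  have s0: "s = 0" if n': "2 \<le> n'"
  proof -
    define k where "k y = g y * (y - a) ^ nat n'" for y
    have k: "k holomorphic_on ball a e" unfolding k_def[abs_def] by (intro holomorphic_intros g)
    have hk: "h E y = k y" if "y \<in> B" for y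
      using hB(2)[OF that] n' by (simp add: k_def power_int_def)
    have dk: "((deriv ^^ j) k \<longlongrightarrow> (deriv ^^ j) k a) (at a)" for j
    proof -
      have "(deriv ^^ j) k holomorphic_on ball a e" by (intro holomorphic_higher_deriv k open_ball)
      hence "isCont ((deriv ^^ j) k) a"
        by (intro field_differentiable_imp_continuous_at holomorphic_on_imp_differentiable_at[OF _ open_ball aB])
      thus ?thesis by (simp add: isCont_def)
    qed
    have dh: "(deriv ^^ j) (h E) y = (deriv ^^ j) k y" if "y \<in> B" for y j
      by (rule higher_deriv_cong_ev[OF eventually_mono[OF eventually_nhds_in_open[OF opB that]] refl]) (rule hk)
    define j where "j = nat n' - 1"
    have j: "nat n' = Suc j" "0 < j" using n' by (auto simp: j_def)
    have "(g has_field_derivative deriv g a) (at a)" by (rule holomorphic_derivI[OF g open_ball aB])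
    hence "(k has_field_derivative g a * (of_nat (Suc j) * (1 * (a - a) ^ j)) + deriv g a * (a - a) ^ Suc j) (at a)"
      unfolding k_def[abs_def] j by (intro DERIV_mult') (auto intro!: derivative_eq_intros)
    hence k1: "deriv k a = 0" using j by (simp add: DERIV_imp_deriv)
    have k0: "k a = 0" using j by (simp add: k_def)
    have "((\<lambda>y. g y ^ 2 * (y - a) ^ (2 * j) * - ((y - a) ^ 2 * (u y - E)) + 1 / 2 * k y * (deriv ^^ 2) k y - 1 / 4 * (deriv k y) ^ 2)
        \<longlongrightarrow> g a ^ 2 * (a - a) ^ (2 * j) * - of_int (m * (m + 1)) + 1 / 2 * k a * (deriv ^^ 2) k a - 1 / 4 * (deriv k a) ^ 2) (at a)"
    proof -
      have "isCont g a"
        by (intro field_differentiable_imp_continuous_at holomorphic_on_imp_differentiable_at[OF g open_ball aB])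
      thus ?thesis using dk[of 0] dk[of 1] dk[of 2] um by (intro tendsto_intros) (simp_all add: isCont_def)
    qed
    note lim = this
    have "((\<lambda>y. g y ^ 2 * (y - a) ^ (2 * j) * - ((y - a) ^ 2 * (u y - E)) + 1 / 2 * k y * (deriv ^^ 2) k y - 1 / 4 * (deriv k y) ^ 2)
        \<longlongrightarrow> 0) (at a)"
    proof -
      have "g a ^ 2 * (a - a) ^ (2 * j) * - of_int (m * (m + 1)) + 1 / 2 * k a * (deriv ^^ 2) k a - 1 / 4 * (deriv k a) ^ 2 = 0"
        using j by (simp add: k0 k1 power_0_left)
      with lim show ?thesis by (simp only:)
    qed
    moreover have "\<forall>\<^sub>F y in at a. g y ^ 2 * (y - a) ^ (2 * j) * - ((y - a) ^ 2 * (u y - E)) + 1 / 2 * k y * (deriv ^^ 2) k y - 1 / 4 * (deriv k y) ^ 2 = poly Q E"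
      using evB
    proof eventually_elim
      case (elim y)
      have "poly Q E = (k y) ^ 2 * (E - u y) + 1 / 2 * k y * (deriv ^^ 2) k y - 1 / 4 * (deriv k y) ^ 2"
        using Q_eq[OF hB(1)[OF elim], of E] dh[OF elim, of 0] dh[OF elim, of 1] dh[OF elim, of 2] by simp
      moreover have "k y ^ 2 = g y ^ 2 * (y - a) ^ (2 * j) * (y - a) ^ 2"
        unfolding k_def j by (simp add: power_mult_distrib power_mult power2_eq_square power_add[symmetric] mult_ac)
      ultimately show ?case by (simp add: algebra_simps)
    qed
    ultimately have "((\<lambda>y. poly Q E) \<longlongrightarrow> 0) (at a)" by (rule Lim_transform_eventually)
    hence "poly Q E = 0" by (simp add: tendsto_const_iff)
    thus ?thesis using s by simp
  qed
  \<comment> \<open>(y - a) times the logarithmic derivative, for h = g (y - a)^n'. The exponent 1 -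
    n' is negative only if n' >= 2; then s = 0, and the truncation by \<open>nat\<close> is
    harmless.\<close>
  define \<phi> where "\<phi> y = of_int n' / 2 + (y - a) * deriv g y / (2 * g y) + s * (y - a) ^ nat (1 - n') / g y" for y
  have \<phi>_hol: "\<phi> holomorphic_on ball a e"
    unfolding \<phi>_def[abs_def] by (intro holomorphic_intros g open_ball) (use g0 in auto)
  have \<phi>_eq: "(deriv (h E) y / 2 + s) / h E y = \<phi> y / (y - a)" if y: "y \<in> B" for y
  proof -
    have ya: "y - a \<noteq> 0" and yb: "y \<in> ball a e" using y by (auto simp: B_def)
    have gy: "g y \<noteq> 0" by (rule g0[OF yb])
    have "(g has_field_derivative deriv g y) (at y)" by (rule holomorphic_derivI[OF g open_ball yb])
    hence "((\<lambda>y. g y * (y - a) powi n') has_field_derivative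
        g y * (of_int n' * (y - a) powi (n' - 1) * (1 - 0)) + deriv g y * (y - a) powi n') (at y)"
      using ya by (intro DERIV_mult' derivative_eq_intros) auto
    hence "(h E has_field_derivative
        g y * (of_int n' * (y - a) powi (n' - 1) * (1 - 0)) + deriv g y * (y - a) powi n') (at y)"
      by (rule has_field_derivative_transform_within_open[OF _ opB y]) (use hB in simp)
    hence h': "deriv (h E) y = g y * (of_int n' * (y - a) powi (n' - 1)) + deriv g y * (y - a) powi n'"
      using DERIV_imp_deriv by fastforce
    have pw: "(y - a) powi n' = (y - a) powi (n' - 1) * (y - a)"
      using ya power_int_add_1[of "y - a" "n' - 1"] by simp
    have p0: "(y - a) powi (n' - 1) \<noteq> 0" using ya by simp
    have spw: "s = s * (y - a) ^ nat (1 - n') * (y - a) powi (n' - 1)"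
    proof (cases "2 \<le> n'")
      case False
      hence "(y - a) ^ nat (1 - n') = (y - a) powi (1 - n')" by (simp add: power_int_def)
      thus ?thesis using ya power_int_add[of "y - a" "1 - n'" "n' - 1"] by simp
    qed (use s0 in simp)
    have "(deriv (h E) y / 2 + s * (y - a) ^ nat (1 - n') * (y - a) powi (n' - 1)) / h E y = \<phi> y / (y - a)"
      unfolding h' hB(2)[OF y] pw \<phi>_def using p0 ya gy by (simp add: field_simps)
    thus ?thesis using spw by simp
  qed
  have riccati: "(y - a) * deriv \<phi> y - \<phi> y + \<phi> y ^ 2 = (y - a) ^ 2 * (u y - E)" if y: "y \<in> B" for y
  proof -
    have ya: "y - a \<noteq> 0" and yb: "y \<in> ball a e" using y by (auto simp: B_def)
    have h0: "h E y \<noteq> 0" and yH: "y \<in> - H" using hB[OF y] by auto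
    note dh = holomorphic_derivI[OF h_holomorphic open_Compl_H yH, of E UNIV]
      and dh2 = holomorphic_derivI[OF holomorphic_deriv[OF h_holomorphic open_Compl_H] open_Compl_H yH, of E UNIV]
    have "((\<lambda>y. (deriv (h E) y / 2 + s) / h E y) has_field_derivative
        ((deriv (deriv (h E)) y / 2 + 0) * h E y - (deriv (h E) y / 2 + s) * deriv (h E) y) / (h E y * h E y)) (at y)"
      by (intro DERIV_divide DERIV_add DERIV_cdivide DERIV_const dh dh2 h0)
    hence "((\<lambda>y. \<phi> y / (y - a)) has_field_derivative
        ((deriv (deriv (h E)) y / 2 + 0) * h E y - (deriv (h E) y / 2 + s) * deriv (h E) y) / (h E y * h E y)) (at y)"
      by (rule has_field_derivative_transform_within_open[OF _ opB y]) (rule \<phi>_eq)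
    moreover have "((\<lambda>y. \<phi> y / (y - a)) has_field_derivative (deriv \<phi> y * (y - a) - \<phi> y * (1 - 0)) / ((y - a) * (y - a))) (at y)"
      by (intro DERIV_divide DERIV_diff DERIV_ident DERIV_const holomorphic_derivI[OF \<phi>_hol open_ball yb] ya)
    ultimately have e: "((deriv (deriv (h E)) y / 2 + 0) * h E y - (deriv (h E) y / 2 + s) * deriv (h E) y) / (h E y * h E y)
        = (deriv \<phi> y * (y - a) - \<phi> y * (1 - 0)) / ((y - a) * (y - a))" by (rule DERIV_unique)
    have aux: "d * \<delta> - f + f ^ 2 = d ^ 2 * (U - F)"
      if "((k2 / 2 + 0) * k - (k1 / 2 + t) * k1) / (k * k) = (\<delta> * d - f * (1 - 0)) / (d * d)"
        "(k1 / 2 + t) / k = f / d" "- (t ^ 2) = k ^ 2 * (F - U) + 1 / 2 * k * k2 - 1 / 4 * k1 ^ 2" "k \<noteq> 0" "d \<noteq> 0"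
      for d \<delta> f U F k k1 k2 t :: complex
    proof -
      have 1: "d ^ 2 * (((k2 / 2) * k - (k1 / 2 + t) * k1) / (k * k)) = d * \<delta> - f"
        using that(1,5) by (simp add: power2_eq_square field_simps)
      have 2: "f = d * ((k1 / 2 + t) / k)" using that(2,5) by simp
      have "d * \<delta> - f + f ^ 2 = d ^ 2 * (((k2 / 2) * k - (k1 / 2 + t) * k1) / (k * k) + ((k1 / 2 + t) / k) ^ 2)"
        unfolding 1[symmetric] unfolding 2 by (simp only: power_mult_distrib distrib_left)
      also have "((k2 / 2) * k - (k1 / 2 + t) * k1) / (k * k) + ((k1 / 2 + t) / k) ^ 2
          = (1 / 2 * k * k2 - 1 / 4 * k1 ^ 2 - (- (t ^ 2))) / k ^ 2"
        using that(4) by (simp add: power2_eq_square field_simps)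
      also have "\<dots> = U - F" unfolding that(3) using that(4) by (simp add: field_simps)
      finally show ?thesis .
    qed
    have "- (s ^ 2) = (h E y) ^ 2 * (E - u y) + 1 / 2 * h E y * deriv (deriv (h E)) y - 1 / 4 * (deriv (h E) y) ^ 2"
      using Q_eq[of y E] yH s by (simp add: numeral_2_eq_2)
    from aux[OF e \<phi>_eq[OF y] this h0 ya] show ?thesis .
  qed
  have cont: "isCont \<phi> a" "isCont (deriv \<phi>) a"
    using holomorphic_on_imp_differentiable_at[OF \<phi>_hol open_ball aB]
      holomorphic_on_imp_differentiable_at[OF holomorphic_deriv[OF \<phi>_hol open_ball] open_ball aB]
      field_differentiable_imp_continuous_at by auto
  have "((\<lambda>y. (y - a) * deriv \<phi> y - \<phi> y + \<phi> y ^ 2) \<longlongrightarrow> (a - a) * deriv \<phi> a - \<phi> a + \<phi> a ^ 2) (at a)"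
    using cont by (intro tendsto_intros) (simp_all add: isCont_def)
  moreover have "\<forall>\<^sub>F y in at a. (y - a) * deriv \<phi> y - \<phi> y + \<phi> y ^ 2 = (y - a) ^ 2 * (u y - E)"
    using evB by eventually_elim (rule riccati)
  ultimately have "((\<lambda>y. (y - a) ^ 2 * (u y - E)) \<longlongrightarrow> (a - a) * deriv \<phi> a - \<phi> a + \<phi> a ^ 2) (at a)"
    by (rule Lim_transform_eventually)
  from tendsto_unique[OF trivial_limit_at this um]
  have "- \<phi> a + \<phi> a ^ 2 = of_int m * (of_int m + 1)" by simp
  hence "(\<phi> a - of_int (m + 1)) * (\<phi> a - of_int (- m)) = 0" by (simp add: power2_eq_square algebra_simps)
  hence "\<phi> a = of_int (m + 1) \<or> \<phi> a = of_int (- m)" unfolding mult_eq_0_iff right_minus_eq .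
  then obtain N where N: "\<phi> a = of_int N" "N \<in> {m + 1, - m}" by blast
  show thesis
  proof (rule that[OF e \<phi>_hol N(1)])
    show "a \<notin> H \<Longrightarrow> N \<in> {0, 1}" using N(2) m by auto
    show "y \<notin> H \<and> h E y \<noteq> 0 \<and> (deriv (h E) y / 2 + s) / h E y = \<phi> y / (y - a)" if "y \<in> ball a e" "y \<noteq> a" for y
      using hB[of y] \<phi>_eq[of y] that by (simp add: B_def)
  qed
qed

end

lemma prod_logarithmic_derivative:
  fixes f :: "'a \<Rightarrow> complex \<Rightarrow> complex"
  assumes "finite R" "\<And>r. r \<in> R \<Longrightarrow> (f r has_field_derivative f r z * c r) (at z)"
  shows "((\<lambda>z. \<Prod>r\<in>R. f r z) has_field_derivative (\<Prod>r\<in>R. f r z) * (\<Sum>r\<in>R. c r)) (at z)"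
  using assms
proof (induction R rule: finite_induct)
  case (insert r R)
  have "((\<lambda>z. f r z * (\<Prod>r\<in>R. f r z)) has_field_derivative f r z * ((\<Prod>r\<in>R. f r z) * (\<Sum>r\<in>R. c r)) + f r z * c r * (\<Prod>r\<in>R. f r z)) (at z)"
    by (intro DERIV_mult' insert) (use insert.prems in auto)
  thus ?case using insert.hyps by (simp add: algebra_simps)
qed simp

section \<open>Quasi-periods and representatives modulo the lattice\<close>

context weierstrass begin

lemma wz_add_lattice:
  assumes v: "v \<in> L" obtains c where "\<And>z. z \<notin> L \<Longrightarrow> wz (z + v) = wz z + c"
proof -
  have d: "((\<lambda>z. wz (z + v) - wz z) has_field_derivative 0) (at z)" if z: "z \<notin> L" for z
  proof -
    have zv: "z + v \<notin> L" using z v by (simp add: L_add_iff)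
    have "((\<lambda>z. wz (z + v) - wz z) has_field_derivative - wp (z + v) - - wp z) (at z)"
      by (intro DERIV_diff shifted_derivative wz_derivative z zv)
    thus ?thesis using wp_periodic[OF v z] by simp
  qed
  obtain x where x: "x \<notin> L" using hp_notin_L[of 1] by auto
  show thesis
  proof (rule that)
    fix z assume "z \<notin> L"
    from constant_on_Compl_L[OF d this x] show "wz (z + v) = wz z + (wz (x + v) - wz x)" by (simp add: algebra_simps)
  qed
qed

text \<open>Translating \<sigma> by the two periods in either order gives the same value. This is
  Legendre's relation in exponential form: 4 (\<eta>_3 \<omega>_1 - \<eta>_1 \<omega>_3) is a
  multiple of 2 \<pi> i.\<close>

lemma legendre: "exp (4 * qp 3 * hp 1) = exp (4 * qp 1 * hp 3)"
proof -
  define z where "z = hp 1"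
  have nz: "ws z \<noteq> 0" using hp_notin_L[of 1] by (simp add: ws_eq_0_iff z_def)
  have 1: "ws (z + 2 * hp 1 + 2 * hp 3) = exp (2 * qp 3 * (z + 2 * hp 1 + hp 3)) * exp (2 * qp 1 * (z + hp 1)) * ws z"
    using ws_quasi_periodic[of 3 "z + 2 * hp 1"] ws_quasi_periodic[of 1 z] by simp
  have 2: "ws (z + 2 * hp 3 + 2 * hp 1) = exp (2 * qp 1 * (z + 2 * hp 3 + hp 1)) * exp (2 * qp 3 * (z + hp 3)) * ws z"
    using ws_quasi_periodic[of 1 "z + 2 * hp 3"] ws_quasi_periodic[of 3 z] by simp
  have "z + 2 * hp 1 + 2 * hp 3 = z + 2 * hp 3 + 2 * hp 1" by simp
  hence "exp (2 * qp 3 * (z + 2 * hp 1 + hp 3)) * exp (2 * qp 1 * (z + hp 1)) * ws z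
      = exp (2 * qp 1 * (z + 2 * hp 3 + hp 1)) * exp (2 * qp 3 * (z + hp 3)) * ws z" using 1 2 by metis
  hence "exp (2 * qp 3 * (z + 2 * hp 1 + hp 3)) * exp (2 * qp 1 * (z + hp 1))
      = exp (2 * qp 1 * (z + 2 * hp 3 + hp 1)) * exp (2 * qp 3 * (z + hp 3))" using mult_right_cancel[OF nz] by blast
  moreover have "exp (2 * qp 3 * (z + 2 * hp 1 + hp 3)) * exp (2 * qp 1 * (z + hp 1))
      = exp (4 * qp 3 * hp 1) * exp (2 * qp 3 * (z + hp 3) + 2 * qp 1 * (z + hp 1))"
    unfolding exp_add[symmetric] by (simp add: algebra_simps)
  moreover have "exp (2 * qp 1 * (z + 2 * hp 3 + hp 1)) * exp (2 * qp 3 * (z + hp 3))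
      = exp (4 * qp 1 * hp 3) * exp (2 * qp 3 * (z + hp 3) + 2 * qp 1 * (z + hp 1))"
    unfolding exp_add[symmetric] by (simp add: algebra_simps)
  ultimately show ?thesis by simp
qed

text \<open>The values \<wp>(\<alpha>) and \<wp>'(\<alpha>) fix \<alpha> modulo L only, so the
  multiplier must depend on the class of \<alpha> alone. A step by one period changes the exponent
  by 0 or by a quantity that Legendre's relation makes a multiple of 2 \<pi> i.\<close>

lemma multiplier_add_lattice:
  assumes k: "k \<in> {1, 3}" and v: "v \<in> L"
  shows "\<forall>a. a \<notin> L \<longrightarrow> exp (2 * hp k * wz (a + v) - 2 * qp k * (a + v)) = exp (2 * hp k * wz a - 2 * qp k * a)"
  using v
proof (induction rule: L_induct)
  case (step v j)
  have one: "exp (4 * qp j * hp k - 4 * qp k * hp j) = 1"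
    using k step(2) legendre by (auto simp: exp_diff)
  have sh: "exp (2 * hp k * wz (z + 2 * hp j) - 2 * qp k * (z + 2 * hp j)) = exp (2 * hp k * wz z - 2 * qp k * z)"
    if z: "z \<notin> L" for z
  proof -
    have "wz (z + 2 * hp j) = wz z + 2 * qp j" by (rule wz_quasi_periodic[OF z]) (use step(2) in auto)
    hence "2 * hp k * wz (z + 2 * hp j) - 2 * qp k * (z + 2 * hp j) = 2 * hp k * wz z - 2 * qp k * z + (4 * qp j * hp k - 4 * qp k * hp j)"
      by (simp add: algebra_simps)
    thus ?thesis using one by (simp only: exp_add mult_1_right)
  qed
  show ?case
  proof (intro conjI allI impI)
    fix a assume a: "a \<notin> L"
    have av: "a + v \<notin> L"
      using a step(1) L_add_iff(1)[OF step(1), of a] by auto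
    show "exp (2 * hp k * wz (a + (v + 2 * hp j)) - 2 * qp k * (a + (v + 2 * hp j))) = exp (2 * hp k * wz a - 2 * qp k * a)"
      using sh[OF av] step(3)[rule_format, OF a] by (simp only: add.assoc)
  next
    fix a assume a: "a \<notin> L"
    have av: "a + v \<notin> L" "a + v - 2 * hp j \<notin> L"
      using a step(1) L_add_iff(1)[OF step(1), of a] L_add[of "a + v - 2 * hp j" "2 * hp j"] by auto
    show "exp (2 * hp k * wz (a + (v - 2 * hp j)) - 2 * qp k * (a + (v - 2 * hp j))) = exp (2 * hp k * wz a - 2 * qp k * a)"
      using sh[OF av(2)] step(3)[rule_format, OF a] by (simp add: add_diff_eq)
  qed
qed simp

text \<open>Equal values of \<wp> leave a = a' or a = - a' modulo L. In the second case the oddness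
  of \<wp>' gives \<wp>'(a) = 0, so 2 a is in L and the two cases coincide.\<close>

lemma lattice_difference:
  assumes a: "a \<notin> L" "a' \<notin> L" and eq: "wp a = wp a'" "dwp a = dwp a'" shows "a - a' \<in> L"
proof (rule ccontr)
  assume "a - a' \<notin> L"
  hence s: "a + a' \<in> L" using wp_eq_iff[OF a] eq(1) by blast
  have odd: "dwp (- z) = - dwp z" if "z \<notin> L" for z
  proof -
    have "- z \<notin> L" using that by (simp add: L_minus_iff)
    have "((\<lambda>z. wp (- z)) has_field_derivative dwp (- z) * - 1) (at z)"
      by (rule DERIV_chain2[where f = wp and g = uminus, OF wp_derivative[OF \<open>- z \<notin> L\<close>]]) (auto intro!: derivative_eq_intros)
    hence "(wp has_field_derivative dwp (- z) * - 1) (at z)" by (simp add: wp_even)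
    from DERIV_unique[OF this wp_derivative[OF that]] have "dwp z = dwp (- z) * - 1" by (rule sym)
    thus ?thesis by simp
  qed
  have "dwp a' = dwp (- a + (a + a'))" by simp
  also have "\<dots> = dwp (- a)" by (rule dwp_periodic[OF s])
  also have "\<dots> = - dwp a" by (rule odd[OF a(1)])
  finally have "dwp a = 0" using eq(2) by simp
  hence "2 * a \<in> L" using dwp_eq_0_iff[OF a(1)] by (simp add: H_iff)
  from L_diff[OF this s] \<open>a - a' \<notin> L\<close> show False by simp
qed

lemma lattice_representatives:
  assumes disc: "\<And>z. \<not> z islimpt Z" and Z: "\<And>z v. v \<in> L \<Longrightarrow> z \<in> Z \<Longrightarrow> z + v \<in> Z"
  obtains R where "finite R" "R \<subseteq> Z" "\<And>a. a \<in> Z \<Longrightarrow> \<exists>r\<in>R. a - r \<in> L" "\<And>r r'. r \<in> R \<Longrightarrow> r' \<in> R \<Longrightarrow> r - r' \<in> L \<Longrightarrow> r = r'"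
proof -
  obtain C where C: "compact C" "\<And>z. \<exists>v\<in>L. z + v \<in> C" using period_cell by blast
  have fin: "finite (C \<inter> Z)" using finite_not_islimpt_in_compact[of C Z] C(1) disc by blast
  define rep where "rep a = (SOME c. c \<in> C \<inter> Z \<and> a - c \<in> L)" for a
  have rep: "rep a \<in> C \<inter> Z \<and> a - rep a \<in> L" if a: "a \<in> Z" for a
  proof -
    obtain v where v: "v \<in> L" "a + v \<in> C" using C(2) by blast
    have "a - (a + v) \<in> L" using v(1) by (simp add: L_minus_iff)
    hence "a + v \<in> C \<inter> Z \<and> a - (a + v) \<in> L" using v Z[OF v(1) a] by simp
    thus ?thesis unfolding rep_def by (rule someI)
  qed
  have rep_eq: "rep a = rep b" if "a - b \<in> L" for a b
  proof -
    have "a - c \<in> L \<longleftrightarrow> b - c \<in> L" for c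
      using L_diff[of "a - c" "a - b"] L_add[of "b - c" "a - b"] that by (auto simp: algebra_simps)
    thus ?thesis by (simp add: rep_def)
  qed
  show thesis
  proof (rule that[of "rep ` Z"])
    show "finite (rep ` Z)" by (rule finite_subset[OF _ fin]) (use rep in blast)
    show "rep ` Z \<subseteq> Z" using rep by blast
    show "\<exists>r\<in>rep ` Z. a - r \<in> L" if "a \<in> Z" for a using rep[OF that] that by blast
    fix r r' assume "r \<in> rep ` Z" "r' \<in> rep ` Z" and d: "r - r' \<in> L"
    then obtain a b where ab: "a \<in> Z" "b \<in> Z" "r = rep a" "r' = rep b" by blast
    have "a - r \<in> L" "b - r' \<in> L" using rep[OF ab(1)] rep[OF ab(2)] ab by auto
    hence "(a - r) + (r - r') - (b - r') \<in> L" using L_diff[OF L_add[OF _ d]] by blast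
    hence "a - b \<in> L" by simp
    thus "r = r'" using rep_eq ab by simp
  qed
qed

end

section \<open>Global construction of \<Lambda>\<close>

context finite_gap begin

lemma logarithmic_derivative_residues:
  assumes s: "s ^ 2 = - poly Q E"
  defines "qf \<equiv> \<lambda>y. (deriv (h E) y / 2 + s) / h E y"
  shows "\<exists>N :: complex \<Rightarrow> int. \<forall>a. (a \<notin> H \<longrightarrow> N a \<in> {0, 1}) \<and>
    (\<exists>l. ((\<lambda>y. qf y - of_int (N a) / (y - a)) \<longlongrightarrow> l) (at a)) \<and> (\<forall>\<^sub>F y in at a. y \<notin> H \<and> h E y \<noteq> 0)"
proof -
  have "\<exists>N. (a \<notin> H \<longrightarrow> N \<in> {0, 1}) \<and> (\<exists>l. ((\<lambda>y. qf y - of_int N / (y - a)) \<longlongrightarrow> l) (at a)) \<and> (\<forall>\<^sub>F y in at a. y \<notin> H \<and> h E y \<noteq> 0)" for a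
  proof -
    obtain e \<phi> and N :: int where e: "0 < e" and \<phi>: "\<phi> holomorphic_on ball a e" "\<phi> a = of_int N" and N: "a \<notin> H \<Longrightarrow> N \<in> {0, 1}"
      and eq: "\<And>y. y \<in> ball a e \<Longrightarrow> y \<noteq> a \<Longrightarrow> y \<notin> H \<and> h E y \<noteq> 0 \<and> (deriv (h E) y / 2 + s) / h E y = \<phi> y / (y - a)"
      using logarithmic_derivative_pole[OF s, of a] by metis
    have ev: "\<forall>\<^sub>F y in at a. y \<in> ball a e \<and> y \<noteq> a"
      using eventually_at_in_open'[of "ball a e" a] e by (auto simp: eventually_at_filter)
    have "(\<phi> has_field_derivative deriv \<phi> a) (at a)" by (rule holomorphic_derivI[OF \<phi>(1) open_ball]) (use e in simp)
    hence "((\<lambda>y. (\<phi> y - \<phi> a) / (y - a)) \<longlongrightarrow> deriv \<phi> a) (at a)" by (simp add: has_field_derivative_iff)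
    moreover have "\<forall>\<^sub>F y in at a. (\<phi> y - \<phi> a) / (y - a) = qf y - of_int N / (y - a)"
      using ev by eventually_elim (simp add: qf_def eq \<phi>(2) diff_divide_distrib)
    ultimately have "((\<lambda>y. qf y - of_int N / (y - a)) \<longlongrightarrow> deriv \<phi> a) (at a)" by (rule Lim_transform_eventually)
    moreover have "\<forall>\<^sub>F y in at a. y \<notin> H \<and> h E y \<noteq> 0" using ev by eventually_elim (use eq in blast)
    ultimately show ?thesis using N by blast
  qed
  thus ?thesis by (intro choice allI)
qed

text \<open>Subtracting \<open>\<Sum> N\<^sub>r \<zeta>(z - r)\<close> from the logarithmic derivative leaves an entire function, so
  \<open>\<Lambda>\<close> is the exponential of an entire function times \<open>\<Prod> \<sigma>(z - r)\<^bsup>N\<^sub>r\<^esup>\<close>.\<close>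

lemma Lambda_log_derivative:
  assumes s: "s ^ 2 = - poly Q E"
  shows "\<exists>F. F holomorphic_on - H \<and> (\<forall>z. z \<notin> H \<longrightarrow> h E z \<noteq> 0 \<longrightarrow>
    F z \<noteq> 0 \<and> (F has_field_derivative F z * ((deriv (h E) z / 2 + s) / h E z)) (at z))"
proof -
  define qf where "qf y = (deriv (h E) y / 2 + s) / h E y" for y
  obtain N :: "complex \<Rightarrow> int" where N: "\<And>a. a \<notin> H \<Longrightarrow> N a \<in> {0, 1}"
    and Nlim: "\<And>a. \<exists>l. ((\<lambda>y. qf y - of_int (N a) / (y - a)) \<longlongrightarrow> l) (at a)"
    and ev: "\<And>a. \<forall>\<^sub>F y in at a. y \<notin> H \<and> h E y \<noteq> 0"
    using logarithmic_derivative_residues[OF s] unfolding qf_def by blast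
  define Z where "Z = {z. z \<in> H \<or> h E z = 0}"
  have evZ: "\<forall>\<^sub>F y in at a. y \<notin> Z" for a using ev[of a] by eventually_elim (simp add: Z_def)
  hence disc: "\<not> a islimpt Z" for a by (simp add: islimpt_iff_eventually)
  have Zper: "z + v \<in> Z \<longleftrightarrow> z \<in> Z" if v: "v \<in> L" for z v
    using H_add_L[OF v, of z] h_periodic(1)[OF v, of z E] by (cases "z \<in> H") (auto simp: Z_def)
  have qf_per: "qf (z + v) = qf z" if v: "v \<in> L" and z: "z \<notin> H" for z v
  proof -
    have "(deriv ^^ 1) (h E) (z + v) = 1 * (deriv ^^ 1) (h E) z"
      by (rule periodic_deriv[OF h_holomorphic open_Compl_H]) (use z H_add_L[OF v] h_periodic[OF v] in auto)
    thus ?thesis using h_periodic(1)[OF v z] by (simp add: qf_def)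
  qed
  obtain R where R: "finite R" "R \<subseteq> Z" "\<And>a. a \<in> Z \<Longrightarrow> \<exists>r\<in>R. a - r \<in> L"
    "\<And>r r'. r \<in> R \<Longrightarrow> r' \<in> R \<Longrightarrow> r - r' \<in> L \<Longrightarrow> r = r'"
    using lattice_representatives[of Z] disc Zper by metis
  have notL: "z - r \<notin> L" if "z \<notin> Z" "r \<in> R" for z r
    using Zper[of "z - r" r] R(2) that by auto
  define f where "f z = qf z - (\<Sum>r\<in>R. of_int (N r) * wz (z - r))" for z
  have wz_hol: "(\<lambda>z. wz (z - r)) holomorphic_on - Z" if "r \<in> R" for r
  proof -
    have "wz \<circ> (\<lambda>z. z - r) holomorphic_on - Z"
      by (rule holomorphic_on_compose_gen[OF _ wz_holomorphic]) (use notL that in \<open>auto intro!: holomorphic_intros\<close>)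
    thus ?thesis by (simp add: o_def)
  qed
  have subH: "- Z \<subseteq> - H" by (auto simp: Z_def)
  have f_hol: "f holomorphic_on - Z"
    unfolding f_def[abs_def] qf_def[abs_def]
    by (intro holomorphic_intros wz_hol holomorphic_on_subset[OF h_holomorphic subH]
        holomorphic_on_subset[OF holomorphic_deriv[OF h_holomorphic open_Compl_H] subH]) (auto simp: Z_def)
  \<comment> \<open>By periodicity the residue at a is \<open>N r\<close> for the representative r
    of a. The term of r in the \<zeta>-sum cancels it, and the other terms are regular at a because
    representatives are inequivalent.\<close>
  have "\<exists>l. (f \<longlongrightarrow> l) (at a)" if a: "a \<in> Z" for a
  proof -
    obtain r where r: "r \<in> R" "a - r \<in> L" using R(3)[OF a] by blast
    define v where "v = a - r"
    have v: "v \<in> L" using r by (simp add: v_def)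
    obtain l1 where "((\<lambda>y. qf y - of_int (N r) / (y - r)) \<longlongrightarrow> l1) (at r)" using Nlim by blast
    hence "((\<lambda>y. qf (y - v) - of_int (N r) / (y - v - r)) \<longlongrightarrow> l1) (at a)"
      by (rule filterlim_compose[where f = "\<lambda>y. y - v"])
         (auto intro!: filterlim_atI tendsto_eq_intros simp: v_def eventually_at_filter)
    moreover have "\<forall>\<^sub>F y in at a. qf (y - v) - of_int (N r) / (y - v - r) = qf y - of_int (N r) / (y - a)"
      using evZ[of a]
    proof eventually_elim
      case (elim y)
      have mv: "- v \<in> L" using v by (simp add: L_minus_iff)
      have "y \<notin> H" using elim by (simp add: Z_def)
      from qf_per[OF mv this] have "qf (y - v) = qf y" by simp
      moreover have "y - v - r = y - a" by (simp add: v_def)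
      ultimately show ?case by simp
    qed
    ultimately have 1: "((\<lambda>y. qf y - of_int (N r) / (y - a)) \<longlongrightarrow> l1) (at a)" by (rule Lim_transform_eventually)
    obtain c where c: "\<And>z. z \<notin> L \<Longrightarrow> wz (z + v) = wz z + c" using wz_add_lattice[OF v] by blast
    have "isCont (\<lambda>y. wz_reg (y - a)) a" by (rule isCont_o2) (auto intro!: continuous_intros regular_parts_continuous)
    hence "((\<lambda>y. of_int (N r) * (- (wz_reg (y - a) + c))) \<longlongrightarrow> of_int (N r) * (- (wz_reg (a - a) + c))) (at a)"
      by (intro tendsto_intros) (simp add: isCont_def)
    moreover have "\<forall>\<^sub>F y in at a. of_int (N r) * (- (wz_reg (y - a) + c)) = of_int (N r) * (1 / (y - a) - wz (y - r))"
      using evZ[of a]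
    proof eventually_elim
      case (elim y)
      have "y - a \<notin> L" using Zper[of "y - a" a] elim a by auto
      from c[OF this] have "wz (y - r) = 1 / (y - a) + wz_reg (y - a) + c" by (simp add: v_def wz_eq)
      thus ?case by simp
    qed
    ultimately have 2: "((\<lambda>y. of_int (N r) * (1 / (y - a) - wz (y - r))) \<longlongrightarrow> of_int (N r) * (- (wz_reg (a - a) + c))) (at a)"
      by (rule Lim_transform_eventually)
    have "((\<lambda>y. wz (y - r')) \<longlongrightarrow> wz (a - r')) (at a)" if r': "r' \<in> R - {r}" for r'
    proof -
      have "a - r' \<notin> L" using R(4)[of r' r] L_diff[of "a - r" "a - r'"] r r' by auto
      hence "isCont (\<lambda>y. wz (y - r')) a" by (intro isCont_o2[OF _ wz_continuous]) (auto intro!: continuous_intros)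
      thus ?thesis by (simp add: isCont_def)
    qed
    hence 3: "((\<lambda>y. \<Sum>r'\<in>R - {r}. of_int (N r') * wz (y - r')) \<longlongrightarrow> (\<Sum>r'\<in>R - {r}. of_int (N r') * wz (a - r'))) (at a)"
      by (intro tendsto_intros) auto
    have feq: "f = (\<lambda>y. (qf y - of_int (N r) / (y - a)) + of_int (N r) * (1 / (y - a) - wz (y - r)) - (\<Sum>r'\<in>R - {r}. of_int (N r') * wz (y - r')))"
      by (rule ext) (simp add: f_def sum.remove[OF R(1) r(1)] algebra_simps)
    show ?thesis unfolding feq by (rule exI, rule tendsto_diff[OF tendsto_add[OF 1 2] 3])
  qed
  then obtain G where G: "G holomorphic_on UNIV" "\<And>z. z \<notin> Z \<Longrightarrow> G z = f z"
    using holomorphic_extension_discrete[OF disc f_hol] by metis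
  obtain \<Gamma> where \<Gamma>: "\<And>z. (\<Gamma> has_field_derivative G z) (at z)"
    using holomorphic_convex_primitive'[OF convex_UNIV open_UNIV G(1)] by auto
  define F where "F z = exp (\<Gamma> z) * (\<Prod>r\<in>R. ws (z - r) powi N r)" for z
  have ws_hol: "(\<lambda>z. ws (z - r)) holomorphic_on A" for r A
  proof -
    have "ws \<circ> (\<lambda>z. z - r) holomorphic_on A"
      by (rule holomorphic_on_compose_gen[OF _ ws_holomorphic]) (auto intro!: holomorphic_intros)
    thus ?thesis by (simp add: o_def)
  qed
  show ?thesis
  proof (intro exI[of _ F] conjI allI impI)
    \<comment> \<open>Negative exponents occur only for r in H, where \<sigma>(z - r) has no zero
      off H; for r outside H the residue is 0 or 1.\<close>
    have hol: "(\<lambda>z. ws (z - r) powi N r) holomorphic_on - H" if r: "r \<in> R" for r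
    proof (cases "r \<in> H")
      case True
      have "ws (z - r) \<noteq> 0" if "z \<in> - H" for z
        using H_add_L[of "z - r" r] True that by (auto simp: ws_eq_0_iff)
      thus ?thesis by (intro holomorphic_intros ws_hol) auto
    next
      case False
      hence "0 \<le> N r" using N[OF False] by auto
      thus ?thesis by (intro holomorphic_intros ws_hol) auto
    qed
    have "\<Gamma> holomorphic_on - H"
      using \<Gamma> has_field_derivative_at_within unfolding holomorphic_on_def field_differentiable_def by blast
    hence "(\<lambda>z. exp (\<Gamma> z)) holomorphic_on - H" by (intro holomorphic_intros)
    thus "F holomorphic_on - H"
      unfolding F_def[abs_def] by (intro holomorphic_on_mult holomorphic_on_prod hol)
    fix z assume "z \<notin> H" "h E z \<noteq> 0"
    hence z: "z \<notin> Z" by (simp add: Z_def)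
    show "F z \<noteq> 0" using notL[OF z] R(1) by (auto simp: F_def ws_eq_0_iff)
    have "((\<lambda>z. ws (z - r) powi N r) has_field_derivative (ws (z - r) powi N r) * (of_int (N r) * wz (z - r))) (at z)" if r: "r \<in> R" for r
    proof -
      have nL: "z - r \<notin> L" by (rule notL[OF z r])
      hence w0: "ws (z - r) \<noteq> 0" by (simp add: ws_eq_0_iff)
      have "((\<lambda>z. ws (z - r)) has_field_derivative ws (z - r) * wz (z - r) * (1 - 0)) (at z)"
        by (rule DERIV_chain2[where f = ws and g = "\<lambda>z. z - r", OF ws_derivative[OF nL]]) (auto intro!: derivative_eq_intros)
      hence "((\<lambda>z. ws (z - r) powi N r) has_field_derivative of_int (N r) * ws (z - r) powi (N r - 1) * (ws (z - r) * wz (z - r) * (1 - 0))) (at z)"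
        using w0 by (auto intro!: derivative_eq_intros)
      moreover have "ws (z - r) powi (N r - 1) * ws (z - r) = ws (z - r) powi N r"
        using power_int_add_1[of "ws (z - r)" "N r - 1"] w0 by simp
      ultimately show ?thesis by (elim DERIV_cong) (simp add: mult_ac)
    qed
    from prod_logarithmic_derivative[OF R(1), of "\<lambda>r z. ws (z - r) powi N r", OF this]
    have P: "((\<lambda>z. \<Prod>r\<in>R. ws (z - r) powi N r) has_field_derivative
        (\<Prod>r\<in>R. ws (z - r) powi N r) * (\<Sum>r\<in>R. of_int (N r) * wz (z - r))) (at z)" .
    have "(F has_field_derivative exp (\<Gamma> z) * ((\<Prod>r\<in>R. ws (z - r) powi N r) * (\<Sum>r\<in>R. of_int (N r) * wz (z - r)))
        + exp (\<Gamma> z) * G z * (\<Prod>r\<in>R. ws (z - r) powi N r)) (at z)"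
      unfolding F_def[abs_def] by (intro DERIV_mult' P DERIV_chain2[OF DERIV_exp \<Gamma>])
    thus "(F has_field_derivative F z * ((deriv (h E) z / 2 + s) / h E z)) (at z)"
      by (rule DERIV_cong) (unfold qf_def[of z, symmetric] F_def G(2)[OF z] f_def, simp add: algebra_simps)
  qed
qed

text \<open>Locally F has the same logarithmic derivative as a root of \<Xi> times the exponential
  of a primitive, so the two differ by a constant factor C, which is absorbed into the primitive as
  \<open>Ln C\<close>.\<close>

lemma Lambda_exists:
  assumes s: "s ^ 2 = - poly Q E" obtains F where "is_Lambda H (h E) s F"
proof -
  obtain F where F: "F holomorphic_on - H"
    and F': "\<forall>z. z \<notin> H \<longrightarrow> h E z \<noteq> 0 \<longrightarrow> F z \<noteq> 0 \<and> (F has_field_derivative F z * ((deriv (h E) z / 2 + s) / h E z)) (at z)"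
    using Lambda_log_derivative[OF s] by (elim exE conjE)
  have nz: "F z \<noteq> 0" and dF: "(F has_field_derivative F z * ((deriv (h E) z / 2 + s) / h E z)) (at z)"
    if "z \<notin> H" "h E z \<noteq> 0" for z using F' that by simp_all
  have "is_Lambda H (h E) s F"
    unfolding is_Lambda_def
  proof (intro conjI ballI impI F)
    fix z assume z: "z \<in> - H" and hz: "h E z \<noteq> 0"
    have "open (- H \<inter> h E -` (- {0}))"
      by (intro continuous_open_preimage holomorphic_on_imp_continuous_on h_holomorphic open_Compl_H) auto
    then obtain e where e: "0 < e" "ball z e \<subseteq> - H \<inter> h E -` (- {0})" using z hz by (auto elim!: openE)
    have yb: "y \<notin> H" "h E y \<noteq> 0" if "y \<in> ball z e" for y using e(2) that by auto
    have hol: "h E holomorphic_on ball z e" by (rule holomorphic_on_subset[OF h_holomorphic]) (use e in auto)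
    obtain r where r: "r holomorphic_on ball z e" "\<And>y. y \<in> ball z e \<Longrightarrow> h E y = r y ^ 2"
      using contractible_imp_holomorphic_sqrt[OF hol convex_imp_contractible[OF convex_ball]] yb by metis
    have "(\<lambda>y. s / h E y) holomorphic_on ball z e" by (intro holomorphic_intros hol) (use yb in auto)
    from holomorphic_convex_primitive'[OF convex_ball open_ball this]
    obtain P where P': "\<And>y. y \<in> ball z e \<Longrightarrow> (P has_field_derivative s / h E y) (at y within ball z e)" by blast
    have P: "(P has_field_derivative s / h E y) (at y)" if y: "y \<in> ball z e" for y
      using P'[OF y] unfolding at_within_open[OF y open_ball] .
    have r0: "r y \<noteq> 0" if "y \<in> ball z e" for y using r(2)[OF that] yb[OF that] by auto
    have d0: "((\<lambda>y. F y / (r y * exp (P y))) has_field_derivative 0) (at y within ball z e)" if y: "y \<in> ball z e" for y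
    proof -
      have dr: "(r has_field_derivative deriv r y) (at y)" by (rule holomorphic_derivI[OF r(1) open_ball y])
      have "((\<lambda>y. r y ^ 2) has_field_derivative 2 * r y * deriv r y) (at y)"
        by (auto intro!: derivative_eq_intros dr)
      hence "(h E has_field_derivative 2 * r y * deriv r y) (at y)"
        by (rule has_field_derivative_transform_within_open[OF _ open_ball y]) (use r in simp)
      hence h': "deriv (h E) y = 2 * r y * deriv r y" by (rule DERIV_imp_deriv)
      have "((\<lambda>y. F y / (r y * exp (P y))) has_field_derivative
          (F y * ((deriv (h E) y / 2 + s) / h E y) * (r y * exp (P y)) - F y * (r y * (exp (P y) * (s / h E y)) + deriv r y * exp (P y)))
          / ((r y * exp (P y)) * (r y * exp (P y)))) (at y)"
        by (intro DERIV_divide DERIV_mult' dF dr DERIV_chain2[OF DERIV_exp P[OF y]]) (use yb[OF y] r0[OF y] in auto)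
      hence "((\<lambda>y. F y / (r y * exp (P y))) has_field_derivative 0) (at y)"
        by (rule DERIV_cong) (use r0[OF y] in \<open>simp add: h' r(2)[OF y] field_simps power2_eq_square\<close>)
      thus ?thesis by (rule has_field_derivative_at_within)
    qed
    have "\<exists>C. \<forall>y\<in>ball z e. F y / (r y * exp (P y)) = C"
      by (rule has_field_derivative_zero_constant[OF convex_ball d0])
    then obtain C where C: "\<And>y. y \<in> ball z e \<Longrightarrow> F y / (r y * exp (P y)) = C" by blast
    have zb: "z \<in> ball z e" using e by simp
    have C0: "C \<noteq> 0" using C[OF zb] nz yb[OF zb] r0[OF zb] by auto
    show "\<exists>e>0. \<exists>r P. r holomorphic_on ball z e \<and>
        (\<forall>y\<in>ball z e. r y ^ 2 = h E y \<and> (P has_field_derivative s / h E y) (at y) \<and> F y = r y * exp (P y))"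
    proof (intro exI conjI ballI)
      fix y assume y: "y \<in> ball z e"
      show "r y ^ 2 = h E y" using r(2)[OF y] by simp
      show "((\<lambda>y. P y + Ln C) has_field_derivative s / h E y) (at y)"
        using DERIV_add[OF P[OF y] DERIV_const] by simp
      show "F y = r y * exp (P y + Ln C)" using C[OF y] C0 r0[OF y] by (simp add: exp_add field_simps)
    qed (use e r in auto)
  qed
  thus thesis by (rule that)
qed

end

section \<open>The multiplier in the Hermite-Krichever form\<close>

context finite_gap_line begin

text \<open>The \<sigma>-quotient contributes exp(- 2 \<eta>_k a) and the exponential contributes
  exp(2 \<omega>_k \<zeta>(a)). Neither depends on i, so the whole sum has one multiplier.\<close>

lemma Phi_fun_quasi_periodic:
  assumes x: "x \<notin> H"
  shows "Phi_fun \<omega>\<^sub>1 \<omega>\<^sub>3 i a (x + p) = exp (2 * hp k * wz a - 2 * qp k * a) * Phi_fun \<omega>\<^sub>1 \<omega>\<^sub>3 i a x"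
proof -
  have k': "k \<in> {1, 2, 3}" using k by auto
  have n0: "ws (x + hp i) \<noteq> 0" using x notin_H_imp_notin_L by (metis H_add_hp(1) ws_eq_0_iff)
  have "ws (x + p + hp i - a) = - exp (2 * qp k * (x + hp i - a + hp k)) * ws (x + hp i - a)"
    using ws_quasi_periodic[OF k', of "x + hp i - a"] by (simp add: p_def algebra_simps)
  moreover have "ws (x + p + hp i) = - exp (2 * qp k * (x + hp i + hp k)) * ws (x + hp i)"
    using ws_quasi_periodic[OF k', of "x + hp i"] by (simp add: p_def algebra_simps)
  moreover have "exp (2 * qp k * (x + hp i - a + hp k)) * exp (wz a * (x + p))
      = exp (2 * hp k * wz a - 2 * qp k * a) * exp (2 * qp k * (x + hp i + hp k)) * exp (wz a * x)"
    unfolding exp_add[symmetric] by (simp add: p_def algebra_simps)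
  ultimately show ?thesis using n0 by (simp add: Phi_fun_def field_simps)
qed

lemma Phi_fun_holomorphic: "Phi_fun \<omega>\<^sub>1 \<omega>\<^sub>3 i a holomorphic_on - H"
proof -
  have "ws \<circ> (\<lambda>x. x + v) holomorphic_on - H" for v
    by (rule holomorphic_on_compose_gen[OF _ ws_holomorphic]) (auto intro!: holomorphic_intros)
  hence w: "(\<lambda>x. ws (x + v)) holomorphic_on - H" for v by (simp add: o_def)
  have "(\<lambda>x. ws (x + (hp i - a)) / ws (x + hp i) * exp (wz a * x)) holomorphic_on - H"
    by (intro holomorphic_intros w) (use notin_H_imp_notin_L H_add_hp(1) in \<open>auto simp: ws_eq_0_iff\<close>)
  thus ?thesis by (simp add: Phi_fun_def[abs_def] add_diff_eq)
qed

lemma hermite_krichever_trace: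
  assumes HK: "hermite_krichever \<omega>\<^sub>1 \<omega>\<^sub>3 l c\<^sub>0 b Q P" "HK_defined P E" and s: "s ^ 2 = - poly Q E"
    and val: "HK_values \<omega>\<^sub>1 \<omega>\<^sub>3 P E s a \<kappa>"
  shows "hill_trace (W E) = 2 * cos (\<i> * (2 * hp k * (wz a + \<kappa>) - 2 * qp k * a))"
proof -
  obtain F where F: "is_Lambda H (h E) s F" by (rule Lambda_exists[OF s])
  obtain a' \<kappa>' bt where val': "HK_values \<omega>\<^sub>1 \<omega>\<^sub>3 P E s a' \<kappa>'"
    and Feq: "\<And>x. x \<notin> H \<Longrightarrow> F x = exp (\<kappa>' * x) * (\<Sum>i\<le>3. \<Sum>j<n i. bt i j * (deriv ^^ j) (Phi_fun \<omega>\<^sub>1 \<omega>\<^sub>3 i a') x)"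
    using HK s F unfolding hermite_krichever_def h_def by blast
  have aL: "a \<notin> L" "a' \<notin> L" and \<kappa>: "\<kappa>' = \<kappa>" and eq: "wp a = wp a'" "deriv wp a = deriv wp a'"
    using val val' by (auto simp: HK_values_def)
  \<comment> \<open>The Ansatz provides its own \<alpha>, possibly different from the given one;
    both satisfy the same equations, so they agree modulo L and yield the same multiplier.\<close>
  have "a - a' \<in> L"
    using lattice_difference[OF aL eq(1)] eq(2) by (simp add: deriv_wp aL)
  from multiplier_add_lattice[OF k this, rule_format, OF aL(2)]
  have mult: "exp (2 * hp k * wz a - 2 * qp k * a) = exp (2 * hp k * wz a' - 2 * qp k * a')" by simp
  define \<mu> where "\<mu> = exp (2 * hp k * (wz a + \<kappa>) - 2 * qp k * a)"
  have \<mu>: "\<mu> = exp (\<kappa>' * p) * exp (2 * hp k * wz a' - 2 * qp k * a')"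
    unfolding \<mu>_def mult[symmetric] exp_add[symmetric] \<kappa> by (simp add: p_def algebra_simps)
  have per: "F (z + p) = \<mu> * F z" if z: "z \<notin> H" for z
  proof -
    have D: "(deriv ^^ j) (Phi_fun \<omega>\<^sub>1 \<omega>\<^sub>3 i a') (z + p) = exp (2 * hp k * wz a' - 2 * qp k * a') * (deriv ^^ j) (Phi_fun \<omega>\<^sub>1 \<omega>\<^sub>3 i a') z" for i j
      by (rule periodic_deriv[OF Phi_fun_holomorphic open_Compl_H]) (use z H_add_L[OF p_in_L] Phi_fun_quasi_periodic in auto)
    have S: "(\<Sum>i\<le>3. \<Sum>j<n i. bt i j * (deriv ^^ j) (Phi_fun \<omega>\<^sub>1 \<omega>\<^sub>3 i a') (z + p))
        = exp (2 * hp k * wz a' - 2 * qp k * a') * (\<Sum>i\<le>3. \<Sum>j<n i. bt i j * (deriv ^^ j) (Phi_fun \<omega>\<^sub>1 \<omega>\<^sub>3 i a') z)"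
      unfolding D sum_distrib_left by (intro sum.cong refl) (simp only: mult_ac)
    have "z + p \<notin> H" using z H_add_L[OF p_in_L] by simp
    from Feq[OF this] have "F (z + p) = exp (\<kappa>' * z) * exp (\<kappa>' * p) *
        (exp (2 * hp k * wz a' - 2 * qp k * a') * (\<Sum>i\<le>3. \<Sum>j<n i. bt i j * (deriv ^^ j) (Phi_fun \<omega>\<^sub>1 \<omega>\<^sub>3 i a') z))"
      unfolding S distrib_left exp_add .
    also have "\<dots> = \<mu> * F z" unfolding \<mu> Feq[OF z] by (simp only: mult_ac)
    finally show ?thesis .
  qed
  obtain x where x: "x \<notin> H" "F x \<noteq> 0" by (rule Lambda_nonzero[OF F])
  have "F holomorphic_on - H" using F by (simp add: is_Lambda_def)
  from bloch_trace(2)[OF this Lambda_solution[OF F s] x per]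
  have "hill_trace (W E) = \<mu> + 1 / \<mu>" .
  moreover have "2 * cos (\<i> * Y) = exp Y + 1 / exp Y" for Y :: complex
    by (simp add: cos_exp_eq mult.assoc[symmetric] exp_minus inverse_eq_divide)
  ultimately show ?thesis by (simp only: \<mu>_def)
qed

end

subsection \<open>The monodromy matrix\<close>

context weierstrass begin

lemma line_avoids_half_lattice:
  assumes k: "k \<in> {1, 3}" and seg: "closed_segment x (x + 2 * hp k) \<inter> H = {}"
  shows "x + of_real s * (2 * hp k) \<notin> H"
proof -
  define m where "m = \<lfloor>s\<rfloor>"
  have mL: "of_int m * (2 * hp k) \<in> L"
    using k L_I[of m 0] L_I[of 0 m] by (auto simp: half_period_def)
  have "x + of_real (frac s) * (2 * hp k) \<in> closed_segment x (x + 2 * hp k)"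
    unfolding in_segment
    by (rule exI[of _ "frac s"]) (use frac_ge_0[of s] frac_lt_1[of s] in \<open>auto simp: scaleR_conv_of_real algebra_simps\<close>)
  hence "x + of_real (frac s) * (2 * hp k) \<notin> H" using seg by blast
  hence "x + of_real (frac s) * (2 * hp k) + of_int m * (2 * hp k) \<notin> H" using H_add_L[OF mL] by blast
  moreover have "x + of_real (frac s) * (2 * hp k) + of_int m * (2 * hp k) = x + of_real s * (2 * hp k)"
    by (simp add: frac_def m_def algebra_simps)
  ultimately show ?thesis by simp
qed

end

context weierstrass_line begin

lemma solution_along_line:
  assumes S: "open S" "closed_segment x\<^sub>0 (x\<^sub>0 + p) \<subseteq> S" and f: "solution_on u E S f"
  shows "hill_sol (\<lambda>s. p ^ 2 * u (X s) + - (p ^ 2) * E) (\<lambda>s. f (X s)) (\<lambda>s. p * deriv f (X s))"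
  unfolding hill_sol_def
proof (intro ballI conjI)
  fix s :: real assume s: "s \<in> {0..1}"
  have "X s \<in> closed_segment x\<^sub>0 (x\<^sub>0 + p)"
    unfolding in_segment by (rule exI[of _ s]) (use s in \<open>auto simp: X_def scaleR_conv_of_real algebra_simps\<close>)
  hence XS: "X s \<in> S" using S by blast
  have f1: "f holomorphic_on S" and f2: "- (deriv ^^ 2) f (X s) + (u (X s) - E) * f (X s) = 0"
    using f XS by (auto simp: solution_on_def)
  show "((\<lambda>s. f (X s)) has_vector_derivative p * deriv f (X s)) (at s within {0..1})"
    unfolding X_def
    by (rule has_vector_derivative_along_line, rule holomorphic_derivI[OF f1 S(1)]) (use XS in \<open>simp add: X_def\<close>)
  have "((\<lambda>s. deriv f (X s)) has_vector_derivative p * deriv (deriv f) (X s)) (at s within {0..1})"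
    unfolding X_def
    by (rule has_vector_derivative_along_line, rule holomorphic_derivI[OF holomorphic_deriv[OF f1 S(1)] S(1)]) (use XS in \<open>simp add: X_def\<close>)
  hence "((\<lambda>s. p * deriv f (X s)) has_vector_derivative p * (p * deriv (deriv f) (X s))) (at s within {0..1})"
    by (rule has_vector_derivative_mult_right)
  moreover have ode: "deriv (deriv f) (X s) = (u (X s) - E) * f (X s)"
    using f2 by (simp add: numeral_2_eq_2)
  ultimately show "((\<lambda>s. p * deriv f (X s)) has_vector_derivative (p ^ 2 * u (X s) + - (p ^ 2) * E) * f (X s)) (at s within {0..1})"
    unfolding ode by (elim has_vector_derivative_eq_rhs) (simp add: power2_eq_square algebra_simps)
qed

text \<open>M and the Hill monodromy matrix describe the same map in two bases, related by the
  matrix of initial values of the two solutions. The traces are compared after multiplication by the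
  determinant of that matrix.\<close>

lemma trace_monodromy_matrix:
  assumes u: "u holomorphic_on - H" and M: "monodromy_matrix u E p x\<^sub>0 f\<^sub>1 f\<^sub>2 M"
  shows "trace M = hill_trace (\<lambda>s. p ^ 2 * u (X s) + - (p ^ 2) * E)"
proof -
  let ?w = "\<lambda>s. p ^ 2 * u (X s) + - (p ^ 2) * E"
  obtain S where S: "open S" "closed_segment x\<^sub>0 (x\<^sub>0 + p) \<subseteq> S"
    and sol: "solution_on u E S f\<^sub>1" "solution_on u E S f\<^sub>2"
    using M unfolding monodromy_matrix_def by blast
  have indep: "r = 0 \<and> s = 0" if "\<forall>\<^sub>F y in nhds x\<^sub>0. r * f\<^sub>1 y + s * f\<^sub>2 y = 0" for r s
    using M that unfolding monodromy_matrix_def by blast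
  have rel: "\<forall>\<^sub>F y in nhds x\<^sub>0. (vector [f\<^sub>1 (y + p), f\<^sub>2 (y + p)] :: complex^2) = vector [f\<^sub>1 y, f\<^sub>2 y] v* M"
    using M unfolding monodromy_matrix_def by blast
  have X0: "X 0 = x\<^sub>0" "X 1 = x\<^sub>0 + p" by (simp_all add: X_def)
  have xS: "x\<^sub>0 \<in> S" "x\<^sub>0 + p \<in> S" using S by auto
  have c: "continuous_on {0..1} ?w"
  proof -
    have "continuous_on {0..1} (\<lambda>s. u (X s))"
      by (rule continuous_on_compose2[OF holomorphic_on_imp_continuous_on[OF u]])
         (use X_notin_H in \<open>auto simp: X_def intro!: continuous_intros\<close>)
    thus ?thesis by (intro continuous_intros)
  qed
  note hs = solution_along_line[OF S sol(1)] solution_along_line[OF S sol(2)]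
  have hol: "f\<^sub>1 holomorphic_on S" "f\<^sub>2 holomorphic_on S" using sol by (auto simp: solution_on_def)
  note d = holomorphic_derivI[OF hol(1) S(1), of _ UNIV] holomorphic_derivI[OF hol(2) S(1), of _ UNIV]
  define a b c' d' where "a = f\<^sub>1 x\<^sub>0" and "b = f\<^sub>2 x\<^sub>0" and "c' = p * deriv f\<^sub>1 x\<^sub>0" and "d' = p * deriv f\<^sub>2 x\<^sub>0"
  define A B C D where "A = hill_y ?w 1 0 1" and "B = hill_y ?w 0 1 1" and "C = hill_dy ?w 1 0 1" and "D = hill_dy ?w 0 1 1"
  have e: "f\<^sub>1 (x\<^sub>0 + p) = a * A + c' * B" "p * deriv f\<^sub>1 (x\<^sub>0 + p) = a * C + c' * D"
    "f\<^sub>2 (x\<^sub>0 + p) = b * A + d' * B" "p * deriv f\<^sub>2 (x\<^sub>0 + p) = b * C + d' * D"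
    using hill_sol_representation[OF c hs(1), of 1] hill_sol_representation[OF c hs(2), of 1]
    by (simp_all add: X0 a_def b_def c'_def d'_def A_def B_def C_def D_def)
  have rel1: "\<forall>\<^sub>F y in nhds x\<^sub>0. f\<^sub>1 (y + p) = f\<^sub>1 y * M$1$1 + f\<^sub>2 y * M$2$1"
    and rel2: "\<forall>\<^sub>F y in nhds x\<^sub>0. f\<^sub>2 (y + p) = f\<^sub>1 y * M$1$2 + f\<^sub>2 y * M$2$2"
    using rel by (eventually_elim, simp add: vec_eq_iff forall_2 vector_matrix_mult_def sum_2)+
  have val: "f (x\<^sub>0 + p) = f\<^sub>1 x\<^sub>0 * \<mu> + f\<^sub>2 x\<^sub>0 * \<nu>" "deriv f (x\<^sub>0 + p) = deriv f\<^sub>1 x\<^sub>0 * \<mu> + deriv f\<^sub>2 x\<^sub>0 * \<nu>"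
    if ev: "\<forall>\<^sub>F y in nhds x\<^sub>0. f (y + p) = f\<^sub>1 y * \<mu> + f\<^sub>2 y * \<nu>" and f: "f holomorphic_on S" for f \<mu> \<nu>
  proof -
    show "f (x\<^sub>0 + p) = f\<^sub>1 x\<^sub>0 * \<mu> + f\<^sub>2 x\<^sub>0 * \<nu>" using eventually_nhds_x_imp_x[OF ev] .
    have "((\<lambda>y. f (y + p)) has_field_derivative deriv f (x\<^sub>0 + p)) (at x\<^sub>0)"
      by (rule shifted_derivative, rule holomorphic_derivI[OF f S(1) xS(2)])
    moreover have "((\<lambda>y. f\<^sub>1 y * \<mu> + f\<^sub>2 y * \<nu>) has_field_derivative deriv f\<^sub>1 x\<^sub>0 * \<mu> + deriv f\<^sub>2 x\<^sub>0 * \<nu>) (at x\<^sub>0)"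
      by (intro DERIV_add DERIV_cmult_right d xS(1))
    hence "((\<lambda>y. f (y + p)) has_field_derivative deriv f\<^sub>1 x\<^sub>0 * \<mu> + deriv f\<^sub>2 x\<^sub>0 * \<nu>) (at x\<^sub>0)"
      using DERIV_cong_ev[OF refl ev refl] by blast
    ultimately show "deriv f (x\<^sub>0 + p) = deriv f\<^sub>1 x\<^sub>0 * \<mu> + deriv f\<^sub>2 x\<^sub>0 * \<nu>" by (rule DERIV_unique)
  qed
  note v = val[OF rel1 hol(1)] val[OF rel2 hol(2)]
  have m: "a * M$1$1 + b * M$2$1 = a * A + c' * B" "c' * M$1$1 + d' * M$2$1 = a * C + c' * D"
    "a * M$1$2 + b * M$2$2 = b * A + d' * B" "c' * M$1$2 + d' * M$2$2 = b * C + d' * D"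
    using v e by (simp_all add: a_def b_def c'_def d'_def algebra_simps)
  \<comment> \<open>A vanishing Wronskian would give a combination with zero initial data; it
    vanishes on the segment, and as \<open>x\<^sub>0\<close> is a limit point of the segment, also
    in a neighbourhood, against the independence of the germs.\<close>
  have W: "a * d' - b * c' \<noteq> 0"
  proof
    assume W0: "a * d' - b * c' = 0"
    have "\<exists>r s. (r \<noteq> 0 \<or> s \<noteq> 0) \<and> r * a + s * b = 0 \<and> r * c' + s * d' = 0"
    proof (cases "a = 0 \<and> b = 0")
      case True
      show ?thesis
      proof (cases "c' = 0 \<and> d' = 0")
        case False thus ?thesis using True by (intro exI[of _ "- d'"] exI[of _ c']) auto
      qed (use True in \<open>auto intro!: exI[of _ 1]\<close>)
    next
      case False thus ?thesis using W0 by (intro exI[of _ "- b"] exI[of _ a]) (auto simp: algebra_simps)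
    qed
    then obtain r s where rs: "r \<noteq> 0 \<or> s \<noteq> 0" "r * a + s * b = 0" "r * c' + s * d' = 0" by blast
    have z: "r * f\<^sub>1 (X t) + s * f\<^sub>2 (X t) = 0" if t: "t \<in> {0..1}" for t
    proof -
      have t': "0 \<le> t" "t \<le> 1" using t by auto
      have "r * f\<^sub>1 (X t) + s * f\<^sub>2 (X t) = (r * a + s * b) * hill_y ?w 1 0 t + (r * c' + s * d') * hill_y ?w 0 1 t"
        using hill_sol_representation(1)[OF c hs(1) t'] hill_sol_representation(1)[OF c hs(2) t']
        by (simp add: X0 a_def b_def c'_def d'_def algebra_simps)
      thus ?thesis by (simp add: rs)
    qed
    obtain e where e: "0 < e" "ball x\<^sub>0 e \<subseteq> S" using S(1) xS(1) by (auto elim: openE)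
    define U where "U = X ` {0..1} \<inter> ball x\<^sub>0 e"
    have "x\<^sub>0 islimpt U"
    proof (rule islimptI)
      fix T assume T: "x\<^sub>0 \<in> T" "open T"
      have "(X \<longlongrightarrow> X 0) (at_right 0)" unfolding X_def by (intro tendsto_intros)
      hence "\<forall>\<^sub>F t in at_right 0. X t \<in> T \<inter> ball x\<^sub>0 e"
        by (rule topological_tendstoD) (use T e in \<open>auto simp: X0\<close>)
      moreover have "\<forall>\<^sub>F t in at_right (0::real). 0 < t \<and> t < 1"
        using eventually_at_right_field[of "\<lambda>t. 0 < t \<and> t < 1" 0] zero_less_one by blast
      ultimately have "\<forall>\<^sub>F t in at_right (0::real). X t \<in> U \<and> X t \<in> T \<and> X t \<noteq> x\<^sub>0"
        by eventually_elim (use p_nonzero in \<open>auto simp: U_def X_def\<close>)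
      hence "\<exists>t. X t \<in> U \<and> X t \<in> T \<and> X t \<noteq> x\<^sub>0" by (rule eventually_happens'[rotated]) simp
      thus "\<exists>y\<in>U. y \<in> T \<and> y \<noteq> x\<^sub>0" by blast
    qed
    hence "r * f\<^sub>1 y + s * f\<^sub>2 y = 0" if "y \<in> ball x\<^sub>0 e" for y
      by (rule analytic_continuation[of "\<lambda>y. r * f\<^sub>1 y + s * f\<^sub>2 y" "ball x\<^sub>0 e" U x\<^sub>0, rotated 5])
         (use z that e hol holomorphic_on_subset in \<open>auto simp: U_def intro!: holomorphic_intros\<close>)
    hence "\<forall>\<^sub>F y in nhds x\<^sub>0. r * f\<^sub>1 y + s * f\<^sub>2 y = 0"
      using eventually_nhds_in_open[of "ball x\<^sub>0 e" x\<^sub>0] e by (auto elim!: eventually_mono)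
    from indep[OF this] rs(1) show False by blast
  qed
  have "(a * d' - b * c') * (M$1$1 + M$2$2) = (a * d' - b * c') * (A + D)"
    using m by algebra
  hence "M$1$1 + M$2$2 = A + D" using W by simp
  thus ?thesis by (simp add: trace_def sum_2 hill_trace_def A_def D_def)
qed

end

context finite_gap_line begin

lemma hill_trace_isomonodromic:
  assumes \<tau>: "\<tau> = 1 / 2 - of_nat j" "(\<Sum>i\<le>3. a i) = 2 * \<tau>"
    and b: "\<And>i. i \<le> 3 \<Longrightarrow> (\<tau> - a i) * (\<tau> - a i - 1) = of_int (l i) * (of_int (l i) + 1)"
  shows "hill_trace (\<lambda>s. p ^ 2 * (\<Sum>i\<le>3. a i * (a i - 1) * wp (X s + hp i)) + \<kappa>) = hill_trace (\<lambda>s. V s + \<kappa>)"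
proof -
  interpret K: weierstrass_kernel \<omega>\<^sub>1 \<omega>\<^sub>3 x\<^sub>0 k a \<tau> j
    by unfold_locales (fact \<tau>)+
  have Va: "K.Va = (\<lambda>s. p ^ 2 * (\<Sum>i\<le>3. a i * (a i - 1) * wp (X s + hp i)))"
    by (rule ext) (simp add: K.Va_def K.wpX_def)
  have Vb: "K.Vb = V"
  proof
    fix s
    have "(\<Sum>i\<le>3. K.b i * (K.b i - 1) * K.wpX i s) = u (X s)"
      unfolding u_def potential_def K.b_def K.wpX_def by (intro sum.cong refl) (simp add: b)
    thus "K.Vb s = V s" by (simp add: K.Vb_def V_def)
  qed
  obtain T1 K where large: "\<And>T. T1 \<le> T \<Longrightarrow> nearly_constant_product V K T"
    using large_energy by blast
  from K.hill_trace_transfer[unfolded Va Vb, OF large, where \<kappa> = \<kappa>] show ?thesis .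
qed

end

subsection \<open>The parameters\<close>

text \<open>The half-odd numbers are symmetric about 1, so one of \<tau> and 2 - \<tau> lies below
  1, which is the range of convergence of the kernel.\<close>

lemma half_odd_iff_nat: "half_odd \<tau> \<longleftrightarrow> (\<exists>j::nat. \<tau> = 1 / 2 - of_nat j \<or> 2 - \<tau> = 1 / 2 - of_nat j)"
proof
  assume "half_odd \<tau>"
  then obtain m :: int where m: "\<tau> = of_int m + 1 / 2" by (auto simp: half_odd_def)
  show "\<exists>j::nat. \<tau> = 1 / 2 - of_nat j \<or> 2 - \<tau> = 1 / 2 - of_nat j"
  proof (cases "m \<le> 0")
    case True
    hence "(of_int m :: complex) = - of_nat (nat (- m))" by (simp add: of_nat_nat)
    thus ?thesis using m by (intro exI[of _ "nat (- m)"]) simp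
  next
    case False
    hence "(of_int m :: complex) = 1 + of_nat (nat (m - 1))" by (simp add: of_nat_nat)
    thus ?thesis using m by (intro exI[of _ "nat (m - 1)"]) simp
  qed
next
  assume "\<exists>j::nat. \<tau> = 1 / 2 - of_nat j \<or> 2 - \<tau> = 1 / 2 - of_nat j"
  then obtain j :: nat where "\<tau> = 1 / 2 - of_nat j \<or> 2 - \<tau> = 1 / 2 - of_nat j" ..
  hence "\<tau> = of_int (- int j) + 1 / 2 \<or> \<tau> = of_int (int j + 1) + 1 / 2" by (auto simp: field_simps)
  thus "half_odd \<tau>" unfolding half_odd_def by blast
qed

lemma parameters_integral:
  assumes alpha0: "\<alpha>\<^sub>0 \<in> {- l 0, l 0 + 1}" and half_odd_l: "\<forall>i\<le>3. half_odd (l i)"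
    and odd_sum: "\<exists>m::int. odd m \<and> l 0 + l 1 + l 2 + l 3 = of_int m"
  shows "half_odd (eta_param \<alpha>\<^sub>0 l)" "\<forall>i\<le>3. l_prime \<alpha>\<^sub>0 l i \<in> \<int>"
proof -
  from half_odd_l obtain m where m: "\<And>i. i \<le> 3 \<Longrightarrow> l i = of_int (m i) + 1 / 2"
    unfolding half_odd_def by metis
  have l: "l 0 = of_int (m 0) + 1 / 2" "l 1 = of_int (m 1) + 1 / 2" "l 2 = of_int (m 2) + 1 / 2" "l 3 = of_int (m 3) + 1 / 2"
    by (rule m; simp)+
  obtain t :: int where t: "l 0 + l 1 + l 2 + l 3 = of_int (2 * t + 1)" using odd_sum by (auto elim!: oddE)
  \<comment> \<open>The four halves add up to 2, so the odd total determines the parity of the sum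
    of the integer parts; eliminating m 0 makes every quotient visibly integral or half-odd.\<close>
  have m0: "(of_int (m 0) :: complex) = 2 * of_int t - 1 - of_int (m 1) - of_int (m 2) - of_int (m 3)"
    using t unfolding l by (simp add: algebra_simps)
  consider "\<alpha>\<^sub>0 = - l 0" | "\<alpha>\<^sub>0 = l 0 + 1" using alpha0 by blast
  hence "half_odd (eta_param \<alpha>\<^sub>0 l) \<and> l_prime \<alpha>\<^sub>0 l 0 \<in> \<int> \<and> l_prime \<alpha>\<^sub>0 l 1 \<in> \<int> \<and> l_prime \<alpha>\<^sub>0 l 2 \<in> \<int> \<and> l_prime \<alpha>\<^sub>0 l 3 \<in> \<int>"
  proof cases
    case 1
    have "eta_param \<alpha>\<^sub>0 l = of_int (t - 1 - m 1 - m 2 - m 3) + 1 / 2" "l_prime \<alpha>\<^sub>0 l 0 = of_int (t + 1)"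
      "l_prime \<alpha>\<^sub>0 l 1 = of_int (t - 1 - m 2 - m 3)" "l_prime \<alpha>\<^sub>0 l 2 = of_int (t - 1 - m 1 - m 3)" "l_prime \<alpha>\<^sub>0 l 3 = of_int (t - 1 - m 1 - m 2)"
      unfolding eta_param_def l_prime_def 1 l m0 by (simp_all add: field_simps)
    thus ?thesis unfolding half_odd_def by (metis Ints_of_int)
  next
    case 2
    have "eta_param \<alpha>\<^sub>0 l = of_int (- t - 1) + 1 / 2" "l_prime \<alpha>\<^sub>0 l 0 = of_int (m 1 + m 2 + m 3 - t + 1)"
      "l_prime \<alpha>\<^sub>0 l 1 = of_int (m 1 - t - 1)" "l_prime \<alpha>\<^sub>0 l 2 = of_int (m 2 - t - 1)" "l_prime \<alpha>\<^sub>0 l 3 = of_int (m 3 - t - 1)"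
      unfolding eta_param_def l_prime_def 2 l m0 by (simp_all add: field_simps)
    thus ?thesis unfolding half_odd_def by (metis Ints_of_int)
  qed
  moreover have "i = 0 \<or> i = 1 \<or> i = 2 \<or> i = 3" if "i \<le> 3" for i :: nat using that by auto
  ultimately show "half_odd (eta_param \<alpha>\<^sub>0 l)" "\<forall>i\<le>3. l_prime \<alpha>\<^sub>0 l i \<in> \<int>" by blast+
qed

text \<open>The exponents \<open>a\<close> and \<open>1 - a\<close> give the same potentials, and the kernel converges for one of the two choices.\<close>

lemma kernel_parameters:
  assumes alpha0: "\<alpha>\<^sub>0 \<in> {- l 0, l 0 + 1}" and eta: "half_odd (eta_param \<alpha>\<^sub>0 l)"
  obtains a \<tau> and j :: nat where "\<tau> = 1 / 2 - of_nat j" "(\<Sum>i\<le>3. a i) = 2 * \<tau>"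
    "\<And>i. i \<le> 3 \<Longrightarrow> a i * (a i - 1) = l i * (l i + 1)"
    "\<And>i. i \<le> 3 \<Longrightarrow> (\<tau> - a i) * (\<tau> - a i - 1) = l_prime \<alpha>\<^sub>0 l i * (l_prime \<alpha>\<^sub>0 l i + 1)"
proof -
  define a where "a i = (if i = 0 then \<alpha>\<^sub>0 else l i + 1)" for i :: nat
  \<comment> \<open>Half the sum of the exponents \<open>a i\<close>, expressed by the parameter
    \<eta>.\<close>
  define \<tau> where "\<tau> = 2 - eta_param \<alpha>\<^sub>0 l"
  have cases: "i = 0 \<or> i = 1 \<or> i = 2 \<or> i = 3" if "i \<le> 3" for i :: nat using that by auto
  have sum: "(\<Sum>i\<le>3. a i) = 2 * \<tau>" by (simp add: sum_le_3 a_def \<tau>_def eta_param_def field_simps)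
  have a: "a i * (a i - 1) = l i * (l i + 1)" for i
    using alpha0 by (auto simp: a_def algebra_simps)
  have "\<tau> - a 0 = l_prime \<alpha>\<^sub>0 l 0 + 1" "\<tau> - a 1 = - l_prime \<alpha>\<^sub>0 l 1" "\<tau> - a 2 = - l_prime \<alpha>\<^sub>0 l 2" "\<tau> - a 3 = - l_prime \<alpha>\<^sub>0 l 3"
    by (simp_all add: a_def \<tau>_def eta_param_def l_prime_def field_simps)
  hence "\<tau> - a i = l_prime \<alpha>\<^sub>0 l i + 1 \<or> \<tau> - a i = - l_prime \<alpha>\<^sub>0 l i" if "i \<le> 3" for i
    using cases[OF that] by blast
  hence b: "(\<tau> - a i) * (\<tau> - a i - 1) = l_prime \<alpha>\<^sub>0 l i * (l_prime \<alpha>\<^sub>0 l i + 1)" if "i \<le> 3" for i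
    using that by (elim meta_allE[of _ i] meta_impE disjE) (simp_all only:, simp_all add: algebra_simps)
  obtain j :: nat where "2 - \<tau> = 1 / 2 - of_nat j \<or> \<tau> = 1 / 2 - of_nat j"
    using eta unfolding half_odd_iff_nat \<tau>_def by auto
  thus thesis
  proof
    assume j: "2 - \<tau> = 1 / 2 - of_nat j"
    show thesis
    proof (rule that[of "2 - \<tau>" j "\<lambda>i. 1 - a i"])
      show "(\<Sum>i\<le>3. 1 - a i) = 2 * (2 - \<tau>)" using sum by (simp add: sum_subtractf)
      show "(1 - a i) * (1 - a i - 1) = l i * (l i + 1)" for i using a[of i] by (simp add: algebra_simps)
      show "(2 - \<tau> - (1 - a i)) * (2 - \<tau> - (1 - a i) - 1) = l_prime \<alpha>\<^sub>0 l i * (l_prime \<alpha>\<^sub>0 l i + 1)" if "i \<le> 3" for i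
        using b[OF that] by (simp add: algebra_simps)
    qed (rule j)
  next
    assume "\<tau> = 1 / 2 - of_nat j"
    from that[OF this sum a b] show thesis .
  qed
qed

lemma trace_isomonodromic:
  fixes \<omega>\<^sub>1 \<omega>\<^sub>3 \<alpha>\<^sub>0 :: complex and l :: "nat \<Rightarrow> complex"
  assumes fg: "finite_gap_line \<omega>\<^sub>1 \<omega>\<^sub>3 l' c\<^sub>0 b Q x k"
    and alpha0: "\<alpha>\<^sub>0 \<in> {- l 0, l 0 + 1}" and eta: "half_odd (eta_param \<alpha>\<^sub>0 l)"
    and l': "\<And>i. i \<le> 3 \<Longrightarrow> of_int (l' i) = l_prime \<alpha>\<^sub>0 l i"
    and M: "monodromy_matrix (potential \<omega>\<^sub>1 \<omega>\<^sub>3 l) E (2 * half_period \<omega>\<^sub>1 \<omega>\<^sub>3 k) x f\<^sub>1 f\<^sub>2 M"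
  shows "trace M = hill_trace (\<lambda>s. finite_gap_line.V \<omega>\<^sub>1 \<omega>\<^sub>3 l' x k s + - ((weierstrass_line.p \<omega>\<^sub>1 \<omega>\<^sub>3 k) ^ 2) * E)"
proof -
  interpret finite_gap_line \<omega>\<^sub>1 \<omega>\<^sub>3 l' c\<^sub>0 b Q x k by (rule fg)
  obtain a \<tau> and j :: nat where \<tau>: "\<tau> = 1 / 2 - of_nat j" "(\<Sum>i\<le>3. a i) = 2 * \<tau>"
    and a: "\<And>i. i \<le> 3 \<Longrightarrow> a i * (a i - 1) = l i * (l i + 1)"
    and b: "\<And>i. i \<le> 3 \<Longrightarrow> (\<tau> - a i) * (\<tau> - a i - 1) = l_prime \<alpha>\<^sub>0 l i * (l_prime \<alpha>\<^sub>0 l i + 1)"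
    using kernel_parameters[OF alpha0 eta] by metis
  have pot: "potential \<omega>\<^sub>1 \<omega>\<^sub>3 l z = (\<Sum>i\<le>3. a i * (a i - 1) * wp (z + hp i))" for z
    unfolding potential_def by (intro sum.cong refl) (simp add: a)
  have "trace M = hill_trace (\<lambda>s. p ^ 2 * potential \<omega>\<^sub>1 \<omega>\<^sub>3 l (X s) + - (p ^ 2) * E)"
    using M by (intro trace_monodromy_matrix[OF potential_holomorphic]) (simp add: p_def)
  also have "\<dots> = hill_trace (\<lambda>s. V s + - (p ^ 2) * E)"
    unfolding pot by (rule hill_trace_isomonodromic[OF \<tau>]) (use b l' in simp)
  finally show ?thesis .
qed

theorem proposition7p8:
  fixes \<omega>\<^sub>1 \<omega>\<^sub>3 \<alpha>\<^sub>0 :: complex and l :: "nat \<Rightarrow> complex"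
  assumes periods: "Im (\<omega>\<^sub>3 / \<omega>\<^sub>1) \<noteq> 0"
    and alpha0: "\<alpha>\<^sub>0 \<in> {- l 0, l 0 + 1}"
    and half_odd_l: "\<forall>i\<le>3. half_odd (l i)"
    and odd_sum: "\<exists>m::int. odd m \<and> l 0 + l 1 + l 2 + l 3 = of_int m"
  shows "half_odd (eta_param \<alpha>\<^sub>0 l) \<and> (\<forall>i\<le>3. l_prime \<alpha>\<^sub>0 l i \<in> \<int>) \<and>
    (\<forall>(l' :: nat \<Rightarrow> int) c\<^sub>0 b Q c a.
      (\<forall>i\<le>3. of_int (l' i) = l_prime \<alpha>\<^sub>0 l i) \<and>
      is_Xi \<omega>\<^sub>1 \<omega>\<^sub>3 l' c\<^sub>0 b \<and> is_Q \<omega>\<^sub>1 \<omega>\<^sub>3 l' c\<^sub>0 b Q \<and>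
      derivative_expansion \<omega>\<^sub>1 \<omega>\<^sub>3 l' c\<^sub>0 b c a \<longrightarrow>
      (\<forall>k\<in>{1, 3}. \<forall>E x f\<^sub>1 f\<^sub>2 M.
        closed_segment x (x + 2 * half_period \<omega>\<^sub>1 \<omega>\<^sub>3 k) \<inter> half_lattice \<omega>\<^sub>1 \<omega>\<^sub>3 = {} \<and>
        monodromy_matrix (potential \<omega>\<^sub>1 \<omega>\<^sub>3 l) E (2 * half_period \<omega>\<^sub>1 \<omega>\<^sub>3 k) x f\<^sub>1 f\<^sub>2 M \<longrightarrow>
        (\<forall>E\<^sub>0 L\<^sub>0 (q :: nat) g r.
          poly Q E\<^sub>0 = 0 \<and>
          is_Lambda (half_lattice \<omega>\<^sub>1 \<omega>\<^sub>3) (Xi_fun \<omega>\<^sub>1 \<omega>\<^sub>3 l' c\<^sub>0 b E\<^sub>0) 0 L\<^sub>0 \<and>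
          q \<in> {0, 1} \<and>
          (\<forall>y\<in>- half_lattice \<omega>\<^sub>1 \<omega>\<^sub>3. L\<^sub>0 (y + 2 * half_period \<omega>\<^sub>1 \<omega>\<^sub>3 k) = (- 1) ^ q * L\<^sub>0 y) \<and>
          spectral_path Q E\<^sub>0 E g r \<longrightarrow>
          (\<exists>I. has_spectral_integral \<omega>\<^sub>1 \<omega>\<^sub>3 k c (a_total l' a) g r I \<and>
               trace M = 2 * (- 1) ^ q * cos I)) \<and>
        (\<forall>P s \<alpha> \<kappa>.
          hermite_krichever \<omega>\<^sub>1 \<omega>\<^sub>3 l' c\<^sub>0 b Q P \<and> HK_defined P E \<and>
          s ^ 2 = - poly Q E \<and> HK_values \<omega>\<^sub>1 \<omega>\<^sub>3 P E s \<alpha> \<kappa> \<longrightarrow>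
          trace M = 2 * cos (\<i> * (2 * half_period \<omega>\<^sub>1 \<omega>\<^sub>3 k * (weierstrass_zeta \<omega>\<^sub>1 \<omega>\<^sub>3 \<alpha> + \<kappa>)
                                  - 2 * quasi_period \<omega>\<^sub>1 \<omega>\<^sub>3 k * \<alpha>)))))"
proof (intro conjI allI impI ballI; (elim conjE)?)
  note int = parameters_integral[OF alpha0 half_odd_l odd_sum]
  show "half_odd (eta_param \<alpha>\<^sub>0 l)" by (rule int(1))
  show "l_prime \<alpha>\<^sub>0 l i \<in> \<int>" if "i \<le> 3" for i using int(2) that by blast
  fix l' :: "nat \<Rightarrow> int" and c\<^sub>0 b Q c a k E x f\<^sub>1 f\<^sub>2 M
  assume l': "\<forall>i\<le>3. of_int (l' i) = l_prime \<alpha>\<^sub>0 l i"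
    and Xi: "is_Xi \<omega>\<^sub>1 \<omega>\<^sub>3 l' c\<^sub>0 b" and Q: "is_Q \<omega>\<^sub>1 \<omega>\<^sub>3 l' c\<^sub>0 b Q" and k: "k \<in> {1, 3}"
    and seg: "closed_segment x (x + 2 * half_period \<omega>\<^sub>1 \<omega>\<^sub>3 k) \<inter> half_lattice \<omega>\<^sub>1 \<omega>\<^sub>3 = {}"
    and M: "monodromy_matrix (potential \<omega>\<^sub>1 \<omega>\<^sub>3 l) E (2 * half_period \<omega>\<^sub>1 \<omega>\<^sub>3 k) x f\<^sub>1 f\<^sub>2 M"
  interpret weierstrass \<omega>\<^sub>1 \<omega>\<^sub>3 by (rule weierstrass.intro[OF periods])
  have fg: "finite_gap_line \<omega>\<^sub>1 \<omega>\<^sub>3 l' c\<^sub>0 b Q x k"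
    by unfold_locales (use Xi Q k line_avoids_half_lattice[OF k seg] in auto)
  interpret F: finite_gap_line \<omega>\<^sub>1 \<omega>\<^sub>3 l' c\<^sub>0 b Q x k by (rule fg)
  have tr: "trace M = hill_trace (F.W E)"
    by (rule trace_isomonodromic[OF fg alpha0 int(1) _ M]) (use l' in blast)
  {
    fix E\<^sub>0 L\<^sub>0 and q :: nat and g r
    assume exp: "derivative_expansion \<omega>\<^sub>1 \<omega>\<^sub>3 l' c\<^sub>0 b c a" and E0: "poly Q E\<^sub>0 = 0"
      and L: "is_Lambda (half_lattice \<omega>\<^sub>1 \<omega>\<^sub>3) (Xi_fun \<omega>\<^sub>1 \<omega>\<^sub>3 l' c\<^sub>0 b E\<^sub>0) 0 L\<^sub>0"
      and per: "\<forall>y\<in>- half_lattice \<omega>\<^sub>1 \<omega>\<^sub>3. L\<^sub>0 (y + 2 * half_period \<omega>\<^sub>1 \<omega>\<^sub>3 k) = (- 1) ^ q * L\<^sub>0 y"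
      and path: "spectral_path Q E\<^sub>0 E g r"
    have L': "is_Lambda H (F.h E\<^sub>0) 0 L\<^sub>0" using L by (simp add: F.h_def)
    have s0: "0 ^ 2 = - poly Q E\<^sub>0" by (simp add: E0)
    obtain y where y: "y \<notin> H" "L\<^sub>0 y \<noteq> 0" by (rule F.Lambda_nonzero[OF L'])
    have "L\<^sub>0 holomorphic_on - H" using L by (simp add: is_Lambda_def)
    \<comment> \<open>At a zero of Q the function \<Lambda> is a Bloch solution whose multiplier is
      its own inverse; this fixes the initial value of the trace on the path.\<close>
    from F.bloch_trace(2)[OF this F.Lambda_solution[OF L' s0] y, of "(- 1) ^ q"]
    have "hill_trace (F.W E\<^sub>0) = (- 1) ^ q + 1 / (- 1) ^ q" using per by (simp add: F.p_def)
    also have "\<dots> = 2 * (- 1) ^ q" by (cases "even q") auto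
    finally have tr0: "hill_trace (F.W E\<^sub>0) = 2 * (- 1) ^ q" .
    have "((- 1 :: complex) ^ q) ^ 2 = 1" by (simp flip: power_mult)
    from F.spectral_trace[OF exp tr0 this path]
    show "\<exists>I. has_spectral_integral \<omega>\<^sub>1 \<omega>\<^sub>3 k c (a_total l' a) g r I \<and> trace M = 2 * (- 1) ^ q * cos I"
      unfolding tr .
  }
  show "trace M = 2 * cos (\<i> * (2 * half_period \<omega>\<^sub>1 \<omega>\<^sub>3 k * (weierstrass_zeta \<omega>\<^sub>1 \<omega>\<^sub>3 \<alpha> + \<kappa>)
      - 2 * quasi_period \<omega>\<^sub>1 \<omega>\<^sub>3 k * \<alpha>))"
    if "hermite_krichever \<omega>\<^sub>1 \<omega>\<^sub>3 l' c\<^sub>0 b Q P" "HK_defined P E" "s ^ 2 = - poly Q E" "HK_values \<omega>\<^sub>1 \<omega>\<^sub>3 P E s \<alpha> \<kappa>" for P s \<alpha> \<kappa>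
    unfolding tr by (rule F.hermite_krichever_trace[OF that])
qed

end
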